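(* Let $d\in\mathbb N^*$ and let $k\in\mathbb N^*$ be such that $k>d/2$. Then the Cahn–Hilliard equation $$u_t+\Delta^2u+\Delta u=\Delta(u^3)+\eta \ \text{ in } (0,T)\times\mathbb T^d,\qquad u(0)=u_0 \ \text{ in }\mathbb T^d,$$ is small-time globally $H^k$-approximately controllable; that is: for every $T>0$, every $u_0,u_1\in H^k(\mathbb T^d)$ and every $\epsilon>0$, there exists a control $\eta\in L^\infty(0,T;\mathscr H_0)$ such that the corresponding solution $u$ satisfies $$\|u(T)-u_1\|_{H^k(\mathbb T^d)}<\epsilon .$$
   Context: $\mathbb T^d=\mathbb R^d/2\pi\mathbb Z^d$; functions are real-valued; $H^k(\mathbb T^d)$ is the usual Sobolev space, with norm $\|u\|_{H^k}^2=\sum_{n\in\mathbb Z^d}|u_n|^2(1+|n|^2)^k$ where $u_n$ are the Fourier coefficients of $u$. $\mathcal K\subset\mathbb Z^d$ is the canonical basis $\{(1,0,\dots,0),(0,1,0,\dots,0),\dots,(0,\dots,0,1)\}$ of $\mathbb R^d$, and $$\mathscr H_0=\operatorname{span}\{1,\ \sin(x\cdot n),\ \cos(x\cdot n): n\in\mathcal K\},$$ a space of functions on $\mathbb T^d$ of dimension $2d+1$. Solutions are mild solutions in $C([0,T];H^k(\mathbb T^d))$: $u(t)=\mathcal S(t)u_0+\int_0^t\mathcal S(t-\sigma)\big(\Delta(u^3)+\eta\big)(\sigma)\,d\sigma$, where $\mathcal S$ is the strongly continuous semigroup on $L^2(\mathbb T^d)$ generated by $\mathcal A=-\Delta^2-\Delta$.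 The claim includes that the solution for the chosen control exists on $[0,T]$. *)

theory Defs
  imports "HOL-Analysis.Analysis" "HOL-Library.Function_Algebras"
begin

text \<open>
  The dimension is \<open>d = CARD('d)\<close>. Functions on the torus are \<open>2\<pi>\<close>-periodic functions on
  \<open>real^'d\<close>; elements of \<open>L\<^sup>2\<close> and \<open>H\<^sup>k\<close> are represented by functions, so identities
  between them are stated almost everywhere. Addition and subtraction of functions are pointwise.
  A real Sobolev distribution on the torus is represented by its family of Fourier coefficients
  \<open>int^'d \<Rightarrow> complex\<close>; this is needed because \<open>\<Delta>(u\<^sup>3)\<close> need not be a function.
\<close>

section \<open>Functions on the torus\<close>

definition lattice_vec :: "int^'d \<Rightarrow> real^'d" where
  "lattice_vec n = (\<chi> i. real_of_int (n $ i))"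

definition periodic :: "(real^'d \<Rightarrow> real) \<Rightarrow> bool" where
  "periodic u \<longleftrightarrow> (\<forall>x n. u (x + (2 * pi) *\<^sub>R lattice_vec n) = u x)"

definition torus :: "(real^'d) measure" where
  "torus = lebesgue_on (cbox 0 (\<chi> i. 2 * pi))"

definition L2 :: "(real^'d \<Rightarrow> real) set" where
  "L2 = {u. periodic u \<and> u \<in> borel_measurable torus \<and> integrable torus (\<lambda>x. (u x)\<^sup>2)}"

definition L2_norm :: "(real^'d \<Rightarrow> real) \<Rightarrow> real" where
  "L2_norm u = sqrt (\<integral>x. (u x)\<^sup>2 \<partial>torus)"

definition ae_eq :: "(real^'d \<Rightarrow> real) \<Rightarrow> (real^'d \<Rightarrow> real) \<Rightarrow> bool" where
  "ae_eq u v \<longleftrightarrow> (AE x in torus. u x = v x)"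

definition fourier_coeff :: "(real^'d \<Rightarrow> real) \<Rightarrow> int^'d \<Rightarrow> complex" where
  "fourier_coeff u n =
     (\<integral>x. of_real (u x) * cis (- (x \<bullet> lattice_vec n)) \<partial>torus) / of_real ((2 * pi) ^ CARD('d))"

section \<open>Sobolev spaces\<close>

definition sobolev_weight :: "int \<Rightarrow> (int^'d \<Rightarrow> complex) \<Rightarrow> int^'d \<Rightarrow> real" where
  "sobolev_weight s c n = (cmod (c n))\<^sup>2 * (1 + (norm (lattice_vec n))\<^sup>2) powi s"

definition sobolev_coeffs :: "int \<Rightarrow> (int^'d \<Rightarrow> complex) set" where
  "sobolev_coeffs s = {c. sobolev_weight s c summable_on UNIV}"

definition sobolev_coeffs_norm :: "int \<Rightarrow> (int^'d \<Rightarrow> complex) \<Rightarrow> real" where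
  "sobolev_coeffs_norm s c = sqrt (\<Sum>\<^sub>\<infinity>n. sobolev_weight s c n)"

definition sobolev_space :: "nat \<Rightarrow> (real^'d \<Rightarrow> real) set" where
  "sobolev_space k = {u \<in> L2. fourier_coeff u \<in> sobolev_coeffs (int k)}"

definition sobolev_norm :: "nat \<Rightarrow> (real^'d \<Rightarrow> real) \<Rightarrow> real" where
  "sobolev_norm k u = sobolev_coeffs_norm (int k) (fourier_coeff u)"

definition laplacian :: "(int^'d \<Rightarrow> complex) \<Rightarrow> int^'d \<Rightarrow> complex" where
  "laplacian c n = - of_real ((norm (lattice_vec n))\<^sup>2) * c n"

section \<open>The semigroup generated by \<open>-\<Delta>\<^sup>2 - \<Delta>\<close>\<close>

definition C0_semigroup :: "(real \<Rightarrow> (real^'d \<Rightarrow> real) \<Rightarrow> (real^'d \<Rightarrow> real)) \<Rightarrow> bool" where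
  "C0_semigroup S \<longleftrightarrow>
     (\<forall>t\<ge>0. \<forall>u\<in>L2. S t u \<in> L2) \<and>
     (\<forall>t\<ge>0. \<forall>u\<in>L2. \<forall>v\<in>L2. \<forall>a b.
        ae_eq (S t (\<lambda>x. a * u x + b * v x)) (\<lambda>x. a * S t u x + b * S t v x)) \<and>
     (\<forall>t\<ge>0. \<exists>M. \<forall>u\<in>L2. L2_norm (S t u) \<le> M * L2_norm u) \<and>
     (\<forall>u\<in>L2. ae_eq (S 0 u) u) \<and>
     (\<forall>s\<ge>0. \<forall>t\<ge>0. \<forall>u\<in>L2. ae_eq (S (s + t) u) (S s (S t u))) \<and>
     (\<forall>u\<in>L2. ((\<lambda>t. L2_norm (S t u - u)) \<longlongrightarrow> 0) (at_right 0))"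

definition generator_graph ::
  "(real \<Rightarrow> (real^'d \<Rightarrow> real) \<Rightarrow> (real^'d \<Rightarrow> real)) \<Rightarrow> ((real^'d \<Rightarrow> real) \<times> (real^'d \<Rightarrow> real)) set" where
  "generator_graph S = {(u, v). u \<in> L2 \<and> v \<in> L2 \<and>
     ((\<lambda>h. L2_norm (\<lambda>x. (S h u x - u x) / h - v x)) \<longlongrightarrow> 0) (at_right 0)}"

text \<open>The graph of \<open>A = -\<Delta>\<^sup>2 - \<Delta>\<close> on \<open>L\<^sup>2\<close>, with domain \<open>H\<^sup>4\<close>.\<close>

definition A_graph :: "((real^'d \<Rightarrow> real) \<times> (real^'d \<Rightarrow> real)) set" where
  "A_graph = {(u, v). u \<in> sobolev_space 4 \<and> v \<in> L2 \<and>
     (\<forall>n. fourier_coeff v n =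
        - laplacian (laplacian (fourier_coeff u)) n - laplacian (fourier_coeff u) n)}"

text \<open>The choice operator only selects representatives: the semigroup generated by \<open>A\<close> is unique
  up to equality almost everywhere.\<close>

definition CH_semigroup :: "real \<Rightarrow> (real^'d \<Rightarrow> real) \<Rightarrow> (real^'d \<Rightarrow> real)" where
  "CH_semigroup = (SOME S. C0_semigroup S \<and> generator_graph S = A_graph)"

text \<open>For \<open>t > 0\<close>, \<open>CH_semigroup t\<close> is bounded from the \<open>H\<^sup>-\<^sup>2\<close>-norm to the \<open>L\<^sup>2\<close>-norm.
  The following is its extension by continuity from \<open>L\<^sup>2\<close> to \<open>H\<^sup>-\<^sup>2\<close>, a space which contains
  \<open>\<Delta>f\<close> for every \<open>f\<close> in \<open>L\<^sup>2\<close>; again it is determined up to equality almost everywhere.\<close>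

definition CH_semigroup_ext :: "real \<Rightarrow> (int^'d \<Rightarrow> complex) \<Rightarrow> (real^'d \<Rightarrow> real)" where
  "CH_semigroup_ext t F = (SOME w. w \<in> L2 \<and>
     (\<forall>f :: nat \<Rightarrow> real^'d \<Rightarrow> real.
        (\<forall>j. f j \<in> L2 \<and> fourier_coeff (f j) - F \<in> sobolev_coeffs (- 2)) \<and>
        (\<lambda>j. sobolev_coeffs_norm (- 2) (fourier_coeff (f j) - F)) \<longlonglongrightarrow> 0 \<longrightarrow>
        (\<lambda>j. L2_norm (CH_semigroup t (f j) - w)) \<longlonglongrightarrow> 0))"

section \<open>Measurability and integration of curves in \<open>L\<^sup>2\<close>\<close>

definition simple_curve ::
  "(real^'d \<Rightarrow> real) set \<Rightarrow> real set \<Rightarrow> (real \<Rightarrow> real^'d \<Rightarrow> real) \<Rightarrow> bool" where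
  "simple_curve X I s \<longleftrightarrow>
     s ` I \<subseteq> X \<and> finite (s ` I) \<and> (\<forall>y. {t \<in> I. s t = y} \<in> sets lebesgue)"

definition simple_integral ::
  "real set \<Rightarrow> (real \<Rightarrow> real^'d \<Rightarrow> real) \<Rightarrow> (real^'d \<Rightarrow> real)" where
  "simple_integral I s = (\<lambda>x. \<Sum>y\<in>s ` I. measure lebesgue {t \<in> I. s t = y} * y x)"

definition strongly_measurable_curve ::
  "(real^'d \<Rightarrow> real) set \<Rightarrow> real set \<Rightarrow> (real \<Rightarrow> real^'d \<Rightarrow> real) \<Rightarrow> bool" where
  "strongly_measurable_curve X I f \<longleftrightarrow>
     (AE t in lebesgue_on I. f t \<in> X) \<and>
     (\<exists>s. (\<forall>j::nat. simple_curve X I (s j)) \<and>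
          (AE t in lebesgue_on I. (\<lambda>j. L2_norm (f t - s j t)) \<longlonglongrightarrow> 0))"

definition has_L2_bochner_integral ::
  "(real \<Rightarrow> real^'d \<Rightarrow> real) \<Rightarrow> (real^'d \<Rightarrow> real) \<Rightarrow> real set \<Rightarrow> bool" where
  "has_L2_bochner_integral f w I \<longleftrightarrow>
     strongly_measurable_curve L2 I f \<and> w \<in> L2 \<and>
     (\<exists>s. (\<forall>j::nat. simple_curve L2 I (s j)) \<and>
          (\<lambda>j. \<integral>\<^sup>+t. ennreal (L2_norm (f t - s j t)) \<partial>lebesgue_on I) \<longlonglongrightarrow> 0 \<and>
          (\<lambda>j. L2_norm (simple_integral I (s j) - w)) \<longlonglongrightarrow> 0)"

section \<open>Controls and mild solutions\<close>

definition canonical_K :: "(int^'d) set" where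
  "canonical_K = range (\<lambda>i. axis i 1)"

definition H0 :: "(real^'d \<Rightarrow> real) set" where
  "H0 = module.span (\<lambda>c f. (\<lambda>x. c * f x))
     ({\<lambda>x. 1} \<union> (\<lambda>n x. sin (x \<bullet> lattice_vec n)) ` canonical_K \<union> (\<lambda>n x. cos (x \<bullet> lattice_vec n)) ` canonical_K)"

text \<open>On the finite-dimensional space \<open>H0\<close> all norms are equivalent; the \<open>L\<^sup>2\<close>-norm is used.\<close>

definition Linfty_H0 :: "real \<Rightarrow> (real \<Rightarrow> real^'d \<Rightarrow> real) set" where
  "Linfty_H0 T = {\<eta>. strongly_measurable_curve H0 {0<..<T} \<eta> \<and>
     (\<exists>M. AE t in lebesgue_on {0<..<T}. L2_norm (\<eta> t) \<le> M)}"

definition continuous_curve :: "nat \<Rightarrow> real \<Rightarrow> (real \<Rightarrow> real^'d \<Rightarrow> real) \<Rightarrow> bool" where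
  "continuous_curve k T u \<longleftrightarrow>
     (\<forall>t\<in>{0..T}. u t \<in> sobolev_space k \<and> ((\<lambda>s. sobolev_norm k (u s - u t)) \<longlongrightarrow> 0) (at t within {0..T}))"

definition mild_solution ::
  "nat \<Rightarrow> real \<Rightarrow> (real^'d \<Rightarrow> real) \<Rightarrow> (real \<Rightarrow> real^'d \<Rightarrow> real) \<Rightarrow> (real \<Rightarrow> real^'d \<Rightarrow> real) \<Rightarrow> bool" where
  "mild_solution k T u0 \<eta> u \<longleftrightarrow>
     continuous_curve k T u \<and>
     (\<forall>t\<in>{0..T}. \<exists>w.
        has_L2_bochner_integral
          (\<lambda>\<sigma>. CH_semigroup_ext (t - \<sigma>)
             (laplacian (fourier_coeff (\<lambda>x. (u \<sigma> x) ^ 3)) + fourier_coeff (\<eta> \<sigma>))) w {0..t} \<and>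
        ae_eq (u t) (CH_semigroup t u0 + w))"

end

theory Submission
  imports Defs
begin

text \<open>
  A function in \<open>H\<^sup>k\<close> is represented by its Fourier coefficients multiplied by
  \<open>(1 + \<bar>n\<bar>\<^sup>2) powr (k / 2)\<close>, an element \<open>x\<close> of a Hilbert space of square summable Hermitian families.
  As \<open>2 * k > d\<close>, pointwise multiplication is a bounded bilinear map \<open>prd\<close> there.

  Start from \<open>a + A\<phi>\<close> with a trigonometric polynomial \<open>\<phi>\<close> and large \<open>A\<close>, and use the control \<open>\<eta> / \<delta>\<close>
  for a time \<open>\<delta> = A\<^sup>-\<^sup>3\<close>: the solution is then close to \<open>a + A\<phi> + \<Delta>(\<phi>\<^sup>3) + \<eta>\<close>. Hence if one can move along
  \<open>\<phi>\<close> approximately in arbitrarily short time, one can also move along \<open>\<Delta>(\<phi>\<^sup>3)\<close>: go along \<open>A\<phi>\<close>, let the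
  equation act, and go back. With \<open>1\<close> among the directions, polarization turns \<open>\<Delta>(\<phi>\<^sup>3)\<close> into \<open>\<Delta>(\<phi>\<psi>)\<close>; products
  of modes are combinations of modes whose frequencies are sums, so starting from the canonical basis all
  trigonometric polynomials are reached, and these are dense. Stability of the state \<open>0\<close> and of
  the target trajectory allows one to wait until the prescribed time.

  The semigroup generated by \<open>A\<close> is identified with the multiplier \<open>exp (lam n * t)\<close> by its behaviour on the
  finite-dimensional eigenspaces, and two mild solutions coincide by Gronwall's inequality.
\<close>

section \<open>The frequency lattice\<close>

text \<open>The delicate point is the linear term during the impulse. The error \<open>z\<close>
  between the solution and the expected path feels 3 A^2 \<Delta>(\<phi>^2 z) for a time A^-3.
  Absorbing this into the bi-Laplacian alone costs a growth rate of order A^4, far too much for that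
  time. What helps is the sign: multiplication by \<phi>^2 is positive, so the term is dissipative
  up to a commutator with the gradient and the H^k weight. The commutator loses one derivative less;
  split by a parameter \<kappa> it costs (A^2 \<kappa>)^2 + A^2 / \<kappa>. With \<kappa> = A^(-2/3)
  the rate is A^(8/3), and the growth over the whole impulse is only A^(-1/3).

  The error is merely in H^k, so energies with more derivatives may be infinite. They are truncated
  by a profile for which the commutator bounds are uniform in the truncation radius.

  Since \<Delta>(u^3) is two derivatives rougher than the state, the dynamics are handled as
  ordinary differential equations for the coefficients. Only at the end are these matched with the
  mild formulation, by estimates with an integrable singularity (t - \<sigma>)^(-3/4).\<close>

lemma lattice_vec_simps [simp]:
  "lattice_vec 0 = 0"
  "lattice_vec (m + n) = lattice_vec m + lattice_vec n"
  "lattice_vec (m - n) = lattice_vec m - lattice_vec n"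
  "lattice_vec (- n) = - lattice_vec n"
  by (simp_all add: lattice_vec_def vec_eq_iff)

lemma lattice_vec_eq_iff [simp]: "lattice_vec m = lattice_vec n \<longleftrightarrow> m = n"
  by (simp add: lattice_vec_def vec_eq_iff)

lemma lattice_vec_eq_0_iff [simp]: "lattice_vec m = 0 \<longleftrightarrow> m = 0"
  using lattice_vec_eq_iff[of m 0] by simp

definition freq :: "int^'d \<Rightarrow> real" where
  "freq n = norm (lattice_vec n)"

lemma freq_nonneg [simp]: "0 \<le> freq n"
  and freq_uminus [simp]: "freq (- n) = freq n"
  and freq_0 [simp]: "freq 0 = 0"
  and freq_triangle: "freq (m + n) \<le> freq m + freq n"
  and freq_eq_0_iff [simp]: "freq n = 0 \<longleftrightarrow> n = 0"
  by (simp_all add: freq_def norm_triangle_ineq)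

lemma freq_diff_le: "\<bar>freq m - freq n\<bar> \<le> freq (m - n)"
  by (simp add: freq_def norm_triangle_ineq3)

lemma freq_power2: "(freq n)\<^sup>2 = of_int (\<Sum>i\<in>UNIV. (n $ i)\<^sup>2)"
  unfolding freq_def power2_norm_eq_inner lattice_vec_def inner_vec_def
  by (simp add: power2_eq_square)

text \<open>The squared length is an integer. This gap between 0 and 1 is what makes
  \<open>lam\<close> nonpositive.\<close>

lemma freq_ge_1: "n \<noteq> 0 \<Longrightarrow> 1 \<le> freq n"
proof -
  assume "n \<noteq> 0"
  then have "0 < (freq n)\<^sup>2" by simp
  then have "1 \<le> (freq n)\<^sup>2"
    unfolding freq_power2 by (simp only: of_int_0_less_iff of_int_1_le_iff)
  then show ?thesis
    using power2_le_imp_le[of 1 "freq n"] by simp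
qed

lemma finite_freq_le: "finite {n :: int^'d. freq n \<le> R}"
proof -
  let ?A = "PiE (UNIV :: 'd set) (\<lambda>_. {-\<lceil>R\<rceil>..\<lceil>R\<rceil>})"
  have "{n :: int^'d. freq n \<le> R} \<subseteq> vec_lambda ` ?A"
  proof
    fix n :: "int^'d" assume n: "n \<in> {n. freq n \<le> R}"
    have "n $ i \<in> {-\<lceil>R\<rceil>..\<lceil>R\<rceil>}" for i
    proof -
      have "\<bar>lattice_vec n $ i\<bar> \<le> R"
        using component_le_norm_cart[of "lattice_vec n" i] n by (simp add: freq_def)
      then have "\<bar>real_of_int (n $ i)\<bar> \<le> R" by (simp add: lattice_vec_def)
      then have "\<bar>n $ i\<bar> \<le> \<lceil>R\<rceil>" by linarith
      then show ?thesis by auto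
    qed
    then have "vec_nth n \<in> ?A" by auto
    then show "n \<in> vec_lambda ` ?A" by (metis image_eqI vec_nth_inverse)
  qed
  then show ?thesis by (rule finite_subset) (intro finite_imageI finite_PiE, auto)
qed

text \<open>The eigenvalue of \<open>-\<Delta>\<^sup>2 - \<Delta>\<close> at frequency \<open>n\<close>.\<close>

definition lam :: "int^'d \<Rightarrow> real" where
  "lam n = (freq n)\<^sup>2 - (freq n) ^ 4"

lemma lam_uminus [simp]: "lam (- n) = lam n" and lam_0 [simp]: "lam 0 = 0"
  by (simp_all add: lam_def)

lemma lam_nonpos: "lam n \<le> 0"
proof (cases "n = 0")
  case False
  then have "(freq n) ^ 2 \<le> (freq n) ^ 4"
    by (intro power_increasing) (auto intro: freq_ge_1)
  then show ?thesis by (simp add: lam_def)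
qed simp

section \<open>Hermitian square summable families\<close>

definition herm :: "(int^'d \<Rightarrow> complex) \<Rightarrow> bool" where
  "herm c \<longleftrightarrow> (\<forall>n. c (- n) = cnj (c n))"

text \<open>Hermitian symmetry expresses that the function is real-valued. The families carry no
  weight of their own, so the same type serves L2 through \<open>emb\<close> and every H^k through
  \<open>embk k\<close>.\<close>

typedef (overloaded) ('d::finite) l2 =
  "{c :: int^'d \<Rightarrow> complex. herm c \<and> (\<lambda>n. (cmod (c n))\<^sup>2) summable_on UNIV}"
  morphisms co mkl2
  by (rule exI[of _ "\<lambda>_. 0"]) (auto simp: herm_def)

lemma herm_co: "herm (co x)" and co_uminus_index: "co x (- n) = cnj (co x n)"
  and co_summable: "(\<lambda>n. (cmod (co x n))\<^sup>2) summable_on UNIV"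
  using co[of x] by (auto simp: herm_def)

lemma l2_eqI: "(\<And>n. co x n = co y n) \<Longrightarrow> x = y"
  by (metis co_inject ext)

lemma co_mkl2_bound:
  assumes "herm c" and "\<And>F. finite F \<Longrightarrow> (\<Sum>n\<in>F. (cmod (c n))\<^sup>2) \<le> B"
  shows "co (mkl2 c) = c"
proof (rule mkl2_inverse)
  have "(\<lambda>n. (cmod (c n))\<^sup>2) summable_on UNIV"
    by (rule nonneg_bdd_above_summable_on) (use assms in \<open>auto intro!: bdd_aboveI[of _ B]\<close>)
  then show "c \<in> {c. herm c \<and> (\<lambda>n. (cmod (c n))\<^sup>2) summable_on UNIV}"
    using assms(1) by simp
qed

lemma co_mkl2_summable:
  "herm c \<Longrightarrow> (\<lambda>n. (cmod (c n))\<^sup>2) summable_on UNIV \<Longrightarrow> co (mkl2 c) = c"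
  by (rule mkl2_inverse) simp

lemma L2_set_sum_le: "L2_set (\<lambda>n. \<Sum>j\<in>J. f j n) F \<le> (\<Sum>j\<in>J. L2_set (f j) F)"
proof (cases "finite J")
  case True
  then show ?thesis
  proof induct
    case empty show ?case by (simp add: L2_set_def)
  next
    case (insert j J)
    have "L2_set (\<lambda>n. f j n + (\<Sum>j\<in>J. f j n)) F \<le> L2_set (f j) F + L2_set (\<lambda>n. \<Sum>j\<in>J. f j n) F"
      by (rule L2_set_triangle_ineq)
    then show ?case using insert by simp
  qed
qed (simp add: L2_set_def)

instantiation l2 :: (finite) real_normed_vector
begin

definition "0 = mkl2 (\<lambda>_. 0)"
definition "x + y = mkl2 (\<lambda>n. co x n + co y n)"
definition "- (x :: 'a l2) = mkl2 (\<lambda>n. - co x n)"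
definition "x - y = mkl2 (\<lambda>n. co x n - co y n)"
definition "r *\<^sub>R x = mkl2 (\<lambda>n. of_real r * co x n)"
definition "norm x = sqrt (\<Sum>\<^sub>\<infinity>n. (cmod (co x n))\<^sup>2)"
definition "dist x y = norm (x - y :: 'a l2)"
definition "sgn (x :: 'a l2) = inverse (norm x) *\<^sub>R x"
definition "(uniformity :: ('a l2 \<times> 'a l2) filter) = (INF e\<in>{0<..}. principal {(x, y). dist x y < e})"
definition "open (S :: 'a l2 set) \<longleftrightarrow> (\<forall>x\<in>S. \<forall>\<^sub>F (x', y) in uniformity. x' = x \<longrightarrow> y \<in> S)"

lemma co_sum_le_norm: "(\<Sum>n\<in>F. (cmod (co x n))\<^sup>2) \<le> (norm x)\<^sup>2"
proof (cases "finite F")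
  case True
  then have "(\<Sum>n\<in>F. (cmod (co x n))\<^sup>2) \<le> (\<Sum>\<^sub>\<infinity>n. (cmod (co x n))\<^sup>2)"
    by (intro finite_sum_le_infsum co_summable) auto
  then show ?thesis by (simp add: norm_l2_def infsum_nonneg)
qed simp

lemma L2_set_co_le_norm: "L2_set (\<lambda>n. cmod (co x n)) F \<le> norm x"
proof -
  have "0 \<le> norm x" by (simp add: norm_l2_def infsum_nonneg)
  then show ?thesis using co_sum_le_norm[of x F] by (simp add: L2_set_def real_le_lsqrt)
qed

text \<open>Norm bounds are proved on finite sets of frequencies, where \<open>L2_set\<close>
  supplies the inequalities of Minkowski and Cauchy-Schwarz.\<close>

lemma l2_norm_leI:
  assumes "0 \<le> B" and "\<And>F. finite F \<Longrightarrow> L2_set (\<lambda>n. cmod (co x n)) F \<le> B"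
  shows "norm x \<le> B"
proof -
  have "(\<Sum>\<^sub>\<infinity>n. (cmod (co x n))\<^sup>2) \<le> B\<^sup>2"
  proof (rule infsum_le_finite_sums[OF co_summable])
    fix F :: "(int^'a) set" assume "finite F"
    then have "sqrt (\<Sum>n\<in>F. (cmod (co x n))\<^sup>2) \<le> B" using assms(2)[of F] by (simp add: L2_set_def)
    then show "(\<Sum>n\<in>F. (cmod (co x n))\<^sup>2) \<le> B\<^sup>2" by (simp add: sqrt_le_D)
  qed
  then show ?thesis using assms(1) by (simp add: norm_l2_def real_le_lsqrt infsum_nonneg)
qed

lemma herm_intros: "herm c \<Longrightarrow> herm d \<Longrightarrow> herm (\<lambda>n. c n + d n)"
  "herm c \<Longrightarrow> herm d \<Longrightarrow> herm (\<lambda>n. c n - d n)" "herm c \<Longrightarrow> herm (\<lambda>n. - c n)"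
  "herm c \<Longrightarrow> herm (\<lambda>n. of_real r * c n)" "herm (\<lambda>n. 0)"
  by (auto simp: herm_def)

lemma co_mkl2_L2:
  fixes c :: "int^'a \<Rightarrow> complex"
  assumes "herm c" "\<And>F. finite F \<Longrightarrow> L2_set (\<lambda>n. cmod (c n)) F \<le> B"
  shows "co (mkl2 c) = c"
proof (rule co_mkl2_bound[OF assms(1), of "B\<^sup>2"])
  fix F :: "(int^'a) set" assume "finite F"
  then have "sqrt (\<Sum>n\<in>F. (cmod (c n))\<^sup>2) \<le> B" using assms(2)[of F] by (simp add: L2_set_def)
  then show "(\<Sum>n\<in>F. (cmod (c n))\<^sup>2) \<le> B\<^sup>2" by (simp add: sqrt_le_D)
qed

lemma L2_set_add_le: 
  "L2_set (\<lambda>n. cmod (co x n + co y n)) F \<le> norm x + norm (y :: 'a l2)"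
proof -
  have "L2_set (\<lambda>n. cmod (co x n + co y n)) F \<le> L2_set (\<lambda>n. cmod (co x n) + cmod (co y n)) F"
    by (intro L2_set_mono norm_triangle_ineq norm_ge_zero)
  also have "\<dots> \<le> L2_set (\<lambda>n. cmod (co x n)) F + L2_set (\<lambda>n. cmod (co y n)) F"
    by (rule L2_set_triangle_ineq)
  also have "\<dots> \<le> norm x + norm y" by (intro add_mono L2_set_co_le_norm)
  finally show ?thesis .
qed

lemma co_zero [simp]: "co (0 :: 'a l2) n = 0"
proof -
  have "co (0 :: 'a l2) = (\<lambda>_. 0)" unfolding zero_l2_def
    by (rule co_mkl2_bound[of _ 0]) (auto simp: herm_intros)
  then show ?thesis by simp
qed

lemma co_plus [simp]: "co (x + y :: 'a l2) n = co x n + co y n"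
proof -
  have "co (x + y) = (\<lambda>n. co x n + co y n)" unfolding plus_l2_def
    by (rule co_mkl2_L2[OF _ L2_set_add_le]) (intro herm_intros herm_co)
  then show ?thesis by simp
qed

lemma L2_set_scale: "L2_set (\<lambda>n. cmod (of_real r * co x n)) F = \<bar>r\<bar> * L2_set (\<lambda>n. cmod (co x n)) F"
  by (simp add: L2_set_right_distrib[symmetric] norm_mult)

lemma co_scaleR [simp]: "co (r *\<^sub>R x :: 'a l2) n = of_real r * co x n"
proof -
  have "co (r *\<^sub>R x) = (\<lambda>n. of_real r * co x n)" unfolding scaleR_l2_def
    by (rule co_mkl2_L2[of _ "\<bar>r\<bar> * norm x"])
       (auto simp only: L2_set_scale intro!: herm_intros herm_co mult_left_mono L2_set_co_le_norm)
  then show ?thesis by simp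
qed

lemma co_uminus [simp]: "co (- x :: 'a l2) n = - co x n"
proof -
  have "co (- x) = (\<lambda>n. - co x n)" unfolding uminus_l2_def
    by (rule co_mkl2_L2[of _ "norm x"]) (auto intro!: herm_intros herm_co L2_set_co_le_norm)
  then show ?thesis by simp
qed

lemma co_minus [simp]: "co (x - y :: 'a l2) n = co x n - co y n"
proof -
  have "co (x - y) = (\<lambda>n. co x n - co y n)" unfolding minus_l2_def
    by (rule co_mkl2_L2[of _ "norm x + norm (- y)"])
      (use L2_set_add_le[of x "- y"] in \<open>auto intro!: herm_intros herm_co\<close>)
  then show ?thesis by simp
qed

instance
proof
  fix x y z :: "'a l2" and a b :: real
  show "x + y + z = x + (y + z)" "x + y = y + x" "0 + x = x" "- x + x = 0" "x - y = x + - y"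
    "a *\<^sub>R (x + y) = a *\<^sub>R x + a *\<^sub>R y" "(a + b) *\<^sub>R x = a *\<^sub>R x + b *\<^sub>R x"
    "a *\<^sub>R b *\<^sub>R x = (a * b) *\<^sub>R x" "1 *\<^sub>R x = x"
    by (auto intro!: l2_eqI simp: algebra_simps)
  show "dist x y = norm (x - y)" "sgn x = inverse (norm x) *\<^sub>R x"
    "(uniformity :: ('a l2 \<times> 'a l2) filter) = (INF e\<in>{0<..}. principal {(x, y). dist x y < e})"
    "\<And>S :: 'a l2 set. open S \<longleftrightarrow> (\<forall>x\<in>S. \<forall>\<^sub>F (x', y) in uniformity. x' = x \<longrightarrow> y \<in> S)"
    by (fact dist_l2_def sgn_l2_def uniformity_l2_def open_l2_def)+
  have nn: "0 \<le> norm w" for w :: "'a l2" by (simp add: norm_l2_def infsum_nonneg)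
  show "norm x = 0 \<longleftrightarrow> x = 0"
  proof
    assume "norm x = 0"
    have "co x n = 0" for n
      using co_sum_le_norm[where x=x and F="{n}"] \<open>norm x = 0\<close> by simp
    then show "x = 0" by (intro l2_eqI) simp
  qed (simp add: norm_l2_def)
  show "norm (x + y) \<le> norm x + norm y"
    by (rule l2_norm_leI) (use L2_set_add_le[of x y] nn in auto)
  have "(\<Sum>\<^sub>\<infinity>n. (cmod (co (a *\<^sub>R x) n))\<^sup>2) = a\<^sup>2 * (\<Sum>\<^sub>\<infinity>n. (cmod (co x n))\<^sup>2)"
    by (subst infsum_cmult_right'[symmetric]) (simp add: norm_mult power_mult_distrib)
  then show "norm (a *\<^sub>R x) = \<bar>a\<bar> * norm x"
    by (simp add: norm_l2_def real_sqrt_mult)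
qed

end

lemma co_sum [simp]: "co (sum f A) n = (\<Sum>a\<in>A. co (f a) n)"
  by (induct A rule: infinite_finite_induct) auto

lemma co_le_norm: "cmod (co x n) \<le> norm x"
  using L2_set_co_le_norm[of x "{n}"] by (simp add: L2_set_def)

lemma bounded_linear_co: "bounded_linear (\<lambda>x. co x n)"
  by (rule bounded_linear_intro[of _ 1]) (auto simp: co_le_norm scaleR_conv_of_real)

lemmas tendsto_co = bounded_linear.tendsto[OF bounded_linear_co]
lemmas continuous_on_co = bounded_linear.continuous_on[OF bounded_linear_co]

text \<open>Lower semicontinuity of the norm under coefficientwise convergence; in the completeness
  proof it bounds the distance to the limit.\<close>

lemma norm_l2_le_limit:
  assumes lim: "\<And>n. (\<lambda>j. co (f j) n) \<longlonglongrightarrow> co x n" and le: "\<forall>\<^sub>F j in sequentially. norm (f j) \<le> B"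
  shows "norm x \<le> B"
proof (rule l2_norm_leI)
  obtain j where "norm (f j) \<le> B" using le by (auto simp: eventually_sequentially)
  then show "0 \<le> B" by (meson norm_ge_zero order_trans)
next
  fix F :: "(int^'a) set" assume "finite F"
  have "(\<lambda>j. L2_set (\<lambda>n. cmod (co (f j) n)) F) \<longlonglongrightarrow> L2_set (\<lambda>n. cmod (co x n)) F"
    unfolding L2_set_def by (intro tendsto_intros lim)
  moreover have "\<forall>\<^sub>F j in sequentially. L2_set (\<lambda>n. cmod (co (f j) n)) F \<le> B"
    using le by eventually_elim (rule order_trans[OF L2_set_co_le_norm])
  ultimately show "L2_set (\<lambda>n. cmod (co x n)) F \<le> B"
    by (intro tendsto_upperbound[where F=sequentially]) auto
qed

instance l2 :: (finite) banach
proof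
  fix X :: "nat \<Rightarrow> 'a l2" assume X: "Cauchy X"
  have "Cauchy (\<lambda>j. co (X j) n)" for n
    using bounded_linear.Cauchy[OF bounded_linear_co X] .
  then have "\<exists>l. (\<lambda>j. co (X j) n) \<longlonglongrightarrow> l" for n
    by (simp add: Cauchy_convergent_iff convergent_def)
  then obtain c where c: "\<And>n. (\<lambda>j. co (X j) n) \<longlonglongrightarrow> c n"
    by metis
  obtain B where B: "\<And>j. norm (X j) \<le> B"
    using Cauchy_Bseq[OF X] by (auto simp: Bseq_def)
  have "herm c"
  proof (unfold herm_def, rule allI)
    fix n
    have "(\<lambda>j. co (X j) (- n)) \<longlonglongrightarrow> cnj (c n)"
      using tendsto_cnj[OF c[of n]] by (simp add: co_uminus_index)
    then show "c (- n) = cnj (c n)" using c LIMSEQ_unique by blast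
  qed
  moreover have "L2_set (\<lambda>n. cmod (c n)) F \<le> B" if "finite F" for F
  proof (rule tendsto_upperbound[where F=sequentially])
    show "(\<lambda>j. L2_set (\<lambda>n. cmod (co (X j) n)) F) \<longlonglongrightarrow> L2_set (\<lambda>n. cmod (c n)) F"
      unfolding L2_set_def by (intro tendsto_intros c)
    show "\<forall>\<^sub>F j in sequentially. L2_set (\<lambda>n. cmod (co (X j) n)) F \<le> B"
      by (intro always_eventually allI) (rule order_trans[OF L2_set_co_le_norm B])
  qed auto
  ultimately have co_c: "co (mkl2 c) = c" by (rule co_mkl2_L2)
  have "X \<longlonglongrightarrow> mkl2 c"
  proof (rule LIMSEQ_I)
    fix r :: real assume "0 < r"
    then obtain N where N: "\<And>i j. i \<ge> N \<Longrightarrow> j \<ge> N \<Longrightarrow> norm (X i - X j) < r / 2"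
      using CauchyD[OF X, of "r/2"] by auto
    have "norm (X i - mkl2 c) \<le> r / 2" if "i \<ge> N" for i
    proof (rule norm_l2_le_limit)
      show "(\<lambda>j. co (X i - X j) n) \<longlonglongrightarrow> co (X i - mkl2 c) n" for n
        using tendsto_diff[OF tendsto_const c[of n]] by (simp add: co_c)
      show "\<forall>\<^sub>F j in sequentially. norm (X i - X j) \<le> r / 2"
        using eventually_ge_at_top[of N] by eventually_elim (use N[OF that] in \<open>auto intro: less_imp_le\<close>)
    qed
    then show "\<exists>no. \<forall>n\<ge>no. norm (X n - mkl2 c) < r" using \<open>0 < r\<close> by (intro exI[of _ N]) force
  qed
  then show "convergent X" by (auto simp: convergent_def)
qed

no_notation Infinite_Set_Sum.abs_summable_on (infix \<open>abs'_summable'_on\<close> 50)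

section \<open>Fourier multipliers\<close>

definition mul :: "(int^'d \<Rightarrow> real) \<Rightarrow> 'd l2 \<Rightarrow> 'd::finite l2" where
  "mul m x = mkl2 (\<lambda>n. of_real (m n) * co x n)"

lemma L2_set_mul_le:
  assumes "\<And>n. \<bar>m n\<bar> \<le> B"
  shows "L2_set (\<lambda>n. cmod (of_real (m n) * co x n)) F \<le> B * norm x"
proof -
  have B: "0 \<le> B" using assms[of 0] by linarith
  have "L2_set (\<lambda>n. cmod (of_real (m n) * co x n)) F \<le> L2_set (\<lambda>n. B * cmod (co x n)) F"
    by (intro L2_set_mono) (auto simp: norm_mult assms mult_right_mono)
  also have "\<dots> = B * L2_set (\<lambda>n. cmod (co x n)) F"
    using B by (simp add: L2_set_right_distrib)
  also have "\<dots> \<le> B * norm x" using B by (intro mult_left_mono L2_set_co_le_norm)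
  finally show ?thesis .
qed

lemma
  assumes even: "\<And>n. m (- n) = m n" and bd: "\<And>n. \<bar>m n\<bar> \<le> B"
  shows co_mul: "co (mul m x) n = of_real (m n) * co x n"
    and norm_mul_le: "norm (mul m x) \<le> B * norm x"
proof -
  have "herm (\<lambda>n. of_real (m n) * co x n)"
    by (auto simp: herm_def even co_uminus_index)
  then have *: "co (mul m x) = (\<lambda>n. of_real (m n) * co x n)"
    unfolding mul_def by (rule co_mkl2_L2[OF _ L2_set_mul_le[OF bd]])
  then show "co (mul m x) n = of_real (m n) * co x n" by simp
  have "0 \<le> B" using bd[of 0] by linarith
  then show "norm (mul m x) \<le> B * norm x"
    by (intro l2_norm_leI) (simp_all add: * L2_set_mul_le[OF bd])
qed

text \<open>Dominated convergence: outside a finite set \<open>H\<close> the majorant has small mass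
  and the difference is at most \<open>2 * b\<close>, while on \<open>H\<close> coefficientwise
  convergence is enough.\<close>

lemma l2_tendsto_dominated:
  assumes lim: "\<And>n. ((\<lambda>t. co (f t) n) \<longlongrightarrow> co l n) G"
    and dom: "\<forall>\<^sub>F t in G. \<forall>n. cmod (co (f t) n) \<le> b n" and doml: "\<And>n. cmod (co l n) \<le> b n"
    and sb: "(\<lambda>n. (b n)\<^sup>2) summable_on UNIV"
  shows "(f \<longlongrightarrow> l) G"
proof (rule tendstoI)
  fix e :: real assume "0 < e"
  define e' where "e' = e / 4"
  have e': "0 < e'" using \<open>0 < e\<close> by (simp add: e'_def)
  obtain H where H: "finite H" "dist (\<Sum>n\<in>H. (b n)\<^sup>2) (\<Sum>\<^sub>\<infinity>n. (b n)\<^sup>2) \<le> e'\<^sup>2"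
    using infsum_finite_approximation[OF sb, of "e'\<^sup>2"] e' by auto
  have tail: "L2_set b F \<le> e'" if F: "finite F" "F \<inter> H = {}" for F
  proof -
    have "(\<Sum>n\<in>F. (b n)\<^sup>2) + (\<Sum>n\<in>H. (b n)\<^sup>2) = (\<Sum>n\<in>F \<union> H. (b n)\<^sup>2)"
      using F H(1) by (simp add: sum.union_disjoint)
    also have "\<dots> \<le> (\<Sum>\<^sub>\<infinity>n. (b n)\<^sup>2)" using F H(1) by (intro finite_sum_le_infsum sb) auto
    finally have "(\<Sum>n\<in>F. (b n)\<^sup>2) \<le> e'\<^sup>2" using H(2) by (auto simp: dist_real_def)
    then show ?thesis using e' by (simp add: L2_set_def real_le_lsqrt)
  qed
  have "((\<lambda>t. L2_set (\<lambda>n. cmod (co (f t) n - co l n)) H) \<longlongrightarrow> L2_set (\<lambda>n. cmod (co l n - co l n)) H) G"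
    unfolding L2_set_def by (intro tendsto_intros lim)
  then have "\<forall>\<^sub>F t in G. L2_set (\<lambda>n. cmod (co (f t) n - co l n)) H < e'"
    using e' by (intro order_tendstoD(2)) (auto simp: L2_set_def)
  then show "\<forall>\<^sub>F t in G. dist (f t) l < e"
    using dom
  proof eventually_elim
    case (elim t)
    have "norm (f t - l) \<le> e' + 2 * e'"
    proof (rule l2_norm_leI)
      fix F :: "(int^'a) set" assume F: "finite F"
      let ?g = "\<lambda>n. cmod (co (f t) n - co l n)"
      have "L2_set ?g F \<le> L2_set ?g (F \<union> H)" using F H(1)
        by (simp add: L2_set_def sum_mono2)
      also have "L2_set ?g (F \<union> H) = sqrt ((L2_set ?g H)\<^sup>2 + (L2_set ?g (F - H))\<^sup>2)"
      proof -
        have "F \<union> H = H \<union> (F - H)" by auto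
        then have "(\<Sum>n\<in>F \<union> H. (?g n)\<^sup>2) = (\<Sum>n\<in>H. (?g n)\<^sup>2) + (\<Sum>n\<in>F - H. (?g n)\<^sup>2)"
          using F H(1) sum.union_disjoint[of H "F - H" "\<lambda>n. (?g n)\<^sup>2"] by auto
        then show ?thesis by (simp add: L2_set_def sum_nonneg)
      qed
      also have "\<dots> \<le> L2_set ?g H + L2_set ?g (F - H)"
        by (rule sqrt_sum_squares_le_sum) auto
      also have "L2_set ?g (F - H) \<le> L2_set (\<lambda>n. 2 * b n) (F - H)"
        by (intro L2_set_mono) (use elim(2) doml norm_triangle_ineq4[of "co (f t) _" "co l _"] in
          \<open>auto, smt (verit, best)\<close>)
      also have "\<dots> = 2 * L2_set b (F - H)" by (simp add: L2_set_right_distrib)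
      also have "\<dots> \<le> 2 * e'" using tail[of "F - H"] F by auto
      finally show "L2_set (\<lambda>n. cmod (co (f t - l) n)) F \<le> e' + 2 * e'" using elim(1) by simp
    qed (use e' in auto)
    then show ?case using \<open>0 < e\<close> by (simp add: dist_norm e'_def)
  qed
qed

definition proj :: "real \<Rightarrow> 'd l2 \<Rightarrow> 'd::finite l2" where
  "proj R = mul (\<lambda>n. if freq n \<le> R then 1 else 0)"

lemma co_proj: "co (proj R x) n = (if freq n \<le> R then co x n else 0)"
  unfolding proj_def by (subst co_mul[where B=1]) auto

lemma norm_proj_le: "norm (proj R x) \<le> norm x"
  unfolding proj_def using norm_mul_le[of "\<lambda>n. if freq n \<le> R then 1 else 0" 1 x] by simp

lemma proj_diff: "proj R (x - y) = proj R x - proj R y"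
  by (rule l2_eqI) (simp add: co_proj)

lemma proj_tendsto: "((\<lambda>R. proj R x) \<longlongrightarrow> x) at_top"
proof (rule l2_tendsto_dominated[where b="\<lambda>n. cmod (co x n)"])
  fix n
  have "\<forall>\<^sub>F R in at_top. co (proj R x) n = co x n"
    using eventually_ge_at_top[of "freq n"] by eventually_elim (simp add: co_proj)
  then show "((\<lambda>R. co (proj R x) n) \<longlongrightarrow> co x n) at_top"
    by (rule tendsto_eventually)
qed (auto simp: co_proj co_summable intro!: always_eventually)

text \<open>A finite net suffices because the projections are contractions. This later reduces
  continuity of \<open>duh f\<close> to finitely many modes.\<close>

lemma proj_uniform_on_compact:
  assumes "compact K" and "0 < e"
  shows "\<exists>R0. \<forall>R\<ge>R0. \<forall>x\<in>K. norm (x - proj R x) < e"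
proof -
  obtain C where C: "finite C" "C \<subseteq> K" "K \<subseteq> (\<Union>x\<in>C. ball x (e / 3))"
    by (rule compactE_image[OF assms(1), of K "\<lambda>x. ball x (e/3)"]) (use assms(2) in force)+
  have "\<forall>\<^sub>F R in at_top. \<forall>x\<in>C. dist (proj R x) x < e / 3"
    using C(1) assms(2) by (intro eventually_ball_finite ballI tendstoD[OF proj_tendsto]) auto
  then obtain R0 where R0: "\<And>R x. R \<ge> R0 \<Longrightarrow> x \<in> C \<Longrightarrow> dist (proj R x) x < e / 3"
    by (auto simp: eventually_at_top_linorder)
  have "norm (x - proj R x) < e" if "R \<ge> R0" "x \<in> K" for R x
  proof -
    obtain y where y: "y \<in> C" "norm (x - y) < e / 3"
      using C(3) \<open>x \<in> K\<close> by (auto simp: dist_norm norm_minus_commute)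
    have "x - proj R x = (x - y) + (y - proj R y) - proj R (x - y)"
      by (simp add: proj_diff)
    then have "norm (x - proj R x) = norm ((x - y) + (y - proj R y) - proj R (x - y))"
      by (rule arg_cong)
    then have "norm (x - proj R x) \<le> norm (x - y) + norm (y - proj R y) + norm (proj R (x - y))"
      using norm_triangle_ineq4[of "(x - y) + (y - proj R y)" "proj R (x - y)"]
        norm_triangle_ineq[of "x - y" "y - proj R y"] by linarith
    then show ?thesis
      using y R0[OF that(1) y(1)] norm_proj_le[of R "x - y"] by (simp add: dist_norm norm_minus_commute)
  qed
  then show ?thesis by blast
qed

section \<open>Convolution and trigonometric series\<close>

definition conv :: "(int^'d \<Rightarrow> 'a) \<Rightarrow> (int^'d \<Rightarrow> 'a) \<Rightarrow> int^'d \<Rightarrow> 'a::{real_normed_field,banach}" where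
  "conv a b n = (\<Sum>\<^sub>\<infinity>p. a p * b (n - p))"

definition fser :: "(int^'d \<Rightarrow> complex) \<Rightarrow> real^'d \<Rightarrow> complex" where
  "fser c y = (\<Sum>\<^sub>\<infinity>n. c n * cis (y \<bullet> lattice_vec n))"

lemma conv_commute: "conv a b = conv b a"
proof
  fix n
  show "conv a b n = conv b a n" unfolding conv_def
    by (rule infsum_reindex_bij_witness[of _ "\<lambda>p. n - p" "\<lambda>p. n - p"]) auto
qed

lemma abs_summable_bounded:
  assumes "c abs_summable_on (UNIV :: (int^'d) set)"
  obtains B where "0 \<le> B" "\<And>n. norm (c n) \<le> B"
proof
  show "0 \<le> infsum (\<lambda>n. norm (c n)) UNIV" by (simp add: infsum_nonneg)
  show "norm (c n) \<le> infsum (\<lambda>n. norm (c n)) UNIV" for n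
    using finite_sum_le_infsum[OF assms, of "{n}"] by simp
qed

lemma conv_abs_summable1:
  fixes a b :: "int^'d \<Rightarrow> 'a::{real_normed_field,banach}"
  assumes a: "a abs_summable_on UNIV" and b: "\<And>n. norm (b n) \<le> B"
  shows "(\<lambda>p. a p * b (n - p)) abs_summable_on UNIV"
proof (rule Infinite_Sum.abs_summable_on_comparison_test')
  show "(\<lambda>p. norm (a p) * B) summable_on UNIV" by (rule summable_on_cmult_left[OF a])
  show "norm (a p * b (n - p)) \<le> norm (a p) * B" for p
    by (simp add: norm_mult b mult_left_mono)
qed

lemma abs_summable_prod:
  fixes a b :: "int^'d \<Rightarrow> 'a::{real_normed_field,banach}"
  assumes a: "a abs_summable_on UNIV" and b: "b abs_summable_on UNIV"
  shows "(\<lambda>(p, q). a p * b q) abs_summable_on UNIV \<times> UNIV"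
proof (subst Infinite_Sum.abs_summable_on_Sigma_iff, intro conjI ballI)
  show "(\<lambda>y. case (x, y) of (p, q) \<Rightarrow> a p * b q) abs_summable_on UNIV" for x
    using summable_on_cmult_right[OF b] by (simp add: norm_mult)
  have "(\<lambda>x. norm (a x) * (\<Sum>\<^sub>\<infinity>q. norm (b q))) summable_on UNIV"
    by (rule summable_on_cmult_left[OF a])
  then show "(\<lambda>x. \<Sum>\<^sub>\<infinity>y. norm (case (x, y) of (p, q) \<Rightarrow> a p * b q)) abs_summable_on UNIV"
    by (simp add: norm_mult infsum_cmult_right' abs_mult infsum_nonneg)
qed

text \<open>Fubini for the absolutely summable double family, reindexed so that the outer variable
  is the sum of the two frequencies.\<close>

lemma
  fixes a b :: "int^'d \<Rightarrow> 'a::{real_normed_field,banach}"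
  assumes a: "a abs_summable_on UNIV" and b: "b abs_summable_on UNIV"
  shows conv_has_sum: "(conv a b has_sum (infsum a UNIV * infsum b UNIV)) UNIV"
    and conv_abs_summable: "conv a b abs_summable_on UNIV"
proof -
  \<comment> \<open>Stated for a fresh field type, so that it applies both to the given families and
    to their real norms, which dominate the convolution.\<close>
  have gen: "(conv a b has_sum (infsum a UNIV * infsum b UNIV)) UNIV"
    if a: "a abs_summable_on UNIV" and b: "b abs_summable_on UNIV"
    for a b :: "int^'d \<Rightarrow> 'b::{real_normed_field,banach}"
  proof -
    let ?S = "infsum a UNIV * infsum b UNIV"
    have s: "(\<lambda>(p, q). a p * b q) summable_on UNIV \<times> UNIV"
      by (rule abs_summable_summable[OF abs_summable_prod[OF a b]])
    have "infsum (\<lambda>(p, q). a p * b q) (UNIV \<times> UNIV) = ?S"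
      using infsum_Sigma_banach[OF s] by (simp add: infsum_cmult_right' infsum_cmult_left')
    then have "((\<lambda>(p, q). a p * b q) has_sum ?S) (UNIV \<times> UNIV)"
      using has_sum_infsum[OF s] by simp
    also have "((\<lambda>(p, q). a p * b q) has_sum ?S) (UNIV \<times> UNIV) \<longleftrightarrow>
        ((\<lambda>(n, p). a p * b (n - p)) has_sum ?S) (UNIV \<times> UNIV)"
      by (rule has_sum_reindex_bij_witness[of _ "\<lambda>(n, p). (p, n - p)" "\<lambda>(p, q). (p + q, p)"]) auto
    finally have *: "((\<lambda>(n, p). a p * b (n - p)) has_sum ?S) (UNIV \<times> UNIV)" .
    obtain B where B: "\<And>n. norm (b n) \<le> B" using abs_summable_bounded[OF b] by blast
    show ?thesis
    proof (rule has_sum_SigmaD[OF *])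
      show "((\<lambda>p. case (n, p) of (n, p) \<Rightarrow> a p * b (n - p)) has_sum conv a b n) UNIV" for n
        unfolding conv_def prod.case
        by (rule has_sum_infsum[OF abs_summable_summable[OF conv_abs_summable1[OF a B]]])
    qed
  qed
  show "(conv a b has_sum (infsum a UNIV * infsum b UNIV)) UNIV" by (rule gen[OF a b])
  have "(conv (\<lambda>n. norm (a n)) (\<lambda>n. norm (b n)) has_sum
      (infsum (\<lambda>n. norm (a n)) UNIV * infsum (\<lambda>n. norm (b n)) UNIV)) UNIV"
    by (rule gen) (use a b in simp_all)
  then have "conv (\<lambda>n. norm (a n)) (\<lambda>n. norm (b n)) summable_on UNIV" by (rule has_sum_imp_summable)
  then show "conv a b abs_summable_on UNIV"
  proof (rule Infinite_Sum.abs_summable_on_comparison_test')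
    fix n
    obtain B where B: "\<And>n. norm (b n) \<le> B" using abs_summable_bounded[OF b] by blast
    show "norm (conv a b n) \<le> conv (\<lambda>n. norm (a n)) (\<lambda>n. norm (b n)) n"
      unfolding conv_def using norm_infsum_bound[OF conv_abs_summable1[where n=n, OF a B]] by (simp add: norm_mult)
  qed
qed

lemma fser_abs_summable:
  "c abs_summable_on UNIV \<Longrightarrow> (\<lambda>n. c n * cis (y \<bullet> lattice_vec n)) abs_summable_on UNIV"
  by (simp add: norm_mult)

text \<open>Twisting both families by the character at \<open>y\<close> commutes with convolution,
  so this is the product formula for the twisted families.\<close>

lemma fser_conv:
  assumes a: "a abs_summable_on UNIV" and b: "b abs_summable_on UNIV"
  shows "fser (conv a b) y = fser a y * fser b y"
proof -
  let ?e = "\<lambda>n. cis (y \<bullet> lattice_vec n)"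
  have "conv (\<lambda>n. a n * ?e n) (\<lambda>n. b n * ?e n) n = conv a b n * ?e n" for n
  proof -
    have "?e p * ?e (n - p) = ?e n" for p by (simp add: cis_mult inner_diff_right)
    then have "a p * ?e p * (b (n - p) * ?e (n - p)) = a p * b (n - p) * ?e n" for p
      by (metis (no_types, lifting) mult.assoc mult.left_commute)
    then show ?thesis unfolding conv_def by (simp only: infsum_cmult_left')
  qed
  then have "conv (\<lambda>n. a n * ?e n) (\<lambda>n. b n * ?e n) = (\<lambda>n. conv a b n * ?e n)" ..
  then show ?thesis
    using infsumI[OF conv_has_sum[OF fser_abs_summable[OF a, of y] fser_abs_summable[OF b, of y]]]
    by (simp add: fser_def)
qed

lemma conv_add_left:
  assumes a: "a abs_summable_on UNIV" "a' abs_summable_on UNIV" and b: "b abs_summable_on UNIV"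
  shows "conv (\<lambda>n. a n + a' n) b n = conv a b n + conv a' b n"
proof -
  obtain B where B: "\<And>n. norm (b n) \<le> B" using abs_summable_bounded[OF b] by blast
  show ?thesis unfolding conv_def
    by (subst infsum_add[symmetric])
      (auto intro!: abs_summable_summable conv_abs_summable1[OF _ B] a simp: algebra_simps)
qed

lemma herm_conv: "herm a \<Longrightarrow> herm b \<Longrightarrow> herm (conv a b)"
proof (unfold herm_def, rule allI)
  fix n assume h: "\<forall>n. a (- n) = cnj (a n)" "\<forall>n. b (- n) = cnj (b n)"
  have "conv a b (- n) = (\<Sum>\<^sub>\<infinity>p. cnj (a p * b (n - p)))" unfolding conv_def
  proof (rule infsum_reindex_bij_witness[of _ uminus uminus])
    fix p
    show "cnj (a (- p) * b (n - - p)) = a p * b (- n - p)"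
      using h(1)[rule_format, of p] h(2)[rule_format, of "n + p"] by (simp add: algebra_simps)
  qed auto
  then show "conv a b (- n) = cnj (conv a b n)" by (simp only: infsum_cnj conv_def)
qed

lemma fser_real: assumes "herm c" shows "fser c y = of_real (Re (fser c y))"
proof -
  have "cnj (fser c y) = (\<Sum>\<^sub>\<infinity>n. cnj (c n * cis (y \<bullet> lattice_vec n)))"
    by (simp only: infsum_cnj fser_def)
  also have "\<dots> = fser c y" unfolding fser_def
    by (rule infsum_reindex_bij_witness[of _ uminus uminus])
       (use assms in \<open>auto simp: herm_def cis_cnj\<close>)
  finally show ?thesis by (metis Reals_cnj_iff of_real_Re)
qed

text \<open>Young's inequality for l1 against l2: the convolution is a limit of finite combinations
  of translates of \<open>x\<close>, and translation preserves the bound \<open>X\<close>.\<close>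

lemma young_L2_set:
  fixes \<beta> x :: "int^'d \<Rightarrow> real"
  assumes \<beta>: "\<beta> summable_on UNIV" "\<And>n. 0 \<le> \<beta> n"
    and x: "\<And>F. finite F \<Longrightarrow> L2_set x F \<le> X" and F: "finite F"
  shows "L2_set (conv \<beta> x) F \<le> infsum \<beta> UNIV * X"
proof (rule tendsto_upperbound)
  have X0: "0 \<le> X" using x[of "{}"] by simp
  have xb: "norm (x n) \<le> X" for n using x[of "{n}"] by (simp add: L2_set_def)
  have \<beta>': "\<beta> abs_summable_on UNIV" using \<beta> by simp
  show "((\<lambda>J. L2_set (\<lambda>n. \<Sum>j\<in>J. \<beta> j * x (n - j)) F) \<longlongrightarrow> L2_set (conv \<beta> x) F) (finite_subsets_at_top UNIV)"
    unfolding L2_set_def conv_def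
    by (intro tendsto_intros infsum_tendsto abs_summable_summable[OF conv_abs_summable1[OF \<beta>' xb]])
  show "\<forall>\<^sub>F J in finite_subsets_at_top UNIV. L2_set (\<lambda>n. \<Sum>j\<in>J. \<beta> j * x (n - j)) F \<le> infsum \<beta> UNIV * X"
  proof (rule eventually_finite_subsets_at_top_weakI)
    fix J :: "(int^'d) set" assume J: "finite J"
    have "L2_set (\<lambda>n. \<Sum>j\<in>J. \<beta> j * x (n - j)) F \<le> (\<Sum>j\<in>J. L2_set (\<lambda>n. \<beta> j * x (n - j)) F)"
      by (rule L2_set_sum_le)
    also have "\<dots> \<le> (\<Sum>j\<in>J. \<beta> j * X)"
    proof (rule sum_mono)
      fix j
      have "L2_set (\<lambda>n. x (n - j)) F = L2_set x ((\<lambda>n. n - j) ` F)"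
        unfolding L2_set_def by (subst sum.reindex) (auto simp: inj_on_def)
      also have "\<dots> \<le> X" using F by (intro x) simp
      finally show "L2_set (\<lambda>n. \<beta> j * x (n - j)) F \<le> \<beta> j * X"
        using \<beta>(2) by (simp add: L2_set_right_distrib[symmetric] mult_left_mono)
    qed
    also have "\<dots> = (\<Sum>j\<in>J. \<beta> j) * X" by (simp add: sum_distrib_right)
    also have "\<dots> \<le> infsum \<beta> UNIV * X"
      using J \<beta> by (intro mult_right_mono finite_sum_le_infsum X0) auto
    finally show "L2_set (\<lambda>n. \<Sum>j\<in>J. \<beta> j * x (n - j)) F \<le> infsum \<beta> UNIV * X" .
  qed
qed auto

section \<open>The algebra \<open>H\<^sup>k\<close>\<close>

text \<open>The Japanese bracket; its \<open>k\<close>-th power is the H^k weight on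
  amplitudes.\<close>

definition jb :: "int^'d \<Rightarrow> real" where
  "jb n = sqrt (1 + (freq n)\<^sup>2)"

definition wt :: "nat \<Rightarrow> int^'d \<Rightarrow> real" where
  "wt k n = jb n ^ k"

lemma jb_ge_1: "1 \<le> jb n" and jb_uminus [simp]: "jb (- n) = jb n"
  and freq_le_jb: "freq n \<le> jb n"
  by (auto simp: jb_def intro!: real_le_rsqrt)

lemma jb_add_le: "jb (m + n) \<le> jb m + freq n"
proof -
  have "(freq (m + n))\<^sup>2 \<le> (freq m + freq n)\<^sup>2" by (intro power_mono freq_triangle) simp
  moreover have "freq m * freq n \<le> jb m * freq n" by (intro mult_right_mono freq_le_jb) simp
  moreover have "(jb m)\<^sup>2 = 1 + (freq m)\<^sup>2" by (simp add: jb_def)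
  ultimately have "1 + (freq (m + n))\<^sup>2 \<le> (jb m + freq n)\<^sup>2" by (simp add: power2_sum)
  then show ?thesis unfolding jb_def[of "m + n"]
    using jb_ge_1[of m] freq_nonneg[of n] by (intro real_le_lsqrt) linarith+
qed

lemma wt_pos: "0 < wt k n" and wt_ge_1: "1 \<le> wt k n" and wt_uminus [simp]: "wt k (- n) = wt k n"
  using jb_ge_1[of n] by (auto simp: wt_def)

lemma wt_power2: "(wt k n)\<^sup>2 = (1 + (freq n)\<^sup>2) ^ k"
proof -
  have "(jb n)\<^sup>2 = 1 + (freq n)\<^sup>2" by (simp add: jb_def)
  then show ?thesis by (simp add: wt_def power_mult[symmetric] mult.commute[of k]) (simp add: power_mult)
qed

lemma wt_add_le: "wt k (m + n) \<le> 2 ^ k * (wt k m + wt k n)"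
proof -
  have "jb (m + n) \<le> 2 * max (jb m) (jb n)"
    using jb_add_le[of m n] freq_le_jb[of n] by linarith
  then have "wt k (m + n) \<le> (2 * max (jb m) (jb n)) ^ k"
    unfolding wt_def using jb_ge_1[of "m + n"] by (intro power_mono) linarith+
  also have "\<dots> = 2 ^ k * max (jb m) (jb n) ^ k" by (simp add: power_mult_distrib)
  also have "max (jb m) (jb n) ^ k \<le> wt k m + wt k n"
    using wt_pos[of k m] wt_pos[of k n] by (auto simp: max_def wt_def)
  finally show ?thesis by simp
qed

text \<open>The exponent \<open>k\<close> is shared equally among the \<open>d\<close> coordinates:
  each factor \<open>1 + |n|^2\<close> is bounded below by \<open>1 + (n $ i)^2\<close> and gets the
  power \<open>s = k / d\<close>. The sum is then dominated by a product of one-dimensional series,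
  which converge since \<open>2 * s > 1\<close>.\<close>

lemma summable_inverse_wt:
  assumes k: "CARD('d) < 2 * k"
  shows "(\<lambda>n :: int^'d. 1 / (wt k n)\<^sup>2) summable_on UNIV"
proof -
  define d where "d = real CARD('d)"
  define s where "s = real k / d"
  have d: "0 < d" by (simp add: d_def)
  have s: "1 < 2 * s" using k by (simp add: s_def d_def field_simps)
  define a :: "int \<Rightarrow> real" where "a m = (1 + (of_int m)\<^sup>2) powr (- s)" for m
  have le: "1 / (wt k n)\<^sup>2 \<le> (\<Prod>i\<in>UNIV. a (n $ i))" for n :: "int^'d"
  proof -
    have "((1 + (freq n)\<^sup>2) powr (- s)) ^ CARD('d) = (1 + (freq n)\<^sup>2) powr (- s * d)"
      using add_pos_nonneg[of 1 "(freq n)\<^sup>2"] by (simp add: powr_realpow[symmetric] powr_powr d_def)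
    also have "- s * d = - real k" using d by (simp add: s_def)
    also have "(1 + (freq n)\<^sup>2) powr (- real k) = 1 / (wt k n)\<^sup>2"
      using add_pos_nonneg[of 1 "(freq n)\<^sup>2"]
      by (simp add: wt_power2 powr_minus powr_realpow divide_inverse)
    finally have "1 / (wt k n)\<^sup>2 = (\<Prod>i\<in>(UNIV :: 'd set). (1 + (freq n)\<^sup>2) powr (- s))" by simp
    also have "\<dots> \<le> (\<Prod>i\<in>UNIV. a (n $ i))"
    proof (rule prod_mono, intro conjI)
      fix i :: 'd
      have "\<bar>of_int (n $ i)\<bar> \<le> freq n"
        using component_le_norm_cart[of "lattice_vec n" i] by (simp add: freq_def lattice_vec_def)
      then have "(of_int (n $ i))\<^sup>2 \<le> (freq n)\<^sup>2"
        by (metis abs_le_square_iff abs_of_nonneg freq_nonneg)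
      then show "(1 + (freq n)\<^sup>2) powr (- s) \<le> a (n $ i)" unfolding a_def
        using s by (intro powr_mono2') (auto intro: add_pos_nonneg)
    qed simp
    finally show ?thesis .
  qed
  have "summable (\<lambda>m. of_nat m powr (- 2 * s) :: real)"
    using s by (simp add: summable_real_powr_iff)
  define C where "C = 1 + 2 * (\<Sum>m. of_nat m powr (- 2 * s) :: real)"
  have sumC: "(\<Sum>m\<in>{-int N..int N}. a m) \<le> C" for N
  proof -
    have am: "a (int m) \<le> of_nat m powr (- 2 * s)" if "m > 0" for m
    proof -
      have "a (int m) \<le> ((real m)\<^sup>2) powr (- s)" unfolding a_def
        using that s by (intro powr_mono2') auto
      also have "\<dots> = of_nat m powr (- 2 * s)"
      proof -
        have "(real m)\<^sup>2 = real m powr 2" using that by simp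
        then show ?thesis by (simp only: powr_powr) simp
      qed
      finally show ?thesis .
    qed
    have "(\<Sum>m\<in>{-int N..int N}. a m) \<le> (\<Sum>m\<in>int ` {1..N}. a m) + (\<Sum>m\<in>(\<lambda>m. - int m) ` {1..N}. a m) + (\<Sum>m\<in>{0}. a m)"
    proof -
      have "{-int N..int N} \<subseteq> (int ` {1..N} \<union> (\<lambda>m. - int m) ` {1..N}) \<union> {0}"
      proof
        fix m assume "m \<in> {-int N..int N}"
        then have "m = 0 \<or> m = int (nat \<bar>m\<bar>) \<and> nat \<bar>m\<bar> \<in> {1..N} \<or> m = - int (nat \<bar>m\<bar>) \<and> nat \<bar>m\<bar> \<in> {1..N}" by auto
        then show "m \<in> (int ` {1..N} \<union> (\<lambda>m. - int m) ` {1..N}) \<union> {0}" by blast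
      qed
      moreover have "int ` {1..N} \<inter> (\<lambda>m. - int m) ` {1..N} = {}" by auto
      moreover have "(int ` {1..N} \<union> (\<lambda>m. - int m) ` {1..N}) \<inter> {0} = {}" by auto
      moreover have "\<And>m. 0 \<le> a m" by (simp add: a_def)
      ultimately show ?thesis
        using sum_mono2[of "(int ` {1..N} \<union> (\<lambda>m. - int m) ` {1..N}) \<union> {0}" "{-int N..int N}" a]
          sum.union_disjoint[of "int ` {1..N} \<union> (\<lambda>m. - int m) ` {1..N}" "{0}" a]
          sum.union_disjoint[of "int ` {1..N}" "(\<lambda>m. - int m) ` {1..N}" a] by auto
    qed
    also have "(\<Sum>m\<in>int ` {1..N}. a m) = (\<Sum>m\<in>{1..N}. a (int m))" by (subst sum.reindex) (auto simp: inj_on_def)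
    also have "(\<Sum>m\<in>(\<lambda>m. - int m) ` {1..N}. a m) = (\<Sum>m\<in>{1..N}. a (int m))"
      by (subst sum.reindex) (auto simp: inj_on_def a_def)
    also have "(\<Sum>m\<in>{1..N}. a (int m)) \<le> (\<Sum>m\<in>{1..N}. of_nat m powr (- 2 * s))"
      by (intro sum_mono am) auto
    also have "\<dots> \<le> (\<Sum>m. of_nat m powr (- 2 * s))"
      by (intro sum_le_suminf) (use \<open>summable _\<close> in auto)
    also have "(\<Sum>m\<in>{0}. a m) = 1" by (simp add: a_def)
    finally show ?thesis by (simp add: C_def)
  qed
  show ?thesis
  proof (rule nonneg_bdd_above_summable_on, simp, rule bdd_aboveI2)
    fix F :: "(int^'d) set" assume F: "F \<in> {F. F \<subseteq> UNIV \<and> finite F}"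
    obtain N where N: "\<And>n i. n \<in> F \<Longrightarrow> n $ i \<in> {-int N..int N}"
    proof -
      let ?M = "Max ((\<lambda>(n, i). \<bar>n $ i\<bar>) ` (F \<times> UNIV))"
      have "\<bar>n $ i\<bar> \<le> ?M" if "n \<in> F" for n i
        using F that by (intro Max_ge) (auto intro: image_eqI[of _ _ "(n, i)"])
      then have "n $ i \<in> {-int (nat ?M)..int (nat ?M)}" if "n \<in> F" for n i
        using that by (smt (verit) atLeastAtMost_iff int_nat_eq)
      then show ?thesis using that by blast
    qed
    have "(\<Sum>n\<in>F. 1 / (wt k n)\<^sup>2) \<le> (\<Sum>n\<in>F. \<Prod>i\<in>UNIV. a (n $ i))" by (intro sum_mono le)
    also have "\<dots> = (\<Sum>g\<in>vec_nth ` F. \<Prod>i\<in>UNIV. a (g i))"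
      by (subst sum.reindex) (auto simp: inj_on_def vec_eq_iff)
    also have "\<dots> \<le> (\<Sum>g\<in>PiE (UNIV :: 'd set) (\<lambda>_. {-int N..int N}). \<Prod>i\<in>UNIV. a (g i))"
    proof (rule sum_mono2)
      show "vec_nth ` F \<subseteq> PiE UNIV (\<lambda>_. {-int N..int N})" using N by (auto simp: PiE_def Pi_def)
    qed (auto intro!: finite_PiE prod_nonneg simp: a_def)
    also have "\<dots> = (\<Prod>i\<in>(UNIV :: 'd set). \<Sum>m\<in>{-int N..int N}. a m)"
      by (subst prod_sum_PiE) auto
    also have "\<dots> \<le> C ^ CARD('d)"
      using sumC[of N] by (simp add: power_mono sum_nonneg a_def)
    finally show "(\<Sum>n\<in>F. 1 / (wt k n)\<^sup>2) \<le> C ^ CARD('d)" .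
  qed
qed

text \<open>The true Fourier coefficients of the function represented by \<open>x\<close>, whose
  \<open>co\<close> carries the Sobolev weight.\<close>

definition hat :: "nat \<Rightarrow> 'd l2 \<Rightarrow> int^'d \<Rightarrow> complex" where
  "hat k x n = co x n / of_real (wt k n)"

definition prd :: "nat \<Rightarrow> 'd l2 \<Rightarrow> 'd l2 \<Rightarrow> 'd::finite l2" where
  "prd k x y = mkl2 (\<lambda>n. of_real (wt k n) * conv (hat k x) (hat k y) n)"

definition rl :: "nat \<Rightarrow> 'd l2 \<Rightarrow> real^'d \<Rightarrow> real" where
  "rl k x y = Re (fser (hat k x) y)"

lemma herm_hat: "herm (hat k x)"
  by (auto simp: herm_def hat_def co_uminus_index)

lemma hat_simps [simp]:
  "hat k (x + y) n = hat k x n + hat k y n" "hat k (x - y) n = hat k x n - hat k y n"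
  "hat k (r *\<^sub>R x) n = of_real r * hat k x n" "hat k 0 n = 0" "hat k (- x) n = - hat k x n"
  by (simp_all add: hat_def field_simps add_divide_distrib diff_divide_distrib)

lemma co_hat: "co x n = of_real (wt k n) * hat k x n"
  using wt_pos[of k n] by (simp add: hat_def)

locale sobolev =
  fixes k :: nat and dim :: "'d::finite itself"
  assumes k_gt: "CARD('d) < 2 * k"
begin

definition wsum :: real where "wsum = sqrt (\<Sum>\<^sub>\<infinity>n :: int^'d. 1 / (wt k n)\<^sup>2)"

lemma wsum_nonneg: "0 \<le> wsum"
  by (simp add: wsum_def infsum_nonneg)

text \<open>Cauchy-Schwarz against the inverse weights; their square summability is where
  \<open>2 * k > d\<close> enters. Elements of H^k thus have absolutely convergent Fourier
  series.\<close>

lemma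
  fixes x :: "'d l2"
  shows hat_abs_summable: "hat k x abs_summable_on UNIV"
    and hat_l1_le: "(\<Sum>\<^sub>\<infinity>n. cmod (hat k x n)) \<le> wsum * norm x"
proof -
  have *: "(\<Sum>n\<in>F. cmod (hat k x n)) \<le> wsum * norm x" if "finite F" for F
  proof -
    have "(\<Sum>n\<in>F. cmod (hat k x n)) = (\<Sum>n\<in>F. \<bar>1 / wt k n\<bar> * \<bar>cmod (co x n)\<bar>)"
      using wt_pos[of k] by (simp add: hat_def norm_divide abs_of_pos)
    also have "\<dots> \<le> L2_set (\<lambda>n. 1 / wt k n) F * L2_set (\<lambda>n. cmod (co x n)) F"
      by (rule L2_set_mult_ineq)
    also have "\<dots> \<le> wsum * norm x"
    proof (rule mult_mono[OF _ L2_set_co_le_norm wsum_nonneg])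
      show "L2_set (\<lambda>n. 1 / wt k n) F \<le> wsum"
        unfolding L2_set_def wsum_def power_divide power_one
        using that by (intro real_sqrt_le_mono finite_sum_le_infsum summable_inverse_wt k_gt) auto
    qed simp
    finally show ?thesis .
  qed
  show s: "hat k x abs_summable_on UNIV"
    by (rule nonneg_bdd_above_summable_on) (auto intro!: bdd_aboveI2 *)
  show "(\<Sum>\<^sub>\<infinity>n. cmod (hat k x n)) \<le> wsum * norm x"
    by (rule infsum_le_finite_sums[OF s]) (use * in auto)
qed

text \<open>By \<open>wt_add_le\<close> the weight of the product falls on one of the two factors.
  The other factor is unweighted and absolutely summable, so Young's inequality bounds each of the
  two resulting convolutions.\<close>

lemma L2_set_prd_le:
  fixes x y :: "'d l2"
  assumes F: "finite F"
  shows "L2_set (\<lambda>n. cmod (of_real (wt k n) * conv (hat k x) (hat k y) n)) F \<le> 2 ^ Suc k * wsum * norm x * norm y"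
proof -
  let ?x = "\<lambda>n. cmod (co x n)" and ?y = "\<lambda>n. cmod (co y n)"
  let ?hx = "\<lambda>n. cmod (hat k x n)" and ?hy = "\<lambda>n. cmod (hat k y n)"
  have young: "L2_set (conv (\<lambda>n. cmod (hat k u n)) (\<lambda>n. cmod (co v n))) F \<le> wsum * norm u * norm v"
    for u v :: "'d l2"
  proof -
    have "L2_set (conv (\<lambda>n. cmod (hat k u n)) (\<lambda>n. cmod (co v n))) F
        \<le> (\<Sum>\<^sub>\<infinity>n. cmod (hat k u n)) * norm v"
      by (rule young_L2_set) (auto simp: hat_abs_summable L2_set_co_le_norm F)
    also have "\<dots> \<le> wsum * norm u * norm v" by (intro mult_right_mono hat_l1_le) simp
    finally show ?thesis .
  qed
  have s1: "(\<lambda>p. ?hx p * ?y (n - p)) summable_on UNIV" for n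
    using conv_abs_summable1[of ?hx ?y "norm y" n] by (simp add: hat_abs_summable co_le_norm norm_mult)
  have s2: "(\<lambda>p. ?x p * ?hy (n - p)) summable_on UNIV" for n
  proof -
    have "(\<lambda>p. ?hy p * ?x (n - p)) summable_on UNIV"
      using conv_abs_summable1[of ?hy ?x "norm x" n] by (simp add: hat_abs_summable co_le_norm norm_mult)
    then show ?thesis
      by (subst summable_on_reindex_bij_witness[of _ "\<lambda>p. n - p" "\<lambda>p. n - p" _ "\<lambda>p. ?hy p * ?x (n - p)"]) auto
  qed
  have pt: "cmod (of_real (wt k n) * conv (hat k x) (hat k y) n) \<le> 2 ^ k * (conv ?hx ?y n + conv ?hy ?x n)" for n
  proof -
    obtain B where B: "\<And>n. norm (hat k y n) \<le> B" using abs_summable_bounded[OF hat_abs_summable[of y]] by blast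
    note s = conv_abs_summable1[where n=n, OF hat_abs_summable[of x] B]
    have "cmod (conv (hat k x) (hat k y) n) \<le> (\<Sum>\<^sub>\<infinity>p. ?hx p * ?hy (n - p))"
      unfolding conv_def using norm_infsum_bound[OF s] by (simp add: norm_mult)
    then have "cmod (of_real (wt k n) * conv (hat k x) (hat k y) n) \<le> wt k n * (\<Sum>\<^sub>\<infinity>p. ?hx p * ?hy (n - p))"
      using wt_pos[of k n] by (simp add: norm_mult)
    also have "\<dots> = (\<Sum>\<^sub>\<infinity>p. wt k n * (?hx p * ?hy (n - p)))" by (simp add: infsum_cmult_right')
    also have "\<dots> \<le> (\<Sum>\<^sub>\<infinity>p. 2 ^ k * (?hx p * ?y (n - p) + ?x p * ?hy (n - p)))"
    proof (rule infsum_mono)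
      show "(\<lambda>p. wt k n * (?hx p * ?hy (n - p))) summable_on UNIV"
        using s by (intro summable_on_cmult_right) (simp add: norm_mult)
      show "(\<lambda>p. 2 ^ k * (?hx p * ?y (n - p) + ?x p * ?hy (n - p))) summable_on UNIV"
        by (intro summable_on_cmult_right summable_on_add s1 s2)
      fix p
      have "wt k n \<le> 2 ^ k * (wt k p + wt k (n - p))" using wt_add_le[of k p "n - p"] by simp
      then have "wt k n * (?hx p * ?hy (n - p)) \<le> 2 ^ k * (wt k p + wt k (n - p)) * (?hx p * ?hy (n - p))"
        by (rule mult_right_mono) simp
      also have "\<dots> = 2 ^ k * (?hx p * ?y (n - p) + ?x p * ?hy (n - p))"
        using wt_pos[of k p] wt_pos[of k "n - p"] by (simp add: co_hat[of _ _ k] norm_mult algebra_simps)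
      finally show "wt k n * (?hx p * ?hy (n - p)) \<le> 2 ^ k * (?hx p * ?y (n - p) + ?x p * ?hy (n - p))" .
    qed
    also have "\<dots> = 2 ^ k * ((\<Sum>\<^sub>\<infinity>p. ?hx p * ?y (n - p)) + (\<Sum>\<^sub>\<infinity>p. ?x p * ?hy (n - p)))"
      by (simp add: infsum_cmult_right' infsum_add s1 s2)
    also have "\<dots> = 2 ^ k * (conv ?hx ?y n + conv ?hy ?x n)"
      by (subst conv_commute[of ?hy]) (simp add: conv_def)
    finally show ?thesis .
  qed
  have "L2_set (\<lambda>n. cmod (of_real (wt k n) * conv (hat k x) (hat k y) n)) F
      \<le> L2_set (\<lambda>n. 2 ^ k * (conv ?hx ?y n + conv ?hy ?x n)) F"
    by (intro L2_set_mono pt norm_ge_zero)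
  also have "\<dots> = 2 ^ k * L2_set (\<lambda>n. conv ?hx ?y n + conv ?hy ?x n) F"
    by (simp add: L2_set_right_distrib)
  also have "\<dots> \<le> 2 ^ k * (wsum * norm x * norm y + wsum * norm y * norm x)"
    by (intro mult_left_mono order_trans[OF L2_set_triangle_ineq] add_mono young) simp
  finally show ?thesis by (simp add: mult_ac)
qed

lemma co_prd: "co (prd k x y :: 'd l2) n = of_real (wt k n) * conv (hat k x) (hat k y) n"
proof -
  have "herm (\<lambda>n. of_real (wt k n) * conv (hat k x) (hat k y) n)"
    using herm_conv[OF herm_hat[of k x] herm_hat[of k y]] by (simp add: herm_def)
  then have "co (prd k x y) = (\<lambda>n. of_real (wt k n) * conv (hat k x) (hat k y) n)"
    unfolding prd_def by (rule co_mkl2_L2[OF _ L2_set_prd_le])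
  then show ?thesis by simp
qed

lemma hat_prd: "hat k (prd k x y :: 'd l2) n = conv (hat k x) (hat k y) n"
  using wt_pos[of k n] by (simp add: hat_def[of k "prd k x y"] co_prd)

lemma norm_prd_le: "norm (prd k x y :: 'd l2) \<le> 2 ^ Suc k * wsum * norm x * norm y"
  by (rule l2_norm_leI) (simp_all only: co_prd L2_set_prd_le, simp add: wsum_nonneg)

lemma prd_commute: "prd k x y = (prd k y x :: 'd l2)"
  by (simp add: prd_def conv_commute)

lemma bounded_bilinear_prd: "bounded_bilinear (prd k :: 'd l2 \<Rightarrow> 'd l2 \<Rightarrow> 'd l2)"
proof -
  have add: "prd k (x + x') y = prd k x y + prd k x' y" for x x' y :: "'d l2"
  proof (rule l2_eqI)
    fix n
    have "conv (hat k (x + x')) (hat k y) n = conv (\<lambda>n. hat k x n + hat k x' n) (hat k y) n"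
      by (simp add: conv_def)
    then show "co (prd k (x + x') y) n = co (prd k x y + prd k x' y) n"
      by (simp add: co_prd conv_add_left hat_abs_summable algebra_simps)
  qed
  have scale: "prd k (r *\<^sub>R x) y = r *\<^sub>R prd k x y" for r and x y :: "'d l2"
    by (rule l2_eqI) (simp add: co_prd conv_def mult.assoc infsum_cmult_right')
  show ?thesis
  proof
    show "prd k (a + a') b = prd k a b + prd k a' b" for a a' b :: "'d l2" by (rule add)
    show "prd k a (b + b') = prd k a b + prd k a b'" for a b b' :: "'d l2"
      using add[of b b' a] by (simp add: prd_commute)
    show "prd k (r *\<^sub>R a) b = r *\<^sub>R prd k a b" for r and a b :: "'d l2" by (rule scale)
    show "prd k a (r *\<^sub>R b) = r *\<^sub>R prd k a b" for r and a b :: "'d l2"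
      using scale[of r b a] by (simp add: prd_commute)
    show "\<exists>K. \<forall>a b :: 'd l2. norm (prd k a b) \<le> norm a * norm b * K"
      by (rule exI[of _ "2 ^ Suc k * wsum"], intro allI order_trans[OF norm_prd_le]) (simp add: mult_ac)
  qed
qed

lemma rl_prd: "rl k (prd k x y :: 'd l2) z = rl k x z * rl k y z"
proof -
  have "hat k (prd k x y) = conv (hat k x) (hat k y)" by (rule ext) (rule hat_prd)
  then have "fser (hat k (prd k x y)) z = fser (hat k x) z * fser (hat k y) z"
    by (simp add: fser_conv hat_abs_summable)
  also have "\<dots> = of_real (rl k x z * rl k y z)"
    unfolding rl_def by (metis fser_real herm_hat of_real_mult)
  finally show ?thesis by (simp add: rl_def)
qed

end

section \<open>Fourier series on the torus\<close>

lemma space_torus: "space (torus :: (real^'d) measure) = cbox 0 (\<chi> i. 2 * pi)"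
  by (simp add: torus_def)

lemma finite_measure_torus: "finite_measure (torus :: (real^'d) measure)"
  unfolding torus_def by (rule finite_measure_lebesgue_on) simp

lemma measurable_torus_continuous:
  fixes f :: "real^'d \<Rightarrow> 'b::topological_space"
  assumes "continuous_on UNIV f"
  shows "f \<in> borel_measurable torus"
  unfolding torus_def using borel_measurable_continuous_onI[OF assms]
  by (intro measurable_restrict_space1 measurable_completion) simp

lemma integrable_torus_bounded:
  fixes f :: "real^'d \<Rightarrow> 'b::{banach,second_countable_topology}"
  assumes "f \<in> borel_measurable torus" "\<And>x. norm (f x) \<le> B"
  shows "integrable torus f"
proof -
  interpret finite_measure "torus :: (real^'d) measure" by (rule finite_measure_torus)
  show ?thesis by (rule integrable_const_bound[where B=B]) (use assms in auto)
qed

lemma continuous_cis_inner: "continuous_on UNIV (\<lambda>x. cis (x \<bullet> l))"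
  unfolding cis_conv_exp by (intro continuous_intros)

lemma integral_cis_interval:
  fixes m :: int
  shows "integrable lborel (\<lambda>t. indicator {0..2 * pi} t *\<^sub>R cis (t * of_int m))" (is ?int)
    and "(\<integral>t. indicator {0..2 * pi} t *\<^sub>R cis (t * of_int m) \<partial>lborel) = (if m = 0 then of_real (2 * pi) else 0)" (is ?eq)
proof -
  define F :: "real \<Rightarrow> complex" where
    "F t = (if m = 0 then of_real t else exp (t *\<^sub>R (\<i> * of_int m)) / (\<i> * of_int m))" for t
  have ce: "cis (t * of_int m) = exp (t *\<^sub>R (\<i> * of_int m))" for t
    by (simp add: cis_conv_exp scaleR_conv_of_real mult_ac)
  have "(F has_vector_derivative cis (t * of_int m)) (at t within {0..2 * pi})" for t
  proof (cases "m = 0")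
    case True
    have "((\<lambda>t. of_real t :: complex) has_vector_derivative of_real 1) (at t within {0..2 * pi})"
      by (intro has_vector_derivative_of_real) (auto intro!: derivative_eq_intros)
    then show ?thesis using True by (simp add: F_def[abs_def])
  next
    case False
    have "((\<lambda>t. exp (t *\<^sub>R (\<i> * of_int m)) / (\<i> * of_int m)) has_vector_derivative
        (exp (t *\<^sub>R (\<i> * of_int m)) * (\<i> * of_int m)) / (\<i> * of_int m)) (at t within {0..2 * pi})"
      by (intro has_vector_derivative_divide exp_scaleR_has_vector_derivative_right)
    then show ?thesis using False by (simp add: F_def[abs_def] ce)
  qed
  moreover have "continuous_on {0..2 * pi} (\<lambda>t. cis (t * of_int m))"
    unfolding cis_conv_exp by (intro continuous_intros)
  ultimately have *: "has_bochner_integral lborel (\<lambda>t. indicator {0..2 * pi} t *\<^sub>R cis (t * of_int m)) (F (2 * pi) - F 0)"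
    by (intro has_bochner_integral_FTC_Icc) auto
  then show ?int by (simp add: has_bochner_integral_iff)
  have "F (2 * pi) - F 0 = (if m = 0 then of_real (2 * pi) else 0)"
  proof -
    have "exp ((2 * pi) *\<^sub>R (\<i> * of_int m)) = (1 :: complex)"
      using cis_multiple_2pi[of "of_int m"] ce[of "2 * pi"] by simp
    then show ?thesis by (simp add: F_def)
  qed
  then show ?eq using * by (simp add: has_bochner_integral_iff)
qed

text \<open>On the cube the character is a product of one-dimensional ones, and Lebesgue measure is
  a product measure.\<close>

lemma integral_torus_cis:
  fixes n :: "int^'d"
  shows "(\<integral>x. cis (x \<bullet> lattice_vec n) \<partial>torus) = (if n = 0 then of_real ((2 * pi) ^ CARD('d)) else 0)"
proof -
  let ?L = "lattice_vec n" and ?Q = "cbox 0 (\<chi> i. 2 * pi) :: (real^'d) set"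
  \<comment> \<open>On basis vectors the inner product is an integer coordinate, so the floor only
    changes its type.\<close>
  define m :: "real^'d \<Rightarrow> int" where "m b = \<lfloor>?L \<bullet> b\<rfloor>" for b
  have m: "of_int (m b) = ?L \<bullet> b" if "b \<in> Basis" for b
    using that by (auto simp: m_def lattice_vec_def Basis_vec_def inner_axis)
  define f where "f b t = indicator {0..2 * pi} t *\<^sub>R cis (t * of_int (m b))" for b t
  have split: "indicator ?Q x *\<^sub>R cis (x \<bullet> ?L) = (\<Prod>b\<in>Basis. f b (x \<bullet> b))" for x
  proof -
    have "cis (x \<bullet> ?L) = exp (\<Sum>b\<in>Basis. \<i> * of_real ((x \<bullet> b) * of_int (m b)))"
      by (subst euclidean_inner) (simp add: cis_conv_exp sum_distrib_left m)
    also have "\<dots> = (\<Prod>b\<in>Basis. cis ((x \<bullet> b) * of_int (m b)))"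
      by (subst exp_sum) (simp_all add: cis_conv_exp)
    finally have c: "cis (x \<bullet> ?L) = (\<Prod>b\<in>Basis. cis ((x \<bullet> b) * of_int (m b)))" .
    have "x \<in> ?Q \<longleftrightarrow> (\<forall>b\<in>Basis. x \<bullet> b \<in> {0..2 * pi})"
      by (auto simp: mem_box Basis_vec_def inner_axis)
    then have "(of_real (indicator ?Q x) :: complex) = (\<Prod>b\<in>Basis. of_real (indicator {0..2 * pi} (x \<bullet> b)))"
      by (auto simp: indicator_def prod_zero_iff)
    then show ?thesis
      by (simp add: f_def scaleR_conv_of_real c prod.distrib)
  qed
  interpret product_sigma_finite "\<lambda>b::real^'d. lborel :: real measure" by standard
  have fb[measurable]: "f b \<in> borel_measurable borel" for b
    using borel_measurable_integrable[OF integral_cis_interval(1)[of "m b"]] by (simp add: f_def[abs_def])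
  have "(\<integral>x. cis (x \<bullet> ?L) \<partial>torus) = (\<integral>x. indicator ?Q x *\<^sub>R cis (x \<bullet> ?L) \<partial>lebesgue)"
    unfolding torus_def by (subst integral_restrict_space) auto
  also have "\<dots> = (\<integral>x. indicator ?Q x *\<^sub>R cis (x \<bullet> ?L) \<partial>lborel)"
    using borel_measurable_continuous_onI[OF continuous_cis_inner[of ?L]]
    by (intro integral_completion) (auto intro!: borel_measurable_scaleR)
  also have "\<dots> = (\<integral>x. (\<Prod>b\<in>Basis. f b (x \<bullet> b)) \<partial>lborel)" by (simp add: split)
  also have "\<dots> = (\<integral>g. (\<Prod>b\<in>Basis. f b ((\<Sum>b\<in>Basis. g b *\<^sub>R b) \<bullet> b)) \<partial>(\<Pi>\<^sub>M b\<in>(Basis :: (real^'d) set). lborel))"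
    by (subst lborel_eq, subst integral_distr) auto
  also have "\<dots> = (\<integral>g. (\<Prod>b\<in>Basis. f b (g b)) \<partial>(\<Pi>\<^sub>M b\<in>(Basis :: (real^'d) set). lborel))"
    by (intro Bochner_Integration.integral_cong refl prod.cong) (simp add: inner_sum_left_Basis)
  also have "\<dots> = (\<Prod>b\<in>Basis. \<integral>t. f b t \<partial>lborel)"
    by (rule product_integral_prod) (auto simp: f_def integral_cis_interval(1))
  also have "\<dots> = (\<Prod>b\<in>(Basis :: (real^'d) set). if m b = 0 then of_real (2 * pi) else 0)"
    by (intro prod.cong refl) (simp add: f_def integral_cis_interval(2))
  also have "\<dots> = (if n = 0 then of_real ((2 * pi) ^ CARD('d)) else 0)"
  proof (cases "n = 0")
    case True
    then show ?thesis by (simp add: m_def)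
  next
    case False
    then obtain i where i: "n $ i \<noteq> 0" by (auto simp: vec_eq_iff)
    have "axis i 1 \<in> (Basis :: (real^'d) set)" by (simp add: axis_in_Basis_iff)
    moreover have "m (axis i 1) \<noteq> 0" using i by (simp add: m_def inner_axis lattice_vec_def)
    ultimately show ?thesis using False by (auto simp: prod_zero_iff)
  qed
  finally show ?thesis .
qed

lemma cis_mult_lattice: "cis (x \<bullet> lattice_vec m) * cis (- (x \<bullet> lattice_vec n)) = cis (x \<bullet> lattice_vec (m - n))"
  by (simp add: cis_mult inner_diff_right)

instance bcontfun :: (metric_space, banach) banach ..

text \<open>The series is summed in the Banach space of bounded continuous functions. Continuity of
  the sum is then automatic, and integration against \<open>v\<close> is a bounded linear
  functional, which may be exchanged with the summation.\<close>

lemma fser_uniform: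
  fixes c :: "int^'d \<Rightarrow> complex"
  assumes c: "c abs_summable_on UNIV"
  shows "continuous_on UNIV (fser c)" and "norm (fser c x) \<le> (\<Sum>\<^sub>\<infinity>n. cmod (c n))"
    and "integrable torus v \<Longrightarrow>
      ((\<lambda>n. c n * (\<integral>x. v x * cis (x \<bullet> lattice_vec n) \<partial>torus)) has_sum (\<integral>x. v x * fser c x \<partial>torus)) UNIV"
proof -
  define g where "g n = Bcontfun (\<lambda>x. c n * cis (x \<bullet> lattice_vec n))" for n
  have g: "apply_bcontfun (g n) x = c n * cis (x \<bullet> lattice_vec n)" for n x
    unfolding g_def
    by (subst Bcontfun_inverse) (auto intro!: bcontfun_normI[of _ "cmod (c n)"] continuous_intros continuous_cis_inner simp: norm_mult)
  have "norm (g n) \<le> cmod (c n)" for n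
    by (rule norm_bound) (simp add: g norm_mult)
  then have gs: "g abs_summable_on UNIV"
    by (rule Infinite_Sum.abs_summable_on_comparison_test'[OF c])
  define S where "S = infsum g UNIV"
  have S: "(g has_sum S) UNIV" unfolding S_def by (rule has_sum_infsum[OF abs_summable_summable[OF gs]])
  have ev: "bounded_linear (\<lambda>h :: (real^'d) \<Rightarrow>\<^sub>C complex. apply_bcontfun h x)" for x
    by (rule bounded_linear_intro[of _ 1]) (auto simp: norm_bounded)
  have Sx: "apply_bcontfun S x = fser c x" for x
    using infsumI[OF has_sum_bounded_linear[OF ev S, of x]] by (simp add: g fser_def)
  show "continuous_on UNIV (fser c)"
    using continuous_on_apply_bcontfun[of UNIV S] by (simp add: Sx cong: continuous_on_cong)
  show "norm (fser c x) \<le> (\<Sum>\<^sub>\<infinity>n. cmod (c n))"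
    unfolding fser_def using norm_infsum_bound[OF fser_abs_summable[OF c, of x]] by (simp add: norm_mult)
  assume v: "integrable torus v"
  have int: "integrable torus (\<lambda>x. v x * apply_bcontfun h x)" for h :: "(real^'d) \<Rightarrow>\<^sub>C complex"
  proof (rule Bochner_Integration.integrable_bound)
    show "integrable torus (\<lambda>x. norm h *\<^sub>R v x)" using v by simp
    show "(\<lambda>x. v x * apply_bcontfun h x) \<in> borel_measurable torus"
      by (intro borel_measurable_times borel_measurable_integrable[OF v] measurable_torus_continuous) simp
    show "AE x in torus. norm (v x * apply_bcontfun h x) \<le> norm (norm h *\<^sub>R v x)"
      by (intro AE_I2) (simp add: norm_mult, subst mult.commute, intro mult_right_mono norm_bounded norm_ge_zero)
  qed
  have "bounded_linear (\<lambda>h. \<integral>x. v x * apply_bcontfun h x \<partial>torus)"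
  proof (rule bounded_linear_intro[of _ "\<integral>x. norm (v x) \<partial>torus"])
    fix h h' :: "(real^'d) \<Rightarrow>\<^sub>C complex" and r
    show "(\<integral>x. v x * apply_bcontfun (h + h') x \<partial>torus) = (\<integral>x. v x * apply_bcontfun h x \<partial>torus) + (\<integral>x. v x * apply_bcontfun h' x \<partial>torus)"
      by (simp add: distrib_left int)
    show "(\<integral>x. v x * apply_bcontfun (r *\<^sub>R h) x \<partial>torus) = r *\<^sub>R (\<integral>x. v x * apply_bcontfun h x \<partial>torus)"
      by simp
    have "norm (\<integral>x. v x * apply_bcontfun h x \<partial>torus) \<le> (\<integral>x. norm (v x * apply_bcontfun h x) \<partial>torus)"
      by (rule integral_norm_bound)
    also have "\<dots> \<le> (\<integral>x. norm h * norm (v x) \<partial>torus)"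
      by (intro integral_mono integrable_norm int integrable_mult_right v)
        (simp only: norm_mult mult.commute[of "norm h"], intro mult_left_mono norm_bounded norm_ge_zero)
    finally show "norm (\<integral>x. v x * apply_bcontfun h x \<partial>torus) \<le> norm h * (\<integral>x. norm (v x) \<partial>torus)" by simp
  qed
  from has_sum_bounded_linear[OF this S]
  show "((\<lambda>n. c n * (\<integral>x. v x * cis (x \<bullet> lattice_vec n) \<partial>torus)) has_sum (\<integral>x. v x * fser c x \<partial>torus)) UNIV"
    by (simp add: g Sx mult.left_commute)
qed

definition trig :: "(int^'d \<Rightarrow> complex) \<Rightarrow> real^'d \<Rightarrow> real" where
  "trig c y = Re (fser c y)"

lemma rl_trig: "rl k x = trig (hat k x)"
  by (simp add: fun_eq_iff rl_def trig_def)

lemma of_real_trig: "herm c \<Longrightarrow> of_real (trig c y) = fser c y"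
  using fser_real[of c y] by (simp add: trig_def)

lemma
  fixes c :: "int^'d \<Rightarrow> complex"
  assumes c: "c abs_summable_on UNIV" and h: "herm c"
  shows continuous_trig: "continuous_on UNIV (trig c)"
    and trig_in_L2: "trig c \<in> L2" and fourier_coeff_trig: "fourier_coeff (trig c) = c"
    and abs_trig_le: "\<bar>trig c y\<bar> \<le> (\<Sum>\<^sub>\<infinity>n. cmod (c n))"
proof -
  show cont: "continuous_on UNIV (trig c)"
    unfolding trig_def[abs_def] by (intro continuous_intros fser_uniform(1) c)
  show bd: "\<bar>trig c x\<bar> \<le> (\<Sum>\<^sub>\<infinity>n. cmod (c n))" for x
    using fser_uniform(2)[OF c, of x] of_real_trig[OF h, of x] by (metis norm_of_real)
  show "trig c \<in> L2" unfolding L2_def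
  proof (intro CollectI conjI)
    have "cis ((x + (2 * pi) *\<^sub>R lattice_vec m) \<bullet> lattice_vec n) = cis (x \<bullet> lattice_vec n)" for x and m n :: "int^'d"
    proof -
      obtain M :: int where M: "lattice_vec m \<bullet> lattice_vec n = of_int M"
      proof
        show "lattice_vec m \<bullet> lattice_vec n = of_int (\<Sum>i\<in>UNIV. m $ i * n $ i)"
          by (simp add: lattice_vec_def inner_vec_def)
      qed
      then show ?thesis
        using cis_multiple_2pi[of "of_int M"] by (simp add: inner_add_left cis_mult[symmetric])
    qed
    then show "periodic (trig c)" by (simp add: periodic_def trig_def fser_def)
    show m: "trig c \<in> borel_measurable torus" by (rule measurable_torus_continuous[OF cont])
    show "integrable torus (\<lambda>x. (trig c x)\<^sup>2)"
      by (rule integrable_torus_bounded[where B="(\<Sum>\<^sub>\<infinity>n. cmod (c n))\<^sup>2"])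
        (use m bd in \<open>auto simp: abs_le_square_iff[symmetric] infsum_nonneg\<close>)
  qed
  show "fourier_coeff (trig c) = c"
  proof
    fix n :: "int^'d"
    let ?\<mu> = "of_real ((2 * pi) ^ CARD('d)) :: complex"
    have "integrable torus (\<lambda>x :: real^'d. cis (- (x \<bullet> lattice_vec n)))"
      using continuous_cis_inner[of "- lattice_vec n"]
      by (intro integrable_torus_bounded[where B=1] measurable_torus_continuous) simp_all
    from fser_uniform(3)[OF c this]
    have "((\<lambda>m. c m * (\<integral>x. cis (x \<bullet> lattice_vec (m - n)) \<partial>torus)) has_sum (\<integral>x. cis (- (x \<bullet> lattice_vec n)) * fser c x \<partial>torus)) UNIV"
      by (simp only: cis_mult_lattice mult.commute[of "cis (- _)" "cis _"])
    then have *: "((\<lambda>m. c m * (if m - n = 0 then ?\<mu> else 0)) has_sum (\<integral>x. cis (- (x \<bullet> lattice_vec n)) * fser c x \<partial>torus)) UNIV"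
      by (simp only: integral_torus_cis)
    have "((\<lambda>m. c m * (if m - n = 0 then ?\<mu> else 0)) has_sum (c n * ?\<mu>)) UNIV"
      by (rule has_sum_finite_neutralI[of "{n}"]) auto
    with * have "(\<integral>x. cis (- (x \<bullet> lattice_vec n)) * fser c x \<partial>torus) = c n * ?\<mu>"
      using has_sum_unique by blast
    then show "fourier_coeff (trig c) n = c n"
      by (simp add: fourier_coeff_def of_real_trig[OF h] mult.commute)
  qed
qed

section \<open>The space \<open>L\<^sup>2\<close> of the torus\<close>

lemma L2_D: "u \<in> L2 \<Longrightarrow> periodic u" "u \<in> L2 \<Longrightarrow> u \<in> borel_measurable torus"
  "u \<in> L2 \<Longrightarrow> integrable torus (\<lambda>x. (u x)\<^sup>2)"
  by (auto simp: L2_def)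

lemma L2_integrable_mult:
  assumes "u \<in> L2" "v \<in> L2" shows "integrable torus (\<lambda>x. u x * v x)"
proof (rule Bochner_Integration.integrable_bound)
  show "integrable torus (\<lambda>x. (u x)\<^sup>2 + (v x)\<^sup>2)" using assms by (simp add: L2_D)
  show "(\<lambda>x. u x * v x) \<in> borel_measurable torus" by (intro borel_measurable_times L2_D(2) assms)
  have "\<bar>a * b\<bar> \<le> a\<^sup>2 + b\<^sup>2" for a b :: real
    using sum_squares_bound[of "\<bar>a\<bar>" "\<bar>b\<bar>"] mult_nonneg_nonneg[of "\<bar>a\<bar>" "\<bar>b\<bar>"]
    unfolding abs_mult power2_abs by linarith
  then show "AE x in torus. norm (u x * v x) \<le> norm ((u x)\<^sup>2 + (v x)\<^sup>2)"
    by (intro AE_I2) (simp add: abs_of_nonneg[OF add_nonneg_nonneg])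
qed

lemma L2_const: "(\<lambda>x :: real^'d. a) \<in> L2"
proof -
  interpret finite_measure "torus :: (real^'d) measure" by (rule finite_measure_torus)
  show ?thesis by (simp add: L2_def periodic_def)
qed

lemma L2_integrable: "u \<in> L2 \<Longrightarrow> integrable torus u"
  using L2_integrable_mult[OF _ L2_const[of 1]] by simp

lemma L2_add: assumes "u \<in> L2" "v \<in> L2" shows "(\<lambda>x. u x + v x) \<in> L2"
proof -
  have "integrable torus (\<lambda>x. (u x)\<^sup>2 + 2 * (u x * v x) + (v x)\<^sup>2)"
    by (intro Bochner_Integration.integrable_add integrable_mult_right L2_integrable_mult L2_D(3) assms)
  then show ?thesis using assms
    by (auto simp: L2_def periodic_def power2_sum algebra_simps)
qed

lemma L2_scale: "u \<in> L2 \<Longrightarrow> (\<lambda>x. a * u x) \<in> L2"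
  by (auto simp: L2_def periodic_def power_mult_distrib)

lemma L2_diff: "u \<in> L2 \<Longrightarrow> v \<in> L2 \<Longrightarrow> (\<lambda>x. u x - v x) \<in> L2"
  using L2_add[of u "\<lambda>x. -1 * v x"] L2_scale[of v "-1"] by simp

lemma L2_sum: "finite A \<Longrightarrow> (\<And>a. a \<in> A \<Longrightarrow> f a \<in> L2) \<Longrightarrow> (\<lambda>x. \<Sum>a\<in>A. f a x) \<in> L2"
  by (induct A rule: finite_induct) (auto intro: L2_const L2_add)

lemma fourier_integrable:
  fixes u :: "real^'d \<Rightarrow> real"
  assumes "integrable torus u" shows "integrable torus (\<lambda>x. of_real (u x) * cis (- (x \<bullet> lattice_vec n)))"
proof (rule Bochner_Integration.integrable_bound[OF assms])
  show "(\<lambda>x. of_real (u x) * cis (- (x \<bullet> lattice_vec n))) \<in> borel_measurable torus"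
  proof (rule borel_measurable_times)
    show "(\<lambda>x. of_real (u x) :: complex) \<in> borel_measurable torus" using assms by auto
    show "(\<lambda>x. cis (- (x \<bullet> lattice_vec n))) \<in> borel_measurable torus"
      using continuous_cis_inner[of "- lattice_vec n"] by (intro measurable_torus_continuous) simp
  qed
qed (simp add: norm_mult)

lemma fourier_coeff_add: "u \<in> L2 \<Longrightarrow> v \<in> L2 \<Longrightarrow> fourier_coeff (\<lambda>x. u x + v x) n = fourier_coeff u n + fourier_coeff v n"
  by (simp add: fourier_coeff_def distrib_right fourier_integrable L2_integrable add_divide_distrib)

lemma fourier_coeff_scale: "fourier_coeff (\<lambda>x. a * u x) n = of_real a * fourier_coeff u n"
  by (simp add: fourier_coeff_def mult.assoc)

lemma fourier_coeff_diff: "u \<in> L2 \<Longrightarrow> v \<in> L2 \<Longrightarrow> fourier_coeff (\<lambda>x. u x - v x) n = fourier_coeff u n - fourier_coeff v n"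
  using fourier_coeff_add[OF _ L2_scale[of v "-1"], of u n] fourier_coeff_scale[of "-1" v n] by simp

lemma fourier_coeff_sum: "finite A \<Longrightarrow> (\<And>a. a \<in> A \<Longrightarrow> f a \<in> L2) \<Longrightarrow>
    fourier_coeff (\<lambda>x. \<Sum>a\<in>A. f a x) n = (\<Sum>a\<in>A. fourier_coeff (f a) n)"
proof (induct A rule: finite_induct)
  case empty
  show ?case by (simp add: fourier_coeff_def)
next
  case (insert a A)
  then show ?case using fourier_coeff_add[of "f a" "\<lambda>x. \<Sum>a\<in>A. f a x" n] by (simp add: L2_sum)
qed

lemma fourier_coeff_cong_AE:
  fixes u v :: "real^'d \<Rightarrow> real"
  assumes "AE x in torus. u x = v x" and "u \<in> borel_measurable torus" "v \<in> borel_measurable torus"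
  shows "fourier_coeff u = fourier_coeff v"
proof
  fix n :: "int^'d"
  have "(\<lambda>x :: real^'d. cis (- (x \<bullet> lattice_vec n))) \<in> borel_measurable torus"
    using continuous_cis_inner[of "- lattice_vec n"] by (intro measurable_torus_continuous) simp
  then show "fourier_coeff u n = fourier_coeff v n" unfolding fourier_coeff_def
    using assms by (intro arg_cong2[where f="(/)"] integral_cong_AE) auto
qed

lemma herm_fourier_coeff: "herm (fourier_coeff u)"
proof -
  have "fourier_coeff u (- n) = cnj (fourier_coeff u n)" for n
  proof -
    have "(\<integral>x. of_real (u x) * cis (- (x \<bullet> lattice_vec (- n))) \<partial>torus) =
        (\<integral>x. cnj (of_real (u x) * cis (- (x \<bullet> lattice_vec n))) \<partial>torus)"
      by (simp add: cis_cnj)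
    then show ?thesis by (simp only: fourier_coeff_def complex_cnj_divide complex_cnj_complex_of_real) (simp only: Bochner_Integration.integral_cnj)
  qed
  then show ?thesis by (simp add: herm_def)
qed

lemma L2_norm_power2: "(L2_norm u)\<^sup>2 = (\<integral>x. (u x)\<^sup>2 \<partial>torus)"
  by (simp add: L2_norm_def)

lemma L2_norm_nonneg: "0 \<le> L2_norm u"
  by (simp add: L2_norm_def)

lemma finite_support_abs_summable:
  assumes "finite F" "\<And>n. n \<notin> F \<Longrightarrow> c n = 0" shows "c abs_summable_on UNIV"
  by (rule summable_on_cong_neutral[THEN iffD1, OF _ _ _ summable_on_finite[OF assms(1)]])
     (use assms(2) in auto)

text \<open>Bessel's identity for a truncation of the Fourier series. The set \<open>F\<close> is
  symmetric so that the truncated series is real.\<close>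

lemma L2_norm_diff_trig:
  fixes u :: "real^'d \<Rightarrow> real"
  assumes u: "u \<in> L2" and F: "finite F" "\<And>n. n \<in> F \<Longrightarrow> - n \<in> F"
  defines "c \<equiv> (\<lambda>n. if n \<in> F then fourier_coeff u n else 0)"
  shows "c abs_summable_on UNIV" "herm c"
    and "(L2_norm (\<lambda>x. u x - trig c x))\<^sup>2 = (L2_norm u)\<^sup>2 - (2 * pi) ^ CARD('d) * (\<Sum>n\<in>F. (cmod (fourier_coeff u n))\<^sup>2)"
proof -
  let ?\<mu> = "(2 * pi) ^ CARD('d)"
  show ca: "c abs_summable_on UNIV" by (rule finite_support_abs_summable[OF F(1)]) (simp add: c_def)
  show ch: "herm c"
  proof -
    have "- n \<in> F \<longleftrightarrow> n \<in> F" for n using F(2)[of n] F(2)[of "- n"] by auto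
    then show ?thesis using herm_fourier_coeff[of u] by (auto simp: herm_def c_def)
  qed
  \<comment> \<open>Used for \<open>v = u\<close> and for \<open>v = trig c\<close>: both have the
    same coefficients on \<open>F\<close>, so both inner products with \<open>trig c\<close>
    agree.\<close>
  have pair: "(\<integral>x. v x * trig c x \<partial>torus) = ?\<mu> * (\<Sum>n\<in>F. (cmod (fourier_coeff u n))\<^sup>2)"
    if v: "v \<in> L2" and eq: "\<And>n. n \<in> F \<Longrightarrow> fourier_coeff v n = fourier_coeff u n" for v
  proof -
    have vi: "(\<integral>x. of_real (v x) * cis (x \<bullet> lattice_vec n) \<partial>torus) = of_real ?\<mu> * cnj (fourier_coeff v n)" for n
    proof -
      have "fourier_coeff v (- n) = cnj (fourier_coeff v n)" using herm_fourier_coeff[of v] by (simp add: herm_def)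
      then have "(\<integral>x. of_real (v x) * cis (x \<bullet> lattice_vec n) \<partial>torus) / of_real ?\<mu> = cnj (fourier_coeff v n)"
        unfolding fourier_coeff_def[of v "- n"] by (simp del: of_real_power of_real_mult)
      then show ?thesis by (simp add: field_simps)
    qed
    have "of_real (\<integral>x. v x * trig c x \<partial>torus) = (\<integral>x. of_real (v x) * fser c x \<partial>torus)"
      by (subst integral_complex_of_real[symmetric]) (simp add: of_real_trig[OF ch])
    also have "\<dots> = (\<Sum>n\<in>F. c n * (of_real ?\<mu> * cnj (fourier_coeff v n)))"
    proof (rule has_sum_unique)
      show "((\<lambda>n. c n * (\<integral>x. of_real (v x) * cis (x \<bullet> lattice_vec n) \<partial>torus)) has_sum (\<integral>x. of_real (v x) * fser c x \<partial>torus)) UNIV"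
        by (rule fser_uniform(3)[OF ca]) (simp add: L2_integrable v)
      show "((\<lambda>n. c n * (\<integral>x. of_real (v x) * cis (x \<bullet> lattice_vec n) \<partial>torus)) has_sum (\<Sum>n\<in>F. c n * (of_real ?\<mu> * cnj (fourier_coeff v n)))) UNIV"
        by (rule has_sum_finite_neutralI[OF F(1)]) (simp_all add: c_def vi)
    qed
    also have "\<dots> = (\<Sum>n\<in>F. of_real (?\<mu> * (cmod (fourier_coeff u n))\<^sup>2))"
      by (intro sum.cong refl, simp only: of_real_mult complex_norm_square) (simp add: c_def eq mult_ac)
    also have "\<dots> = of_real (?\<mu> * (\<Sum>n\<in>F. (cmod (fourier_coeff u n))\<^sup>2))" by (simp add: sum_distrib_left)
    finally show ?thesis by (simp only: of_real_eq_iff)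
  qed
  note t = trig_in_L2[OF ca ch]
  have 1: "(\<integral>x. u x * trig c x \<partial>torus) = ?\<mu> * (\<Sum>n\<in>F. (cmod (fourier_coeff u n))\<^sup>2)"
    by (rule pair[OF u]) simp
  have 2: "(\<integral>x. trig c x * trig c x \<partial>torus) = ?\<mu> * (\<Sum>n\<in>F. (cmod (fourier_coeff u n))\<^sup>2)"
    by (rule pair[OF t]) (metis (no_types) fourier_coeff_trig[OF ca ch] c_def)
  have "(\<integral>x. (u x - trig c x)\<^sup>2 \<partial>torus) = (\<integral>x. (u x)\<^sup>2 - 2 * (u x * trig c x) + trig c x * trig c x \<partial>torus)"
    by (intro Bochner_Integration.integral_cong refl) (simp add: power2_eq_square algebra_simps)
  also have "\<dots> = (\<integral>x. (u x)\<^sup>2 \<partial>torus) - 2 * (\<integral>x. u x * trig c x \<partial>torus) + (\<integral>x. trig c x * trig c x \<partial>torus)"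
    using L2_integrable_mult[OF u t] L2_integrable_mult[OF t t] L2_D(3)[OF u] by simp
  finally show "(L2_norm (\<lambda>x. u x - trig c x))\<^sup>2 = (L2_norm u)\<^sup>2 - ?\<mu> * (\<Sum>n\<in>F. (cmod (fourier_coeff u n))\<^sup>2)"
    by (simp only: L2_norm_power2 1 2)
qed

definition emb :: "(real^'d \<Rightarrow> real) \<Rightarrow> 'd::finite l2" where
  "emb u = mkl2 (fourier_coeff u)"

lemma sum_fourier_coeff_le:
  fixes u :: "real^'d \<Rightarrow> real"
  assumes u: "u \<in> L2" and F: "finite F"
  shows "(2 * pi) ^ CARD('d) * (\<Sum>n\<in>F. (cmod (fourier_coeff u n))\<^sup>2) \<le> (L2_norm u)\<^sup>2"
proof -
  \<comment> \<open>Symmetrised, as Bessel's identity requires; enlarging the set only increases the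
    sum.\<close>
  let ?F = "F \<union> uminus ` F"
  have "finite ?F" "\<And>n. n \<in> ?F \<Longrightarrow> - n \<in> ?F" using F by auto
  from L2_norm_diff_trig(3)[OF u this]
  have "(2 * pi) ^ CARD('d) * (\<Sum>n\<in>?F. (cmod (fourier_coeff u n))\<^sup>2) \<le> (L2_norm u)\<^sup>2"
    by (smt (verit) zero_le_power2)
  moreover have "(\<Sum>n\<in>F. (cmod (fourier_coeff u n))\<^sup>2) \<le> (\<Sum>n\<in>?F. (cmod (fourier_coeff u n))\<^sup>2)"
    using F by (intro sum_mono2) auto
  ultimately show ?thesis
    by (meson mult_left_mono order_trans pi_ge_zero zero_le_mult_iff zero_le_numeral zero_le_power)
qed

lemma co_emb:
  fixes u :: "real^'d \<Rightarrow> real"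
  assumes "u \<in> L2" shows "co (emb u) = fourier_coeff u"
  unfolding emb_def
proof (rule co_mkl2_bound[OF herm_fourier_coeff])
  fix F :: "(int^'d) set" assume "finite F"
  from sum_fourier_coeff_le[OF assms this]
  show "(\<Sum>n\<in>F. (cmod (fourier_coeff u n))\<^sup>2) \<le> (L2_norm u)\<^sup>2 / (2 * pi) ^ CARD('d)"
    by (simp add: field_simps)
qed

section \<open>Completeness of the trigonometric system\<close>

lemma trig_separates:
  "\<exists>c. c abs_summable_on UNIV \<and> (\<forall>x :: real^'d. of_real (cos (x $ i)) = fser c x)"
  "\<exists>c. c abs_summable_on UNIV \<and> (\<forall>x :: real^'d. of_real (sin (x $ i)) = fser c x)"
proof -
  let ?a = "axis i 1 :: int^'d"
  have ne: "- ?a \<noteq> ?a" by (auto simp: vec_eq_iff axis_def)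
  have la: "x \<bullet> lattice_vec ?a = x $ i" for x :: "real^'d"
  proof -
    have "lattice_vec ?a = axis i 1" by (auto simp: lattice_vec_def axis_def vec_eq_iff)
    then show ?thesis by (simp add: inner_axis)
  qed
  have *: "\<exists>c. c abs_summable_on UNIV \<and> (\<forall>x :: real^'d. p * cis (x $ i) + q * cis (- (x $ i)) = fser c x)" for p q
  proof (intro exI conjI allI)
    let ?c = "\<lambda>n. if n = ?a then p else if n = - ?a then q else 0"
    show "?c abs_summable_on UNIV" by (rule finite_support_abs_summable[of "{?a, - ?a}"]) auto
    fix x :: "real^'d"
    have "((\<lambda>n. ?c n * cis (x \<bullet> lattice_vec n)) has_sum (\<Sum>n\<in>{?a, - ?a}. ?c n * cis (x \<bullet> lattice_vec n))) UNIV"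
      by (rule has_sum_finite_neutralI) auto
    also have "(\<Sum>n\<in>{?a, - ?a}. ?c n * cis (x \<bullet> lattice_vec n)) = p * cis (x $ i) + q * cis (- (x $ i))"
      using ne by (simp add: la)
    finally show "p * cis (x $ i) + q * cis (- (x $ i)) = fser ?c x" by (simp add: fser_def infsumI)
  qed
  have "1 / 2 * cis t + 1 / 2 * cis (- t) = of_real (cos t)" for t by (simp add: complex_eq_iff)
  then show "\<exists>c. c abs_summable_on UNIV \<and> (\<forall>x :: real^'d. of_real (cos (x $ i)) = fser c x)"
    using *[of "1/2" "1/2"] by simp
  have "- \<i> / 2 * cis t + \<i> / 2 * cis (- t) = of_real (sin t)" for t by (simp add: complex_eq_iff)
  then show "\<exists>c. c abs_summable_on UNIV \<and> (\<forall>x :: real^'d. of_real (sin (x $ i)) = fser c x)"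
    using *[of "- \<i>/2" "\<i>/2"] by simp
qed

definition circ :: "real^'d \<Rightarrow> (real^'d) \<times> (real^'d)" where
  "circ x = (\<chi> i. cos (x $ i), \<chi> i. sin (x $ i))"

lemma continuous_circ: "continuous_on S circ"
  unfolding circ_def by (intro continuous_intros)

text \<open>The torus is embedded in a product of circles, where Stone--Weierstrass applies.\<close>

lemma zero_coeffs_orthogonal:
  fixes u :: "real^'d \<Rightarrow> real"
  assumes u: "u \<in> L2" and 0: "\<And>n. fourier_coeff u n = 0"
    and f: "continuous_on (circ ` cbox 0 (\<chi> i. 2 * pi)) f"
  shows "(\<integral>x. u x * f (circ x) \<partial>torus) = 0"
proof -
  let ?Q = "cbox 0 (\<chi> i. 2 * pi) :: (real^'d) set" let ?S = "circ ` ?Q"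
  \<comment> \<open>Functions on the product of circles whose pullback has an absolutely convergent
    Fourier series. They form an algebra because products correspond to convolutions, and they
    separate points by \<open>trig_separates\<close>.\<close>
  define P :: "((real^'d) \<times> (real^'d) \<Rightarrow> real) \<Rightarrow> bool" where
    "P g \<longleftrightarrow> continuous_on UNIV g \<and> (\<exists>c. c abs_summable_on UNIV \<and> (\<forall>x. of_real (g (circ x)) = fser c x))" for g
  have orth: "(\<integral>x. u x * g (circ x) \<partial>torus) = 0" if "P g" for g
  proof -
    from that obtain c where c: "c abs_summable_on UNIV" "\<And>x. of_real (g (circ x)) = fser c x"
      by (auto simp: P_def)
    have "(\<integral>x. of_real (u x) * cis (x \<bullet> lattice_vec n) \<partial>torus) = 0" for n
      using 0[of "- n"] by (simp add: fourier_coeff_def)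
    then have "((\<lambda>n :: int^'d. 0) has_sum (\<integral>x. of_real (u x) * fser c x \<partial>torus)) UNIV"
      using fser_uniform(3)[OF c(1), of "\<lambda>x. of_real (u x)"] u by (simp add: L2_integrable)
    then have "(\<integral>x. of_real (u x) * fser c x \<partial>torus) = 0"
      using has_sum_unique has_sum_0_simp by blast
    then have "(\<integral>x. of_real (u x * g (circ x)) \<partial>torus) = (0 :: complex)" by (simp add: c(2))
    then show ?thesis by (simp only: integral_complex_of_real of_real_eq_0_iff)
  qed
  have cS: "compact ?S" by (intro compact_continuous_image continuous_circ compact_cbox)
  have approx: "\<exists>g. P g \<and> (\<forall>z\<in>?S. \<bar>f z - g z\<bar> < e)" if "0 < e" for e
  proof (rule Stone_Weierstrass_HOL[OF cS _ _ _ _ _ f that])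
    show "P (\<lambda>x. c)" for c
    proof -
      let ?c = "\<lambda>n. if n = 0 then of_real c else 0"
      have "((\<lambda>n. ?c n * cis (x \<bullet> lattice_vec n)) has_sum (\<Sum>n\<in>{0}. ?c n * cis (x \<bullet> lattice_vec n))) UNIV" for x :: "real^'d"
        by (rule has_sum_finite_neutralI[of "{0}"]) auto
      then have "of_real c = fser ?c x" for x :: "real^'d"
        unfolding fser_def by (subst infsumI) auto
      moreover have "?c abs_summable_on (UNIV :: (int^'d) set)"
        by (rule finite_support_abs_summable[of "{0}"]) auto
      ultimately show ?thesis unfolding P_def by (intro conjI exI[of _ ?c]) auto
    qed
    show "continuous_on ?S g" if "P g" for g
      using that unfolding P_def by (meson continuous_on_subset subset_UNIV)
    show "P (\<lambda>x. g x + h x)" if "P g \<and> P h" for g h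
    proof -
      from that obtain c d where c: "c abs_summable_on UNIV" "\<And>x. of_real (g (circ x)) = fser c x"
        and d: "d abs_summable_on UNIV" "\<And>x. of_real (h (circ x)) = fser d x"
        by (auto simp: P_def)
      have "(\<lambda>n. c n + d n) abs_summable_on UNIV"
        by (rule Infinite_Sum.abs_summable_on_comparison_test'[OF summable_on_add[OF c(1) d(1)]]) (simp add: norm_triangle_ineq)
      moreover have "of_real (g (circ x) + h (circ x)) = fser (\<lambda>n. c n + d n) x" for x
        unfolding fser_def of_real_add c(2) d(2) distrib_right
        by (subst infsum_add) (auto intro!: abs_summable_summable fser_abs_summable c d)
      ultimately show ?thesis using that unfolding P_def by (auto intro!: continuous_intros)
    qed
    show "P (\<lambda>x. g x * h x)" if "P g \<and> P h" for g h
    proof -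
      from that obtain c d where c: "c abs_summable_on UNIV" "\<And>x. of_real (g (circ x)) = fser c x"
        and d: "d abs_summable_on UNIV" "\<And>x. of_real (h (circ x)) = fser d x"
        by (auto simp: P_def)
      have "of_real (g (circ x) * h (circ x)) = fser (conv c d) x" for x
        by (simp add: fser_conv[OF c(1) d(1)] c(2) d(2))
      then show ?thesis using that conv_abs_summable[OF c(1) d(1)] unfolding P_def
        by (auto intro!: continuous_intros)
    qed
    show "\<exists>g. P g \<and> g z \<noteq> g w" if "z \<in> ?S \<and> w \<in> ?S \<and> z \<noteq> w" for z w
    proof -
      have "P (\<lambda>z. fst z $ i)" "P (\<lambda>z. snd z $ i)" for i
        unfolding P_def using trig_separates[of i] by (auto intro!: continuous_intros simp: circ_def)
      moreover have "\<exists>i. fst z $ i \<noteq> fst w $ i \<or> snd z $ i \<noteq> snd w $ i"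
        using that by (metis prod_eqI vec_eq_iff)
      ultimately show ?thesis by blast
    qed
  qed
  let ?I = "\<integral>x. \<bar>u x\<bar> \<partial>torus"
  have fm: "(\<lambda>x. f (circ x)) \<in> borel_measurable torus"
  proof -
    have "continuous_on ?Q (f \<circ> circ)" by (rule continuous_on_compose[OF continuous_circ f])
    then have "f \<circ> circ \<in> borel_measurable torus" unfolding torus_def
      by (intro continuous_imp_measurable_on_sets_lebesgue) auto
    then show ?thesis by (simp add: comp_def)
  qed
  have le: "\<bar>\<integral>x. u x * f (circ x) \<partial>torus\<bar> \<le> e * ?I" if e: "0 < e" for e
  proof -
    obtain g where g: "P g" "\<And>z. z \<in> ?S \<Longrightarrow> \<bar>f z - g z\<bar> < e" using approx[OF e] by blast
    have gm: "(\<lambda>x. g (circ x)) \<in> borel_measurable torus"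
    proof -
      have "continuous_on UNIV (g \<circ> circ)"
        using g(1) by (intro continuous_on_compose continuous_circ) (auto simp: P_def intro: continuous_on_subset)
      then show ?thesis using measurable_torus_continuous by (auto simp: comp_def)
    qed
    obtain B where B: "\<And>z. z \<in> ?S \<Longrightarrow> \<bar>g z\<bar> \<le> B"
    proof -
      have "compact (g ` ?S)" using g(1) by (intro compact_continuous_image cS) (auto simp: P_def intro: continuous_on_subset)
      then show ?thesis using that by (metis bounded_real compact_imp_bounded imageI)
    qed
    have i1: "integrable torus (\<lambda>x. u x * g (circ x))"
    proof (rule Bochner_Integration.integrable_bound)
      show "integrable torus (\<lambda>x. B * u x)" using u by (simp add: L2_integrable)
      show "AE x in torus. norm (u x * g (circ x)) \<le> norm (B * u x)"
      proof (rule AE_I2)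
        fix x :: "real^'d" assume "x \<in> space torus"
        then have "\<bar>g (circ x)\<bar> \<le> B" by (intro B) (auto simp: space_torus)
        then show "norm (u x * g (circ x)) \<le> norm (B * u x)"
          using abs_ge_zero[of "u x"] unfolding real_norm_def abs_mult
          by (metis abs_ge_self mult.commute mult_right_mono order_trans)
      qed
    qed (use gm u in \<open>auto dest: L2_D\<close>)
    have i2: "integrable torus (\<lambda>x. u x * (f (circ x) - g (circ x)))" and
      b2: "\<And>x. x \<in> space torus \<Longrightarrow> \<bar>u x * (f (circ x) - g (circ x))\<bar> \<le> e * \<bar>u x\<bar>"
    proof -
      show b: "\<bar>u x * (f (circ x) - g (circ x))\<bar> \<le> e * \<bar>u x\<bar>" if "x \<in> space torus" for x
        using g(2)[of "circ x"] that by (auto simp: space_torus abs_mult mult.commute[of _ "\<bar>u x\<bar>"] intro!: mult_left_mono)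
      show "integrable torus (\<lambda>x. u x * (f (circ x) - g (circ x)))"
      proof (rule Bochner_Integration.integrable_bound)
        show "integrable torus (\<lambda>x. e * u x)" using u by (simp add: L2_integrable)
        show "AE x in torus. norm (u x * (f (circ x) - g (circ x))) \<le> norm (e * u x)"
          using b e by (intro AE_I2) (simp add: abs_mult)
      qed (use gm fm u in \<open>auto dest: L2_D\<close>)
    qed
    have "(\<integral>x. u x * f (circ x) \<partial>torus) = (\<integral>x. u x * (f (circ x) - g (circ x)) + u x * g (circ x) \<partial>torus)"
      by (simp add: algebra_simps)
    also have "\<dots> = (\<integral>x. u x * (f (circ x) - g (circ x)) \<partial>torus)"
      by (subst Bochner_Integration.integral_add[OF i2 i1]) (simp add: orth[OF g(1)])
    also have "\<bar>\<dots>\<bar> \<le> (\<integral>x. \<bar>u x * (f (circ x) - g (circ x))\<bar> \<partial>torus)" by (rule integral_abs_bound)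
    also have "\<dots> \<le> (\<integral>x. e * \<bar>u x\<bar> \<partial>torus)"
      using i2 u b2 by (intro integral_mono) (auto simp: L2_integrable)
    finally show ?thesis by simp
  qed
  have I0: "0 \<le> ?I" by simp
  have "\<bar>\<integral>x. u x * f (circ x) \<partial>torus\<bar> \<le> 0"
  proof (rule field_le_epsilon)
    fix e :: real assume "0 < e"
    have "?I / (?I + 1) \<le> 1" using I0 by (simp only: divide_le_eq_1) linarith
    with \<open>0 < e\<close> have "e * (?I / (?I + 1)) \<le> e * 1" by (intro mult_left_mono) auto
    then have "e / (?I + 1) * ?I \<le> e" by simp
    then show "\<bar>\<integral>x. u x * f (circ x) \<partial>torus\<bar> \<le> 0 + e"
      using le[of "e / (?I + 1)"] \<open>0 < e\<close> I0 by (simp add: add_nonneg_pos)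
  qed
  then show ?thesis by simp
qed

lemma norm_emb_le:
  fixes u :: "real^'d \<Rightarrow> real"
  assumes u: "u \<in> L2" shows "sqrt ((2 * pi) ^ CARD('d)) * norm (emb u) \<le> L2_norm u"
proof -
  let ?s = "sqrt ((2 * pi) ^ CARD('d))"
  have s: "0 < ?s" by simp
  have "norm (emb u) \<le> L2_norm u / ?s"
  proof (rule l2_norm_leI)
    show "0 \<le> L2_norm u / ?s" by (simp add: L2_norm_nonneg)
    fix F :: "(int^'d) set" assume "finite F"
    from sum_fourier_coeff_le[OF u this]
    have "(\<Sum>n\<in>F. (cmod (fourier_coeff u n))\<^sup>2) \<le> (L2_norm u)\<^sup>2 / (2 * pi) ^ CARD('d)"
      by (simp add: field_simps)
    also have "\<dots> = (L2_norm u / ?s)\<^sup>2" by (simp add: power_divide)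
    finally show "L2_set (\<lambda>n. cmod (co (emb u) n)) F \<le> L2_norm u / ?s"
      using \<open>0 \<le> L2_norm u / ?s\<close> by (simp add: L2_set_def co_emb[OF u] real_le_lsqrt)
  qed
  then show ?thesis using s by (simp add: field_simps)
qed

text \<open>By inner regularity the set where \<open>u\<close> is positive is exhausted up to small
  measure by compact subsets of the open box. The integral of \<open>u\<close> over such a compact
  set is a limit of integrals against continuous functions of \<open>circ\<close>, hence zero, so
  the compact set is null. The same applies to the negative of \<open>u\<close>.\<close>

lemma zero_coeffs_imp_AE_zero:
  fixes u :: "real^'d \<Rightarrow> real"
  assumes u: "u \<in> L2" and 0: "\<And>n. fourier_coeff u n = 0"
  shows "AE x in torus. u x = 0"
proof -
  let ?Q = "cbox 0 (\<chi> i. 2 * pi) :: (real^'d) set" and ?B = "box 0 (\<chi> i. 2 * pi) :: (real^'d) set"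
  have Kzero: "(\<integral>x. v x * indicator K x \<partial>torus) = 0"
    if v: "v \<in> L2" "\<And>n. fourier_coeff v n = 0" and K: "compact K" "K \<subseteq> ?B" for v :: "real^'d \<Rightarrow> real" and K
  proof (cases "K = {}")
    case False
    let ?C = "circ ` K"
    have C: "closed ?C" "?C \<noteq> {}"
      using False by (auto intro!: compact_imp_closed compact_continuous_image continuous_circ K)
    \<comment> \<open>\<open>circ\<close> identifies opposite faces of the cube, but points of
      \<open>K\<close> lie in the open box and have no second preimage.\<close>
    have inj: "x \<in> K" if "x \<in> ?Q" "circ x \<in> ?C" for x
    proof -
      obtain y where y: "y \<in> K" "circ x = circ y" using \<open>circ x \<in> ?C\<close> by auto
      have "x $ i = y $ i" for i
      proof -
        have "sin (x $ i) = sin (y $ i) \<and> cos (x $ i) = cos (y $ i)"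
          using y(2) by (simp add: circ_def vec_eq_iff)
        then obtain n :: int where n: "x $ i = y $ i + 2 * pi * n" by (auto simp: sin_cos_eq_iff)
        have "0 < y $ i" "y $ i < 2 * pi" "0 \<le> x $ i" "x $ i \<le> 2 * pi"
          using y(1) K(2) \<open>x \<in> ?Q\<close> by (auto simp: mem_box_cart)
        then have "- (2 * pi) < 2 * pi * n" "2 * pi * n < 2 * pi" using n by linarith+
        then have "- 1 < real_of_int n" "real_of_int n < 1"
          using mult_less_cancel_left_pos[of "2 * pi" "-1" "real_of_int n"]
            mult_less_cancel_left_pos[of "2 * pi" "real_of_int n" 1] by simp_all
        then have "n = 0" by linarith
        then show ?thesis using n by simp
      qed
      then show ?thesis using y(1) by (metis vec_eq_iff)
    qed
    \<comment> \<open>Continuous tents around the image of \<open>K\<close>, decreasing to its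
      indicator.\<close>
    define f where "f j z = max 0 (1 - real j * infdist z ?C)" for j z
    have fc: "continuous_on S (f j)" for S j unfolding f_def by (intro continuous_intros)
    have z: "(\<integral>x. v x * f j (circ x) \<partial>torus) = 0" for j
      by (rule zero_coeffs_orthogonal[OF v fc])
    have fm: "(\<lambda>x. f j (circ x)) \<in> borel_measurable torus" for j
      using continuous_on_compose[OF continuous_circ[of UNIV] fc[of _ j]]
      by (intro measurable_torus_continuous) (simp add: comp_def)
    have "(\<lambda>j. \<integral>x. v x * f j (circ x) \<partial>torus) \<longlonglongrightarrow> (\<integral>x. v x * indicator K x \<partial>torus)"
    proof (rule integral_dominated_convergence[where w="\<lambda>x. \<bar>v x\<bar>"])
      have "K \<in> sets torus" unfolding torus_def
        using K by (auto simp: sets_restrict_space_iff dest: compact_imp_closed intro: box_subset_cbox[THEN subsetD])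
      then show "(\<lambda>x. v x * indicator K x) \<in> borel_measurable torus"
        by (intro borel_measurable_times L2_D(2) v borel_measurable_indicator)
      show "(\<lambda>x. v x * f j (circ x)) \<in> borel_measurable torus" for j
        by (intro borel_measurable_times L2_D(2) v fm)
      show "integrable torus (\<lambda>x. \<bar>v x\<bar>)" using v by (simp add: L2_integrable)
      have "\<bar>f j z\<bar> \<le> 1" for j z by (simp add: f_def infdist_nonneg)
      then show "AE x in torus. norm (v x * f j (circ x)) \<le> \<bar>v x\<bar>" for j
        by (intro AE_I2) (simp add: abs_mult mult_left_le)
      show "AE x in torus. (\<lambda>j. v x * f j (circ x)) \<longlonglongrightarrow> v x * indicator K x"
      proof (rule AE_I2)
        fix x :: "real^'d" assume "x \<in> space torus"
        then have xQ: "x \<in> ?Q" by (simp add: space_torus)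
        have "(\<lambda>j. f j (circ x)) \<longlonglongrightarrow> indicator K x"
        proof (cases "x \<in> K")
          case True
          then show ?thesis by (simp add: f_def)
        next
          case False
          then have "circ x \<notin> ?C" using inj xQ by blast
          then have d: "0 < infdist (circ x) ?C"
            using C by (meson infdist_pos_not_in_closed)
          obtain N where N: "1 / infdist (circ x) ?C \<le> real N" using real_arch_simple by blast
          have "f j (circ x) = 0" if "j \<ge> N" for j
          proof -
            have "1 / infdist (circ x) ?C \<le> real j" using N that by linarith
            then have "1 \<le> real j * infdist (circ x) ?C" using d by (simp add: field_simps)
            then show ?thesis by (simp add: f_def)
          qed
          then have "\<forall>\<^sub>F j in sequentially. f j (circ x) = indicator K x"
            using False by (auto simp: eventually_sequentially)
          then show ?thesis by (rule tendsto_eventually)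
        qed
        then show "(\<lambda>j. v x * f j (circ x)) \<longlonglongrightarrow> v x * indicator K x" by (intro tendsto_intros)
      qed
    qed
    then show ?thesis using z by (simp add: LIMSEQ_const_iff)
  qed simp
  have null: "{x \<in> ?B. 0 < v x} \<in> null_sets lebesgue"
    if v: "v \<in> L2" "\<And>n. fourier_coeff v n = 0" for v :: "real^'d \<Rightarrow> real"
  proof -
    let ?E = "{x \<in> ?B. 0 < v x}"
    have "{x \<in> space torus. 0 < v x} \<in> sets torus" using L2_D(2)[OF v(1)] by measurable
    then have "{x \<in> ?Q. 0 < v x} \<in> sets lebesgue"
      by (auto simp: torus_def sets_restrict_space_iff)
    moreover have "?E = {x \<in> ?Q. 0 < v x} \<inter> ?B" using box_subset_cbox by blast
    ultimately have E: "?E \<in> sets lebesgue" by auto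
    have "emeasure lebesgue ?E \<le> ennreal e" if e: "0 < e" for e
    proof -
      obtain T where T: "closed T" "T \<subseteq> ?E" "?E - T \<in> lmeasurable" "emeasure lebesgue (?E - T) < ennreal e"
        using sets_lebesgue_inner_closed[OF E e] by blast
      have TB: "T \<subseteq> ?B" using T(2) by auto
      then have cT: "compact T" using T(1) bounded_subset[OF bounded_box] by (auto simp: compact_eq_bounded_closed)
      have Tt: "T \<in> sets torus" "T \<in> sets lebesgue" "T \<subseteq> ?Q" using cT TB box_subset_cbox[of 0 "\<chi> i. 2 * pi"]
        by (auto simp: torus_def sets_restrict_space_iff dest: compact_imp_closed)
      have int: "integrable torus (\<lambda>x. v x * indicator T x)"
        using integrable_mult_indicator[OF Tt(1) L2_integrable[OF v(1)]] by (simp add: mult.commute)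
      have nn: "AE x in torus. 0 \<le> v x * indicator T x"
        using T(2) by (intro AE_I2) (auto simp: indicator_def less_imp_le)
      have "AE x in torus. v x * indicator T x = 0"
        using Kzero[OF v cT TB] integral_nonneg_eq_0_iff_AE[OF int nn] by simp
      then have "AE x in torus. x \<notin> T" by eventually_elim (use T(2) in \<open>auto simp: indicator_def\<close>)
      then have "AE x in lebesgue. x \<in> ?Q \<longrightarrow> x \<notin> T"
        unfolding torus_def by (subst (asm) AE_restrict_space_iff) auto
      then have "AE x in lebesgue. x \<notin> T" by eventually_elim (use Tt(3) in auto)
      then have "emeasure lebesgue T = 0"
        using AE_iff_null_sets[OF Tt(2)] by (auto simp: null_sets_def)
      moreover have "emeasure lebesgue ?E \<le> emeasure lebesgue T + emeasure lebesgue (?E - T)"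
      proof -
        have "?E = T \<union> (?E - T)" using T(2) by auto
        then show ?thesis using emeasure_subadditive[of T lebesgue "?E - T"] Tt(2) T(3) by (metis fmeasurableD)
      qed
      ultimately show ?thesis using T(4) by (auto intro: less_imp_le)
    qed
    note small = this
    have "emeasure lebesgue ?E \<le> 0"
    proof (rule ennreal_le_epsilon)
      fix e :: real assume "0 < e"
      then show "emeasure lebesgue ?E \<le> 0 + ennreal e" using small[of e] by simp
    qed
    then have "emeasure lebesgue ?E = 0" by simp
    then show ?thesis using E by auto
  qed
  have n1: "{x \<in> ?B. 0 < u x} \<in> null_sets lebesgue" by (rule null[OF u 0])
  have n2: "{x \<in> ?B. 0 < -1 * u x} \<in> null_sets lebesgue"
    by (rule null[OF L2_scale[OF u]]) (simp only: fourier_coeff_scale 0, simp)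
  have n3: "?Q - ?B \<in> null_sets lebesgue"
    using negligible_frontier_interval[of 0 "\<chi> i. 2 * pi :: real^'d"] by (simp add: negligible_iff_null_sets)
  have "AE x in lebesgue. x \<in> ?Q \<longrightarrow> u x = 0"
    using AE_not_in[OF n1] AE_not_in[OF n2] AE_not_in[OF n3] by eventually_elim auto
  then show ?thesis unfolding torus_def by (subst AE_restrict_space_iff) auto
qed

lemma ae_eq_iff_fourier_coeff:
  fixes u v :: "real^'d \<Rightarrow> real"
  assumes "u \<in> L2" "v \<in> L2"
  shows "ae_eq u v \<longleftrightarrow> fourier_coeff u = fourier_coeff v"
proof
  assume "ae_eq u v"
  then show "fourier_coeff u = fourier_coeff v" unfolding ae_eq_def
    using assms by (intro fourier_coeff_cong_AE) (auto dest: L2_D)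
next
  assume "fourier_coeff u = fourier_coeff v"
  then have "AE x in torus. u x - v x = 0"
    using assms by (intro zero_coeffs_imp_AE_zero L2_diff) (auto simp: fourier_coeff_diff)
  then show "ae_eq u v" by (simp add: ae_eq_def)
qed

section \<open>Completeness of L2, the Riesz-Fischer theorem and Parseval's identity\<close>

lemma nn_integral_L2_norm:
  assumes "u \<in> L2" shows "(\<integral>\<^sup>+x. ennreal ((u x)\<^sup>2) \<partial>torus) = ennreal ((L2_norm u)\<^sup>2)"
  unfolding L2_norm_power2 by (rule nn_integral_eq_integral) (use assms in \<open>auto dest: L2_D\<close>)

text \<open>The geometric rate stands in for the passage to a subsequence: consecutive differences
  are summable in L1, hence almost everywhere, and Fatou's lemma transfers the rate to the
  limit.\<close>

lemma L2_complete:
  fixes f :: "nat \<Rightarrow> real^'d \<Rightarrow> real"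
  assumes f: "\<And>j. f j \<in> L2"
    and cauchy: "\<And>i j. L2_norm (\<lambda>x. f i x - f j x) \<le> C * ((1/2) ^ i + (1/2) ^ j)"
  obtains v where "v \<in> L2" "\<And>j. L2_norm (\<lambda>x. f j x - v x) \<le> C * (1/2) ^ j"
proof -
  interpret finite_measure "torus :: (real^'d) measure" by (rule finite_measure_torus)
  have C: "0 \<le> C" using cauchy[of 0 0] L2_norm_nonneg[of "\<lambda>x. f 0 x - f 0 x"] by simp
  define \<mu> where "\<mu> = measure (torus :: (real^'d) measure) (space torus)"
  define g where "g j x = f (Suc j) x - f j x" for j x
  have gL: "g j \<in> L2" for j unfolding g_def by (intro L2_diff f)
  define K where "K = (4 * C\<^sup>2 + \<mu>) / 2"
  have "0 \<le> \<mu>" by (simp add: \<mu>_def)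
  have g1: "(\<integral>\<^sup>+x. ennreal \<bar>g j x\<bar> \<partial>torus) \<le> ennreal (K * (1/2) ^ j)" for j
  proof -
    let ?a = "(1/2 :: real) ^ j"
    have a: "0 < ?a" by simp
    \<comment> \<open>The arithmetic-geometric mean inequality with weight \<open>?a\<close>. As the
      squared L2 norm of \<open>g j\<close> is of order \<open>?a^2\<close>, both summands integrate
      to the order of \<open>?a\<close>.\<close>
    have pt: "\<bar>g j x\<bar> \<le> ((g j x)\<^sup>2 / ?a + ?a) / 2" for x
    proof -
      have "0 \<le> \<bar>g j x\<bar>\<^sup>2 + ?a\<^sup>2 - 2 * \<bar>g j x\<bar> * ?a"
        using zero_le_power2[of "\<bar>g j x\<bar> - ?a"] by (simp only: power2_diff)
      then have "2 * \<bar>g j x\<bar> * ?a \<le> (g j x)\<^sup>2 + ?a * ?a"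
        unfolding power2_abs power2_eq_square[of ?a] by linarith
      then show ?thesis using a by (simp add: field_simps)
    qed
    have "(\<integral>\<^sup>+x. ennreal \<bar>g j x\<bar> \<partial>torus) \<le> (\<integral>\<^sup>+x. ennreal (((g j x)\<^sup>2 / ?a + ?a) / 2) \<partial>torus)"
      by (intro nn_integral_mono ennreal_leI pt)
    also have "\<dots> = ennreal (\<integral>x. ((g j x)\<^sup>2 / ?a + ?a) / 2 \<partial>torus)"
      using gL[of j] by (intro nn_integral_eq_integral) (auto dest: L2_D)
    also have "(\<integral>x. ((g j x)\<^sup>2 / ?a + ?a) / 2 \<partial>torus) = ((L2_norm (g j))\<^sup>2 / ?a + ?a * \<mu>) / 2"
      using gL[of j] by (simp add: L2_D L2_norm_power2 \<mu>_def)
    also have "\<dots> \<le> K * ?a"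
    proof -
      have "L2_norm (g j) \<le> C * (3/2 * ?a)" using cauchy[of "Suc j" j] by (simp add: g_def[abs_def])
      also have "\<dots> \<le> C * (2 * ?a)" using C a by (intro mult_left_mono) auto
      finally have "(L2_norm (g j))\<^sup>2 \<le> (C * (2 * ?a))\<^sup>2" by (intro power_mono L2_norm_nonneg)
      then have "(L2_norm (g j))\<^sup>2 / ?a \<le> (C * (2 * ?a))\<^sup>2 / ?a" using a by (intro divide_right_mono) auto
      also have "\<dots> = 4 * C\<^sup>2 * ?a" using a by (simp add: power2_eq_square)
      finally show ?thesis by (simp add: K_def algebra_simps)
    qed
    finally show ?thesis by (simp add: ennreal_leI)
  qed
  have K: "0 \<le> K" using \<open>0 \<le> \<mu>\<close> by (simp add: K_def)
  have gm[measurable]: "g j \<in> borel_measurable torus" for j using gL by (rule L2_D)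
  have "(\<integral>\<^sup>+x. (\<Sum>j. ennreal \<bar>g j x\<bar>) \<partial>torus) = (\<Sum>j. \<integral>\<^sup>+x. ennreal \<bar>g j x\<bar> \<partial>torus)"
    by (intro nn_integral_suminf) measurable
  also have "\<dots> \<le> (\<Sum>j. ennreal (K * (1/2) ^ j))" by (intro suminf_le g1) auto
  also have "\<dots> = ennreal (\<Sum>j. K * (1/2) ^ j)"
    using K by (intro suminf_ennreal2) (auto intro!: summable_mult summable_geometric)
  finally have "(\<integral>\<^sup>+x. (\<Sum>j. ennreal \<bar>g j x\<bar>) \<partial>torus) \<noteq> \<infinity>" by (auto simp: top_unique)
  then have "AE x in torus. (\<Sum>j. ennreal \<bar>g j x\<bar>) \<noteq> \<infinity>" by (intro nn_integral_PInf_AE) auto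
  then have conv: "AE x in torus. convergent (\<lambda>j. f j x)"
  proof eventually_elim
    case (elim x)
    then have "summable (\<lambda>j. \<bar>g j x\<bar>)" by (intro summable_suminf_not_top) auto
    then have "summable (\<lambda>j. g j x)" by (rule summable_rabs_cancel)
    then have "convergent (\<lambda>j. f 0 x + (\<Sum>i<j. g i x))"
      by (intro convergent_add convergent_const) (simp add: summable_iff_convergent)
    moreover have "f 0 x + (\<Sum>i<j. g i x) = f j x" for j
      unfolding g_def using sum_lessThan_telescope[of "\<lambda>j. f j x" j] by simp
    ultimately show ?case by simp
  qed
  define v where "v x = lim (\<lambda>j. f j x)" for x
  have vm[measurable]: "v \<in> borel_measurable torus"
    unfolding v_def by (intro borel_measurable_lim_metric L2_D f)
  have fm[measurable]: "f j \<in> borel_measurable torus" for j using f by (rule L2_D)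
  have vp: "periodic v" using f by (simp add: v_def periodic_def L2_def)
  have fatou: "(\<integral>\<^sup>+x. ennreal ((f j x - v x)\<^sup>2) \<partial>torus) \<le> ennreal ((C * (1/2) ^ j)\<^sup>2)" for j
  proof -
    have "(\<integral>\<^sup>+x. ennreal ((f j x - v x)\<^sup>2) \<partial>torus) = (\<integral>\<^sup>+x. liminf (\<lambda>i. ennreal ((f j x - f i x)\<^sup>2)) \<partial>torus)"
    proof (rule nn_integral_cong_AE)
      show "AE x in torus. ennreal ((f j x - v x)\<^sup>2) = liminf (\<lambda>i. ennreal ((f j x - f i x)\<^sup>2))"
        using conv
      proof eventually_elim
        case (elim x)
        then have "(\<lambda>i. f i x) \<longlonglongrightarrow> v x" by (simp add: v_def convergent_LIMSEQ_iff)
        then have "(\<lambda>i. ennreal ((f j x - f i x)\<^sup>2)) \<longlonglongrightarrow> ennreal ((f j x - v x)\<^sup>2)"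
          by (intro tendsto_intros)
        then show ?case using lim_imp_Liminf[OF sequentially_bot] by metis
      qed
    qed
    also have "\<dots> \<le> liminf (\<lambda>i. \<integral>\<^sup>+x. ennreal ((f j x - f i x)\<^sup>2) \<partial>torus)"
      by (rule nn_integral_liminf) measurable
    also have "\<dots> = liminf (\<lambda>i. ennreal ((L2_norm (\<lambda>x. f j x - f i x))\<^sup>2))"
      by (simp add: nn_integral_L2_norm L2_diff f)
    also have "\<dots> \<le> liminf (\<lambda>i. ennreal ((C * ((1/2) ^ j + (1/2) ^ i))\<^sup>2))"
      by (intro Liminf_mono always_eventually allI ennreal_leI power_mono cauchy L2_norm_nonneg)
    also have "\<dots> = ennreal ((C * ((1/2) ^ j + 0))\<^sup>2)"
      by (intro lim_imp_Liminf sequentially_bot tendsto_intros LIMSEQ_realpow_zero) auto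
    finally show ?thesis by simp
  qed
  have dL: "(\<lambda>x. f j x - v x) \<in> L2" for j
    unfolding L2_def
  proof (intro CollectI conjI)
    show "periodic (\<lambda>x. f j x - v x)" using vp L2_D(1)[OF f[of j]] by (simp add: periodic_def)
    show "integrable torus (\<lambda>x. (f j x - v x)\<^sup>2)"
      by (rule integrableI_bounded) (use fatou[of j] in \<open>auto simp: le_less_trans[OF _ ennreal_less_top]\<close>)
  qed measurable
  have "(\<lambda>x. f 0 x - (f 0 x - v x)) \<in> L2" by (rule L2_diff[OF f dL])
  then have "v \<in> L2" by simp
  moreover have "L2_norm (\<lambda>x. f j x - v x) \<le> C * (1/2) ^ j" for j
  proof -
    have "(L2_norm (\<lambda>x. f j x - v x))\<^sup>2 \<le> (C * (1/2) ^ j)\<^sup>2"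
      using fatou[of j] by (simp add: nn_integral_L2_norm[OF dL] ennreal_le_iff)
    then show ?thesis by (rule power2_le_imp_le) (use C in simp)
  qed
  ultimately show ?thesis using that by blast
qed

lemma
  fixes z :: "'d::finite l2"
  assumes "proj R z = z"
  shows co_abs_summable_proj: "co z abs_summable_on UNIV"
    and L2_norm_trig_proj: "L2_norm (trig (co z)) = sqrt ((2 * pi) ^ CARD('d)) * norm z"
proof -
  let ?F = "{n :: int^'d. freq n \<le> R}"
  have out: "co z n = 0" if "n \<notin> ?F" for n using co_proj[of R z n] assms that by simp
  show a: "co z abs_summable_on UNIV" by (rule finite_support_abs_summable[OF finite_freq_le out])
  have n: "(norm z)\<^sup>2 = (\<Sum>n\<in>?F. (cmod (co z n))\<^sup>2)"
  proof (rule antisym)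
    have "norm z \<le> sqrt (\<Sum>n\<in>?F. (cmod (co z n))\<^sup>2)"
    proof (rule l2_norm_leI)
      fix G :: "(int^'d) set" assume G: "finite G"
      have "(\<Sum>n\<in>G. (cmod (co z n))\<^sup>2) = (\<Sum>n\<in>G \<inter> ?F. (cmod (co z n))\<^sup>2)"
        using G out by (intro sum.mono_neutral_right) auto
      also have "\<dots> \<le> (\<Sum>n\<in>?F. (cmod (co z n))\<^sup>2)" by (intro sum_mono2 finite_freq_le) auto
      finally show "L2_set (\<lambda>n. cmod (co z n)) G \<le> sqrt (\<Sum>n\<in>?F. (cmod (co z n))\<^sup>2)"
        by (simp add: L2_set_def)
    qed (simp add: sum_nonneg)
    from power_mono[OF this norm_ge_zero, of 2]
    show "(norm z)\<^sup>2 \<le> (\<Sum>n\<in>?F. (cmod (co z n))\<^sup>2)" by (simp add: sum_nonneg)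
  qed (rule co_sum_le_norm)
  have fc: "fourier_coeff (trig (co z)) = co z" by (rule fourier_coeff_trig[OF a herm_co])
  have ceq: "(\<lambda>n. if n \<in> ?F then fourier_coeff (trig (co z)) n else 0) = co z"
    using out by (auto simp: fc fun_eq_iff)
  have "(L2_norm (\<lambda>x. trig (co z) x - trig (co z) x))\<^sup>2 = (L2_norm (trig (co z)))\<^sup>2 - (2 * pi) ^ CARD('d) * (\<Sum>n\<in>?F. (cmod (co z n))\<^sup>2)"
    using L2_norm_diff_trig(3)[OF trig_in_L2[OF a herm_co] finite_freq_le[of R]] unfolding ceq by (simp add: fc)
  then have "(L2_norm (trig (co z)))\<^sup>2 = (2 * pi) ^ CARD('d) * (norm z)\<^sup>2" by (simp add: n L2_norm_def sum_nonneg)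
  then have "(L2_norm (trig (co z)))\<^sup>2 = (sqrt ((2 * pi) ^ CARD('d)) * norm z)\<^sup>2" by (simp add: power_mult_distrib)
  then show "L2_norm (trig (co z)) = sqrt ((2 * pi) ^ CARD('d)) * norm z"
    by (rule power2_eq_imp_eq) (simp_all add: L2_norm_nonneg)
qed

lemma fser_diff:
  assumes "c abs_summable_on UNIV" "d abs_summable_on UNIV"
  shows "fser (\<lambda>n. c n - d n) x = fser c x - fser d x"
proof -
  let ?e = "\<lambda>n. cis (x \<bullet> lattice_vec n)"
  have "(\<lambda>n. c n * ?e n) summable_on UNIV" "(\<lambda>n. d n * ?e n) summable_on UNIV"
    using abs_summable_summable[OF fser_abs_summable[OF assms(1)]] abs_summable_summable[OF fser_abs_summable[OF assms(2)]]
    by blast+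
  then have "((\<lambda>n. c n * ?e n + - (d n * ?e n)) has_sum (fser c x + - fser d x)) UNIV"
    unfolding fser_def by (intro has_sum_add has_sum_infsum has_sum_uminus[THEN iffD2]) auto
  then show ?thesis unfolding fser_def[of "\<lambda>n. c n - d n"] by (intro infsumI) (simp add: algebra_simps)
qed

text \<open>Projections at radii with remainder below \<open>(1/2) ^ j\<close> are Cauchy at the
  rate required by \<open>L2_complete\<close>. The radii and the rate are part of the conclusion
  because Parseval's identity passes to the limit along the same projections.\<close>

lemma riesz_fischer:
  fixes x :: "'d::finite l2"
  obtains v R where "v \<in> L2" "fourier_coeff v = co x" "\<And>j. norm (x - proj (R j) x) < (1/2) ^ j"
    "\<And>j. L2_norm (\<lambda>y. trig (co (proj (R j) x)) y - v y) \<le> sqrt ((2 * pi) ^ CARD('d)) * (1/2) ^ j"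
proof -
  let ?s = "sqrt ((2 * pi) ^ CARD('d))"
  have s: "0 < ?s" by simp
  have "\<exists>R. norm (x - proj R x) < (1/2) ^ j" for j :: nat
  proof -
    have "\<forall>\<^sub>F R in at_top. dist (proj R x) x < (1/2) ^ j" by (rule tendstoD[OF proj_tendsto]) simp
    then obtain R where "dist (proj R x) x < (1/2) ^ j" by (auto simp: eventually_at_top_linorder)
    then show ?thesis by (intro exI[of _ R]) (simp add: dist_norm norm_minus_commute)
  qed
  then obtain R where R: "\<And>j. norm (x - proj (R j) x) < (1/2) ^ j" by metis
  have pp: "proj S (proj R x) = proj R x" if "R \<le> S" for R S
    by (rule l2_eqI) (use that in \<open>auto simp: co_proj\<close>)
  define f where "f j = trig (co (proj (R j) x))" for j
  have as: "co (proj (R j) x) abs_summable_on UNIV" for j by (rule co_abs_summable_proj[OF pp[OF order_refl]])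
  have fL: "f j \<in> L2" for j unfolding f_def by (rule trig_in_L2[OF as herm_co])
  have cauchy: "L2_norm (\<lambda>y. f i y - f j y) \<le> ?s * ((1/2) ^ i + (1/2) ^ j)" for i j
  proof -
    let ?z = "proj (R i) x - proj (R j) x"
    have ceq: "co ?z = (\<lambda>n. co (proj (R i) x) n - co (proj (R j) x) n)" by (rule ext) simp
    have "L2_norm (\<lambda>y. f i y - f j y) = L2_norm (trig (co ?z))"
      unfolding ceq by (rule arg_cong[where f=L2_norm], rule ext) (simp add: f_def trig_def fser_diff[OF as as])
    also have "L2_norm (trig (co ?z)) = ?s * norm ?z"
      by (rule L2_norm_trig_proj[where R="max (R i) (R j)"]) (simp add: proj_diff pp)
    also have "norm ?z \<le> (1/2) ^ i + (1/2) ^ j"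
      using norm_triangle_ineq4[of "x - proj (R j) x" "x - proj (R i) x"] R[of i] R[of j] by simp
    finally show ?thesis using s by simp
  qed
  obtain v where v: "v \<in> L2" "\<And>j. L2_norm (\<lambda>y. f j y - v y) \<le> ?s * (1/2) ^ j"
    using L2_complete[OF fL cauchy] by blast
  have "fourier_coeff v n = co x n" for n
  proof (rule LIMSEQ_unique)
    have half: "(\<lambda>j. (1/2 :: real) ^ j) \<longlonglongrightarrow> 0" by (rule LIMSEQ_realpow_zero) auto
    show "(\<lambda>j. co (proj (R j) x) n) \<longlonglongrightarrow> fourier_coeff v n"
    proof (rule LIM_zero_cancel, rule Lim_null_comparison[OF _ half], rule always_eventually, rule allI)
      fix j
      have d: "(\<lambda>y. f j y - v y) \<in> L2" by (rule L2_diff[OF fL v(1)])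
      have "co (proj (R j) x) n - fourier_coeff v n = co (emb (\<lambda>y. f j y - v y)) n"
        by (simp add: co_emb[OF d] fourier_coeff_diff[OF fL v(1)]) (simp add: f_def fourier_coeff_trig[OF as herm_co])
      also have "cmod \<dots> \<le> norm (emb (\<lambda>y. f j y - v y))" by (rule co_le_norm)
      also have "\<dots> \<le> (1/2) ^ j"
      proof -
        have "?s * norm (emb (\<lambda>y. f j y - v y)) \<le> ?s * (1/2) ^ j"
          using norm_emb_le[OF d] v(2)[of j] by linarith
        then show ?thesis using s by simp
      qed
      finally show "norm (co (proj (R j) x) n - fourier_coeff v n) \<le> (1/2) ^ j" .
    qed
    have "(\<lambda>j. proj (R j) x) \<longlonglongrightarrow> x"
    proof (rule LIM_zero_cancel, rule Lim_null_comparison[OF _ half], rule always_eventually, rule allI)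
      show "norm (proj (R j) x - x) \<le> (1/2) ^ j" for j using R[of j] by (simp add: norm_minus_commute)
    qed
    then show "(\<lambda>j. co (proj (R j) x) n) \<longlonglongrightarrow> co x n" by (rule tendsto_co)
  qed
  then have "fourier_coeff v = co x" by (rule ext)
  then show ?thesis by (rule that[OF v(1) _ R v(2)[unfolded f_def]])
qed

text \<open>The function \<open>v\<close> rebuilt from the coefficients of \<open>u\<close> equals
  \<open>u\<close> almost everywhere, so the truncated series of \<open>u\<close> converge to
  \<open>u\<close> in L2. Bessel's identity along them gives the claim in the limit.\<close>

theorem parseval:
  fixes u :: "real^'d \<Rightarrow> real"
  assumes u: "u \<in> L2"
  shows "L2_norm u = sqrt ((2 * pi) ^ CARD('d)) * norm (emb u)"
proof -
  let ?s = "sqrt ((2 * pi) ^ CARD('d))"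
  let ?x = "emb u"
  obtain v R where v: "v \<in> L2" "fourier_coeff v = co ?x" and R: "\<And>j. norm (?x - proj (R j) ?x) < (1/2) ^ j"
    and vR: "\<And>j. L2_norm (\<lambda>y. trig (co (proj (R j) ?x)) y - v y) \<le> ?s * (1/2) ^ j"
    by (rule riesz_fischer[of ?x]) blast
  have uv: "AE y in torus. u y = v y"
    using ae_eq_iff_fourier_coeff[OF u v(1)] v(2) co_emb[OF u] by (simp add: ae_eq_def)
  have half: "(\<lambda>j. (1/2 :: real) ^ j) \<longlonglongrightarrow> 0" by (rule LIMSEQ_realpow_zero) auto
  have p: "(\<lambda>j. proj (R j) ?x) \<longlonglongrightarrow> ?x"
  proof (rule LIM_zero_cancel, rule Lim_null_comparison[OF _ half], rule always_eventually, rule allI)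
    show "norm (proj (R j) ?x - ?x) \<le> (1/2) ^ j" for j using R[of j] by (simp add: norm_minus_commute)
  qed
  have eq: "(L2_norm (\<lambda>y. trig (co (proj (R j) ?x)) y - v y))\<^sup>2 = (L2_norm u)\<^sup>2 - (?s * norm (proj (R j) ?x))\<^sup>2" for j
  proof -
    let ?F = "{n :: int^'d. freq n \<le> R j}" and ?z = "proj (R j) ?x"
    have zz: "proj (R j) ?z = ?z" by (rule l2_eqI) (simp add: co_proj)
    note a = co_abs_summable_proj[OF zz]
    have ceq: "(\<lambda>n. if n \<in> ?F then fourier_coeff u n else 0) = co ?z"
      by (auto simp: co_proj co_emb[OF u])
    have 1: "(L2_norm (\<lambda>y. u y - trig (co ?z) y))\<^sup>2 = (L2_norm u)\<^sup>2 - (2 * pi) ^ CARD('d) * (\<Sum>n\<in>?F. (cmod (fourier_coeff u n))\<^sup>2)"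
      using L2_norm_diff_trig(3)[OF u finite_freq_le[of "R j"]] unfolding ceq by simp
    have ceq2: "(\<lambda>n. if n \<in> ?F then fourier_coeff (trig (co ?z)) n else 0) = co ?z"
      by (auto simp: fourier_coeff_trig[OF a herm_co] co_proj)
    have "(L2_norm (\<lambda>y. trig (co ?z) y - trig (co ?z) y))\<^sup>2 = (L2_norm (trig (co ?z)))\<^sup>2 -
        (2 * pi) ^ CARD('d) * (\<Sum>n\<in>?F. (cmod (fourier_coeff (trig (co ?z)) n))\<^sup>2)"
      using L2_norm_diff_trig(3)[OF trig_in_L2[OF a herm_co] finite_freq_le[of "R j"]] unfolding ceq2 by simp
    also have "(\<Sum>n\<in>?F. (cmod (fourier_coeff (trig (co ?z)) n))\<^sup>2) = (\<Sum>n\<in>?F. (cmod (fourier_coeff u n))\<^sup>2)"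
      by (intro sum.cong refl) (simp add: fourier_coeff_trig[OF a herm_co] co_proj co_emb[OF u])
    finally have 2: "(2 * pi) ^ CARD('d) * (\<Sum>n\<in>?F. (cmod (fourier_coeff u n))\<^sup>2) = (?s * norm ?z)\<^sup>2"
      by (simp add: L2_norm_trig_proj[OF zz]) (simp add: L2_norm_def)
    have "L2_norm (\<lambda>y. trig (co ?z) y - v y) = L2_norm (\<lambda>y. u y - trig (co ?z) y)"
    proof -
      have t: "trig (co ?z) \<in> L2" by (rule trig_in_L2[OF a herm_co])
      have "(\<integral>y. (trig (co ?z) y - v y)\<^sup>2 \<partial>torus) = (\<integral>y. (u y - trig (co ?z) y)\<^sup>2 \<partial>torus)"
      proof (rule integral_cong_AE)
        show "(\<lambda>y. (trig (co ?z) y - v y)\<^sup>2) \<in> borel_measurable torus" "(\<lambda>y. (u y - trig (co ?z) y)\<^sup>2) \<in> borel_measurable torus"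
          using L2_D(2)[OF t] L2_D(2)[OF u] L2_D(2)[OF v(1)] by measurable
        show "AE y in torus. (trig (co ?z) y - v y)\<^sup>2 = (u y - trig (co ?z) y)\<^sup>2"
          using uv by eventually_elim (simp add: power2_commute)
      qed
      then show ?thesis by (simp add: L2_norm_def)
    qed
    then show ?thesis using 1 2 by simp
  qed
  have "(\<lambda>j. (L2_norm (\<lambda>y. trig (co (proj (R j) ?x)) y - v y))\<^sup>2) \<longlonglongrightarrow> 0\<^sup>2"
  proof (rule tendsto_power, rule Lim_null_comparison)
    show "\<forall>\<^sub>F j in sequentially. norm (L2_norm (\<lambda>y. trig (co (proj (R j) ?x)) y - v y)) \<le> ?s * (1/2) ^ j"
      using vR by (simp add: L2_norm_nonneg)
    show "(\<lambda>j. ?s * (1/2) ^ j) \<longlonglongrightarrow> 0" using tendsto_mult_left[OF half, of ?s] by simp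
  qed
  then have A: "(\<lambda>j. (L2_norm u)\<^sup>2 - (?s * norm (proj (R j) ?x))\<^sup>2) \<longlonglongrightarrow> 0\<^sup>2" unfolding eq .
  have "(\<lambda>j. (L2_norm u)\<^sup>2 - (?s * norm (proj (R j) ?x))\<^sup>2) \<longlonglongrightarrow> (L2_norm u)\<^sup>2 - (?s * norm ?x)\<^sup>2"
    by (intro tendsto_intros p)
  from LIMSEQ_unique[OF this A] have "(L2_norm u)\<^sup>2 - (?s * norm ?x)\<^sup>2 = 0" by simp
  then have "(L2_norm u)\<^sup>2 = (?s * norm ?x)\<^sup>2" by simp
  then show ?thesis by (rule power2_eq_imp_eq) (simp_all add: L2_norm_nonneg)
qed

section \<open>Duhamel's formula\<close>

definition sg :: "real \<Rightarrow> 'd::finite l2 \<Rightarrow> 'd l2" where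
  "sg t = mul (\<lambda>n. exp (lam n * t))"

text \<open>The mild solution with source \<Delta>f and zero initial value. It is given by
  coefficients because \<Delta>f need not lie in the space; that the result does is the content of
  \<open>norm_duh_le\<close>.\<close>

definition duh :: "(real \<Rightarrow> 'd::finite l2) \<Rightarrow> real \<Rightarrow> 'd l2" where
  "duh f t = mkl2 (\<lambda>n. - (exp (lam n * t) *\<^sub>R
     integral {0..t} (\<lambda>s. (exp (- lam n * s) * (freq n)\<^sup>2) *\<^sub>R co (f s) n)))"

lemma co_sg: "0 \<le> t \<Longrightarrow> co (sg t x) n = of_real (exp (lam n * t)) * co x n"
  and norm_sg_le: "0 \<le> t \<Longrightarrow> norm (sg t x) \<le> norm x"
proof -
  assume t: "0 \<le> t"
  have b: "\<bar>exp (lam n * t)\<bar> \<le> 1" for n :: "int^'a"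
    using t lam_nonpos[of n] by (simp add: mult_nonpos_nonneg)
  show "co (sg t x) n = of_real (exp (lam n * t)) * co x n"
    unfolding sg_def by (rule co_mul[OF _ b]) simp
  show "norm (sg t x) \<le> norm x"
    using norm_mul_le[of "\<lambda>n. exp (lam n * t)", OF _ b, of x] by (simp add: sg_def)
qed

lemma sg_0 [simp]: "sg 0 x = x"
  by (rule l2_eqI) (simp add: co_sg)

lemma continuous_on_sg: "continuous_on {0..} (\<lambda>t. sg t x)"
  unfolding continuous_on_def
proof
  fix t :: real assume t: "t \<in> {0..}"
  show "((\<lambda>t. sg t x) \<longlongrightarrow> sg t x) (at t within {0..})"
  proof (rule l2_tendsto_dominated[where b="\<lambda>n. cmod (co x n)"])
    have le: "cmod (co (sg s x) n) \<le> cmod (co x n)" if "0 \<le> s" for s n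
    proof -
      have "exp (lam n * s) \<le> 1" using that lam_nonpos[of n] by (simp add: mult_nonpos_nonneg)
      then show ?thesis using that by (simp add: co_sg norm_mult mult_left_le_one_le)
    qed
    show "cmod (co (sg t x) n) \<le> cmod (co x n)" for n using t by (intro le) simp
    have ev: "\<forall>\<^sub>F s in at t within {0..}. 0 \<le> s" by (simp add: eventually_at_filter)
    then show "\<forall>\<^sub>F s in at t within {0..}. \<forall>n. cmod (co (sg s x) n) \<le> cmod (co x n)"
      by eventually_elim (auto intro: le)
    fix n
    have "((\<lambda>s. of_real (exp (lam n * s)) * co x n) \<longlongrightarrow> of_real (exp (lam n * t)) * co x n) (at t within {0..})"
      by (intro tendsto_intros)
    moreover have "\<forall>\<^sub>F s in at t within {0..}. of_real (exp (lam n * s)) * co x n = co (sg s x) n"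
      using ev by eventually_elim (simp add: co_sg)
    ultimately show "((\<lambda>s. co (sg s x) n) \<longlongrightarrow> co (sg t x) n) (at t within {0..})"
      using t Lim_transform_eventually by (fastforce simp: co_sg)
  qed (rule co_summable)
qed

section \<open>Scalar equations and their energy bounds\<close>

lemma norm_power2_has_derivative:
  fixes y :: "real \<Rightarrow> complex"
  assumes "(y has_vector_derivative y') (at t within S)"
  shows "((\<lambda>t. (cmod (y t))\<^sup>2) has_real_derivative 2 * (y t \<bullet> y')) (at t within S)"
proof -
  have "((\<lambda>t. y t \<bullet> y t) has_derivative (\<lambda>h. y t \<bullet> (h *\<^sub>R y') + (h *\<^sub>R y') \<bullet> y t)) (at t within S)"
    using assms unfolding has_vector_derivative_def by (intro has_derivative_inner)
  moreover have "(\<lambda>h. y t \<bullet> (h *\<^sub>R y') + (h *\<^sub>R y') \<bullet> y t) = (*) (2 * (y t \<bullet> y'))"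
    by (rule ext) (simp add: inner_commute)
  ultimately show ?thesis by (simp only: has_field_derivative_def power2_norm_eq_inner)
qed

lemma increment_le_integral:
  fixes \<phi> :: "real \<Rightarrow> real"
  assumes d: "\<And>s. s \<in> {0..T} \<Longrightarrow> (\<phi> has_real_derivative \<phi>' s) (at s within {0..T})"
    and le: "\<And>s. s \<in> {0..T} \<Longrightarrow> \<phi>' s \<le> h s" and h: "continuous_on {0..T} h" and t: "t \<in> {0..T}"
  shows "\<phi> t \<le> \<phi> 0 + integral {0..t} h"
proof -
  have sub: "{0..t} \<subseteq> {0..T}" using t by auto
  have "(\<phi>' has_integral \<phi> t - \<phi> 0) {0..t}"
  proof (rule fundamental_theorem_of_calculus)
    show "(\<phi> has_vector_derivative \<phi>' s) (at s within {0..t})" if "s \<in> {0..t}" for s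
      unfolding has_real_derivative_iff_has_vector_derivative[symmetric]
      by (rule DERIV_subset[OF d sub]) (use sub that in auto)
  qed (use t in auto)
  moreover have "(h has_integral integral {0..t} h) {0..t}"
    by (intro integrable_integral integrable_continuous_interval continuous_on_subset[OF h sub])
  ultimately have "\<phi> t - \<phi> 0 \<le> integral {0..t} h" by (rule has_integral_le) (use sub le in auto)
  then show ?thesis by simp
qed

text \<open>Half of the dissipation \<open>(freq n) ^ 4\<close> absorbs the two derivatives of the source.\<close>

lemma dissipation_le:
  fixes y f :: complex
  shows "2 * (y \<bullet> (lam n *\<^sub>R y - (freq n)\<^sup>2 *\<^sub>R f)) \<le> (cmod y)\<^sup>2 + (cmod f)\<^sup>2"
proof -
  define q where "q = (freq n)\<^sup>2"
  have l: "lam n = q - q\<^sup>2" by (simp add: lam_def q_def)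
  have "0 \<le> q" by (simp add: q_def)
  have "2 * (y \<bullet> (lam n *\<^sub>R y - (freq n)\<^sup>2 *\<^sub>R f)) = 2 * (q - q\<^sup>2) * (cmod y)\<^sup>2 - 2 * (q * (y \<bullet> f))"
    by (simp add: inner_diff_right l q_def[symmetric] power2_norm_eq_inner algebra_simps)
  also have "\<dots> \<le> 2 * (q - q\<^sup>2) * (cmod y)\<^sup>2 + 2 * (q * (cmod y * cmod f))"
    using mult_left_mono[OF Cauchy_Schwarz_ineq2[of y f, THEN abs_le_D2] \<open>0 \<le> q\<close>] by linarith
  also have "\<dots> \<le> (cmod y)\<^sup>2 + (cmod f)\<^sup>2"
  proof -
    have "0 \<le> (q * cmod y - cmod f)\<^sup>2 + ((q - 1) * cmod y)\<^sup>2" by simp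
    then show ?thesis by (simp add: power2_eq_square algebra_simps)
  qed
  finally show ?thesis .
qed

lemma duhamel_coefficient:
  fixes f :: "real \<Rightarrow> complex" and l q :: real
  assumes f: "continuous_on {0..T} f" and t: "t \<in> {0..T}"
  defines "y \<equiv> (\<lambda>t. - (exp (l * t) *\<^sub>R integral {0..t} (\<lambda>s. (exp (- l * s) * q) *\<^sub>R f s)))"
  shows "(y has_vector_derivative l *\<^sub>R y t - q *\<^sub>R f t) (at t within {0..T})"
proof -
  let ?g = "\<lambda>s. (exp (- l * s) * q) *\<^sub>R f s"
  have "continuous_on {0..T} ?g" by (intro continuous_intros f)
  then have "((\<lambda>t. integral {0..t} ?g) has_vector_derivative ?g t) (at t within {0..T})"
    by (rule integral_has_vector_derivative) (use t in auto)
  moreover have "((\<lambda>t. exp (l * t)) has_real_derivative l * exp (l * t)) (at t within {0..T})"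
    by (auto intro!: derivative_eq_intros)
  ultimately have "(y has_vector_derivative
      - (exp (l * t) *\<^sub>R ?g t + (l * exp (l * t)) *\<^sub>R integral {0..t} ?g)) (at t within {0..T})"
    unfolding y_def by (intro has_vector_derivative_minus has_vector_derivative_scaleR)
  moreover have "- (exp (l * t) *\<^sub>R ?g t + (l * exp (l * t)) *\<^sub>R integral {0..t} ?g) = l *\<^sub>R y t - q *\<^sub>R f t"
  proof -
    have "exp (l * t) *\<^sub>R ?g t = q *\<^sub>R f t"
      by (simp add: exp_add[symmetric] mult.assoc[symmetric] exp_minus)
    moreover have "- (A + (l * e) *\<^sub>R I) = l *\<^sub>R - (e *\<^sub>R I) - A" for A I :: complex and e
      by simp
    ultimately show ?thesis unfolding y_def by (simp only:)
  qed
  ultimately show ?thesis by (simp only:)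
qed

text \<open>Energy estimate with the integrating factor \<open>exp (- t)\<close>. The constant does
  not depend on \<open>n\<close>, so the bounds can be summed over frequencies.\<close>

lemma ode_coefficient_bound:
  fixes y f :: "real \<Rightarrow> complex"
  assumes y: "\<And>t. t \<in> {0..T} \<Longrightarrow> (y has_vector_derivative lam n *\<^sub>R y t - (freq n)\<^sup>2 *\<^sub>R f t) (at t within {0..T})"
    and f: "continuous_on {0..T} f" and y0: "y 0 = 0" and t: "t \<in> {0..T}"
  shows "(cmod (y t))\<^sup>2 \<le> exp T * integral {0..t} (\<lambda>s. (cmod (f s))\<^sup>2)"
proof -
  let ?F = "\<lambda>s. (cmod (f s))\<^sup>2" and ?y' = "\<lambda>s. lam n *\<^sub>R y s - (freq n)\<^sup>2 *\<^sub>R f s"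
  have Fc: "continuous_on {0..T} ?F" by (intro continuous_intros f)
  have "exp (- t) * (cmod (y t))\<^sup>2 \<le> exp (- 0) * (cmod (y 0))\<^sup>2 + integral {0..t} ?F"
  proof (rule increment_le_integral[OF _ _ Fc t])
    fix s assume s: "s \<in> {0..T}"
    show "((\<lambda>t. exp (- t) * (cmod (y t))\<^sup>2) has_real_derivative
        exp (- s) * (2 * (y s \<bullet> ?y' s) - (cmod (y s))\<^sup>2)) (at s within {0..T})"
    proof -
      have "((\<lambda>t. exp (- t)) has_real_derivative - exp (- s)) (at s within {0..T})"
        by (auto intro!: derivative_eq_intros)
      from DERIV_mult'[OF this norm_power2_has_derivative[OF y[OF s]]] show ?thesis
        by (rule DERIV_cong) (simp add: algebra_simps)
    qed
    have "exp (- s) * (2 * (y s \<bullet> ?y' s) - (cmod (y s))\<^sup>2) \<le> exp (- s) * ?F s"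
      using dissipation_le[of "y s" n "f s"] by (intro mult_left_mono) auto
    also have "\<dots> \<le> 1 * ?F s" using s by (intro mult_right_mono) auto
    finally show "exp (- s) * (2 * (y s \<bullet> ?y' s) - (cmod (y s))\<^sup>2) \<le> ?F s" by simp
  qed
  then have "exp (- t) * (cmod (y t))\<^sup>2 \<le> integral {0..t} ?F" by (simp add: y0)
  then have "exp t * (exp (- t) * (cmod (y t))\<^sup>2) \<le> exp t * integral {0..t} ?F" by (intro mult_left_mono) auto
  also have "exp t * (exp (- t) * (cmod (y t))\<^sup>2) = (cmod (y t))\<^sup>2"
    by (simp add: mult.assoc[symmetric] exp_add[symmetric])
  also have "exp t * integral {0..t} ?F \<le> exp T * integral {0..t} ?F"
    using t by (intro mult_right_mono integral_nonneg integrable_continuous_interval continuous_on_subset[OF Fc]) auto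
  finally show ?thesis .
qed

lemma
  fixes f :: "real \<Rightarrow> 'd::finite l2"
  assumes f: "continuous_on {0..T} f" and t: "t \<in> {0..T}"
  shows co_duh: "co (duh f t) n = - (exp (lam n * t) *\<^sub>R
      integral {0..t} (\<lambda>s. (exp (- lam n * s) * (freq n)\<^sup>2) *\<^sub>R co (f s) n))"
    and norm_duh_le: "(norm (duh f t))\<^sup>2 \<le> exp T * integral {0..t} (\<lambda>s. (norm (f s))\<^sup>2)"
proof -
  let ?c = "\<lambda>t n. - (exp (lam n * t) *\<^sub>R
      integral {0..t} (\<lambda>s. (exp (- lam n * s) * (freq n)\<^sup>2) *\<^sub>R co (f s) n))"
  let ?B = "exp T * integral {0..t} (\<lambda>s. (norm (f s))\<^sup>2)"
  have sub: "{0..t} \<subseteq> {0..T}" using t by auto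
  have fc: "continuous_on {0..T} (\<lambda>s. co (f s) n)" for n by (rule continuous_on_co[OF f])
  have bound: "(\<Sum>n\<in>F. (cmod (?c t n))\<^sup>2) \<le> ?B" if F: "finite F" for F
  proof -
    have "(\<Sum>n\<in>F. (cmod (?c t n))\<^sup>2) \<le> (\<Sum>n\<in>F. exp T * integral {0..t} (\<lambda>s. (cmod (co (f s) n))\<^sup>2))"
      by (intro sum_mono ode_coefficient_bound[OF duhamel_coefficient[OF fc] fc _ t]) auto
    also have "\<dots> = exp T * integral {0..t} (\<lambda>s. \<Sum>n\<in>F. (cmod (co (f s) n))\<^sup>2)"
      by (subst integral_sum)
        (auto simp: sum_distrib_left F intro!: integrable_continuous_interval continuous_intros continuous_on_subset[OF fc sub])
    also have "\<dots> \<le> ?B"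
      by (intro mult_left_mono integral_le integrable_continuous_interval continuous_intros
          continuous_on_subset[OF fc sub] continuous_on_subset[OF f sub] co_sum_le_norm) auto
    finally show ?thesis .
  qed
  have "herm (?c t)" unfolding herm_def
  proof
    fix n
    have "integral {0..t} (\<lambda>s. (exp (- lam n * s) * (freq n)\<^sup>2) *\<^sub>R cnj (co (f s) n)) =
        integral {0..t} (cnj \<circ> (\<lambda>s. (exp (- lam n * s) * (freq n)\<^sup>2) *\<^sub>R co (f s) n))"
      by (intro integral_cong) (simp add: scaleR_conv_of_real)
    also have "\<dots> = cnj (integral {0..t} (\<lambda>s. (exp (- lam n * s) * (freq n)\<^sup>2) *\<^sub>R co (f s) n))"
      by (intro integral_linear bounded_linear_cnj integrable_continuous_interval continuous_intros continuous_on_subset[OF fc sub])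
    finally show "?c t (- n) = cnj (?c t n)" by (simp add: co_uminus_index scaleR_conv_of_real)
  qed
  then have "co (duh f t) = ?c t" unfolding duh_def by (rule co_mkl2_bound[OF _ bound])
  then show c: "co (duh f t) n = ?c t n" for n by simp
  have "norm (duh f t) \<le> sqrt ?B"
  proof (rule l2_norm_leI)
    show "L2_set (\<lambda>n. cmod (co (duh f t) n)) F \<le> sqrt ?B" if "finite F" for F
      unfolding L2_set_def c by (rule real_sqrt_le_mono[OF bound[OF that]])
  qed (auto intro!: mult_nonneg_nonneg integral_nonneg
        integrable_continuous_interval continuous_intros continuous_on_subset[OF f sub])
  from power_mono[OF this norm_ge_zero, of 2] show "(norm (duh f t))\<^sup>2 \<le> ?B"
    by (subst (asm) real_sqrt_pow2)
      (auto intro!: mult_nonneg_nonneg integral_nonneg integrable_continuous_interval continuous_intros continuous_on_subset[OF f sub])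
qed

lemma duh_has_vector_derivative:
  assumes f: "continuous_on {0..T} f" and t: "t \<in> {0..T}"
  shows "((\<lambda>t. co (duh f t) n) has_vector_derivative lam n *\<^sub>R co (duh f t) n - (freq n)\<^sup>2 *\<^sub>R co (f t) n) (at t within {0..T})"
proof -
  have "((\<lambda>t. co (duh f t) n) has_vector_derivative lam n *\<^sub>R - (exp (lam n * t) *\<^sub>R
      integral {0..t} (\<lambda>s. (exp (- lam n * s) * (freq n)\<^sup>2) *\<^sub>R co (f s) n)) - (freq n)\<^sup>2 *\<^sub>R co (f t) n) (at t within {0..T})"
    by (rule has_vector_derivative_transform[OF t _ duhamel_coefficient[OF continuous_on_co[OF f] t]])
      (rule co_duh[OF f])
  then show ?thesis by (simp only: co_duh[OF f t])
qed

lemma sg_has_vector_derivative: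
  assumes t: "t \<in> {0..T}"
  shows "((\<lambda>t. co (sg t x) n) has_vector_derivative lam n *\<^sub>R co (sg t x) n) (at t within {0..T})"
proof -
  have "((\<lambda>t. exp (lam n * t)) has_real_derivative lam n * exp (lam n * t)) (at t within {0..T})"
    by (auto intro!: derivative_eq_intros)
  then have "((\<lambda>t. exp (lam n * t) *\<^sub>R co x n) has_vector_derivative (lam n * exp (lam n * t)) *\<^sub>R co x n) (at t within {0..T})"
    by (auto intro!: derivative_eq_intros)
  then have "((\<lambda>t. co (sg t x) n) has_vector_derivative (lam n * exp (lam n * t)) *\<^sub>R co x n) (at t within {0..T})"
    by (rule has_vector_derivative_transform[OF t, rotated]) (simp add: co_sg scaleR_conv_of_real)
  moreover have "(lam n * exp (lam n * t)) *\<^sub>R co x n = lam n *\<^sub>R co (sg t x) n"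
    using t by (simp add: co_sg scaleR_conv_of_real mult.assoc)
  ultimately show ?thesis by (simp only:)
qed

lemma duh_0 [simp]: "duh f 0 = 0"
  by (simp add: duh_def zero_l2_def)

lemma duh_diff:
  assumes f: "continuous_on {0..T} f" "continuous_on {0..T} g" and t: "t \<in> {0..T}"
  shows "duh f t - duh g t = duh (\<lambda>s. f s - g s) t"
proof (rule l2_eqI)
  fix n
  have sub: "{0..t} \<subseteq> {0..T}" using t by auto
  have "integral {0..t} (\<lambda>s. (exp (- lam n * s) * (freq n)\<^sup>2) *\<^sub>R co (f s - g s) n) =
      integral {0..t} (\<lambda>s. (exp (- lam n * s) * (freq n)\<^sup>2) *\<^sub>R co (f s) n - (exp (- lam n * s) * (freq n)\<^sup>2) *\<^sub>R co (g s) n)"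
    by (simp add: scaleR_diff_right)
  also have "\<dots> = integral {0..t} (\<lambda>s. (exp (- lam n * s) * (freq n)\<^sup>2) *\<^sub>R co (f s) n) -
      integral {0..t} (\<lambda>s. (exp (- lam n * s) * (freq n)\<^sup>2) *\<^sub>R co (g s) n)"
    by (intro integral_diff integrable_continuous_interval continuous_intros
        continuous_on_subset[OF continuous_on_co[OF f(1)] sub] continuous_on_subset[OF continuous_on_co[OF f(2)] sub])
  finally show "co (duh f t - duh g t) n = co (duh (\<lambda>s. f s - g s) t) n"
    using co_duh[OF continuous_on_diff[OF f] t, of n] by (simp add: co_duh[OF f(1) t] co_duh[OF f(2) t] scaleR_diff_right)
qed

section \<open>Continuity in time\<close>

lemma continuous_on_finite_modes:
  fixes g :: "'a::metric_space \<Rightarrow> 'd::finite l2"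
  assumes "\<And>n. continuous_on S (\<lambda>t. co (g t) n)" and F: "finite F" "\<And>t n. t \<in> S \<Longrightarrow> n \<notin> F \<Longrightarrow> co (g t) n = 0"
  shows "continuous_on S g"
  unfolding continuous_on_def
proof
  fix t assume t: "t \<in> S"
  have "((\<lambda>s. \<Sum>n\<in>F. cmod (co (g s) n - co (g t) n)) \<longlongrightarrow> (\<Sum>n\<in>F. cmod (co (g t) n - co (g t) n))) (at t within S)"
    using assms(1) t by (intro tendsto_intros) (auto simp: continuous_on_def)
  then have "((\<lambda>s. \<Sum>n\<in>F. cmod (co (g s) n - co (g t) n)) \<longlongrightarrow> 0) (at t within S)" by simp
  moreover have "\<forall>\<^sub>F s in at t within S. norm (g s - g t) \<le> (\<Sum>n\<in>F. cmod (co (g s) n - co (g t) n))"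
    unfolding eventually_at_filter
  proof (intro always_eventually allI impI)
    fix s assume s: "s \<in> S"
    show "norm (g s - g t) \<le> (\<Sum>n\<in>F. cmod (co (g s) n - co (g t) n))"
    proof (rule l2_norm_leI)
      fix G :: "(int^'d) set" assume G: "finite G"
      let ?z = "\<lambda>n. cmod (co (g s - g t) n)"
      have "(\<Sum>n\<in>G. (?z n)\<^sup>2) = (\<Sum>n\<in>G \<inter> F. (?z n)\<^sup>2)"
        using G F(2)[OF s] F(2)[OF t] by (intro sum.mono_neutral_right) auto
      also have "\<dots> \<le> (\<Sum>n\<in>F. (?z n)\<^sup>2)" by (intro sum_mono2 F) auto
      finally have "L2_set ?z G \<le> L2_set ?z F" by (simp add: L2_set_def)
      also have "\<dots> \<le> (\<Sum>n\<in>F. ?z n)" by (rule L2_set_le_sum) simp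
      finally show "L2_set ?z G \<le> (\<Sum>n\<in>F. cmod (co (g s) n - co (g t) n))" by simp
    qed (simp add: sum_nonneg)
  qed
  ultimately have "((\<lambda>s. g s - g t) \<longlongrightarrow> 0) (at t within S)" by (rule Lim_null_comparison[rotated])
  then show "(g \<longlongrightarrow> g t) (at t within S)" by (rule LIM_zero_cancel)
qed

lemma bounded_linear_proj: "bounded_linear (proj R)"
  by (rule bounded_linear_intro[of _ 1]) (auto intro!: l2_eqI simp: co_proj norm_proj_le)

text \<open>Each projection of \<open>duh f\<close> involves finitely many modes and is continuous.
  The projections converge uniformly, since \<open>f\<close> has compact image and
  \<open>norm_duh_le\<close> carries its uniform approximation over to \<open>duh f\<close>.\<close>

lemma continuous_on_duh:
  fixes f :: "real \<Rightarrow> 'd::finite l2"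
  assumes f: "continuous_on {0..T} f"
  shows "continuous_on {0..T} (duh f)"
proof (cases "0 \<le> T")
  case True
  have pf: "continuous_on {0..T} (\<lambda>s. proj R (f s))" for R
    by (rule bounded_linear.continuous_on[OF bounded_linear_proj f])
  have "continuous_on {0..T} (\<lambda>t. proj (real j) (duh f t))" for j
  proof (rule continuous_on_finite_modes)
    have "continuous_on {0..T} (\<lambda>t. co (duh f t) n)" for n
      unfolding continuous_on_eq_continuous_within
      using has_vector_derivative_continuous[OF duh_has_vector_derivative[OF f]] by blast
    then show "continuous_on {0..T} (\<lambda>t. co (proj (real j) (duh f t)) n)" for n
      by (cases "freq n \<le> real j") (simp_all add: co_proj)
    show "finite {n :: int^'d. freq n \<le> real j}" by (rule finite_freq_le)
  qed (simp add: co_proj)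
  moreover have "uniform_limit {0..T} (\<lambda>j t. proj (real j) (duh f t)) (duh f) sequentially"
  proof (rule uniform_limitI)
    fix e :: real assume e: "0 < e"
    \<comment> \<open>Chosen so that \<open>exp T * (T + 1) * r^2\<close> equals
      \<open>(e / 2)^2\<close>; the summand 1 keeps the denominator positive at
      \<open>T = 0\<close>.\<close>
    define r where "r = e / (2 * sqrt (exp T * (T + 1)))"
    have q: "0 < exp T * (T + 1)" using True by simp
    have r: "0 < r" using e q by (simp add: r_def)
    have "compact (f ` {0..T})" by (intro compact_continuous_image f) simp
    from proj_uniform_on_compact[OF this r]
    obtain R0 where "\<forall>R\<ge>R0. \<forall>x\<in>f ` {0..T}. norm (x - proj R x) < r" by (rule exE)
    then have R0: "norm (f s - proj R (f s)) < r" if "R0 \<le> R" "s \<in> {0..T}" for R s using that by blast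
    have "dist (proj (real j) (duh f t)) (duh f t) < e" if j: "R0 \<le> real j" and t: "t \<in> {0..T}" for j t
    proof -
      have eq: "proj (real j) (duh f t) = duh (\<lambda>s. proj (real j) (f s)) t"
        by (rule l2_eqI) (simp add: co_proj co_duh[OF f t] co_duh[OF pf t])
      have "(norm (duh f t - proj (real j) (duh f t)))\<^sup>2 \<le> exp T * integral {0..t} (\<lambda>s. (norm (f s - proj (real j) (f s)))\<^sup>2)"
        unfolding eq duh_diff[OF f pf t] by (rule norm_duh_le[OF continuous_on_diff[OF f pf] t])
      also have "integral {0..t} (\<lambda>s. (norm (f s - proj (real j) (f s)))\<^sup>2) \<le> integral {0..t} (\<lambda>s. r\<^sup>2)"
        using t R0[OF j] by (intro integral_le integrable_continuous_interval continuous_intros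
            continuous_on_subset[OF f] continuous_on_subset[OF pf] power_mono) (auto intro: less_imp_le)
      also have "\<dots> = t * r\<^sup>2" using t by simp
      also have "\<dots> \<le> (T + 1) * r\<^sup>2" using t by (intro mult_right_mono) auto
      finally have "(norm (duh f t - proj (real j) (duh f t)))\<^sup>2 \<le> exp T * (T + 1) * r\<^sup>2"
        by (simp add: mult.assoc)
      also have "\<dots> = (e / 2)\<^sup>2"
      proof -
        have "Q * (e / (2 * sqrt Q))\<^sup>2 = (e / 2)\<^sup>2" if "0 < Q" for Q
          using that by (simp add: power_divide power_mult_distrib)
        from this[OF q] show ?thesis by (simp only: r_def)
      qed
      finally have "norm (duh f t - proj (real j) (duh f t)) \<le> e / 2"
        by (rule power2_le_imp_le) (use e in simp)
      then show ?thesis using e by (simp add: dist_norm norm_minus_commute)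
    qed
    moreover have "\<forall>\<^sub>F j in sequentially. R0 \<le> real j"
      using eventually_ge_at_top[of "nat \<lceil>R0\<rceil>"] by eventually_elim linarith
    ultimately show "\<forall>\<^sub>F j in sequentially. \<forall>t\<in>{0..T}. dist (proj (real j) (duh f t)) (duh f t) < e"
      by (auto elim: eventually_mono)
  qed
  ultimately show ?thesis by (intro uniform_limit_theorem[where F=sequentially]) auto
qed simp

section \<open>Gronwall's inequality and the fixed point\<close>

lemma gronwall:
  fixes y :: "real \<Rightarrow> real"
  assumes y: "continuous_on {0..T} y" and le: "\<And>t. t \<in> {0..T} \<Longrightarrow> y t \<le> a + c * integral {0..t} y"
    and c: "0 \<le> c" and a: "0 \<le> a" and t: "t \<in> {0..T}"
  shows "y t \<le> a * (1 + c * T * exp (c * T))"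
proof -
  let ?Y = "\<lambda>t. integral {0..t} y"
  have "exp (- c * t) * ?Y t \<le> exp (- c * 0) * ?Y 0 + integral {0..t} (\<lambda>s. a)"
  proof (rule increment_le_integral[OF _ _ _ t])
    fix s assume s: "s \<in> {0..T}"
    have "(?Y has_real_derivative y s) (at s within {0..T})"
      unfolding has_real_derivative_iff_has_vector_derivative by (rule integral_has_vector_derivative[OF y s])
    then show "((\<lambda>t. exp (- c * t) * ?Y t) has_real_derivative exp (- c * s) * (y s - c * ?Y s)) (at s within {0..T})"
      by (auto intro!: derivative_eq_intros simp: algebra_simps)
    have "exp (- c * s) * (y s - c * ?Y s) \<le> exp (- c * s) * a" using le[OF s] by (intro mult_left_mono) auto
    also have "\<dots> \<le> 1 * a" using s c a by (intro mult_right_mono) auto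
    finally show "exp (- c * s) * (y s - c * ?Y s) \<le> a" by simp
  qed simp
  then have "exp (c * t) * (exp (- c * t) * ?Y t) \<le> exp (c * t) * (a * t)" using t by (intro mult_left_mono) (auto simp: mult.commute)
  then have "?Y t \<le> exp (c * t) * (a * t)" by (simp add: mult.assoc[symmetric] exp_add[symmetric])
  also have "\<dots> \<le> exp (c * T) * (a * T)" using t a c by (intro mult_mono) (auto simp: mult_left_mono)
  finally have "c * ?Y t \<le> c * (exp (c * T) * (a * T))" by (rule mult_left_mono[OF _ c])
  then show ?thesis using le[OF t] by (simp add: algebra_simps)
qed

text \<open>A contraction in a weighted supremum norm.\<close>

lemma duhamel_fixed_point:
  fixes G :: "real \<Rightarrow> 'd::finite l2 \<Rightarrow> 'd l2"
  assumes T: "0 \<le> T" and G: "\<And>z. continuous_on {0..T} z \<Longrightarrow> continuous_on {0..T} (\<lambda>t. G t (z t))"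
    and lip: "\<And>t x y. t \<in> {0..T} \<Longrightarrow> norm (G t x - G t y) \<le> L * norm (x - y)"
  obtains z where "continuous_on {0..T} z" "\<And>t. t \<in> {0..T} \<Longrightarrow> z t = sg t z0 + duh (\<lambda>s. G s (z s)) t"
proof -
  have L: "0 \<le> L \<or> (\<forall>x y :: 'd l2. x = y)"
    using lip[of 0] T by (smt (verit) atLeastAtMost_iff eq_iff_diff_eq_0 mult_neg_pos norm_eq_zero norm_ge_zero)
  \<comment> \<open>The rate of the exponential weight: the squared contraction factor
    \<open>exp T * L^2 / (2 * K)\<close> stays below \<open>(3/4)^2\<close>. The summand 1 keeps
    \<open>K\<close> positive when \<open>L = 0\<close>.\<close>
  define K where "K = 2 * exp T * L\<^sup>2 + 1"
  have K: "0 < K" by (simp add: K_def add_nonneg_pos)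
  \<comment> \<open>Clamping time to \<open>{0..T}\<close> turns curves on the interval into bounded
    continuous functions on the whole line, where Banach's theorem is applied.\<close>
  define cl where "cl t = max 0 (min T t)" for t
  have cl: "cl t \<in> {0..T}" "t \<in> {0..T} \<Longrightarrow> cl t = t" for t using T by (auto simp: cl_def)
  have clc: "continuous_on UNIV cl" unfolding cl_def by (intro continuous_intros)
  define D where "D w = duh (\<lambda>s. G s (exp (K * s) *\<^sub>R apply_bcontfun w s))" for w :: "real \<Rightarrow>\<^sub>C 'd l2"
  have wc: "continuous_on {0..T} (\<lambda>s. G s (exp (K * s) *\<^sub>R apply_bcontfun w s))" for w
    by (intro G continuous_intros) auto
  define P where "P w t = exp (- K * cl t) *\<^sub>R (sg (cl t) z0 + D w (cl t))" for w t
  have Pb: "P w \<in> bcontfun" for w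
  proof -
    have c: "continuous_on {0..T} (\<lambda>t. exp (- K * t) *\<^sub>R (sg t z0 + D w t))"
      unfolding D_def by (intro continuous_intros continuous_on_duh wc continuous_on_subset[OF continuous_on_sg]) auto
    have "continuous_on UNIV ((\<lambda>t. exp (- K * t) *\<^sub>R (sg t z0 + D w t)) \<circ> cl)"
      by (rule continuous_on_compose[OF clc continuous_on_subset[OF c]]) (use cl in auto)
    then have "continuous_on UNIV (P w)" by (simp add: P_def comp_def)
    moreover have "bounded (range (P w))"
    proof -
      have "bounded ((\<lambda>t. exp (- K * t) *\<^sub>R (sg t z0 + D w t)) ` {0..T})"
        by (intro compact_imp_bounded compact_continuous_image c) simp
      then show ?thesis by (rule bounded_subset) (use cl(1) in \<open>auto simp: P_def\<close>)
    qed
    ultimately show ?thesis by (simp add: bcontfun_def)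
  qed
  define \<Phi> where "\<Phi> w = Bcontfun (P w)" for w
  have \<Phi>: "apply_bcontfun (\<Phi> w) = P w" for w unfolding \<Phi>_def by (rule Bcontfun_inverse[OF Pb])
  have "\<exists>!w. \<Phi> w = w"
  proof (rule banach_fix_type[where c="3/4"], simp, simp, intro allI)
    fix w w' :: "real \<Rightarrow>\<^sub>C 'd l2"
    let ?d = "dist w w'"
    show "dist (\<Phi> w) (\<Phi> w') \<le> 3 / 4 * ?d"
    proof (rule dist_bound)
      fix t
      let ?\<tau> = "cl t" and ?f = "\<lambda>w s. G s (exp (K * s) *\<^sub>R apply_bcontfun w s)"
      have sub: "{0..?\<tau>} \<subseteq> {0..T}" using cl(1)[of t] by auto
      have Dd: "D w ?\<tau> - D w' ?\<tau> = duh (\<lambda>s. ?f w s - ?f w' s) ?\<tau>"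
        unfolding D_def by (rule duh_diff[OF wc wc cl(1)])
      have "(norm (D w ?\<tau> - D w' ?\<tau>))\<^sup>2 \<le> exp T * integral {0..?\<tau>} (\<lambda>s. (norm (?f w s - ?f w' s))\<^sup>2)"
        unfolding Dd by (rule norm_duh_le[OF continuous_on_diff[OF wc wc] cl(1)])
      also have "integral {0..?\<tau>} (\<lambda>s. (norm (?f w s - ?f w' s))\<^sup>2) \<le> integral {0..?\<tau>} (\<lambda>s. (L * ?d)\<^sup>2 * exp (2 * K * s))"
      proof (intro integral_le integrable_continuous_interval continuous_intros continuous_on_subset[OF wc sub])
        fix s assume s: "s \<in> {0..?\<tau>}"
        have "norm (?f w s - ?f w' s) \<le> L * norm (exp (K * s) *\<^sub>R apply_bcontfun w s - exp (K * s) *\<^sub>R apply_bcontfun w' s)"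
          using s sub by (intro lip) auto
        also have "\<dots> = L * (exp (K * s) * dist (apply_bcontfun w s) (apply_bcontfun w' s))"
          by (simp add: scaleR_diff_right[symmetric] dist_norm)
        also have "\<dots> \<le> \<bar>L\<bar> * (exp (K * s) * ?d)"
          by (intro mult_mono mult_left_mono dist_bounded) auto
        finally have "(norm (?f w s - ?f w' s))\<^sup>2 \<le> (\<bar>L\<bar> * (exp (K * s) * ?d))\<^sup>2" by (intro power_mono) auto
        also have "\<dots> = (L * ?d)\<^sup>2 * (exp (K * s) * exp (K * s))" by (simp add: power_mult_distrib power2_eq_square mult_ac)
        also have "exp (K * s) * exp (K * s) = exp (2 * K * s)" by (simp add: exp_add[symmetric])
        finally show "(norm (?f w s - ?f w' s))\<^sup>2 \<le> (L * ?d)\<^sup>2 * exp (2 * K * s)" .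
      qed
      also have "integral {0..?\<tau>} (\<lambda>s. (L * ?d)\<^sup>2 * exp (2 * K * s)) \<le> (L * ?d)\<^sup>2 * exp (2 * K * ?\<tau>) / (2 * K)"
      proof -
        have "((\<lambda>s. (L * ?d)\<^sup>2 * exp (2 * K * s)) has_integral
            (L * ?d)\<^sup>2 * exp (2 * K * ?\<tau>) / (2 * K) - (L * ?d)\<^sup>2 * exp (2 * K * 0) / (2 * K)) {0..?\<tau>}"
          by (rule fundamental_theorem_of_calculus)
            (use cl(1)[of t] K in \<open>auto intro!: derivative_eq_intros simp: has_real_derivative_iff_has_vector_derivative[symmetric]\<close>)
        then show ?thesis by (simp only: integral_unique) (use K in simp)
      qed
      finally have A: "(norm (D w ?\<tau> - D w' ?\<tau>))\<^sup>2 \<le> exp T * ((L * ?d)\<^sup>2 * exp (2 * K * ?\<tau>) / (2 * K))" by simp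
      have "P w t - P w' t = exp (- K * ?\<tau>) *\<^sub>R (D w ?\<tau> - D w' ?\<tau>)"
        by (simp add: P_def scaleR_diff_right[symmetric])
      then have "(norm (P w t - P w' t))\<^sup>2 = exp (- 2 * K * ?\<tau>) * (norm (D w ?\<tau> - D w' ?\<tau>))\<^sup>2"
        by (simp add: power_mult_distrib power2_eq_square exp_add[symmetric])
      also have "\<dots> \<le> exp (- 2 * K * ?\<tau>) * (exp T * ((L * ?d)\<^sup>2 * exp (2 * K * ?\<tau>) / (2 * K)))"
        by (intro mult_left_mono A) auto
      also have "\<dots> = (exp T * L\<^sup>2 / (2 * K)) * ?d\<^sup>2"
      proof -
        have "exp (- 2 * K * ?\<tau>) * exp (2 * K * ?\<tau>) = 1" by (simp add: exp_add[symmetric])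
        then show ?thesis by (simp add: power_mult_distrib mult_ac)
      qed
      also have "\<dots> \<le> (3/4)\<^sup>2 * ?d\<^sup>2"
      proof (rule mult_right_mono)
        have "exp T * L\<^sup>2 \<le> K" by (simp add: K_def add_increasing2)
        then show "exp T * L\<^sup>2 / (2 * K) \<le> (3/4)\<^sup>2" using K by (simp add: field_simps power2_eq_square)
      qed simp
      finally have "(norm (P w t - P w' t))\<^sup>2 \<le> (3 / 4 * ?d)\<^sup>2" by (simp only: power_mult_distrib)
      then have "norm (P w t - P w' t) \<le> 3 / 4 * ?d" by (rule power2_le_imp_le) simp
      then show "dist (apply_bcontfun (\<Phi> w) t) (apply_bcontfun (\<Phi> w') t) \<le> 3 / 4 * ?d" by (simp add: \<Phi> dist_norm)
    qed
  qed
  then obtain w where w: "\<Phi> w = w" by blast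
  define z where "z t = exp (K * t) *\<^sub>R apply_bcontfun w t" for t
  show ?thesis
  proof
    show "continuous_on {0..T} z" unfolding z_def by (intro continuous_intros) auto
    fix t assume t: "t \<in> {0..T}"
    have "apply_bcontfun w t = exp (- K * t) *\<^sub>R (sg t z0 + D w t)"
      using \<Phi>[of w] w cl(2)[OF t] by (simp add: P_def fun_eq_iff)
    then have "z t = sg t z0 + D w t" by (simp add: z_def exp_add[symmetric])
    then show "z t = sg t z0 + duh (\<lambda>s. G s (z s)) t" by (simp add: D_def z_def)
  qed
qed

lemma mild_has_vector_derivative:
  assumes f: "continuous_on {0..T} f" and z: "\<And>t. t \<in> {0..T} \<Longrightarrow> z t = sg t z0 + duh f t" and t: "t \<in> {0..T}"
  shows "((\<lambda>t. co (z t) n) has_vector_derivative lam n *\<^sub>R co (z t) n - (freq n)\<^sup>2 *\<^sub>R co (f t) n) (at t within {0..T})"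
proof -
  have "((\<lambda>t. co (sg t z0) n + co (duh f t) n) has_vector_derivative
      lam n *\<^sub>R co (sg t z0) n + (lam n *\<^sub>R co (duh f t) n - (freq n)\<^sup>2 *\<^sub>R co (f t) n)) (at t within {0..T})"
    by (intro has_vector_derivative_add sg_has_vector_derivative duh_has_vector_derivative f t)
  then have "((\<lambda>t. co (z t) n) has_vector_derivative
      lam n *\<^sub>R co (sg t z0) n + (lam n *\<^sub>R co (duh f t) n - (freq n)\<^sup>2 *\<^sub>R co (f t) n)) (at t within {0..T})"
    by (rule has_vector_derivative_transform[OF t, rotated]) (simp add: z)
  then show ?thesis by (simp add: z[OF t] scaleR_add_right algebra_simps)
qed

section \<open>The energy estimate\<close>

text \<open>Reduces identities between convolutions, such as associativity, to identities between
  functions.\<close>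

lemma fser_inject:
  fixes c d :: "int^'d \<Rightarrow> complex"
  assumes c: "c abs_summable_on UNIV" and d: "d abs_summable_on UNIV" and eq: "\<And>x. fser c x = fser d x"
  shows "c = d"
proof
  fix n :: "int^'d"
  let ?\<mu> = "of_real ((2 * pi) ^ CARD('d)) :: complex"
  have coeff: "(\<integral>x. cis (- (x \<bullet> lattice_vec n)) * fser c x \<partial>torus) = c n * ?\<mu>"
    if c: "c abs_summable_on UNIV" for c :: "int^'d \<Rightarrow> complex"
  proof -
    have "integrable torus (\<lambda>x :: real^'d. cis (- (x \<bullet> lattice_vec n)))"
      using continuous_cis_inner[of "- lattice_vec n"]
      by (intro integrable_torus_bounded[where B=1] measurable_torus_continuous) simp_all
    from fser_uniform(3)[OF c this]
    have "((\<lambda>m. c m * (\<integral>x. cis (x \<bullet> lattice_vec (m - n)) \<partial>torus)) has_sum (\<integral>x. cis (- (x \<bullet> lattice_vec n)) * fser c x \<partial>torus)) UNIV"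
      by (simp only: cis_mult_lattice mult.commute[of "cis (- _)" "cis _"])
    then have *: "((\<lambda>m. c m * (if m - n = 0 then ?\<mu> else 0)) has_sum (\<integral>x. cis (- (x \<bullet> lattice_vec n)) * fser c x \<partial>torus)) UNIV"
      by (simp only: integral_torus_cis)
    have "((\<lambda>m. c m * (if m - n = 0 then ?\<mu> else 0)) has_sum (c n * ?\<mu>)) UNIV"
      by (rule has_sum_finite_neutralI[of "{n}"]) auto
    with * show ?thesis using has_sum_unique by blast
  qed
  have "c n * ?\<mu> = d n * ?\<mu>" using coeff[OF c] coeff[OF d] by (simp add: eq)
  then show "c n = d n" by simp
qed

lemma conv_assoc:
  fixes a b c :: "int^'d \<Rightarrow> complex"
  assumes "a abs_summable_on UNIV" "b abs_summable_on UNIV" "c abs_summable_on UNIV"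
  shows "conv (conv a b) c = conv a (conv b c)"
  by (rule fser_inject) (simp_all add: conv_abs_summable fser_conv assms mult.assoc)

lemma conv_finite:
  assumes "finite J" "\<And>j. j \<notin> J \<Longrightarrow> a j = 0"
  shows "conv a b n = (\<Sum>j\<in>J. a j * b (n - j))"
  unfolding conv_def
  by (rule infsumI, rule has_sum_finite_neutralI[OF assms(1)]) (use assms(2) in auto)

text \<open>Coefficients of the complex conjugate function; \<open>conv (star a) b 0\<close> is then
  the inner product of \<open>a\<close> and \<open>b\<close>.\<close>

definition star :: "(int^'d \<Rightarrow> complex) \<Rightarrow> int^'d \<Rightarrow> complex" where
  "star a n = cnj (a (- n))"

lemma conv_star_0: "conv (star a) b 0 = (\<Sum>\<^sub>\<infinity>n. cnj (a n) * b n)"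
  unfolding conv_def
  by (rule infsum_reindex_bij_witness[of _ uminus uminus]) (auto simp: star_def)

lemma star_abs_summable: "a abs_summable_on UNIV \<Longrightarrow> star a abs_summable_on UNIV"
  unfolding star_def using summable_on_reindex_bij_witness[of UNIV uminus uminus UNIV "\<lambda>n. norm (a n)" "\<lambda>n. norm (a (- n))"]
  by simp

lemma star_conv: "star (conv a b) = conv (star a) (star b)"
proof
  fix n
  show "star (conv a b) n = conv (star a) (star b) n"
    unfolding star_def conv_def infsum_cnj[symmetric]
    by (rule infsum_reindex_bij_witness[of _ uminus uminus]) (auto simp: minus_diff_commute)
qed

text \<open>Multiplication by \<open>\<phi>\<^sup>2\<close> is a positive operator, being the square of a symmetric one.\<close>

lemma conv_square_nonneg:
  fixes \<phi> a :: "int^'d \<Rightarrow> complex"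
  assumes \<phi>: "\<phi> abs_summable_on UNIV" "herm \<phi>" and F: "finite F" "\<And>n. n \<notin> F \<Longrightarrow> a n = 0"
  shows "0 \<le> (\<Sum>n\<in>F. a n \<bullet> conv (conv \<phi> \<phi>) a n)"
proof -
  let ?b = "conv \<phi> a"
  have a: "a abs_summable_on UNIV" by (rule finite_support_abs_summable[OF F])
  have s\<phi>: "star \<phi> = \<phi>" using \<phi>(2) by (auto simp: star_def herm_def)
  note sa = star_abs_summable[OF a] and b = conv_abs_summable[OF \<phi>(1) a]
  have "((\<lambda>n. cnj (a n) * conv (conv \<phi> \<phi>) a n) has_sum (\<Sum>n\<in>F. cnj (a n) * conv (conv \<phi> \<phi>) a n)) UNIV"
    by (rule has_sum_finite_neutralI[OF F(1)]) (use F(2) in auto)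
  then have "(\<Sum>n\<in>F. cnj (a n) * conv (conv \<phi> \<phi>) a n) = conv (star a) (conv (conv \<phi> \<phi>) a) 0"
    by (simp add: conv_star_0 infsumI)
  also have "conv (star a) (conv (conv \<phi> \<phi>) a) = conv (star ?b) ?b"
    using conv_assoc[OF sa \<phi>(1) b] conv_assoc[OF \<phi>(1) \<phi>(1) a]
    by (simp add: star_conv s\<phi> conv_commute[of \<phi> "star a"])
  also have "conv (star ?b) ?b 0 = (\<Sum>\<^sub>\<infinity>n. of_real ((cmod (?b n))\<^sup>2))"
    unfolding conv_star_0 by (rule infsum_cong) (simp only: complex_norm_square mult.commute)
  also have "\<dots> = of_real (\<Sum>\<^sub>\<infinity>n. (cmod (?b n))\<^sup>2)"
  proof -
    obtain B where B: "0 \<le> B" "\<And>n. norm (?b n) \<le> B" using abs_summable_bounded[OF b] by blast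
    have "(\<lambda>n. (cmod (?b n))\<^sup>2) summable_on UNIV"
      by (rule summable_on_comparison_test[OF summable_on_cmult_left[OF b, of B]])
        (auto simp: power2_eq_square B mult_left_mono)
    then show ?thesis by (intro infsumI has_sum_of_real has_sum_infsum)
  qed
  finally have "(\<Sum>n\<in>F. cnj (a n) * conv (conv \<phi> \<phi>) a n) = of_real (\<Sum>\<^sub>\<infinity>n. (cmod (?b n))\<^sup>2)" .
  then have "Re (\<Sum>n\<in>F. cnj (a n) * conv (conv \<phi> \<phi>) a n) = (\<Sum>\<^sub>\<infinity>n. (cmod (?b n))\<^sup>2)" by simp
  moreover have "Re (\<Sum>n\<in>F. cnj (a n) * conv (conv \<phi> \<phi>) a n) = (\<Sum>n\<in>F. a n \<bullet> conv (conv \<phi> \<phi>) a n)"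
    by (simp add: inner_complex_def)
  moreover have "0 \<le> (\<Sum>\<^sub>\<infinity>n. (cmod (?b n))\<^sup>2)" by (intro infsum_nonneg) simp
  ultimately show ?thesis by linarith
qed

section \<open>Cutoffs, weights and commutators\<close>

definition cutoff :: "real \<Rightarrow> int^'d \<Rightarrow> real" where
  "cutoff R n = max 0 (1 - freq n / R)"

lemma cutoff_bounds: "0 < R \<Longrightarrow> 0 \<le> cutoff R n" "0 < R \<Longrightarrow> cutoff R n \<le> 1"
  by (auto simp: cutoff_def)

text \<open>The reason for a tent profile instead of a sharp truncation: multiplied by the frequency
  it varies at most by a multiple of the shift, uniformly in \<open>R\<close>. Up to
  \<open>2 * R\<close> its Lipschitz constant \<open>1 / R\<close> compensates the frequency.
  Beyond, the left-hand side vanishes unless \<open>n\<close> lies within \<open>R\<close>, and then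
  the shift exceeds half of \<open>freq m\<close>.\<close>

lemma freq_cutoff_diff_le:
  assumes R: "0 < R" shows "freq m * \<bar>cutoff R n - cutoff R m\<bar> \<le> 2 * freq (n - m)"
proof -
  have fd: "\<bar>freq n - freq m\<bar> \<le> freq (n - m)" by (rule freq_diff_le)
  show ?thesis
  proof (cases "freq m \<le> 2 * R")
    case True
    have "\<bar>cutoff R n - cutoff R m\<bar> \<le> \<bar>freq n / R - freq m / R\<bar>" unfolding cutoff_def by linarith
    also have "\<dots> = \<bar>freq n - freq m\<bar> / R" using R by (simp add: diff_divide_distrib[symmetric])
    also have "\<dots> \<le> freq (n - m) / R" using R fd by (intro divide_right_mono) auto
    finally have "freq m * \<bar>cutoff R n - cutoff R m\<bar> \<le> (2 * R) * (freq (n - m) / R)"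
      using True R by (intro mult_mono) auto
    then show ?thesis using R by simp
  next
    case False
    then have m: "cutoff R m = 0" using R by (simp add: cutoff_def field_simps)
    show ?thesis
    proof (cases "freq n < R")
      case True
      have "freq m * \<bar>cutoff R n - cutoff R m\<bar> \<le> freq m * 1"
        using cutoff_bounds[OF R, of n] m by (intro mult_left_mono) auto
      also have "\<dots> \<le> 2 * freq (n - m)" using False True fd by linarith
      finally show ?thesis .
    next
      case n: False
      then have "cutoff R n = 0" using R by (simp add: cutoff_def field_simps)
      then show ?thesis using m by simp
    qed
  qed
qed

lemma jb_diff_le: "\<bar>jb n - jb m\<bar> \<le> freq (n - m)"
proof -
  have "jb n \<le> jb m + freq (n - m)" using jb_add_le[of m "n - m"] by simp
  moreover have "jb m \<le> jb n + freq (n - m)" using jb_add_le[of n "m - n"] freq_uminus[of "n - m"] by simp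
  ultimately show ?thesis by linarith
qed

lemma jb_mult_le: "jb n \<le> jb m * (1 + freq (n - m))"
proof -
  have "jb n \<le> jb m + freq (n - m)" using jb_add_le[of m "n - m"] by simp
  also have "freq (n - m) \<le> jb m * freq (n - m)" using mult_right_mono[OF jb_ge_1[of m] freq_nonneg[of "n - m"]] by simp
  finally show ?thesis by (simp add: algebra_simps)
qed

lemma wt_mult_le: "wt k n \<le> wt k m * (1 + freq (n - m)) ^ k"
proof -
  have "wt k n \<le> (jb m * (1 + freq (n - m))) ^ k"
    unfolding wt_def using jb_ge_1[of n] by (intro power_mono jb_mult_le) auto
  then show ?thesis by (simp add: wt_def power_mult_distrib)
qed

text \<open>A shift changes the weight by an amount of one order less in the frequency, which makes
  room for the factor \<open>freq m\<close>. The induction applies the product rule for differences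
  to \<open>jb n ^ Suc k\<close>.\<close>

lemma freq_wt_diff_le:
  "freq m * \<bar>wt k n - wt k m\<bar> \<le> real k * freq (n - m) * (1 + freq (n - m)) ^ k * wt k m"
proof -
  let ?j = "freq (n - m)"
  have y1: "1 \<le> jb m" and x1: "1 \<le> jb n" by (rule jb_ge_1)+
  have "jb m * \<bar>jb n ^ k - jb m ^ k\<bar> \<le> real k * ?j * (1 + ?j) ^ k * jb m ^ k" for k
  proof (induction k)
    case (Suc k)
    have p1: "1 \<le> (1 + ?j) ^ Suc k" by (rule one_le_power) simp
    have "jb m * \<bar>jb n ^ Suc k - jb m ^ Suc k\<bar> = jb m * \<bar>(jb n ^ k - jb m ^ k) * jb n + jb m ^ k * (jb n - jb m)\<bar>"
      by (simp add: algebra_simps)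
    also have "\<dots> \<le> jb m * (\<bar>jb n ^ k - jb m ^ k\<bar> * jb n + jb m ^ k * \<bar>jb n - jb m\<bar>)"
      using x1 y1 abs_triangle_ineq[of "(jb n ^ k - jb m ^ k) * jb n" "jb m ^ k * (jb n - jb m)"]
      by (intro mult_left_mono) (auto simp: abs_mult)
    also have "\<dots> = (jb m * \<bar>jb n ^ k - jb m ^ k\<bar>) * jb n + jb m ^ Suc k * \<bar>jb n - jb m\<bar>"
      by (simp add: algebra_simps)
    also have "\<dots> \<le> (real k * ?j * (1 + ?j) ^ k * jb m ^ k) * (jb m * (1 + ?j)) + jb m ^ Suc k * (?j * (1 + ?j) ^ Suc k)"
    proof (rule add_mono)
      show "(jb m * \<bar>jb n ^ k - jb m ^ k\<bar>) * jb n \<le> (real k * ?j * (1 + ?j) ^ k * jb m ^ k) * (jb m * (1 + ?j))"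
        by (rule mult_mono[OF Suc.IH jb_mult_le]) (use x1 y1 in auto)
      have "\<bar>jb n - jb m\<bar> \<le> ?j * 1" using jb_diff_le[of n m] by simp
      also have "\<dots> \<le> ?j * (1 + ?j) ^ Suc k" by (intro mult_left_mono p1) simp
      finally show "jb m ^ Suc k * \<bar>jb n - jb m\<bar> \<le> jb m ^ Suc k * (?j * (1 + ?j) ^ Suc k)"
        using y1 by (intro mult_left_mono) auto
    qed
    also have "\<dots> = real (Suc k) * ?j * (1 + ?j) ^ Suc k * jb m ^ Suc k" by (simp add: algebra_simps)
    finally show ?case .
  qed simp
  moreover have "freq m * \<bar>wt k n - wt k m\<bar> \<le> jb m * \<bar>wt k n - wt k m\<bar>"
    by (intro mult_right_mono freq_le_jb) simp
  ultimately show ?thesis unfolding wt_def by (rule order_trans[rotated])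
qed

text \<open>The multiplier \<open>freq * cutoff * wt k\<close> has order \<open>k + 1\<close>, but
  its commutator with a shift has only order \<open>k\<close>. After division by
  \<open>wt k m\<close> a polynomial in the shift remains, independent of \<open>R\<close>.\<close>

lemma cutoff_commutator_le:
  assumes R: "0 < R"
  shows "\<bar>freq n * cutoff R n * (wt k n / wt k m) - freq m * cutoff R m\<bar> \<le> (real k + 3) * (1 + freq (n - m)) ^ Suc k"
proof -
  let ?j = "freq (n - m)"
  have W: "0 < wt k m" by (rule wt_pos)
  note c = cutoff_bounds[OF R]
  have p: "1 \<le> (1 + ?j) ^ k" by (rule one_le_power) simp
  have "\<bar>freq n * cutoff R n * wt k n - freq m * cutoff R m * wt k m\<bar>
      = \<bar>cutoff R n * ((freq n - freq m) * wt k n + freq m * (wt k n - wt k m)) + freq m * (cutoff R n - cutoff R m) * wt k m\<bar>"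
    by (simp add: algebra_simps)
  also have "\<dots> \<le> cutoff R n * (\<bar>freq n - freq m\<bar> * wt k n + freq m * \<bar>wt k n - wt k m\<bar>) + freq m * \<bar>cutoff R n - cutoff R m\<bar> * wt k m"
    using c[of n] W wt_pos[of k n] abs_triangle_ineq[of "(freq n - freq m) * wt k n" "freq m * (wt k n - wt k m)"]
    by (intro order_trans[OF abs_triangle_ineq] add_mono) (auto simp: abs_mult intro!: mult_left_mono)
  also have "\<dots> \<le> 1 * (?j * (wt k m * (1 + ?j) ^ k) + real k * ?j * (1 + ?j) ^ k * wt k m) + (2 * ?j) * wt k m"
    using c[of n] W wt_pos[of k n]
    by (intro add_mono mult_mono freq_diff_le wt_mult_le freq_wt_diff_le freq_cutoff_diff_le R) auto
  also have "\<dots> \<le> ((real k + 3) * (1 + ?j) ^ Suc k) * wt k m"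
  proof -
    have "?j * (1 + ?j) ^ k * (real k + 1) + 2 * ?j * 1 \<le> ?j * (1 + ?j) ^ k * (real k + 1) + 2 * ?j * (1 + ?j) ^ k"
      using p by (intro add_left_mono mult_left_mono) auto
    also have "\<dots> = (real k + 3) * (?j * (1 + ?j) ^ k)" by (simp add: algebra_simps)
    also have "\<dots> \<le> (real k + 3) * (1 + ?j) ^ Suc k" using p by (intro mult_left_mono) (auto intro: mult_right_mono)
    finally have "(?j * (1 + ?j) ^ k * (real k + 1) + 2 * ?j) * wt k m \<le> ((real k + 3) * (1 + ?j) ^ Suc k) * wt k m"
      using W by (intro mult_right_mono) auto
    then show ?thesis by (simp add: algebra_simps)
  qed
  finally have *: "\<bar>freq n * cutoff R n * wt k n - freq m * cutoff R m * wt k m\<bar> \<le> ((real k + 3) * (1 + ?j) ^ Suc k) * wt k m" .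
  have "freq n * cutoff R n * (wt k n / wt k m) - freq m * cutoff R m = (freq n * cutoff R n * wt k n - freq m * cutoff R m * wt k m) / wt k m"
    using W by (simp add: field_simps)
  then show ?thesis using * W by (simp add: abs_divide pos_divide_le_eq)
qed

definition supp :: "'d::finite l2 \<Rightarrow> (int^'d) set" where
  "supp x = {n. co x n \<noteq> 0}"

lemma hat_outside_supp: "n \<notin> supp x \<Longrightarrow> hat k x n = 0"
  by (simp add: supp_def hat_def)

context sobolev
begin

lemma finite_supp_prd:
  fixes x y :: "'d l2"
  assumes "finite (supp x)" "finite (supp y)" shows "finite (supp (prd k x y))"
proof (rule finite_subset)
  show "finite ((\<lambda>(p, q). p + q) ` (supp x \<times> supp y))" using assms by simp
  show "supp (prd k x y) \<subseteq> (\<lambda>(p, q). p + q) ` (supp x \<times> supp y)"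
  proof
    fix n assume "n \<in> supp (prd k x y)"
    then have nz: "conv (hat k x) (hat k y) n \<noteq> 0" by (simp add: supp_def co_prd)
    have "\<exists>p. hat k x p * hat k y (n - p) \<noteq> 0"
    proof (rule ccontr)
      assume "\<nexists>p. hat k x p * hat k y (n - p) \<noteq> 0"
      then have "conv (hat k x) (hat k y) n = 0" unfolding conv_def by (intro infsum_0) blast
      with nz show False by simp
    qed
    then obtain p where "hat k x p * hat k y (n - p) \<noteq> 0" by (rule exE)
    then have "p \<in> supp x" "n - p \<in> supp y" by (auto simp: supp_def hat_def)
    then show "n \<in> (\<lambda>(p, q). p + q) ` (supp x \<times> supp y)" by (intro image_eqI[of _ _ "(p, n - p)"]) auto
  qed
qed

text \<open>For a trigonometric polynomial \<phi>: the commutator bound summed over the shifts that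
  occur in \<phi>^2.\<close>

definition comm_const :: "'d l2 \<Rightarrow> real" where
  "comm_const \<phi> = (\<Sum>j\<in>supp (prd k \<phi> \<phi>). cmod (hat k (prd k \<phi> \<phi>) j) * ((real k + 3) * (1 + freq j) ^ Suc k))"

lemma comm_const_nonneg: "0 \<le> comm_const \<phi>"
  unfolding comm_const_def by (intro sum_nonneg mult_nonneg_nonneg zero_le_power) auto

text \<open>Half of the factor \<open>(cutoff * freq)^2\<close>, together with the weight
  \<open>wt k\<close>, is moved through the multiplication by \<phi>^2. The main term has a sign by
  \<open>conv_square_nonneg\<close>. In the commutator only one copy of \<open>z\<close> still
  carries a frequency, so it splits into \<kappa> times the first-order energy and
  \<open>1 / \<kappa>\<close> times the squared norm.\<close>

lemma cutoff_dissipation: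
  fixes \<phi> z :: "'d l2"
  assumes \<phi>: "finite (supp \<phi>)" and R: "0 < R" and \<kappa>: "0 < \<kappa>"
  defines "F \<equiv> {n. freq n \<le> R}"
  shows "- 2 * (\<Sum>n\<in>F. (cutoff R n)\<^sup>2 * (freq n)\<^sup>2 * (co z n \<bullet> co (prd k (prd k \<phi> \<phi>) z) n))
    \<le> comm_const \<phi> * (\<kappa> * (\<Sum>n\<in>F. (cutoff R n)\<^sup>2 * (freq n)\<^sup>2 * (cmod (co z n))\<^sup>2) + (norm z)\<^sup>2 / \<kappa>)"
proof -
  let ?q = "prd k \<phi> \<phi>" let ?qh = "hat k ?q" and ?J = "supp (prd k \<phi> \<phi>)"
  have F: "finite F" unfolding F_def by (rule finite_freq_le)
  have J: "finite ?J" by (intro finite_supp_prd \<phi>)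
  define w where "w n = freq n * cutoff R n" for n :: "int^'d"
  have w0: "0 \<le> w n" for n using cutoff_bounds(1)[OF R, of n] by (simp add: w_def)
  define a where "a n = of_real (w n) * co z n" for n
  have aF: "a n = 0" if "n \<notin> F" for n
  proof -
    have "cutoff R n = 0" using that R by (simp add: F_def cutoff_def field_simps)
    then show ?thesis by (simp add: a_def w_def)
  qed
  have qh: "?qh = conv (hat k \<phi>) (hat k \<phi>)" by (rule ext) (rule hat_prd)
  have pos: "0 \<le> (\<Sum>n\<in>F. a n \<bullet> conv ?qh a n)"
    unfolding qh by (rule conv_square_nonneg[OF hat_abs_summable herm_hat F aF])
  \<comment> \<open>The commutator of the multiplier \<open>w * wt k\<close> with the shift by
    \<open>j\<close>, relative to the weight at \<open>n - j\<close>.\<close>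
  define br where "br n j = w n * (wt k n / wt k (n - j)) - w (n - j)" for n j :: "int^'d"
  have brle: "\<bar>br n j\<bar> \<le> (real k + 3) * (1 + freq j) ^ Suc k" for n j
    using cutoff_commutator_le[OF R, of n k "n - j"] by (simp add: br_def w_def)
  have term_eq: "(cutoff R n)\<^sup>2 * (freq n)\<^sup>2 * (co z n \<bullet> co (prd k ?q z) n)
      = a n \<bullet> conv ?qh a n + (\<Sum>j\<in>?J. w n * br n j * (co z n \<bullet> (?qh j * co z (n - j))))" for n
  proof -
    have 1: "co (prd k ?q z) n = (\<Sum>j\<in>?J. (wt k n / wt k (n - j)) *\<^sub>R (?qh j * co z (n - j)))"
      unfolding co_prd by (subst conv_finite[OF J hat_outside_supp])
        (auto simp: sum_distrib_left scaleR_conv_of_real hat_def[of k z] mult_ac)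
    have 2: "conv ?qh a n = (\<Sum>j\<in>?J. w (n - j) *\<^sub>R (?qh j * co z (n - j)))"
      by (subst conv_finite[OF J hat_outside_supp]) (auto simp: a_def scaleR_conv_of_real mult_ac)
    have "a n \<bullet> conv ?qh a n = w n * (co z n \<bullet> conv ?qh a n)"
      by (simp add: a_def scaleR_conv_of_real[symmetric])
    also have "\<dots> + (\<Sum>j\<in>?J. w n * br n j * (co z n \<bullet> (?qh j * co z (n - j))))
        = (\<Sum>j\<in>?J. w n * (w (n - j) + br n j) * (co z n \<bullet> (?qh j * co z (n - j))))"
      unfolding 2 inner_sum_right sum_distrib_left sum.distrib[symmetric]
      by (intro sum.cong refl) (simp add: algebra_simps)
    also have "\<dots> = (w n)\<^sup>2 * (co z n \<bullet> co (prd k ?q z) n)"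
      unfolding 1 inner_sum_right sum_distrib_left
      by (intro sum.cong refl) (simp add: br_def power2_eq_square)
    finally show ?thesis by (simp add: w_def power_mult_distrib mult_ac)
  qed
  let ?A = "\<Sum>n\<in>F. (w n)\<^sup>2 * (cmod (co z n))\<^sup>2"
  have inner: "(\<Sum>n\<in>F. \<bar>w n * br n j * (co z n \<bullet> (?qh j * co z (n - j)))\<bar>)
      \<le> cmod (?qh j) * ((real k + 3) * (1 + freq j) ^ Suc k) * ((\<kappa> * ?A + (norm z)\<^sup>2 / \<kappa>) / 2)" for j
  proof -
    let ?c = "(real k + 3) * (1 + freq j) ^ Suc k"
    have "(\<Sum>n\<in>F. \<bar>w n * br n j * (co z n \<bullet> (?qh j * co z (n - j)))\<bar>)
        \<le> (\<Sum>n\<in>F. cmod (?qh j) * ?c * ((\<kappa> * ((w n)\<^sup>2 * (cmod (co z n))\<^sup>2) + (cmod (co z (n - j)))\<^sup>2 / \<kappa>) / 2))"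
    proof (rule sum_mono)
      fix n
      let ?x = "w n * cmod (co z n)" and ?y = "cmod (co z (n - j))"
      have xy: "?x * ?y \<le> (\<kappa> * ?x\<^sup>2 + ?y\<^sup>2 / \<kappa>) / 2"
      proof -
        have "0 \<le> (\<kappa> * ?x - ?y)\<^sup>2 / \<kappa>" using \<kappa> by simp
        also have "(\<kappa> * ?x - ?y)\<^sup>2 / \<kappa> = \<kappa> * ?x\<^sup>2 - 2 * (?x * ?y) + ?y\<^sup>2 / \<kappa>"
          using \<kappa> by (simp add: power2_diff power_mult_distrib field_simps power2_eq_square)
        finally show ?thesis by simp
      qed
      have "\<bar>w n * br n j * (co z n \<bullet> (?qh j * co z (n - j)))\<bar> = w n * \<bar>br n j\<bar> * \<bar>co z n \<bullet> (?qh j * co z (n - j))\<bar>"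
        using w0[of n] by (simp add: abs_mult)
      also have "\<dots> \<le> w n * ?c * (cmod (co z n) * cmod (?qh j * co z (n - j)))"
        using w0[of n] brle[of n j] by (intro mult_mono Cauchy_Schwarz_ineq2 mult_nonneg_nonneg) auto
      also have "\<dots> = cmod (?qh j) * ?c * (?x * ?y)" by (simp add: norm_mult mult_ac)
      also have "\<dots> \<le> cmod (?qh j) * ?c * ((\<kappa> * ?x\<^sup>2 + ?y\<^sup>2 / \<kappa>) / 2)"
        by (intro mult_left_mono xy mult_nonneg_nonneg zero_le_power) auto
      finally show "\<bar>w n * br n j * (co z n \<bullet> (?qh j * co z (n - j)))\<bar>
          \<le> cmod (?qh j) * ?c * ((\<kappa> * ((w n)\<^sup>2 * (cmod (co z n))\<^sup>2) + (cmod (co z (n - j)))\<^sup>2 / \<kappa>) / 2)"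
        by (simp add: power_mult_distrib)
    qed
    also have "\<dots> = cmod (?qh j) * ?c * ((\<kappa> * ?A + (\<Sum>n\<in>F. (cmod (co z (n - j)))\<^sup>2) / \<kappa>) / 2)"
      by (simp only: sum_distrib_left[symmetric] sum_divide_distrib[symmetric] sum.distrib)
    also have "(\<Sum>n\<in>F. (cmod (co z (n - j)))\<^sup>2) = (\<Sum>n\<in>(\<lambda>n. n - j) ` F. (cmod (co z n))\<^sup>2)"
      by (subst sum.reindex) (auto simp: inj_on_def)
    also have "cmod (?qh j) * ?c * ((\<kappa> * ?A + (\<Sum>n\<in>(\<lambda>n. n - j) ` F. (cmod (co z n))\<^sup>2) / \<kappa>) / 2)
        \<le> cmod (?qh j) * ?c * ((\<kappa> * ?A + (norm z)\<^sup>2 / \<kappa>) / 2)"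
      using \<kappa> by (intro mult_left_mono divide_right_mono add_left_mono co_sum_le_norm mult_nonneg_nonneg zero_le_power) auto
    finally show ?thesis .
  qed
  have "- (\<Sum>n\<in>F. (cutoff R n)\<^sup>2 * (freq n)\<^sup>2 * (co z n \<bullet> co (prd k ?q z) n))
      \<le> - (\<Sum>n\<in>F. \<Sum>j\<in>?J. w n * br n j * (co z n \<bullet> (?qh j * co z (n - j))))"
    using pos by (simp add: term_eq sum.distrib)
  also have "\<dots> \<le> (\<Sum>n\<in>F. \<Sum>j\<in>?J. \<bar>w n * br n j * (co z n \<bullet> (?qh j * co z (n - j)))\<bar>)"
    unfolding sum_negf[symmetric] by (intro sum_mono) simp
  also have "\<dots> = (\<Sum>j\<in>?J. \<Sum>n\<in>F. \<bar>w n * br n j * (co z n \<bullet> (?qh j * co z (n - j)))\<bar>)"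
    by (rule sum.swap)
  also have "\<dots> \<le> (\<Sum>j\<in>?J. cmod (?qh j) * ((real k + 3) * (1 + freq j) ^ Suc k) * ((\<kappa> * ?A + (norm z)\<^sup>2 / \<kappa>) / 2))"
    by (intro sum_mono inner)
  also have "\<dots> = comm_const \<phi> * ((\<kappa> * ?A + (norm z)\<^sup>2 / \<kappa>) / 2)"
    by (simp only: comm_const_def sum_distrib_right)
  finally have "- 2 * (\<Sum>n\<in>F. (cutoff R n)\<^sup>2 * (freq n)\<^sup>2 * (co z n \<bullet> co (prd k ?q z) n)) \<le> comm_const \<phi> * (\<kappa> * ?A + (norm z)\<^sup>2 / \<kappa>)"
    by simp
  moreover have "?A = (\<Sum>n\<in>F. (cutoff R n)\<^sup>2 * (freq n)\<^sup>2 * (cmod (co z n))\<^sup>2)"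
    by (simp add: w_def power_mult_distrib mult_ac)
  ultimately show ?thesis by simp
qed

end

section \<open>Multipliers on trigonometric polynomials and the radial retraction\<close>

lemma
  assumes even: "\<And>n. m (- n) = m n" and fin: "finite (supp x)"
  shows co_mul_finite: "co (mul m x) n = of_real (m n) * co x n"
    and finite_supp_mul: "finite (supp (mul m x))"
proof -
  have "herm (\<lambda>n. of_real (m n) * co x n)"
    by (auto simp: herm_def even co_uminus_index)
  moreover have "(\<lambda>n. (cmod (of_real (m n) * co x n))\<^sup>2) summable_on UNIV"
    by (rule summable_on_cong_neutral[THEN iffD1, OF _ _ _ summable_on_finite[OF fin]]) (auto simp: supp_def)
  ultimately have *: "co (mul m x) = (\<lambda>n. of_real (m n) * co x n)"
    unfolding mul_def by (rule co_mkl2_summable)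
  then show "co (mul m x) n = of_real (m n) * co x n" by simp
  show "finite (supp (mul m x))"
    by (rule finite_subset[OF _ fin]) (auto simp: supp_def *)
qed

lemma finite_supp_add: "finite (supp x) \<Longrightarrow> finite (supp y) \<Longrightarrow> finite (supp (x + y))"
  by (rule finite_subset[of _ "supp x \<union> supp y"]) (auto simp: supp_def)

lemma finite_supp_scaleR: "finite (supp x) \<Longrightarrow> finite (supp (r *\<^sub>R x))"
  by (rule finite_subset[of _ "supp x"]) (auto simp: supp_def)

lemma finite_supp_proj: "finite (supp (proj R x))"
  by (rule finite_subset[OF _ finite_freq_le[of R]]) (auto simp: supp_def co_proj)

text \<open>Meaningful for finitely supported families: the symbol is unbounded.\<close>

definition lap :: "'d l2 \<Rightarrow> 'd::finite l2" where
  "lap = mul (\<lambda>n. - (freq n)\<^sup>2)"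

lemma co_lap: "finite (supp x) \<Longrightarrow> co (lap x) n = - ((freq n)\<^sup>2 *\<^sub>R co x n)"
  unfolding lap_def by (subst co_mul_finite) (auto simp: scaleR_conv_of_real)

lemma finite_supp_lap: "finite (supp x) \<Longrightarrow> finite (supp (lap x))"
  unfolding lap_def by (rule finite_supp_mul) auto

text \<open>Radial retraction onto the ball of radius \<open>M\<close>. It makes the cubic
  nonlinearity globally Lipschitz, and it disappears once the solution is known to stay in the
  ball.\<close>

definition retr :: "real \<Rightarrow> 'a::real_normed_vector \<Rightarrow> 'a" where
  "retr M x = (if norm x \<le> M then x else (M / norm x) *\<^sub>R x)"

lemma norm_retr_le: "0 \<le> M \<Longrightarrow> norm (retr M x) \<le> M"
  by (auto simp: retr_def)

lemma retr_lipschitz: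
  assumes M: "0 \<le> M" shows "norm (retr M x - retr M y) \<le> 2 * norm (x - y)"
proof -
  have one: "norm (retr M x - retr M y) \<le> 2 * norm (x - y)" if x: "M < norm x" and y: "norm y \<le> M" for x y :: 'a
  proof -
    have "x \<noteq> 0" using x M by auto
    have "(M / norm x) *\<^sub>R x - y = (M / norm x - 1) *\<^sub>R x + (x - y)" by (simp add: scaleR_diff_left)
    then have "norm ((M / norm x) *\<^sub>R x - y) \<le> norm ((M / norm x - 1) *\<^sub>R x) + norm (x - y)"
      by (simp only: norm_triangle_ineq)
    also have "norm ((M / norm x - 1) *\<^sub>R x) = norm x - M"
    proof -
      have "M / norm x \<le> 1" using x \<open>x \<noteq> 0\<close> by (simp add: divide_le_eq_1)
      then have "norm ((M / norm x - 1) *\<^sub>R x) = (1 - M / norm x) * norm x" by simp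
      also have "\<dots> = norm x - M" using \<open>x \<noteq> 0\<close> by (simp add: left_diff_distrib)
      finally show ?thesis .
    qed
    also have "norm x - M \<le> norm (x - y)" using y norm_triangle_ineq2[of x y] by linarith
    finally show ?thesis using x y by (simp add: retr_def)
  qed
  consider "norm x \<le> M" "norm y \<le> M" | "M < norm x" "norm y \<le> M" | "norm x \<le> M" "M < norm y" | "M < norm x" "M < norm y"
    by linarith
  then show ?thesis
  proof cases
    case 1
    then show ?thesis by (simp add: retr_def)
  next
    case 2
    then show ?thesis by (rule one)
  next
    case 3
    then show ?thesis using one[of y x] by (simp add: norm_minus_commute)
  next
    case 4
    have nz: "x \<noteq> 0" "y \<noteq> 0" using 4 M by auto
    have "(M / norm x) *\<^sub>R x - (M / norm y) *\<^sub>R y = (M / norm x) *\<^sub>R (x - y) + (M / norm x - M / norm y) *\<^sub>R y"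
      by (simp add: algebra_simps)
    note eq = this
    have r: "retr M x = (M / norm x) *\<^sub>R x" "retr M y = (M / norm y) *\<^sub>R y"
      using 4 by (auto simp: retr_def)
    have "norm (retr M x - retr M y) \<le> norm ((M / norm x) *\<^sub>R (x - y)) + norm ((M / norm x - M / norm y) *\<^sub>R y)"
      unfolding r eq by (rule norm_triangle_ineq)
    also have "norm ((M / norm x - M / norm y) *\<^sub>R y) = (M / norm x) * \<bar>norm y - norm x\<bar>"
    proof -
      have "(M / norm x - M / norm y) * norm y = (M / norm x) * (norm y - norm x)"
        using nz by (simp add: field_simps)
      moreover have "norm ((M / norm x - M / norm y) *\<^sub>R y) = \<bar>(M / norm x - M / norm y) * norm y\<bar>"
        by (simp add: abs_mult)
      ultimately show ?thesis using M by (simp add: abs_mult)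
    qed
    also have "norm ((M / norm x) *\<^sub>R (x - y)) + (M / norm x) * \<bar>norm y - norm x\<bar> \<le> (M / norm x) * (2 * norm (x - y))"
    proof -
      have "\<bar>norm y - norm x\<bar> \<le> norm (x - y)" using norm_triangle_ineq3[of y x] by (simp add: norm_minus_commute)
      then have 1: "(M / norm x) * \<bar>norm y - norm x\<bar> \<le> (M / norm x) * norm (x - y)" using M by (intro mult_left_mono) auto
      have 2: "norm ((M / norm x) *\<^sub>R (x - y)) = (M / norm x) * norm (x - y)" using M by simp
      from add_mono[OF eq_refl[OF 2] 1] show ?thesis by (simp only: mult_2 distrib_left)
    qed
    also have "\<dots> \<le> 1 * (2 * norm (x - y))" using 4 nz M by (intro mult_right_mono) (auto simp: divide_le_eq_1)
    finally show ?thesis by simp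
  qed
qed

lemma continuous_on_retr:
  assumes M: "0 \<le> M" and f: "continuous_on S f" shows "continuous_on S (\<lambda>t. retr M (f t))"
proof -
  have "2-lipschitz_on UNIV (retr M :: 'b \<Rightarrow> 'b)"
    using retr_lipschitz[OF M] by (intro lipschitz_onI) (auto simp: dist_norm)
  then have "continuous_on UNIV (retr M :: 'b \<Rightarrow> 'b)" by (rule lipschitz_on_continuous_on)
  then show ?thesis using continuous_on_compose2[OF _ f] by blast
qed

context sobolev
begin

text \<open>Here \<open>B\<close> stands for \<open>3 * A^2\<close> and \<kappa> remains free. The
  first-order part of the commutator is absorbed by the bi-Laplacian at the cost
  \<open>(B * comm_const \<phi> * \<kappa>)^2 / 2\<close>, the rest costs
  \<open>B * comm_const \<phi> / \<kappa>\<close>; treating the whole term by the bi-Laplacian would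
  cost a multiple of \<open>B^2\<close>. The source \<open>s\<close> has no derivative in front and
  is paid for by \<mu>.\<close>

lemma energy_estimate:
  fixes \<phi> :: "'d l2" and z g s :: "real \<Rightarrow> 'd l2"
  assumes \<phi>: "finite (supp \<phi>)" and \<kappa>: "0 < \<kappa>" and \<mu>: "0 < \<mu>" and B: "0 \<le> B"
    and cont: "continuous_on {0..\<delta>} z" "continuous_on {0..\<delta>} g" "continuous_on {0..\<delta>} s"
    and deriv: "\<And>t n. t \<in> {0..\<delta>} \<Longrightarrow> ((\<lambda>t. co (z t) n) has_vector_derivative
      lam n *\<^sub>R co (z t) n - (freq n)\<^sup>2 *\<^sub>R (B *\<^sub>R co (prd k (prd k \<phi> \<phi>) (z t)) n + co (g t) n) + co (s t) n) (at t within {0..\<delta>})"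
    and t: "t \<in> {0..\<delta>}"
  defines "rate \<equiv> 1 + \<mu> + (B * comm_const \<phi> * \<kappa>)\<^sup>2 / 2 + B * comm_const \<phi> / \<kappa>"
  shows "(norm (z t))\<^sup>2 \<le> (norm (z 0))\<^sup>2 + integral {0..t} (\<lambda>t. rate * (norm (z t))\<^sup>2 + 2 * (norm (g t))\<^sup>2 + (norm (s t))\<^sup>2 / \<mu>)"
proof -
  define h where "h t = rate * (norm (z t))\<^sup>2 + 2 * (norm (g t))\<^sup>2 + (norm (s t))\<^sup>2 / \<mu>" for t
  define C where "C = comm_const \<phi>"
  have C: "0 \<le> C" unfolding C_def by (rule comm_const_nonneg)
  have hc: "continuous_on {0..\<delta>} h" unfolding h_def using \<mu> by (intro continuous_intros cont) auto
  let ?p = "\<lambda>t n. co (prd k (prd k \<phi> \<phi>) (z t)) n"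
  define F where "F R = {n :: int^'d. freq n \<le> R}" for R
  have F: "finite (F R)" for R unfolding F_def by (rule finite_freq_le)
  define E where "E R t = (\<Sum>n\<in>F R. (cutoff R n)\<^sup>2 * (cmod (co (z t) n))\<^sup>2)" for R t
  have ER: "E R t \<le> (norm (z 0))\<^sup>2 + integral {0..t} h" if R: "0 < R" for R
  proof -
    have c1: "(cutoff R n)\<^sup>2 \<le> 1" for n :: "int^'d" using cutoff_bounds[OF R, of n] by (simp add: power_le_one)
    have Ele: "(\<Sum>n\<in>F R. (cutoff R n)\<^sup>2 * (cmod (co x n))\<^sup>2) \<le> (norm x)\<^sup>2" for x
    proof -
      have "(\<Sum>n\<in>F R. (cutoff R n)\<^sup>2 * (cmod (co x n))\<^sup>2) \<le> (\<Sum>n\<in>F R. 1 * (cmod (co x n))\<^sup>2)"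
        by (intro sum_mono mult_right_mono c1) auto
      also have "\<dots> \<le> (norm x)\<^sup>2" using co_sum_le_norm[of x "F R"] by simp
      finally show ?thesis .
    qed
    let ?z' = "\<lambda>t n. lam n *\<^sub>R co (z t) n - (freq n)\<^sup>2 *\<^sub>R (B *\<^sub>R ?p t n + co (g t) n) + co (s t) n"
    have "E R t \<le> E R 0 + integral {0..t} h"
    proof (rule increment_le_integral[OF _ _ hc t])
      fix t assume t: "t \<in> {0..\<delta>}"
      show "(E R has_real_derivative (\<Sum>n\<in>F R. (cutoff R n)\<^sup>2 * (2 * (co (z t) n \<bullet> ?z' t n)))) (at t within {0..\<delta>})"
        unfolding E_def by (intro DERIV_sum DERIV_cmult norm_power2_has_derivative deriv t)
      have pt: "2 * (co (z t) n \<bullet> ?z' t n) \<le> (1 + \<mu> + (B * C * \<kappa>)\<^sup>2 / 2) * (cmod (co (z t) n))\<^sup>2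
          - 2 * B * ((freq n)\<^sup>2 * (co (z t) n \<bullet> ?p t n)) - B * C * \<kappa> * ((freq n)\<^sup>2 * (cmod (co (z t) n))\<^sup>2)
          + (2 * (cmod (co (g t) n))\<^sup>2 + (cmod (co (s t) n))\<^sup>2 / \<mu>)" for n
      proof -
        let ?y = "co (z t) n" and ?gn = "co (g t) n" and ?sn = "co (s t) n"
        define q where "q = (freq n)\<^sup>2"
        define Y where "Y = cmod ?y"
        have q: "0 \<le> q" by (simp add: q_def)
        have l: "lam n = q - q\<^sup>2" by (simp add: lam_def q_def)
        have e: "2 * (?y \<bullet> ?z' t n) = 2 * (q - q\<^sup>2) * Y\<^sup>2 - 2 * B * (q * (?y \<bullet> ?p t n)) - 2 * (q * (?y \<bullet> ?gn)) + 2 * (?y \<bullet> ?sn)"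
          by (simp add: inner_diff_right inner_add_right l q_def[symmetric] Y_def power2_norm_eq_inner algebra_simps)
        have 1: "- 2 * (q * (?y \<bullet> ?gn)) \<le> q\<^sup>2 / 2 * Y\<^sup>2 + 2 * (cmod ?gn)\<^sup>2"
        proof -
          have "- (q * (?y \<bullet> ?gn)) \<le> q * (Y * cmod ?gn)"
            using mult_left_mono[OF Cauchy_Schwarz_ineq2[of ?y ?gn, THEN abs_le_D2] q] by (simp add: Y_def)
          moreover have "0 \<le> (q * Y / 2 - cmod ?gn)\<^sup>2" by simp
          ultimately show ?thesis by (simp add: power2_eq_square algebra_simps)
        qed
        have 2: "2 * (?y \<bullet> ?sn) \<le> \<mu> * Y\<^sup>2 + (cmod ?sn)\<^sup>2 / \<mu>"
        proof -
          have "?y \<bullet> ?sn \<le> Y * cmod ?sn" unfolding Y_def by (rule norm_cauchy_schwarz)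
          moreover have "0 \<le> (\<mu> * Y - cmod ?sn)\<^sup>2 / \<mu>" using \<mu> by simp
          moreover have "(\<mu> * Y - cmod ?sn)\<^sup>2 / \<mu> = \<mu> * Y\<^sup>2 - 2 * (Y * cmod ?sn) + (cmod ?sn)\<^sup>2 / \<mu>"
            using \<mu> by (simp add: power2_diff power_mult_distrib field_simps power2_eq_square)
          ultimately show ?thesis by linarith
        qed
        \<comment> \<open>The dissipation \<open>2 * q^2\<close> is spent in three shares:
          \<open>q^2 / 2\<close> on \<open>g\<close>, \<open>q^2\<close> on the growth
          \<open>2 * q\<close>, and \<open>q^2 / 2\<close> on the commutator.\<close>
        have 3: "(2 * (q - q\<^sup>2) + q\<^sup>2 / 2) * Y\<^sup>2 \<le> (1 + (B * C * \<kappa>)\<^sup>2 / 2 - B * C * \<kappa> * q) * Y\<^sup>2"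
        proof (rule mult_right_mono)
          have "0 \<le> (q - 1)\<^sup>2 + (q - B * C * \<kappa>)\<^sup>2 / 2" by simp
          then show "2 * (q - q\<^sup>2) + q\<^sup>2 / 2 \<le> 1 + (B * C * \<kappa>)\<^sup>2 / 2 - B * C * \<kappa> * q"
            by (simp add: power2_eq_square field_simps)
        qed simp
        show ?thesis unfolding e unfolding q_def[symmetric] Y_def[symmetric] using 1 2 3 by (simp add: algebra_simps)
      qed
      have "(\<Sum>n\<in>F R. (cutoff R n)\<^sup>2 * (2 * (co (z t) n \<bullet> ?z' t n)))
          \<le> (\<Sum>n\<in>F R. (1 + \<mu> + (B * C * \<kappa>)\<^sup>2 / 2) * ((cutoff R n)\<^sup>2 * (cmod (co (z t) n))\<^sup>2)
            + B * (- 2 * ((cutoff R n)\<^sup>2 * (freq n)\<^sup>2 * (co (z t) n \<bullet> ?p t n)))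
            - B * C * \<kappa> * ((cutoff R n)\<^sup>2 * (freq n)\<^sup>2 * (cmod (co (z t) n))\<^sup>2)
            + (2 * ((cutoff R n)\<^sup>2 * (cmod (co (g t) n))\<^sup>2) + ((cutoff R n)\<^sup>2 * (cmod (co (s t) n))\<^sup>2) / \<mu>))"
      proof (rule sum_mono)
        fix n
        from mult_left_mono[OF pt[of n] zero_le_power2[of "cutoff R n"]]
        show "(cutoff R n)\<^sup>2 * (2 * (co (z t) n \<bullet> ?z' t n)) \<le> (1 + \<mu> + (B * C * \<kappa>)\<^sup>2 / 2) * ((cutoff R n)\<^sup>2 * (cmod (co (z t) n))\<^sup>2)
            + B * (- 2 * ((cutoff R n)\<^sup>2 * (freq n)\<^sup>2 * (co (z t) n \<bullet> ?p t n)))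
            - B * C * \<kappa> * ((cutoff R n)\<^sup>2 * (freq n)\<^sup>2 * (cmod (co (z t) n))\<^sup>2)
            + (2 * ((cutoff R n)\<^sup>2 * (cmod (co (g t) n))\<^sup>2) + ((cutoff R n)\<^sup>2 * (cmod (co (s t) n))\<^sup>2) / \<mu>)"
          by (rule order_trans) (simp add: algebra_simps)
      qed
      also have "\<dots> = (1 + \<mu> + (B * C * \<kappa>)\<^sup>2 / 2) * (\<Sum>n\<in>F R. (cutoff R n)\<^sup>2 * (cmod (co (z t) n))\<^sup>2)
            + B * (- 2 * (\<Sum>n\<in>F R. (cutoff R n)\<^sup>2 * (freq n)\<^sup>2 * (co (z t) n \<bullet> ?p t n)))
            - B * C * \<kappa> * (\<Sum>n\<in>F R. (cutoff R n)\<^sup>2 * (freq n)\<^sup>2 * (cmod (co (z t) n))\<^sup>2)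
            + (2 * (\<Sum>n\<in>F R. (cutoff R n)\<^sup>2 * (cmod (co (g t) n))\<^sup>2) + (\<Sum>n\<in>F R. (cutoff R n)\<^sup>2 * (cmod (co (s t) n))\<^sup>2) / \<mu>)"
        by (simp only: sum.distrib sum_subtractf sum_distrib_left[symmetric] sum_divide_distrib[symmetric])
      also have "\<dots> \<le> (1 + \<mu> + (B * C * \<kappa>)\<^sup>2 / 2) * (norm (z t))\<^sup>2
            + B * (C * (\<kappa> * (\<Sum>n\<in>F R. (cutoff R n)\<^sup>2 * (freq n)\<^sup>2 * (cmod (co (z t) n))\<^sup>2) + (norm (z t))\<^sup>2 / \<kappa>))
            - B * C * \<kappa> * (\<Sum>n\<in>F R. (cutoff R n)\<^sup>2 * (freq n)\<^sup>2 * (cmod (co (z t) n))\<^sup>2)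
            + (2 * (norm (g t))\<^sup>2 + (norm (s t))\<^sup>2 / \<mu>)"
        using cutoff_dissipation[OF \<phi> R \<kappa>, of "z t"] \<mu> unfolding F_def[symmetric] C_def[symmetric]
        by (intro add_mono diff_right_mono mult_left_mono divide_right_mono Ele B) (auto intro: add_nonneg_nonneg)
      also have "\<dots> = h t" by (simp add: h_def rate_def C_def[symmetric] algebra_simps)
      finally show "(\<Sum>n\<in>F R. (cutoff R n)\<^sup>2 * (2 * (co (z t) n \<bullet> ?z' t n))) \<le> h t" .
    qed
    also have "E R 0 \<le> (norm (z 0))\<^sup>2" unfolding E_def by (rule Ele)
    finally show ?thesis by simp
  qed
  let ?B = "(norm (z 0))\<^sup>2 + integral {0..t} h"
  \<comment> \<open>The bound on \<open>E R t\<close> is free of \<open>R\<close>, so the cutoff is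
    removed by letting \<open>R\<close> tend to infinity on each finite set.\<close>
  have fin: "(\<Sum>n\<in>G. (cmod (co (z t) n))\<^sup>2) \<le> ?B" if G: "finite G" for G
  proof (rule tendsto_upperbound)
    have "((\<lambda>R. cutoff R n) \<longlongrightarrow> max 0 (1 - 0)) at_top" for n :: "int^'d"
      unfolding cutoff_def by (intro tendsto_intros tendsto_divide_0[OF tendsto_const] filterlim_ident[THEN filterlim_at_top_imp_at_infinity])
    then have "((\<lambda>R. \<Sum>n\<in>G. (cutoff R n)\<^sup>2 * (cmod (co (z t) n))\<^sup>2) \<longlongrightarrow> (\<Sum>n\<in>G. (max 0 (1 - 0))\<^sup>2 * (cmod (co (z t) n))\<^sup>2)) at_top"
      by (intro tendsto_intros)
    then show "((\<lambda>R. \<Sum>n\<in>G. (cutoff R n)\<^sup>2 * (cmod (co (z t) n))\<^sup>2) \<longlongrightarrow> (\<Sum>n\<in>G. (cmod (co (z t) n))\<^sup>2)) at_top" by simp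
    have "\<forall>\<^sub>F R in at_top. \<forall>n\<in>G. freq n \<le> R" using G by (intro eventually_ball_finite ballI eventually_ge_at_top)
    then show "\<forall>\<^sub>F R in at_top. (\<Sum>n\<in>G. (cutoff R n)\<^sup>2 * (cmod (co (z t) n))\<^sup>2) \<le> ?B"
      using eventually_gt_at_top[of 0]
    proof eventually_elim
      case (elim R)
      have "(\<Sum>n\<in>G. (cutoff R n)\<^sup>2 * (cmod (co (z t) n))\<^sup>2) \<le> E R t"
        unfolding E_def using elim F by (intro sum_mono2) (auto simp: F_def)
      also have "\<dots> \<le> ?B" by (rule ER[OF elim(2)])
      finally show ?case .
    qed
  qed simp
  have "0 \<le> ?B" using fin[of "{}"] by simp
  have "norm (z t) \<le> sqrt ?B"
  proof (rule l2_norm_leI)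
    show "L2_set (\<lambda>n. cmod (co (z t) n)) G \<le> sqrt ?B" if "finite G" for G
      unfolding L2_set_def by (rule real_sqrt_le_mono[OF fin[OF that]])
  qed (use \<open>0 \<le> ?B\<close> in simp)
  from power_mono[OF this norm_ge_zero, of 2] show ?thesis using \<open>0 \<le> ?B\<close> by (simp add: h_def[abs_def])
qed

section \<open>The cubic nonlinearity in the algebra\<close>

lemma rl_inject:
  assumes "\<And>y. rl k x y = rl k x' y" shows "x = (x' :: 'd l2)"
proof -
  have "trig (hat k x) = trig (hat k x')" using assms by (simp add: rl_trig[symmetric] fun_eq_iff)
  then have "hat k x = hat k x'"
    using fourier_coeff_trig[OF hat_abs_summable herm_hat, of x] fourier_coeff_trig[OF hat_abs_summable herm_hat, of x'] by metis
  then show ?thesis by (intro l2_eqI) (simp add: co_hat[of _ _ k])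
qed

lemma rl_linear: "rl k (x + y) v = rl k x v + rl k (y :: 'd l2) v" "rl k (r *\<^sub>R x) v = r * rl k x v"
proof -
  have s: "(\<lambda>n. hat k x n * cis (v \<bullet> lattice_vec n)) summable_on UNIV" for x :: "'d l2"
    by (rule abs_summable_summable[OF fser_abs_summable[OF hat_abs_summable]])
  show "rl k (x + y) v = rl k x v + rl k y v"
    unfolding rl_def fser_def by (simp add: distrib_right infsum_add[OF s s])
  show "rl k (r *\<^sub>R x) v = r * rl k x v"
    unfolding rl_def fser_def by (simp add: mult.assoc infsum_cmult_right')
qed

lemma rl_minus: "rl k (x - y) v = rl k x v - rl k (y :: 'd l2) v"
  using rl_linear(1)[of x "- y" v] rl_linear(2)[of "-1" y v] by simp

definition cub :: "'d l2 \<Rightarrow> 'd l2" where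
  "cub x = prd k x (prd k x x)"

lemma rl_cub: "rl k (cub x) v = (rl k x v) ^ 3"
  by (simp add: cub_def rl_prd power3_eq_cube)

text \<open>Checked pointwise: \<open>rl_inject\<close> turns identities of the algebra into
  polynomial identities of real numbers.\<close>

lemma cub_add:
  "cub (A *\<^sub>R \<phi> + w) = A ^ 3 *\<^sub>R cub \<phi> + (3 * A\<^sup>2) *\<^sub>R prd k (prd k \<phi> \<phi>) w + (3 * A) *\<^sub>R prd k \<phi> (prd k w w) + cub w"
  by (rule rl_inject) (simp add: rl_cub rl_linear rl_prd, algebra)

lemma finite_supp_cub: "finite (supp x) \<Longrightarrow> finite (supp (cub x))"
  unfolding cub_def by (intro finite_supp_prd)

lemmas prd_add_right = bounded_bilinear.add_right[OF bounded_bilinear_prd]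
lemmas prd_diff_right = bounded_bilinear.diff_right[OF bounded_bilinear_prd]
lemmas prd_diff_left = bounded_bilinear.diff_left[OF bounded_bilinear_prd]
lemmas prd_scaleR_right = bounded_bilinear.scaleR_right[OF bounded_bilinear_prd]
lemmas continuous_on_prd = bounded_bilinear.continuous_on[OF bounded_bilinear_prd]

definition pc :: real where "pc = 2 ^ Suc k * wsum"

lemma pc_nonneg: "0 \<le> pc" using wsum_nonneg by (simp add: pc_def)

lemma norm_prd: "norm (prd k x y :: 'd l2) \<le> pc * norm x * norm y"
  using norm_prd_le by (simp add: pc_def)

lemma norm_prd_mono: "norm x \<le> X \<Longrightarrow> norm y \<le> Y \<Longrightarrow> norm (prd k x y :: 'd l2) \<le> pc * X * Y"
  by (rule order_trans[OF norm_prd]) (intro mult_mono mult_nonneg_nonneg pc_nonneg norm_ge_zero order_refl; meson norm_ge_zero order_trans)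

lemma norm_cub_le: "norm x \<le> X \<Longrightarrow> norm (cub x) \<le> pc * X * (pc * X * X)"
  unfolding cub_def by (intro norm_prd_mono)

lemma square_lipschitz:
  fixes x y :: "'d l2"
  assumes "norm x \<le> X" "norm y \<le> X"
  shows "norm (prd k x x - prd k y y) \<le> 2 * pc * X * norm (x - y)"
proof -
  have "prd k x x - prd k y y = prd k (x - y) x + prd k y (x - y)"
    by (simp add: prd_diff_left prd_diff_right)
  also have "norm \<dots> \<le> pc * norm (x - y) * X + pc * X * norm (x - y)"
    by (intro norm_triangle_mono norm_prd_mono assms order_refl)
  finally show ?thesis by (simp add: mult_ac)
qed

lemma cub_lipschitz:
  assumes "norm x \<le> X" "norm y \<le> X"
  shows "norm (cub x - cub y) \<le> 3 * (pc * X)\<^sup>2 * norm (x - y)"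
proof -
  have "cub x - cub y = prd k (x - y) (prd k x x) + prd k y (prd k x x - prd k y y)"
    by (simp add: cub_def prd_diff_left prd_diff_right)
  also have "norm \<dots> \<le> pc * norm (x - y) * (pc * X * X) + pc * X * (2 * pc * X * norm (x - y))"
    by (intro norm_triangle_mono norm_prd_mono square_lipschitz assms order_refl)
  finally show ?thesis by (simp add: power2_eq_square algebra_simps)
qed

lemma continuous_on_cub: "continuous_on S f \<Longrightarrow> continuous_on S (\<lambda>t. cub (f t))"
  unfolding cub_def by (intro continuous_on_prd)

end

section \<open>A short impulsive motion\<close>

context sobolev
begin

text \<open>Each coefficient satisfies an ordinary differential equation, so no unbounded operator
  acts on the state. The finite set \<open>P\<close> holds the times at which a control switches,
  which permits concatenation.\<close>

definition sol :: "real \<Rightarrow> (real \<Rightarrow> 'd l2) \<Rightarrow> (real \<Rightarrow> 'd l2) \<Rightarrow> bool" where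
  "sol T c u \<longleftrightarrow> continuous_on {0..T} u \<and> (\<exists>P. finite P \<and> (\<forall>t\<in>{0<..<T} - P. \<forall>n.
     ((\<lambda>t. co (u t) n) has_vector_derivative
       lam n *\<^sub>R co (u t) n - (freq n)\<^sup>2 *\<^sub>R co (cub (u t)) n + co (c t) n) (at t)))"

text \<open>For \<open>u = z + r + A *\<^sub>R \<phi>\<close>, the part of the cube of
  \<open>u\<close> that is quadratic or cubic in \<open>z + r\<close>, with \<open>z\<close>
  retracted to the unit ball.\<close>

definition impulse_g :: "'d l2 \<Rightarrow> real \<Rightarrow> 'd l2 \<Rightarrow> 'd l2 \<Rightarrow> 'd l2" where
  "impulse_g \<phi> A r z = (3 * A) *\<^sub>R prd k \<phi> (prd k (retr 1 z + r) (retr 1 z + r)) + cub (retr 1 z + r)"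

text \<open>The terms that do not involve \<open>z\<close>, written under a Laplacian:
  \<open>- (freq n)^2\<close> times \<open>(freq n)^2 - 1\<close> is \<open>lam n\<close>, so the
  second summand produces the linear operator applied to
  \<open>r + A *\<^sub>R \<phi>\<close>.\<close>

definition impulse_s :: "'d l2 \<Rightarrow> real \<Rightarrow> 'd l2 \<Rightarrow> 'd l2" where
  "impulse_s \<phi> A r = (3 * A\<^sup>2) *\<^sub>R prd k (prd k \<phi> \<phi>) r + mul (\<lambda>n. (freq n)\<^sup>2 - 1) (r + A *\<^sub>R \<phi>)"

lemma impulse_g_bound:
  assumes A: "1 \<le> A" and r: "norm r \<le> X"
  shows "norm (impulse_g \<phi> A r z) \<le> (3 * (pc * norm \<phi> * (pc * (1 + X) * (1 + X))) + pc * (1 + X) * (pc * (1 + X) * (1 + X))) * A"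
proof -
  let ?w = "retr 1 z + r"
  have w: "norm ?w \<le> 1 + X" using norm_retr_le[of 1 z] r by (intro norm_triangle_mono) auto
  have X: "0 \<le> X" using r norm_ge_zero order_trans by blast
  have "norm (impulse_g \<phi> A r z) \<le> norm ((3 * A) *\<^sub>R prd k \<phi> (prd k ?w ?w)) + norm (cub ?w)"
    unfolding impulse_g_def by (rule norm_triangle_ineq)
  also have "norm ((3 * A) *\<^sub>R prd k \<phi> (prd k ?w ?w)) \<le> (3 * A) * (pc * norm \<phi> * (pc * (1 + X) * (1 + X)))"
    using A by (simp only: norm_scaleR) (intro mult_mono norm_prd_mono w order_refl, auto)
  also have "norm (cub ?w) \<le> pc * (1 + X) * (pc * (1 + X) * (1 + X)) * 1" using norm_cub_le[OF w] by simp
  also have "pc * (1 + X) * (pc * (1 + X) * (1 + X)) * 1 \<le> pc * (1 + X) * (pc * (1 + X) * (1 + X)) * A"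
    using A X by (intro mult_left_mono mult_nonneg_nonneg pc_nonneg) auto
  finally show ?thesis by (simp add: algebra_simps)
qed

lemma impulse_g_lipschitz:
  assumes A: "0 \<le> A" and r: "norm r \<le> X"
  shows "norm (impulse_g \<phi> A r x - impulse_g \<phi> A r y) \<le>
    (3 * A * (pc * norm \<phi> * (2 * pc * (1 + X))) + 3 * (pc * (1 + X))\<^sup>2) * 2 * norm (x - y)"
proof -
  let ?x = "retr 1 x + r" and ?y = "retr 1 y + r"
  have w: "norm (retr 1 z + r) \<le> 1 + X" for z using norm_retr_le[of 1 z] r by (intro norm_triangle_mono) auto
  have X: "0 \<le> X" using r norm_ge_zero order_trans by blast
  have d: "norm (?x - ?y) \<le> 2 * norm (x - y)" using retr_lipschitz[of 1 x y] by simp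
  have "impulse_g \<phi> A r x - impulse_g \<phi> A r y = (3 * A) *\<^sub>R prd k \<phi> (prd k ?x ?x - prd k ?y ?y) + (cub ?x - cub ?y)"
    by (simp add: impulse_g_def prd_diff_right scaleR_diff_right)
  also have "norm \<dots> \<le> (3 * A) * (pc * norm \<phi> * (2 * pc * (1 + X) * norm (?x - ?y))) + 3 * (pc * (1 + X))\<^sup>2 * norm (?x - ?y)"
  proof (rule norm_triangle_mono[OF _ cub_lipschitz[OF w w]])
    show "norm ((3 * A) *\<^sub>R prd k \<phi> (prd k ?x ?x - prd k ?y ?y)) \<le> (3 * A) * (pc * norm \<phi> * (2 * pc * (1 + X) * norm (?x - ?y)))"
      using A by (simp only: norm_scaleR) (intro mult_mono norm_prd_mono square_lipschitz w order_refl, auto)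
  qed
  also have "\<dots> = (3 * A * (pc * norm \<phi> * (2 * pc * (1 + X))) + 3 * (pc * (1 + X))\<^sup>2) * norm (?x - ?y)"
    by (simp add: algebra_simps)
  also have "\<dots> \<le> (3 * A * (pc * norm \<phi> * (2 * pc * (1 + X))) + 3 * (pc * (1 + X))\<^sup>2) * (2 * norm (x - y))"
    using A X by (intro mult_left_mono d add_nonneg_nonneg mult_nonneg_nonneg pc_nonneg) auto
  finally show ?thesis by (simp only: mult.assoc)
qed

lemma impulse_s_bound:
  assumes A: "1 \<le> A" and fin: "finite (supp \<phi>)" "finite (supp r)" and S: "\<And>n. n \<in> supp \<phi> \<union> supp r \<union> supp (prd k (prd k \<phi> \<phi>) r) \<Longrightarrow> (freq n)\<^sup>2 \<le> S"
    and S0: "0 \<le> S" and r: "norm r \<le> X"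
  shows "norm (lap (impulse_s \<phi> A r)) \<le> (S * (3 * (pc * (pc * norm \<phi> * norm \<phi>) * X) + (S + 1) * (X + norm \<phi>))) * A\<^sup>2"
proof -
  let ?q = "prd k \<phi> \<phi>" let ?v = "r + A *\<^sub>R \<phi>"
  let ?P = "\<lambda>n. n \<in> supp \<phi> \<union> supp r \<union> supp (prd k ?q r)"
  have X: "0 \<le> X" using r norm_ge_zero order_trans by blast
  have fv: "finite (supp ?v)" by (intro finite_supp_add finite_supp_scaleR fin)
  have fp: "finite (supp (prd k ?q r))" by (intro finite_supp_prd fin)
  have fm: "finite (supp (mul (\<lambda>n. (freq n)\<^sup>2 - 1) ?v))" by (rule finite_supp_mul[OF _ fv]) simp
  have fs: "finite (supp (impulse_s \<phi> A r))"
    unfolding impulse_s_def by (intro finite_supp_add finite_supp_scaleR fp fm)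
  \<comment> \<open>A bounded even symbol that agrees with \<open>(freq n)^2\<close> on all
    frequencies present, so that \<open>norm_mul_le\<close> applies to the Laplacian.\<close>
  define S' where "S' n = min ((freq n)\<^sup>2) S" for n :: "int^'d"
  have S': "\<bar>S' n\<bar> \<le> S" "S' (- n) = S' n" "\<bar>S' n - 1\<bar> \<le> S + 1" for n
  proof -
    have "0 \<le> S' n" "S' n \<le> S" using S0 by (auto simp: S'_def)
    then show "\<bar>S' n\<bar> \<le> S" "\<bar>S' n - 1\<bar> \<le> S + 1" by linarith+
  qed (simp add: S'_def)
  have out: "co ?v n = 0" "co (prd k ?q r) n = 0" if "\<not> ?P n" for n
    using that by (auto simp: supp_def)
  have comul: "co (mul (\<lambda>n. (freq n)\<^sup>2 - 1) ?v) n = of_real ((freq n)\<^sup>2 - 1) * co ?v n" for n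
    by (rule co_mul_finite[OF _ fv]) simp
  have comul': "co (mul (\<lambda>n. S' n - 1) ?v) n = of_real (S' n - 1) * co ?v n" for n
    by (rule co_mul[where m="\<lambda>n. S' n - 1" and B="S + 1"]) (simp_all only: S')
  have e1: "impulse_s \<phi> A r = (3 * A\<^sup>2) *\<^sub>R prd k ?q r + mul (\<lambda>n. S' n - 1) ?v"
  proof (rule l2_eqI)
    fix n
    show "co (impulse_s \<phi> A r) n = co ((3 * A\<^sup>2) *\<^sub>R prd k ?q r + mul (\<lambda>n. S' n - 1) ?v) n"
      using out(1)[of n] S[of n] unfolding impulse_s_def co_plus comul comul' by (cases "?P n") (auto simp: S'_def)
  qed
  have e2: "lap (impulse_s \<phi> A r) = - mul S' (impulse_s \<phi> A r)"
  proof (rule l2_eqI)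
    fix n
    have c: "co (mul S' (impulse_s \<phi> A r)) n = of_real (S' n) * co (impulse_s \<phi> A r) n"
      by (rule co_mul[where m=S' and B=S]) (rule S')+
    show "co (lap (impulse_s \<phi> A r)) n = co (- mul S' (impulse_s \<phi> A r)) n"
    proof (cases "?P n")
      case True
      then show ?thesis using S[of n] by (simp add: co_lap[OF fs] c S'_def scaleR_conv_of_real)
    next
      case False
      then have "co (impulse_s \<phi> A r) n = 0"
        using out[OF False] unfolding impulse_s_def co_plus comul by simp
      then show ?thesis by (simp add: co_lap[OF fs] c)
    qed
  qed
  have le: "norm (lap (impulse_s \<phi> A r)) \<le> S * norm (impulse_s \<phi> A r)"
    unfolding e2 norm_minus_cancel by (rule norm_mul_le[where m=S' and B=S]) (rule S')+
  have "norm (impulse_s \<phi> A r) \<le> (3 * A\<^sup>2) * (pc * (pc * norm \<phi> * norm \<phi>) * X) + (S + 1) * (X * A\<^sup>2 + A\<^sup>2 * norm \<phi>)"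
    unfolding e1
  proof (rule norm_triangle_mono)
    show "norm ((3 * A\<^sup>2) *\<^sub>R prd k ?q r) \<le> (3 * A\<^sup>2) * (pc * (pc * norm \<phi> * norm \<phi>) * X)"
      by (simp only: norm_scaleR) (intro mult_mono norm_prd_mono norm_prd r, auto)
    have A2: "1 \<le> A\<^sup>2" "A \<le> A\<^sup>2" using A one_le_power[OF A, of 2] power_increasing[of 1 2 A] by simp_all
    have "norm (mul (\<lambda>n. S' n - 1) ?v) \<le> (S + 1) * norm ?v"
      by (rule norm_mul_le[where m="\<lambda>n. S' n - 1" and B="S + 1"]) (simp_all only: S')
    also have "norm ?v \<le> X * A\<^sup>2 + A\<^sup>2 * norm \<phi>"
    proof (rule norm_triangle_mono)
      show "norm r \<le> X * A\<^sup>2" using r mult_left_mono[OF A2(1) X] by simp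
      show "norm (A *\<^sub>R \<phi>) \<le> A\<^sup>2 * norm \<phi>" using A A2 by (auto intro: mult_right_mono)
    qed
    finally show "norm (mul (\<lambda>n. S' n - 1) ?v) \<le> (S + 1) * (X * A\<^sup>2 + A\<^sup>2 * norm \<phi>)" using S0 by simp
  qed
  from order_trans[OF le mult_left_mono[OF this S0]] show ?thesis by (simp add: algebra_simps)
qed

text \<open>The path \<open>r (t / \<delta>) + A *\<^sub>R \<phi>\<close> is subtracted from the
  solution. Since \<open>1 / \<delta> = A^3\<close>, its velocity equals the two largest terms, the
  Laplacian of the cube of \<open>A *\<^sub>R \<phi>\<close> and the control. The remainder
  \<open>z\<close> starts at \<open>z0\<close> and is driven by sources of size at most a multiple
  of \<open>A^2\<close> for a time \<open>A^-3\<close>. All data except \<open>z0\<close> are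
  trigonometric polynomials, so their derivatives only change the constants.\<close>

lemma impulse_exists:
  fixes a \<phi> \<eta> :: "'d l2"
  assumes fin: "finite (supp a)" "finite (supp \<phi>)" "finite (supp \<eta>)" and e: "0 < e" "e \<le> 1 / 2" and \<tau>: "0 < \<tau>"
  obtains A \<delta> where "1 \<le> A" "0 < \<delta>" "\<delta> \<le> \<tau>"
    "\<And>z0. norm z0 \<le> e \<Longrightarrow> \<exists>u. sol \<delta> (\<lambda>_. (1 / \<delta>) *\<^sub>R \<eta>) u \<and> u 0 = z0 + a + A *\<^sub>R \<phi> \<and>
       norm (u \<delta> - (a + A *\<^sub>R \<phi> + lap (cub \<phi>) + \<eta>)) \<le> 2 * e"
proof -
  define q where "q = prd k \<phi> \<phi>"
  define v where "v = lap (cub \<phi>) + \<eta>"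
  have fcub: "finite (supp (cub \<phi>))" by (rule finite_supp_cub[OF fin(2)])
  have fv: "finite (supp v)" unfolding v_def by (intro finite_supp_add finite_supp_lap fcub fin)
  define X where "X = norm a + norm v"
  define r where "r \<theta> = a + \<theta> *\<^sub>R v" for \<theta> :: real
  have X: "0 \<le> X" by (simp add: X_def)
  have rX: "norm (r \<theta>) \<le> X" if "0 \<le> \<theta>" "\<theta> \<le> 1" for \<theta>
    unfolding r_def X_def using that by (intro norm_triangle_mono) (auto intro: mult_left_le_one_le)
  have fr: "finite (supp (r \<theta>))" for \<theta> unfolding r_def by (intro finite_supp_add finite_supp_scaleR fin fv)
  define U where "U = supp \<phi> \<union> supp a \<union> supp v \<union> supp (prd k q a) \<union> supp (prd k q v)"
  have fU: "finite U" unfolding U_def q_def by (intro finite_UnI finite_supp_prd fin fv)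
  define S where "S = (\<Sum>n\<in>U. (freq n)\<^sup>2)"
  have S0: "0 \<le> S" by (simp add: S_def sum_nonneg)
  have S: "(freq n)\<^sup>2 \<le> S" if "n \<in> supp \<phi> \<union> supp (r \<theta>) \<union> supp (prd k (prd k \<phi> \<phi>) (r \<theta>))" for n \<theta>
  proof -
    have "n \<in> U" using that by (auto simp: U_def supp_def r_def prd_add_right prd_scaleR_right q_def)
    then show ?thesis unfolding S_def using fU by (intro member_le_sum) auto
  qed
  define G1 where "G1 = 3 * (pc * norm \<phi> * (pc * (1 + X) * (1 + X))) + pc * (1 + X) * (pc * (1 + X) * (1 + X))"
  define S1 where "S1 = S * (3 * (pc * (pc * norm \<phi> * norm \<phi>) * X) + (S + 1) * (X + norm \<phi>))"
  define C where "C = comm_const \<phi>"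
  have C: "0 \<le> C" unfolding C_def by (rule comm_const_nonneg)
  define K1 where "K1 = 2 + 9 * C\<^sup>2 / 2 + 3 * C"
  define K2 where "K2 = 2 * G1\<^sup>2 + S1\<^sup>2"
  have K: "0 \<le> K1" "0 \<le> K2" using C by (simp_all add: K1_def K2_def)
  \<comment> \<open>The summands secure, in this order: \<open>1 \<le> b\<close>;
    \<open>\<delta> \<le> \<tau>\<close>; a Gronwall factor of at most 2; a total source
    contribution of at most \<open>e^2\<close>.\<close>
  define b where "b = 1 + 1 / \<tau> + K1 * exp K1 + K2 / e\<^sup>2"
  have b: "1 \<le> b" "1 / \<tau> \<le> b" "K1 * exp K1 \<le> b" "K2 / e\<^sup>2 \<le> b"
    using K \<tau> e unfolding b_def by (simp_all add: add_nonneg_nonneg add_increasing add_increasing2)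
  define A where "A = b ^ 3"
  define \<delta> where "\<delta> = 1 / A ^ 3"
  have A: "1 \<le> A" using b(1) by (simp add: A_def)
  have bA: "b \<le> A ^ 3" using power_increasing[of 1 9 b] b(1) by (simp add: A_def power_mult[symmetric])
  have \<delta>: "0 < \<delta>" using A by (simp add: \<delta>_def)
  have \<delta>\<tau>: "\<delta> \<le> \<tau>"
  proof -
    have "1 / \<tau> \<le> A ^ 3" using b(2) bA by linarith
    then show ?thesis using \<tau> A by (simp add: \<delta>_def field_simps)
  qed
  have main: "\<exists>u. sol \<delta> (\<lambda>_. (1 / \<delta>) *\<^sub>R \<eta>) u \<and> u 0 = z0 + a + A *\<^sub>R \<phi> \<and> norm (u \<delta> - (a + A *\<^sub>R \<phi> + lap (cub \<phi>) + \<eta>)) \<le> 2 * e"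
    if z0: "norm z0 \<le> e" for z0
  proof -
    define G where "G t z = (3 * A\<^sup>2) *\<^sub>R prd k q z + impulse_g \<phi> A (r (t / \<delta>)) z + impulse_s \<phi> A (r (t / \<delta>))" for t z
    have \<theta>: "0 \<le> t / \<delta>" "t / \<delta> \<le> 1" if "t \<in> {0..\<delta>}" for t using that \<delta> by auto
    have gc: "continuous_on {0..\<delta>} (\<lambda>t. impulse_g \<phi> A (r (t / \<delta>)) (z t))" if "continuous_on {0..\<delta>} z" for z
      unfolding impulse_g_def r_def
      by (intro continuous_intros continuous_on_prd continuous_on_cub continuous_on_retr that) (use \<delta> in auto)
    have mulr: "mul (\<lambda>n. (freq n)\<^sup>2 - 1) (r \<theta> + A *\<^sub>R \<phi>) = mul (\<lambda>n. (freq n)\<^sup>2 - 1) (a + A *\<^sub>R \<phi>) + \<theta> *\<^sub>R mul (\<lambda>n. (freq n)\<^sup>2 - 1) v" for \<theta>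
    proof (rule l2_eqI)
      fix n
      have c: "co (mul (\<lambda>n. (freq n)\<^sup>2 - 1) x) n = of_real ((freq n)\<^sup>2 - 1) * co x n" if "finite (supp x)" for x :: "'d l2"
        by (rule co_mul_finite[OF _ that]) simp
      show "co (mul (\<lambda>n. (freq n)\<^sup>2 - 1) (r \<theta> + A *\<^sub>R \<phi>)) n = co (mul (\<lambda>n. (freq n)\<^sup>2 - 1) (a + A *\<^sub>R \<phi>) + \<theta> *\<^sub>R mul (\<lambda>n. (freq n)\<^sup>2 - 1) v) n"
        by (simp add: c fr fv fin finite_supp_add finite_supp_scaleR r_def algebra_simps)
    qed
    have sc: "continuous_on {0..\<delta>} (\<lambda>t. impulse_s \<phi> A (r (t / \<delta>)))"
      unfolding impulse_s_def mulr unfolding r_def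
      by (intro continuous_intros continuous_on_prd) (use \<delta> in auto)
    \<comment> \<open>Existence of \<open>z\<close> needs only some Lipschitz constant, however
      large in \<open>A\<close>; the size of \<open>z\<close> comes from the energy
      estimate.\<close>
    define L where "L = 3 * A\<^sup>2 * (pc * norm q) + (3 * A * (pc * norm \<phi> * (2 * pc * (1 + X))) + 3 * (pc * (1 + X))\<^sup>2) * 2"
    have Gc: "continuous_on {0..\<delta>} (\<lambda>t. G t (z t))" if "continuous_on {0..\<delta>} z" for z
      unfolding G_def by (intro continuous_intros continuous_on_prd gc sc that)
    have Gl: "norm (G t x - G t y) \<le> L * norm (x - y)" if t: "t \<in> {0..\<delta>}" for t x y
    proof -
      have "G t x - G t y = (3 * A\<^sup>2) *\<^sub>R prd k q (x - y) + (impulse_g \<phi> A (r (t / \<delta>)) x - impulse_g \<phi> A (r (t / \<delta>)) y)"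
        by (simp add: G_def prd_diff_right scaleR_diff_right)
      also have "norm \<dots> \<le> (3 * A\<^sup>2) * (pc * norm q * norm (x - y)) +
          (3 * A * (pc * norm \<phi> * (2 * pc * (1 + X))) + 3 * (pc * (1 + X))\<^sup>2) * 2 * norm (x - y)"
      proof (rule norm_triangle_mono)
        show "norm ((3 * A\<^sup>2) *\<^sub>R prd k q (x - y)) \<le> (3 * A\<^sup>2) * (pc * norm q * norm (x - y))"
          by (simp only: norm_scaleR) (intro mult_mono norm_prd, auto)
      qed (use A in \<open>intro impulse_g_lipschitz rX \<theta> t, auto\<close>)
      also have "\<dots> = L * norm (x - y)" by (simp add: L_def algebra_simps)
      finally show ?thesis .
    qed
    obtain z where zc: "continuous_on {0..\<delta>} z" and z: "\<And>t. t \<in> {0..\<delta>} \<Longrightarrow> z t = sg t z0 + duh (\<lambda>s. G s (z s)) t"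
      by (rule duhamel_fixed_point[of \<delta> G L z0]) (use \<delta> Gc Gl in auto)
    define g where "g t = impulse_g \<phi> A (r (t / \<delta>)) (z t)" for t
    define s where "s t = lap (impulse_s \<phi> A (r (t / \<delta>)))" for t
    have fs: "finite (supp (impulse_s \<phi> A (r \<theta>)))" for \<theta>
      unfolding impulse_s_def
      by (intro finite_supp_add finite_supp_scaleR finite_supp_prd finite_supp_mul fin fr) auto
    have deriv: "((\<lambda>t. co (z t) n) has_vector_derivative
        lam n *\<^sub>R co (z t) n - (freq n)\<^sup>2 *\<^sub>R ((3 * A\<^sup>2) *\<^sub>R co (prd k (prd k \<phi> \<phi>) (z t)) n + co (g t) n) + co (s t) n) (at t within {0..\<delta>})"
      if t: "t \<in> {0..\<delta>}" for t n
    proof -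
      have "co (G t (z t)) n = (3 * A\<^sup>2) *\<^sub>R co (prd k (prd k \<phi> \<phi>) (z t)) n + co (g t) n + co (impulse_s \<phi> A (r (t / \<delta>))) n"
        by (simp add: G_def g_def q_def scaleR_conv_of_real)
      then have "lam n *\<^sub>R co (z t) n - (freq n)\<^sup>2 *\<^sub>R co (G t (z t)) n =
          lam n *\<^sub>R co (z t) n - (freq n)\<^sup>2 *\<^sub>R ((3 * A\<^sup>2) *\<^sub>R co (prd k (prd k \<phi> \<phi>) (z t)) n + co (g t) n) + co (s t) n"
        by (simp add: s_def co_lap[OF fs] scaleR_add_right)
      then show ?thesis using mild_has_vector_derivative[OF Gc[OF zc] z t, of n] by (simp only:)
    qed
    have z00: "z 0 = z0" using z[of 0] \<delta> by simp
    have sc': "continuous_on {0..\<delta>} s"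
    proof (rule continuous_on_finite_modes[where F=U])
      have "co (s t) n = - ((freq n)\<^sup>2 *\<^sub>R co (impulse_s \<phi> A (r (t / \<delta>))) n)" for t n
        unfolding s_def by (rule co_lap[OF fs])
      then show "continuous_on {0..\<delta>} (\<lambda>t. co (s t) n)" for n
        by (simp only:) (intro continuous_intros continuous_on_co sc)
      show "co (s t) n = 0" if "n \<notin> U" for t n
      proof -
        have c: "co (mul (\<lambda>n. (freq n)\<^sup>2 - 1) (r (t / \<delta>) + A *\<^sub>R \<phi>)) n = of_real ((freq n)\<^sup>2 - 1) * co (r (t / \<delta>) + A *\<^sub>R \<phi>) n"
          by (rule co_mul_finite) (simp_all add: fr fin finite_supp_add finite_supp_scaleR)
        show ?thesis unfolding s_def co_lap[OF fs] unfolding impulse_s_def co_plus c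
          using that by (simp add: U_def supp_def r_def prd_add_right prd_scaleR_right q_def)
      qed
    qed (rule fU)
    \<comment> \<open>With \<open>A = b^3\<close>, this balances the two commutator costs:
      \<open>(A^2 * \<kappa>)^2\<close> and \<open>A^2 / \<kappa>\<close> are both
      \<open>b^8\<close>, one power below \<open>1 / \<delta> = b^9\<close>.\<close>
    define \<kappa> where "\<kappa> = 1 / b\<^sup>2"
    define rate where "rate = 1 + A\<^sup>2 + (3 * A\<^sup>2 * C * \<kappa>)\<^sup>2 / 2 + 3 * A\<^sup>2 * C / \<kappa>"
    have rate0: "0 \<le> rate" using C A b(1) by (simp add: rate_def \<kappa>_def)
    have rate\<delta>: "rate * \<delta> \<le> K1 / b"
    proof -
      have p: "A\<^sup>2 = b ^ 6" "A ^ 3 = b ^ 9" by (simp_all add: A_def power_mult[symmetric])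
      have bb: "b ^ 8 * b = b ^ 9" by (simp add: power_Suc[symmetric] mult.commute del: power_Suc)
      have "3 * A\<^sup>2 * C * \<kappa> = 3 * C * b ^ 4"
      proof -
        have "b ^ 6 = b ^ 4 * b\<^sup>2" by (simp add: power_add[symmetric])
        moreover have "b ^ 4 * b\<^sup>2 / b\<^sup>2 = b ^ 4" using b(1) by (intro nonzero_mult_div_cancel_right) auto
        moreover have "3 * A\<^sup>2 * C * \<kappa> = 3 * C * (b ^ 6 / b\<^sup>2)" by (simp add: p \<kappa>_def)
        ultimately show ?thesis by (simp only:)
      qed
      then have "(3 * A\<^sup>2 * C * \<kappa>)\<^sup>2 = (3 * C * b ^ 4)\<^sup>2" by (simp only:)
      then have e1: "(3 * A\<^sup>2 * C * \<kappa>)\<^sup>2 / 2 = 9 * C\<^sup>2 / 2 * b ^ 8"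
        by (simp only: power_mult_distrib power_mult[symmetric]) simp
      have e2: "3 * A\<^sup>2 * C / \<kappa> = 3 * C * b ^ 8"
        by (simp add: p \<kappa>_def mult_ac power_add[symmetric])
      moreover have "1 + A\<^sup>2 \<le> 2 * b ^ 8"
      proof -
        have "1 \<le> b ^ 8" "b ^ 6 \<le> b ^ 8" using b(1) by (auto intro: power_increasing one_le_power)
        then show ?thesis by (simp add: p)
      qed
      moreover have "K1 * b ^ 8 = 2 * b ^ 8 + 9 * C\<^sup>2 / 2 * b ^ 8 + 3 * C * b ^ 8"
        by (simp only: K1_def distrib_right)
      ultimately have "rate \<le> K1 * b ^ 8" unfolding rate_def e1 e2 by linarith
      then have "rate * \<delta> \<le> K1 * b ^ 8 * \<delta>" using \<delta> by (intro mult_right_mono) auto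
      also have "\<dots> = K1 / b" unfolding \<delta>_def p using b(1) bb by (simp add: field_simps)
      finally show ?thesis .
    qed
    \<comment> \<open>With \<open>\<mu> = A^2\<close> the source of size \<open>A^2\<close>
      contributes a multiple of \<open>A^2\<close>, and \<mu> adds the same order to the rate; both
      are small over a time \<open>A^-3\<close>.\<close>
    define c where "c = 2 * (G1 * A)\<^sup>2 + (S1 * A\<^sup>2)\<^sup>2 / A\<^sup>2"
    have c\<delta>: "c * \<delta> \<le> K2 / b"
    proof -
      have "c = K2 * A\<^sup>2" using A by (simp add: c_def K2_def power_mult_distrib power2_eq_square algebra_simps)
      then have "c * \<delta> = K2 / A" using A by (simp add: \<delta>_def power2_eq_square power3_eq_cube)
      also have "\<dots> \<le> K2 / b"
      proof (rule divide_left_mono)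
        show "b \<le> A" using power_increasing[of 1 3 b] b(1) by (simp add: A_def)
      qed (use K A b in auto)
      finally show ?thesis .
    qed
    have yle: "(norm (z t))\<^sup>2 \<le> (e\<^sup>2 + c * \<delta>) + rate * integral {0..t} (\<lambda>t. (norm (z t))\<^sup>2)" if t: "t \<in> {0..\<delta>}" for t
    proof -
      have sub: "{0..t} \<subseteq> {0..\<delta>}" using t by auto
      note ci = integrable_continuous_interval[OF continuous_on_subset[OF _ sub]]
      have "(norm (z t))\<^sup>2 \<le> (norm (z 0))\<^sup>2 + integral {0..t} (\<lambda>t. rate * (norm (z t))\<^sup>2 + 2 * (norm (g t))\<^sup>2 + (norm (s t))\<^sup>2 / A\<^sup>2)"
        using energy_estimate[OF fin(2), of \<kappa> "A\<^sup>2" "3 * A\<^sup>2" \<delta> z g s t] b(1) A deriv t zc sc' gc[OF zc]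
        by (simp add: rate_def C_def \<kappa>_def g_def[abs_def])
      also have "integral {0..t} (\<lambda>t. rate * (norm (z t))\<^sup>2 + 2 * (norm (g t))\<^sup>2 + (norm (s t))\<^sup>2 / A\<^sup>2)
          \<le> integral {0..t} (\<lambda>t. rate * (norm (z t))\<^sup>2 + c)"
      proof (rule integral_le)
        show "(\<lambda>t. rate * (norm (z t))\<^sup>2 + 2 * (norm (g t))\<^sup>2 + (norm (s t))\<^sup>2 / A\<^sup>2) integrable_on {0..t}"
          unfolding g_def using A by (intro ci continuous_intros zc gc sc') auto
        show "(\<lambda>t. rate * (norm (z t))\<^sup>2 + c) integrable_on {0..t}" by (intro ci continuous_intros zc)
        fix x assume "x \<in> {0..t}"
        then have x: "x \<in> {0..\<delta>}" using sub by auto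
        have "norm (g x) \<le> G1 * A" unfolding g_def G1_def by (rule impulse_g_bound[OF A rX[OF \<theta>[OF x]]])
        then have g2: "(norm (g x))\<^sup>2 \<le> (G1 * A)\<^sup>2" by (intro power_mono) auto
        have "norm (s x) \<le> S1 * A\<^sup>2" unfolding s_def S1_def
          by (rule impulse_s_bound[OF A fin(2) fr S S0 rX[OF \<theta>[OF x]]])
        then have "(norm (s x))\<^sup>2 \<le> (S1 * A\<^sup>2)\<^sup>2" by (intro power_mono) auto
        then have "(norm (s x))\<^sup>2 / A\<^sup>2 \<le> (S1 * A\<^sup>2)\<^sup>2 / A\<^sup>2" by (intro divide_right_mono) auto
        with g2 show "rate * (norm (z x))\<^sup>2 + 2 * (norm (g x))\<^sup>2 + (norm (s x))\<^sup>2 / A\<^sup>2 \<le> rate * (norm (z x))\<^sup>2 + c"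
          unfolding c_def by linarith
      qed
      also have "\<dots> = rate * integral {0..t} (\<lambda>t. (norm (z t))\<^sup>2) + c * t"
        using t by (subst integral_add) (auto intro!: ci continuous_intros zc)
      also have "c * t \<le> c * \<delta>" using t by (intro mult_left_mono) (auto simp: c_def)
      also have "(norm (z 0))\<^sup>2 \<le> e\<^sup>2" unfolding z00 using z0 by (intro power_mono) auto
      finally show ?thesis by simp
    qed
    have small: "norm (z t) \<le> 2 * e" if t: "t \<in> {0..\<delta>}" for t
    proof -
      have "(norm (z t))\<^sup>2 \<le> (e\<^sup>2 + c * \<delta>) * (1 + rate * \<delta> * exp (rate * \<delta>))"
        by (rule gronwall[OF _ yle rate0 _ t]) (use zc \<delta> in \<open>auto intro!: continuous_intros simp: c_def\<close>)
      also have "\<dots> \<le> (e\<^sup>2 + e\<^sup>2) * (1 + 1)"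
      proof (rule mult_mono)
        have "K2 / b \<le> e\<^sup>2" using b(4) b(1) e by (simp add: field_simps)
        then show "e\<^sup>2 + c * \<delta> \<le> e\<^sup>2 + e\<^sup>2" using c\<delta> by linarith
        have kb: "K1 / b \<le> K1" using K(1) b(1) by (simp add: divide_le_eq mult_le_cancel_left1)
        have "rate * \<delta> * exp (rate * \<delta>) \<le> (K1 / b) * exp K1"
          using rate\<delta> kb rate0 \<delta> K b(1) by (intro mult_mono) (auto intro: divide_nonneg_nonneg)
        also have "\<dots> \<le> 1" using b(3) b(1) by (simp add: field_simps)
        finally show "1 + rate * \<delta> * exp (rate * \<delta>) \<le> 1 + 1" by simp
      qed (use rate0 \<delta> in auto)
      also have "\<dots> = (2 * e)\<^sup>2" by (simp add: power2_eq_square)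
      finally show ?thesis by (rule power2_le_imp_le) (use e in simp)
    qed
    define u where "u t = z t + r (t / \<delta>) + A *\<^sub>R \<phi>" for t
    have "sol \<delta> (\<lambda>_. (1 / \<delta>) *\<^sub>R \<eta>) u" unfolding sol_def
    proof (intro conjI exI[of _ "{}"] ballI allI)
      show "continuous_on {0..\<delta>} u" unfolding u_def r_def using \<delta> by (intro continuous_intros zc) auto
      fix t n assume "t \<in> {0<..<\<delta>} - {}"
      then have t: "t \<in> {0..\<delta>}" and at: "at t within {0..\<delta>} = at t" by (simp_all add: at_within_Icc_at)
      let ?D = "lam n *\<^sub>R co (z t) n - (freq n)\<^sup>2 *\<^sub>R ((3 * A\<^sup>2) *\<^sub>R co (prd k (prd k \<phi> \<phi>) (z t)) n + co (g t) n) + co (s t) n"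
      have "((\<lambda>t. t / \<delta>) has_real_derivative 1 / \<delta>) (at t within {0..\<delta>})"
        by (rule DERIV_cdivide[OF DERIV_ident])
      from has_vector_derivative_scaleR[OF this has_vector_derivative_const[of "co v n"]]
      have "((\<lambda>t. (t / \<delta>) *\<^sub>R co v n) has_vector_derivative (1 / \<delta>) *\<^sub>R co v n) (at t within {0..\<delta>})" by simp
      from has_vector_derivative_add[OF has_vector_derivative_add[OF deriv[OF t] this] has_vector_derivative_const[of "co a n + A *\<^sub>R co \<phi> n"]]
      have d0: "((\<lambda>t. co (z t) n + (t / \<delta>) *\<^sub>R co v n + (co a n + A *\<^sub>R co \<phi> n)) has_vector_derivative
          ?D + (1 / \<delta>) *\<^sub>R co v n) (at t within {0..\<delta>})" by (simp only: add_0_right)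
      have "(\<lambda>t. co (u t) n) = (\<lambda>t. co (z t) n + (t / \<delta>) *\<^sub>R co v n + (co a n + A *\<^sub>R co \<phi> n))"
        by (simp add: u_def r_def scaleR_conv_of_real fun_eq_iff)
      with d0 have d: "((\<lambda>t. co (u t) n) has_vector_derivative ?D + (1 / \<delta>) *\<^sub>R co v n) (at t within {0..\<delta>})"
        by (simp only:)
      \<comment> \<open>As \<open>e \<le> 1 / 2\<close>, the bound \<open>2 * e\<close> keeps
        \<open>z\<close> in the unit ball, so the retracted equation was the true one.\<close>
      have retr: "retr 1 (z t) = z t" using small[OF t] e by (simp add: retr_def)
      have cu: "cub (u t) = A ^ 3 *\<^sub>R cub \<phi> + (3 * A\<^sup>2) *\<^sub>R prd k (prd k \<phi> \<phi>) (z t) + (3 * A\<^sup>2) *\<^sub>R prd k (prd k \<phi> \<phi>) (r (t / \<delta>)) + g t"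
      proof -
        have "u t = A *\<^sub>R \<phi> + (z t + r (t / \<delta>))" by (simp add: u_def)
        then show ?thesis by (simp only: cub_add) (simp add: g_def impulse_g_def retr prd_add_right scaleR_add_right)
      qed
      have l: "lam n = - (freq n)\<^sup>2 * ((freq n)\<^sup>2 - 1)" by (simp add: lam_def algebra_simps power2_eq_square power4_eq_xxxx)
      have cm: "co (mul (\<lambda>n. (freq n)\<^sup>2 - 1) (r (t / \<delta>) + A *\<^sub>R \<phi>)) n = of_real ((freq n)\<^sup>2 - 1) * co (r (t / \<delta>) + A *\<^sub>R \<phi>) n"
        by (rule co_mul_finite) (simp_all add: fr fin finite_supp_add finite_supp_scaleR)
      have \<delta>A: "1 / \<delta> = A ^ 3" by (simp add: \<delta>_def)
      have "(lam n *\<^sub>R co (z t) n - (freq n)\<^sup>2 *\<^sub>R ((3 * A\<^sup>2) *\<^sub>R co (prd k (prd k \<phi> \<phi>) (z t)) n + co (g t) n) + co (s t) n)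
           + (1 / \<delta>) *\<^sub>R co v n
          = lam n *\<^sub>R co (u t) n - (freq n)\<^sup>2 *\<^sub>R co (cub (u t)) n + co ((1 / \<delta>) *\<^sub>R \<eta>) n"
        unfolding cu s_def co_lap[OF fs] unfolding impulse_s_def co_plus cm u_def v_def co_lap[OF fcub] \<delta>A l
        by (simp add: scaleR_conv_of_real algebra_simps)
      with d show "((\<lambda>t. co (u t) n) has_vector_derivative
          lam n *\<^sub>R co (u t) n - (freq n)\<^sup>2 *\<^sub>R co (cub (u t)) n + co ((1 / \<delta>) *\<^sub>R \<eta>) n) (at t)"
        by (simp only: at)
    qed simp
    moreover have "u 0 = z0 + a + A *\<^sub>R \<phi>" by (simp add: u_def r_def z00)
    moreover have "norm (u \<delta> - (a + A *\<^sub>R \<phi> + lap (cub \<phi>) + \<eta>)) \<le> 2 * e"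
      using small[of \<delta>] \<delta> by (simp add: u_def r_def v_def)
    ultimately show ?thesis by blast
  qed
  show ?thesis using A \<delta> \<delta>\<tau> main by (rule that)
qed

end

section \<open>Approximate reachability\<close>

text \<open>For \<open>n = 0\<close> both branches apply and the coefficient is
  \<open>2 * Re w\<close>, whence the \<open>1 / 2\<close> in \<open>one\<close>.\<close>

definition mode :: "int^'d \<Rightarrow> complex \<Rightarrow> 'd::finite l2" where
  "mode n w = mkl2 (\<lambda>m. (if m = n then w else 0) + (if m = - n then cnj w else 0))"

lemma co_mode: "co (mode n w) m = (if m = n then w else 0) + (if m = - n then cnj w else 0)"
proof -
  let ?c = "\<lambda>m. (if m = n then w else 0) + (if m = - n then cnj w else 0)"
  have "herm ?c"
    unfolding herm_def by (auto simp: equation_minus_iff)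
  moreover have "(\<lambda>m. (cmod (?c m))\<^sup>2) summable_on UNIV"
    by (rule summable_on_cong_neutral[THEN iffD1, OF _ _ _ summable_on_finite[of "{n, - n}"]]) auto
  ultimately have "co (mkl2 ?c) = ?c" by (rule co_mkl2_summable)
  then show ?thesis by (simp add: mode_def)
qed

lemma finite_supp_mode: "finite (supp (mode n w))"
  by (rule finite_subset[of _ "{n, - n}"]) (auto simp: supp_def co_mode split: if_splits)

lemma mode_decomposition:
  assumes "finite (supp x)" shows "x = (\<Sum>n\<in>supp x. (1/2) *\<^sub>R mode n (co x n))"
proof (rule l2_eqI)
  fix m
  have 1: "(\<Sum>n\<in>supp x. if m = n then co x n else 0) = co x m"
    using assms by (simp add: sum.delta' supp_def)
  have "(\<Sum>n\<in>supp x. if m = - n then cnj (co x n) else 0) = (\<Sum>n\<in>supp x. if - m = n then cnj (co x n) else 0)"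
    by (intro sum.cong refl) (auto simp: minus_equation_iff)
  also have "\<dots> = cnj (co x (- m))" using assms by (simp add: sum.delta' supp_def)
  also have "\<dots> = co x m" by (simp add: co_uminus_index)
  finally have 2: "(\<Sum>n\<in>supp x. if m = - n then cnj (co x n) else 0) = co x m" .
  have "co (\<Sum>n\<in>supp x. (1/2) *\<^sub>R mode n (co x n)) m =
      (1/2) * ((\<Sum>n\<in>supp x. if m = n then co x n else 0) + (\<Sum>n\<in>supp x. if m = - n then cnj (co x n) else 0))"
    by (simp add: co_mode sum.distrib[symmetric] sum_distrib_left)
  then show "co x m = co (\<Sum>n\<in>supp x. (1/2) *\<^sub>R mode n (co x n)) m" by (simp only: 1 2) simp
qed

text \<open>The elements representing the functions in \<open>H0\<close>.\<close>

definition base :: "'d::finite l2 set" where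
  "base = {x. supp x \<subseteq> {0} \<union> canonical_K \<union> uminus ` canonical_K}"

lemma finite_canonical_K: "finite (canonical_K :: (int^'d) set)"
  by (simp add: canonical_K_def)

lemma finite_supp_base: "x \<in> base \<Longrightarrow> finite (supp x)"
  unfolding base_def by (auto intro: finite_subset simp: finite_canonical_K)

lemma base_scaleR: "x \<in> base \<Longrightarrow> r *\<^sub>R x \<in> base"
  by (auto simp: base_def supp_def)

lemma zero_in_base: "0 \<in> base"
  by (simp add: base_def supp_def)

lemma mode_in_base: "n \<in> {0} \<union> canonical_K \<union> uminus ` canonical_K \<Longrightarrow> mode n w \<in> base"
  by (auto simp: base_def supp_def co_mode split: if_splits)

text \<open>Finitely many values with Borel level sets: stable under concatenation, bounded, and
  already a simple curve, so measurability of the final control is immediate.\<close>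

definition ctl :: "(real \<Rightarrow> 'd::finite l2) \<Rightarrow> bool" where
  "ctl c \<longleftrightarrow> finite (range c) \<and> range c \<subseteq> base \<and> (\<forall>y. {t. c t = y} \<in> sets borel)"

lemma ctl_const: "x \<in> base \<Longrightarrow> ctl (\<lambda>_. x)"
  by (auto simp: ctl_def)

definition cat :: "real \<Rightarrow> (real \<Rightarrow> 'a) \<Rightarrow> (real \<Rightarrow> 'a) \<Rightarrow> real \<Rightarrow> 'a" where
  "cat s f g t = (if t \<le> s then f t else g (t - s))"

lemma ctl_cat:
  assumes "ctl c" "ctl d" shows "ctl (cat s c d)"
proof -
  have "range (cat s c d) \<subseteq> range c \<union> range d" by (auto simp: cat_def)
  moreover have "{t. cat s c d t = y} \<in> sets borel" for y
  proof -
    have "{t. cat s c d t = y} = ({..s} \<inter> {t. c t = y}) \<union> ({s<..} \<inter> (\<lambda>t. t - s) -` {t. d t = y})"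
      by (auto simp: cat_def)
    moreover have "(\<lambda>t. t - s) -` {t. d t = y} \<in> sets borel"
      using measurable_sets[of "\<lambda>t. t - s" borel borel "{t. d t = y}"] assms(2) by (simp add: ctl_def)
    ultimately show ?thesis using assms(1) by (auto simp: ctl_def)
  qed
  moreover have "finite (range c \<union> range d)" "range c \<union> range d \<subseteq> base" using assms by (auto simp: ctl_def)
  ultimately show ?thesis unfolding ctl_def by (blast intro: finite_subset)
qed

section \<open>Concatenation and stability of solutions, and reachability\<close>

context sobolev
begin

lemma cub_0 [simp]: "cub 0 = 0"
  by (simp add: cub_def bounded_bilinear.zero_left[OF bounded_bilinear_prd])

lemma lap_0 [simp]: "lap (0 :: 'd l2) = 0"
  by (rule l2_eqI) (simp add: co_lap supp_def)

lemma lap_add: "finite (supp x) \<Longrightarrow> finite (supp y) \<Longrightarrow> lap (x + y) = lap x + lap (y :: 'd l2)"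
  by (rule l2_eqI) (simp add: co_lap finite_supp_add scaleR_conv_of_real algebra_simps)

lemma lap_scaleR: "finite (supp x) \<Longrightarrow> lap (r *\<^sub>R x) = r *\<^sub>R lap (x :: 'd l2)"
  by (rule l2_eqI) (simp add: co_lap finite_supp_scaleR scaleR_conv_of_real algebra_simps)

lemma sol_subinterval: "sol T c u \<Longrightarrow> s \<le> T \<Longrightarrow> sol s c u"
  unfolding sol_def by (auto elim!: continuous_on_subset intro!: exI)

lemma sol_zero: "sol T (\<lambda>_. 0) (\<lambda>_. 0)"
  by (simp add: sol_def exI[of _ "{}"])

lemma sol_cat:
  assumes s: "0 \<le> s" "0 \<le> s'" and u: "sol s c u" and v: "sol s' d v" and uv: "v 0 = u s"
  shows "sol (s + s') (cat s c d) (cat s u v)"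
proof -
  obtain P where P: "finite P" "\<And>t n. t \<in> {0<..<s} - P \<Longrightarrow> ((\<lambda>t. co (u t) n) has_vector_derivative
      lam n *\<^sub>R co (u t) n - (freq n)\<^sup>2 *\<^sub>R co (cub (u t)) n + co (c t) n) (at t)"
    and uc: "continuous_on {0..s} u" using u by (auto simp: sol_def)
  obtain Q where Q: "finite Q" "\<And>t n. t \<in> {0<..<s'} - Q \<Longrightarrow> ((\<lambda>t. co (v t) n) has_vector_derivative
      lam n *\<^sub>R co (v t) n - (freq n)\<^sup>2 *\<^sub>R co (cub (v t)) n + co (d t) n) (at t)"
    and vc: "continuous_on {0..s'} v" using v by (auto simp: sol_def)
  let ?w = "cat s u v"
  have cont: "continuous_on {0..s + s'} ?w"
  proof -
    have "{0..s + s'} = {0..s} \<union> {s..s + s'}" using s by auto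
    moreover have "continuous_on {0..s} ?w"
      using uc by (rule continuous_on_eq) (auto simp: cat_def)
    moreover have "continuous_on {s..s + s'} ?w"
    proof (rule continuous_on_eq[of _ "\<lambda>t. v (t - s)"])
      show "continuous_on {s..s + s'} (\<lambda>t. v (t - s))"
        by (rule continuous_on_compose2[OF vc]) (auto intro!: continuous_intros)
    qed (use uv in \<open>auto simp: cat_def\<close>)
    ultimately show ?thesis by (auto intro!: continuous_on_closed_Un)
  qed
  have der: "((\<lambda>t. co (?w t) n) has_vector_derivative
      lam n *\<^sub>R co (?w t) n - (freq n)\<^sup>2 *\<^sub>R co (cub (?w t)) n + co (cat s c d t) n) (at t)"
    if t: "t \<in> {0<..<s + s'} - (P \<union> {s} \<union> (+) s ` Q)" for t n
  proof (cases "t < s")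
    case True
    then have "t \<in> {0<..<s} - P" using t by auto
    from P(2)[OF this] have "((\<lambda>t. co (?w t) n) has_vector_derivative
        lam n *\<^sub>R co (u t) n - (freq n)\<^sup>2 *\<^sub>R co (cub (u t)) n + co (c t) n) (at t)"
      by (rule has_vector_derivative_transform_within_open[of _ _ _ "{0<..<s}"]) (use True t in \<open>auto simp: cat_def\<close>)
    then show ?thesis using True by (simp add: cat_def)
  next
    case False
    then have ts: "s < t" using t by auto
    have "t - s \<notin> Q" using t by force
    then have "t - s \<in> {0<..<s'} - Q" using ts t by auto
    note q = Q(2)[OF this]
    have "((\<lambda>t. t - s) has_vector_derivative 1) (at t)" by (auto intro!: derivative_eq_intros)
    from vector_diff_chain_at[OF this q, of n]
    have "((\<lambda>t. co (v (t - s)) n) has_vector_derivative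
        lam n *\<^sub>R co (v (t - s)) n - (freq n)\<^sup>2 *\<^sub>R co (cub (v (t - s))) n + co (d (t - s)) n) (at t)"
      by (simp add: comp_def)
    then have "((\<lambda>t. co (?w t) n) has_vector_derivative
        lam n *\<^sub>R co (v (t - s)) n - (freq n)\<^sup>2 *\<^sub>R co (cub (v (t - s))) n + co (d (t - s)) n) (at t)"
      by (rule has_vector_derivative_transform_within_open[of _ _ _ "{s<..}"]) (use ts in \<open>auto simp: cat_def\<close>)
    then show ?thesis using ts by (simp add: cat_def)
  qed
  have "finite (P \<union> {s} \<union> (+) s ` Q)" using P(1) Q(1) by simp
  then show ?thesis unfolding sol_def
    by (intro conjI exI[of _ "P \<union> {s} \<union> (+) s ` Q"] ballI allI cont der)
qed

text \<open>The difference \<open>w\<close> solves an equation whose nonlinearity vanishes at 0 and,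
  after retraction, is globally Lipschitz. Gronwall's inequality gives the factor \<open>C\<close>,
  and the radius \<open>1 / C\<close> keeps \<open>w\<close> in the unit ball, where the retraction
  is the identity. In particular the perturbed solution exists on all of
  \<open>{0..T}\<close>.\<close>

lemma stability:
  assumes T: "0 \<le> T" and u: "sol T c u"
  obtains C \<rho> where "0 < C" "0 < \<rho>"
    "\<And>a. norm (a - u 0) \<le> \<rho> \<Longrightarrow> \<exists>v. sol T c v \<and> v 0 = a \<and> (\<forall>t\<in>{0..T}. norm (v t - u t) \<le> C * norm (a - u 0))"
proof -
  obtain P where P: "finite P" "\<And>t n. t \<in> {0<..<T} - P \<Longrightarrow> ((\<lambda>t. co (u t) n) has_vector_derivative
      lam n *\<^sub>R co (u t) n - (freq n)\<^sup>2 *\<^sub>R co (cub (u t)) n + co (c t) n) (at t)"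
    and uc: "continuous_on {0..T} u" using u by (auto simp: sol_def)
  have "bounded (u ` {0..T})" by (intro compact_imp_bounded compact_continuous_image uc) simp
  then obtain X where "\<forall>y\<in>u ` {0..T}. norm y \<le> X" unfolding bounded_iff by (rule exE)
  then have X: "norm (u t) \<le> X" if "t \<in> {0..T}" for t using that by blast
  have X0: "0 \<le> X" using order_trans[OF norm_ge_zero X[of 0]] T by simp
  define L where "L = 3 * (pc * (X + 1))\<^sup>2 * 2"
  define G where "G t w = cub (u t + retr 1 w) - cub (u t)" for t w
  have bd: "norm (u t + retr 1 w) \<le> X + 1" if "t \<in> {0..T}" for t w
    using X[OF that] norm_retr_le[of 1 w] by (intro norm_triangle_mono) auto
  have Gl: "norm (G t x - G t y) \<le> L * norm (x - y)" if t: "t \<in> {0..T}" for t x y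
  proof -
    have "norm (G t x - G t y) = norm (cub (u t + retr 1 x) - cub (u t + retr 1 y))" by (simp add: G_def)
    also have "\<dots> \<le> 3 * (pc * (X + 1))\<^sup>2 * norm (u t + retr 1 x - (u t + retr 1 y))"
      by (rule cub_lipschitz[OF bd[OF t] bd[OF t]])
    also have "\<dots> \<le> 3 * (pc * (X + 1))\<^sup>2 * (2 * norm (x - y))"
      using retr_lipschitz[of 1 x y] by (intro mult_left_mono) auto
    finally show ?thesis by (simp add: L_def)
  qed
  have Gc: "continuous_on {0..T} (\<lambda>t. G t (w t))" if "continuous_on {0..T} w" for w
    unfolding G_def by (intro continuous_intros continuous_on_cub continuous_on_retr uc that) simp
  have G0: "G t 0 = 0" for t by (simp add: G_def retr_def)
  define c1 where "c1 = 2 * exp T * L\<^sup>2"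
  define C where "C = sqrt (2 * (1 + c1 * T * exp (c1 * T)))"
  have c1: "0 \<le> c1" by (simp add: c1_def)
  have q: "1 \<le> 2 * (1 + c1 * T * exp (c1 * T))"
  proof -
    have "0 \<le> c1 * T * exp (c1 * T)" using c1 T by simp
    then show ?thesis by simp
  qed
  have C: "1 \<le> C" unfolding C_def using q by simp
  show ?thesis
  proof (rule that[of C "1 / C"])
    fix a assume a: "norm (a - u 0) \<le> 1 / C"
    obtain w where wc: "continuous_on {0..T} w" and w: "\<And>t. t \<in> {0..T} \<Longrightarrow> w t = sg t (a - u 0) + duh (\<lambda>s. G s (w s)) t"
      by (rule duhamel_fixed_point[of T G L "a - u 0"]) (use T Gc Gl in auto)
    have w0: "w 0 = a - u 0" using w[of 0] T by simp
    have le: "(norm (w t))\<^sup>2 \<le> 2 * (norm (a - u 0))\<^sup>2 + c1 * integral {0..t} (\<lambda>t. (norm (w t))\<^sup>2)" if t: "t \<in> {0..T}" for t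
    proof -
      have sub: "{0..t} \<subseteq> {0..T}" using t by auto
      note ci = integrable_continuous_interval[OF continuous_on_subset[OF _ sub]]
      have n1: "norm (sg t (a - u 0)) \<le> norm (a - u 0)" using t by (intro norm_sg_le) simp
      have "(norm (duh (\<lambda>s. G s (w s)) t))\<^sup>2 \<le> exp T * integral {0..t} (\<lambda>s. (norm (G s (w s)))\<^sup>2)"
        by (rule norm_duh_le[OF Gc[OF wc] t])
      also have "integral {0..t} (\<lambda>s. (norm (G s (w s)))\<^sup>2) \<le> integral {0..t} (\<lambda>s. L\<^sup>2 * (norm (w s))\<^sup>2)"
      proof (intro integral_le ci continuous_intros Gc wc)
        fix s assume "s \<in> {0..t}"
        then have "norm (G s (w s)) \<le> L * norm (w s)" using Gl[of s "w s" 0] sub by (auto simp: G0)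
        then have "(norm (G s (w s)))\<^sup>2 \<le> (L * norm (w s))\<^sup>2" by (intro power_mono) auto
        then show "(norm (G s (w s)))\<^sup>2 \<le> L\<^sup>2 * (norm (w s))\<^sup>2" by (simp only: power_mult_distrib)
      qed
      finally have n2: "(norm (duh (\<lambda>s. G s (w s)) t))\<^sup>2 \<le> exp T * (L\<^sup>2 * integral {0..t} (\<lambda>s. (norm (w s))\<^sup>2))" by simp
      have "norm (w t) \<le> norm (sg t (a - u 0)) + norm (duh (\<lambda>s. G s (w s)) t)" unfolding w[OF t] by (rule norm_triangle_ineq)
      then have "(norm (w t))\<^sup>2 \<le> (norm (sg t (a - u 0)) + norm (duh (\<lambda>s. G s (w s)) t))\<^sup>2" by (intro power_mono) auto
      also have "\<dots> \<le> 2 * (norm (sg t (a - u 0)))\<^sup>2 + 2 * (norm (duh (\<lambda>s. G s (w s)) t))\<^sup>2"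
        using zero_le_power2[of "norm (sg t (a - u 0)) - norm (duh (\<lambda>s. G s (w s)) t)"] by (simp add: power2_sum power2_diff)
      also have "(norm (sg t (a - u 0)))\<^sup>2 \<le> (norm (a - u 0))\<^sup>2" using n1 by (intro power_mono) auto
      finally show ?thesis using n2 by (simp add: c1_def)
    qed
    have small: "norm (w t) \<le> C * norm (a - u 0)" if t: "t \<in> {0..T}" for t
    proof -
      have "(norm (w t))\<^sup>2 \<le> 2 * (norm (a - u 0))\<^sup>2 * (1 + c1 * T * exp (c1 * T))"
        by (rule gronwall[OF _ le c1 _ t]) (auto intro!: continuous_intros wc)
      also have "\<dots> = (C * norm (a - u 0))\<^sup>2"
        unfolding C_def power_mult_distrib using q by (subst real_sqrt_pow2) auto
      finally show ?thesis by (rule power2_le_imp_le) (use C in auto)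
    qed
    have retr: "retr 1 (w t) = w t" if t: "t \<in> {0..T}" for t
    proof -
      have "C * norm (a - u 0) \<le> C * (1 / C)" using a C by (intro mult_left_mono) auto
      then have "norm (w t) \<le> 1" using small[OF t] C by simp
      then show ?thesis by (simp add: retr_def)
    qed
    define v where "v t = u t + w t" for t
    have "sol T c v" unfolding sol_def
    proof (intro conjI exI[of _ P] ballI allI P(1))
      show "continuous_on {0..T} v" unfolding v_def by (intro continuous_intros uc wc)
      fix t n assume t': "t \<in> {0<..<T} - P"
      then have t: "t \<in> {0..T}" and at: "at t within {0..T} = at t" by (auto simp: at_within_Icc_at)
      have "((\<lambda>t. co (u t) n + co (w t) n) has_vector_derivative
          (lam n *\<^sub>R co (u t) n - (freq n)\<^sup>2 *\<^sub>R co (cub (u t)) n + co (c t) n) +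
          (lam n *\<^sub>R co (w t) n - (freq n)\<^sup>2 *\<^sub>R co (G t (w t)) n)) (at t)"
        using P(2)[OF t'] mild_has_vector_derivative[OF Gc[OF wc] w t] unfolding at
        by (intro has_vector_derivative_add) auto
      moreover have "(lam n *\<^sub>R co (u t) n - (freq n)\<^sup>2 *\<^sub>R co (cub (u t)) n + co (c t) n) +
          (lam n *\<^sub>R co (w t) n - (freq n)\<^sup>2 *\<^sub>R co (G t (w t)) n)
          = lam n *\<^sub>R co (v t) n - (freq n)\<^sup>2 *\<^sub>R co (cub (v t)) n + co (c t) n"
        by (simp add: v_def G_def retr[OF t] scaleR_conv_of_real algebra_simps)
      ultimately show "((\<lambda>t. co (v t) n) has_vector_derivative
          lam n *\<^sub>R co (v t) n - (freq n)\<^sup>2 *\<^sub>R co (cub (v t)) n + co (c t) n) (at t)"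
        by (simp add: v_def)
    qed
    moreover have "v 0 = a" by (simp add: v_def w0)
    moreover have "\<forall>t\<in>{0..T}. norm (v t - u t) \<le> C * norm (a - u 0)" using small by (simp add: v_def)
    ultimately show "\<exists>v. sol T c v \<and> v 0 = a \<and> (\<forall>t\<in>{0..T}. norm (v t - u t) \<le> C * norm (a - u 0))" by blast
  qed (use C in auto)
qed

text \<open>The arrival time is only bounded by \<tau>, because an impulse dictates its own
  duration. The exact time is restored at the end by waiting.\<close>

definition rt :: "real \<Rightarrow> 'd l2 \<Rightarrow> 'd l2 \<Rightarrow> bool" where
  "rt \<tau> a b \<longleftrightarrow> (\<forall>\<epsilon>>0. \<exists>s c u. 0 < s \<and> s \<le> \<tau> \<and> ctl c \<and> sol s c u \<and> u 0 = a \<and> norm (u s - b) < \<epsilon>)"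

text \<open>The second leg is fixed first; its stability constants then dictate the accuracy
  demanded of the first.\<close>

lemma rt_trans:
  assumes "rt \<tau> a b" "rt \<tau>' b c" shows "rt (\<tau> + \<tau>') a c"
  unfolding rt_def
proof (intro allI impI)
  fix \<epsilon> :: real assume \<epsilon>: "0 < \<epsilon>"
  then obtain s' d' v where v: "0 < s'" "s' \<le> \<tau>'" "ctl d'" "sol s' d' v" "v 0 = b" "norm (v s' - c) < \<epsilon> / 2"
    using assms(2) half_gt_zero[OF \<epsilon>] unfolding rt_def by metis
  obtain C \<rho> where C: "0 < C" "0 < \<rho>" and st: "\<And>a. norm (a - v 0) \<le> \<rho> \<Longrightarrow>
      \<exists>w. sol s' d' w \<and> w 0 = a \<and> (\<forall>t\<in>{0..s'}. norm (w t - v t) \<le> C * norm (a - v 0))"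
    using stability[OF less_imp_le[OF v(1)] v(4)] by metis
  have "0 < min \<rho> (\<epsilon> / (2 * C))" using C \<epsilon> by simp
  then obtain s d u where u: "0 < s" "s \<le> \<tau>" "ctl d" "sol s d u" "u 0 = a" "norm (u s - b) < min \<rho> (\<epsilon> / (2 * C))"
    using assms(1) unfolding rt_def by metis
  obtain w where w: "sol s' d' w" "w 0 = u s" "\<And>t. t \<in> {0..s'} \<Longrightarrow> norm (w t - v t) \<le> C * norm (u s - v 0)"
    using st[of "u s"] u(6) v(5) by auto
  have "norm (w s' - v s') \<le> C * norm (u s - b)" using w(3)[of s'] v by simp
  also have "\<dots> \<le> C * (\<epsilon> / (2 * C))" using u(6) C by (intro mult_left_mono) auto
  also have "\<dots> = \<epsilon> / 2" using C by simp
  finally have "norm (w s' - c) < \<epsilon>"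
    using norm_triangle_ineq[of "w s' - v s'" "v s' - c"] v(6) by simp
  moreover have "cat s u w (s + s') = w s'" "cat s u w 0 = a" using v(1) u by (simp_all add: cat_def)
  moreover have "sol (s + s') (cat s d d') (cat s u w)" using sol_cat[OF _ _ u(4) w(1) w(2)] u v by simp
  moreover have "ctl (cat s d d')" by (rule ctl_cat[OF u(3) v(3)])
  ultimately show "\<exists>s c' u. 0 < s \<and> s \<le> \<tau> + \<tau>' \<and> ctl c' \<and> sol s c' u \<and> u 0 = a \<and> norm (u s - c) < \<epsilon>"
    using u v by (intro exI[of _ "s + s'"] exI[of _ "cat s d d'"] exI[of _ "cat s u w"]) auto
qed

lemma rt_closed:
  assumes "\<And>\<epsilon>. 0 < \<epsilon> \<Longrightarrow> \<exists>b'. norm (b' - b) < \<epsilon> \<and> rt \<tau> a b'" shows "rt \<tau> a b"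
  unfolding rt_def
proof (intro allI impI)
  fix \<epsilon> :: real assume \<epsilon>: "0 < \<epsilon>"
  then obtain b' where b': "norm (b' - b) < \<epsilon> / 2" "rt \<tau> a b'" using assms[of "\<epsilon> / 2"] by auto
  then obtain s c u where u: "0 < s" "s \<le> \<tau>" "ctl c" "sol s c u" "u 0 = a" "norm (u s - b') < \<epsilon> / 2"
    using half_gt_zero[OF \<epsilon>] unfolding rt_def by metis
  have "norm (u s - b) < \<epsilon>" using norm_triangle_ineq[of "u s - b'" "b' - b"] b'(1) u(6) by simp
  then show "\<exists>s c u. 0 < s \<and> s \<le> \<tau> \<and> ctl c \<and> sol s c u \<and> u 0 = a \<and> norm (u s - b) < \<epsilon>" using u by blast
qed

text \<open>The impulse starts near a trigonometric polynomial, so \<open>a\<close> is replaced by a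
  projection and the remainder enters as the initial error.\<close>

lemma impulse_rt:
  assumes fin: "finite (supp \<phi>)" and \<eta>: "\<eta> \<in> base" and \<tau>: "0 < \<tau>" and \<epsilon>: "0 < \<epsilon>"
  obtains A p where "1 \<le> A" "norm (p - (a + A *\<^sub>R \<phi> + lap (cub \<phi>) + \<eta>)) < \<epsilon>" "rt \<tau> (a + A *\<^sub>R \<phi>) p"
proof -
  define e where "e = min (1 / 2) (\<epsilon> / 4)"
  have e: "0 < e" "e \<le> 1 / 2" "4 * e \<le> \<epsilon>" using \<epsilon> by (auto simp: e_def)
  have "\<forall>\<^sub>F R in at_top. dist (proj R a) a < e" by (rule tendstoD[OF proj_tendsto e(1)])
  then obtain R where R: "norm (a - proj R a) < e"
    by (auto simp: eventually_at_top_linorder dist_norm norm_minus_commute)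
  obtain A \<delta> where A: "1 \<le> A" "0 < \<delta>" "\<delta> \<le> \<tau>" and ex: "\<And>z0. norm z0 \<le> e \<Longrightarrow>
      \<exists>u. sol \<delta> (\<lambda>_. (1 / \<delta>) *\<^sub>R \<eta>) u \<and> u 0 = z0 + proj R a + A *\<^sub>R \<phi> \<and>
       norm (u \<delta> - (proj R a + A *\<^sub>R \<phi> + lap (cub \<phi>) + \<eta>)) \<le> 2 * e"
    using impulse_exists[OF finite_supp_proj fin finite_supp_base[OF \<eta>] e(1,2) \<tau>] by metis
  obtain u where u: "sol \<delta> (\<lambda>_. (1 / \<delta>) *\<^sub>R \<eta>) u" "u 0 = a + A *\<^sub>R \<phi>"
    "norm (u \<delta> - (proj R a + A *\<^sub>R \<phi> + lap (cub \<phi>) + \<eta>)) \<le> 2 * e"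
    using ex[of "a - proj R a"] R by auto
  show ?thesis
  proof (rule that[OF A(1)])
    have "u \<delta> - (a + A *\<^sub>R \<phi> + lap (cub \<phi>) + \<eta>) = (u \<delta> - (proj R a + A *\<^sub>R \<phi> + lap (cub \<phi>) + \<eta>)) - (a - proj R a)"
      by simp
    then have "norm (u \<delta> - (a + A *\<^sub>R \<phi> + lap (cub \<phi>) + \<eta>)) = norm ((u \<delta> - (proj R a + A *\<^sub>R \<phi> + lap (cub \<phi>) + \<eta>)) - (a - proj R a))"
      by (rule arg_cong)
    also have "\<dots> \<le> 2 * e + e"
      using u(3) R norm_triangle_ineq4[of "u \<delta> - (proj R a + A *\<^sub>R \<phi> + lap (cub \<phi>) + \<eta>)" "a - proj R a"] by linarith
    finally have "norm (u \<delta> - (a + A *\<^sub>R \<phi> + lap (cub \<phi>) + \<eta>)) \<le> 2 * e + e" .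
    then show "norm (u \<delta> - (a + A *\<^sub>R \<phi> + lap (cub \<phi>) + \<eta>)) < \<epsilon>" using e by linarith
    show "rt \<tau> (a + A *\<^sub>R \<phi>) (u \<delta>)" unfolding rt_def
      by (rule allI, rule impI, rule exI[of _ \<delta>], rule exI[of _ "\<lambda>_. (1 / \<delta>) *\<^sub>R \<eta>"], rule exI[of _ u])
        (use A u ctl_const[OF base_scaleR[OF \<eta>, of "1 / \<delta>"]] in simp)
  qed
qed

text \<open>Quantified over all multiples and all times: the time can then be divided among several
  motions, which makes this set a linear space.\<close>

definition dirs :: "'d l2 set" where
  "dirs = {g. finite (supp g) \<and> (\<forall>a r \<tau>. 0 < \<tau> \<longrightarrow> rt \<tau> a (a + r *\<^sub>R g))}"

text \<open>An impulse with \<open>\<phi> = 0\<close> moves the state along the control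
  itself.\<close>

lemma base_dirs: "g \<in> base \<Longrightarrow> g \<in> dirs"
  unfolding dirs_def
proof (intro CollectI conjI allI impI finite_supp_base)
  fix a r and \<tau> :: real assume g: "g \<in> base" and \<tau>: "0 < \<tau>"
  show "rt \<tau> a (a + r *\<^sub>R g)"
  proof (rule rt_closed)
    fix \<epsilon> :: real assume "0 < \<epsilon>"
    then show "\<exists>b'. norm (b' - (a + r *\<^sub>R g)) < \<epsilon> \<and> rt \<tau> a b'"
      using impulse_rt[of 0 "r *\<^sub>R g" \<tau> \<epsilon> a] base_scaleR[OF g] \<tau> by (auto simp: supp_def)
  qed
qed

lemma dirs_add: assumes "g \<in> dirs" "h \<in> dirs" shows "g + h \<in> dirs"
  unfolding dirs_def
proof (intro CollectI conjI allI impI)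
  show "finite (supp (g + h))" using assms by (simp add: dirs_def finite_supp_add)
  fix a r and \<tau> :: real assume "0 < \<tau>"
  then have "rt (\<tau>/2) a (a + r *\<^sub>R g)" "rt (\<tau>/2) (a + r *\<^sub>R g) (a + r *\<^sub>R g + r *\<^sub>R h)"
    using assms by (simp_all add: dirs_def)
  from rt_trans[OF this] show "rt \<tau> a (a + r *\<^sub>R (g + h))" by (simp add: scaleR_add_right add.assoc)
qed

lemma dirs_scaleR: assumes g: "g \<in> dirs" shows "r *\<^sub>R g \<in> dirs"
  unfolding dirs_def
proof (intro CollectI conjI allI impI)
  show "finite (supp (r *\<^sub>R g))" using g by (simp add: dirs_def finite_supp_scaleR)
  fix a q and \<tau> :: real assume "0 < \<tau>"
  then have "rt \<tau> a (a + (q * r) *\<^sub>R g)" using g unfolding dirs_def by blast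
  then show "rt \<tau> a (a + q *\<^sub>R (r *\<^sub>R g))" by simp
qed

lemma dirs_diff: "g \<in> dirs \<Longrightarrow> h \<in> dirs \<Longrightarrow> g - h \<in> dirs"
  using dirs_add[of g "(-1) *\<^sub>R h"] dirs_scaleR[of h "-1"] by simp

lemma dirs_sum: "(\<And>i. i \<in> I \<Longrightarrow> f i \<in> dirs) \<Longrightarrow> (\<Sum>i\<in>I. f i) \<in> dirs"
  by (induct I rule: infinite_finite_induct) (auto intro: base_dirs zero_in_base dirs_add)

text \<open>Go along \<open>A\<phi>\<close>, let the equation act for a time of order \<open>A\<^sup>-\<^sup>3\<close>, and go back.\<close>

lemma dirs_lap_cub:
  assumes \<phi>: "\<phi> \<in> dirs" shows "lap (cub \<phi>) \<in> dirs"
  unfolding dirs_def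
proof (intro CollectI conjI allI impI)
  have fin: "finite (supp \<phi>)" using \<phi> by (simp add: dirs_def)
  show "finite (supp (lap (cub \<phi>)))" by (intro finite_supp_lap finite_supp_cub fin)
  fix a r and \<tau> :: real assume \<tau>: "0 < \<tau>"
  \<comment> \<open>The cube root makes the cube of \<psi> equal to \<open>r\<close> times that of
    \<phi>; the exponent is odd, so negative \<open>r\<close> is covered.\<close>
  define \<psi> where "\<psi> = root 3 r *\<^sub>R \<phi>"
  have "cub \<psi> = r *\<^sub>R cub \<phi>"
    by (rule rl_inject) (simp add: \<psi>_def rl_cub rl_linear power_mult_distrib odd_real_root_pow)
  then have lc: "lap (cub \<psi>) = r *\<^sub>R lap (cub \<phi>)" by (simp add: lap_scaleR finite_supp_cub fin)
  have \<psi>: "\<psi> \<in> dirs" unfolding \<psi>_def by (rule dirs_scaleR[OF \<phi>])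
  show "rt \<tau> a (a + r *\<^sub>R lap (cub \<phi>))"
  proof (rule rt_closed)
    fix \<epsilon> :: real assume "0 < \<epsilon>"
    have fin\<psi>: "finite (supp \<psi>)" using \<psi> by (simp add: dirs_def)
    have \<tau>3: "0 < \<tau> / 3" using \<tau> by simp
    obtain A p where p: "norm (p - (a + A *\<^sub>R \<psi> + lap (cub \<psi>) + 0)) < \<epsilon>" "rt (\<tau>/3) (a + A *\<^sub>R \<psi>) p"
      by (rule impulse_rt[OF fin\<psi> zero_in_base \<tau>3 \<open>0 < \<epsilon>\<close>, of a])
    have "rt (\<tau>/3) a (a + A *\<^sub>R \<psi>)" "rt (\<tau>/3) p (p + (- A) *\<^sub>R \<psi>)"
      using \<psi> \<tau> unfolding dirs_def by (blast intro: divide_pos_pos zero_less_numeral)+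
    from rt_trans[OF rt_trans[OF this(1) p(2)] this(2)] have "rt \<tau> a (p + (- A) *\<^sub>R \<psi>)" by simp
    moreover have "norm (p + (- A) *\<^sub>R \<psi> - (a + r *\<^sub>R lap (cub \<phi>))) < \<epsilon>"
      using p(1) by (simp add: lc algebra_simps)
    ultimately show "\<exists>b'. norm (b' - (a + r *\<^sub>R lap (cub \<phi>))) < \<epsilon> \<and> rt \<tau> a b'" by blast
  qed
qed

section \<open>Products of directions and generation of all modes\<close>

definition one :: "'d l2" where "one = mode 0 (1 / 2)"

lemma rl_one: "rl k one v = 1"
proof -
  have "((\<lambda>n. hat k one n * cis (v \<bullet> lattice_vec n)) has_sum 1) UNIV"
    by (rule has_sum_finite_neutralI[of "{0}"]) (auto simp: hat_def one_def co_mode wt_def jb_def)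
  then show ?thesis by (simp add: rl_def fser_def infsumI)
qed

text \<open>Since \<open>(x + 1)^3 - (x - 1)^3 = 6 * x^2 + 2\<close>, subtracting the case
  \<open>x = g - h\<close> from the case \<open>x = g + h\<close> leaves
  \<open>24 * g * h\<close>.\<close>

lemma dirs_lap_prd:
  assumes "g \<in> dirs" "h \<in> dirs" shows "lap (prd k g h) \<in> dirs"
proof -
  have one: "one \<in> dirs" unfolding one_def by (intro base_dirs mode_in_base) simp
  have fin: "finite (supp x)" if "x \<in> dirs" for x using that by (simp add: dirs_def)
  have id: "(1/24) *\<^sub>R (cub (g + h + one) + (-1) *\<^sub>R cub (g + h - one) + (-1) *\<^sub>R cub (g - h + one) + cub (g - h - one)) = prd k g h"
    by (rule rl_inject) (simp add: rl_cub rl_linear rl_minus rl_prd rl_one, algebra)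
  have "lap (prd k g h) = (1/24) *\<^sub>R (lap (cub (g + h + one)) + (-1) *\<^sub>R lap (cub (g + h - one)) + (-1) *\<^sub>R lap (cub (g - h + one)) + lap (cub (g - h - one)))"
    unfolding id[symmetric]
    by (simp only: lap_add lap_scaleR finite_supp_add finite_supp_scaleR finite_supp_cub fin dirs_add dirs_diff assms one)
  also have "\<dots> \<in> dirs"
    by (intro dirs_scaleR dirs_add dirs_lap_cub dirs_diff assms one)
  finally show ?thesis .
qed

lemma rl_mode:
  fixes n :: "int^'d"
  shows "rl k (mode n w) v = 2 * Re (w * cis (v \<bullet> lattice_vec n)) / wt k n"
proof -
  define f where "f m = hat k (mode n w) m * cis (v \<bullet> lattice_vec m)" for m
  have f: "f m = (if m = n then w / wt k n * cis (v \<bullet> lattice_vec n) else 0) + (if m = - n then cnj (w / wt k n * cis (v \<bullet> lattice_vec n)) else 0)" for m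
  proof -
    have e: "lattice_vec (- n) = - lattice_vec n" by (simp add: lattice_vec_def vec_eq_iff)
    have w: "wt k (- n) = wt k n" by simp
    have 1: "hat k (mode n w) m = (if m = n then w / wt k n else 0) + (if m = - n then cnj (w / wt k n) else 0)"
      unfolding hat_def co_mode by (auto simp: w add_divide_distrib)
    have 2: "(if m = n then w / wt k n else 0) * cis (v \<bullet> lattice_vec m) = (if m = n then w / wt k n * cis (v \<bullet> lattice_vec n) else 0)"
      by simp
    have 3: "(if m = - n then cnj (w / wt k n) else 0) * cis (v \<bullet> lattice_vec m) = (if m = - n then cnj (w / wt k n * cis (v \<bullet> lattice_vec n)) else 0)"
      by (cases "m = - n") (simp_all add: e cis_cnj)
    show ?thesis unfolding f_def 1 distrib_right 2 3 ..
  qed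
  have 1: "((\<lambda>m. if m = n then w / wt k n * cis (v \<bullet> lattice_vec n) else 0) has_sum (w / wt k n * cis (v \<bullet> lattice_vec n))) UNIV"
    by (rule has_sum_finite_neutralI[of "{n}"]) auto
  have 2: "((\<lambda>m. if m = - n then cnj (w / wt k n * cis (v \<bullet> lattice_vec n)) else 0) has_sum cnj (w / wt k n * cis (v \<bullet> lattice_vec n))) UNIV"
    by (rule has_sum_finite_neutralI[of "{- n}"]) auto
  have "(f has_sum (w / wt k n * cis (v \<bullet> lattice_vec n) + cnj (w / wt k n * cis (v \<bullet> lattice_vec n)))) UNIV"
    using has_sum_add[OF 1 2] by (simp only: f[abs_def])
  then have "fser (hat k (mode n w)) v = w / wt k n * cis (v \<bullet> lattice_vec n) + cnj (w / wt k n * cis (v \<bullet> lattice_vec n))"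
    unfolding fser_def f_def by (rule infsumI)
  then have "rl k (mode n w) v = 2 * Re (w / wt k n * cis (v \<bullet> lattice_vec n))" by (simp add: rl_def)
  also have "w / wt k n * cis (v \<bullet> lattice_vec n) = (w * cis (v \<bullet> lattice_vec n)) / of_real (wt k n)" by simp
  finally show ?thesis by (simp only: Re_divide_of_real)
qed

text \<open>A product of two modes contains the frequencies \<open>m + n\<close> and
  \<open>m - n\<close>. Multiplying both coefficients by \<open>\<i>\<close> reverses the sign of
  the first and keeps the second, so the difference isolates \<open>m + n\<close>.\<close>

lemma mode_product:
  fixes m n :: "int^'d"
  shows "prd k (mode m w) (mode n v) - prd k (mode m (\<i> * w)) (mode n (\<i> * v)) = mode (m + n) (of_real (2 * wt k (m + n) / (wt k m * wt k n)) * (w * v))"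
proof (rule rl_inject)
  fix y
  let ?a = "w * cis (y \<bullet> lattice_vec m)" and ?b = "v * cis (y \<bullet> lattice_vec n)"
  let ?W = "wt k (m + n)" and ?P = "wt k m * wt k n"
  have W: "?W \<noteq> 0" using wt_pos[of k "m + n"] by simp
  have i: "Re (\<i> * w * cis (y \<bullet> lattice_vec m)) = - Im ?a" "Re (\<i> * v * cis (y \<bullet> lattice_vec n)) = - Im ?b"
    by (simp_all add: mult.assoc)
  have c: "w * v * cis (y \<bullet> lattice_vec (m + n)) = ?a * ?b"
    by (simp add: inner_add_right cis_mult[symmetric])
  have Re_complex_of_real_times: "Re (of_real r * z) = r * Re z" for r z by simp
  have "rl k (prd k (mode m w) (mode n v) - prd k (mode m (\<i> * w)) (mode n (\<i> * v))) y
      = 4 * (Re ?a * Re ?b - Im ?a * Im ?b) / ?P"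
  proof -
    have "2 * a / x * (2 * b / y) - 2 * - c / x * (2 * - d / y) = 4 * (a * b - c * d) / (x * y)" for a b c d x y :: real
      by (simp add: diff_divide_distrib)
    then show ?thesis unfolding rl_minus rl_prd rl_mode i .
  qed
  also have "Re ?a * Re ?b - Im ?a * Im ?b = Re (?a * ?b)" by simp
  also have "4 * Re (?a * ?b) / ?P = 2 * Re (of_real (2 * ?W / ?P) * (?a * ?b)) / ?W"
    using W unfolding Re_complex_of_real_times by simp
  also have "of_real (2 * ?W / ?P) * (?a * ?b) = of_real (2 * ?W / ?P) * (w * v) * cis (y \<bullet> lattice_vec (m + n))"
    using c by (simp only: mult.assoc)
  finally show "rl k (prd k (mode m w) (mode n v) - prd k (mode m (\<i> * w)) (mode n (\<i> * v))) y = rl k (mode (m + n) (of_real (2 * ?W / ?P) * (w * v))) y"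
    unfolding rl_mode .
qed

lemma lap_mode:
  fixes n :: "int^'d"
  shows "lap (mode n w) = (- (freq n)\<^sup>2) *\<^sub>R (mode n w :: 'd l2)"
  by (rule l2_eqI) (auto simp: co_lap finite_supp_mode co_mode scaleR_conv_of_real)

text \<open>A mode is an eigenvector of the Laplacian, so the Laplacian of a product can be undone
  by scaling. The exception is frequency 0, but that mode is controlled directly.\<close>

lemma modes_closed:
  fixes m n :: "int^'d"
  assumes "\<And>w. mode m w \<in> dirs" "\<And>w. mode n w \<in> dirs" shows "mode (m + n) w \<in> dirs"
proof (cases "m + n = 0")
  case True
  then show ?thesis by (intro base_dirs mode_in_base) simp
next
  case False
  let ?c = "2 * wt k (m + n) / (wt k m * wt k n)"
  have c: "?c \<noteq> 0" using wt_pos[of k m] wt_pos[of k n] wt_pos[of k "m + n"] by simp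
  define v where "v = w / of_real ?c"
  let ?p = "prd k (mode m 1) (mode n v)" and ?q = "prd k (mode m (\<i> * 1)) (mode n (\<i> * v))"
  have fin: "finite (supp ?p)" "finite (supp ?q)" by (intro finite_supp_prd finite_supp_mode)+
  have "?p - ?q = mode (m + n) w"
    unfolding mode_product v_def using c by simp
  then have "lap (mode (m + n) w) = lap (?p + (-1) *\<^sub>R ?q)" by simp
  also have "\<dots> = lap ?p + (-1) *\<^sub>R lap ?q" by (simp only: lap_add lap_scaleR finite_supp_scaleR fin)
  also have "\<dots> \<in> dirs" by (intro dirs_add dirs_scaleR dirs_lap_prd assms)
  finally have "(- (freq (m + n))\<^sup>2) *\<^sub>R mode (m + n) w \<in> dirs" unfolding lap_mode .
  from dirs_scaleR[OF this, of "- 1 / (freq (m + n))\<^sup>2"] show ?thesis using False by simp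
qed

lemma mode_in_dirs:
  fixes n :: "int^'d"
  shows "mode n w \<in> dirs"
proof -
  have ax: "mode (axis i j) w \<in> dirs" for i :: 'd and j w
  proof (induct j arbitrary: w rule: int_induct[where k=0])
    case base
    have "axis i 0 = (0 :: int^'d)" by (simp add: axis_def vec_eq_iff)
    then show ?case by (intro base_dirs mode_in_base) simp
  next
    case (step1 j)
    have "axis i (j + 1) = axis i j + (axis i 1 :: int^'d)" by (simp add: axis_def vec_eq_iff)
    moreover have "mode (axis i 1 :: int^'d) w \<in> dirs" for w by (intro base_dirs mode_in_base) (simp add: canonical_K_def)
    ultimately show ?case using modes_closed[OF step1(2)] by simp
  next
    case (step2 j)
    have eq: "axis i (j - 1) = axis i j + (- axis i 1 :: int^'d)" by (simp add: axis_def vec_eq_iff)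
    have "mode (- axis i 1 :: int^'d) w \<in> dirs" for w by (intro base_dirs mode_in_base) (simp add: canonical_K_def)
    then show ?case unfolding eq by (rule modes_closed[OF step2(2)])
  qed
  have "mode (\<Sum>i\<in>S. axis i (n $ i)) w \<in> dirs" if "finite S" for S w
    using that
  proof (induct S arbitrary: w rule: finite_induct)
    case empty
    show ?case by (intro base_dirs mode_in_base) simp
  next
    case (insert i S)
    then show ?case using modes_closed[OF ax[of i "n $ i"] insert(3)] by simp
  qed
  moreover have "(\<Sum>i\<in>UNIV. axis i (n $ i)) = n"
    by (simp add: vec_eq_iff axis_def if_distrib cong: if_cong)
  ultimately show ?thesis by (metis finite)
qed

lemma finite_supp_in_dirs: "finite (supp g) \<Longrightarrow> g \<in> dirs"
  by (subst mode_decomposition) (auto intro: dirs_sum dirs_scaleR mode_in_dirs)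

lemma rt_all: assumes "0 < \<tau>" shows "rt \<tau> a b"
proof (rule rt_closed)
  fix \<epsilon> :: real assume "0 < \<epsilon>"
  then have "\<forall>\<^sub>F R in at_top. dist (proj R (b - a)) (b - a) < \<epsilon>" by (rule tendstoD[OF proj_tendsto])
  then obtain R where R: "norm (proj R (b - a) - (b - a)) < \<epsilon>"
    by (auto simp: eventually_at_top_linorder dist_norm)
  have "rt \<tau> a (a + 1 *\<^sub>R proj R (b - a))"
    using finite_supp_in_dirs[OF finite_supp_proj[of R "b - a"]] assms unfolding dirs_def by blast
  then show "\<exists>b'. norm (b' - b) < \<epsilon> \<and> rt \<tau> a b'"
    using R by (intro exI[of _ "a + 1 *\<^sub>R proj R (b - a)"]) (auto simp: algebra_simps)
qed

text \<open>The uncontrolled rest state \<open>0\<close> is used to wait until the prescribed time.\<close>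

theorem approximate_controllability:
  assumes T: "0 < T" and \<epsilon>: "0 < \<epsilon>"
  obtains c u where "ctl c" "sol T c u" "u 0 = a" "norm (u T - b) < \<epsilon>"
proof -
  \<comment> \<open>The constants are chosen backwards: a last leg from 0 to near \<open>b\<close>,
    the radius \<open>r\<close> around 0 from which it can be followed, and then how close to 0 the
    first leg must come so that the waiting phase stays within \<open>r\<close>. Both legs take at
    most a third of the time, so the waiting time is positive.\<close>
  obtain s2 c2 u2 where u2: "0 < s2" "s2 \<le> T/3" "ctl c2" "sol s2 c2 u2" "u2 0 = 0" "norm (u2 s2 - b) < \<epsilon> / 2"
    using rt_all[of "T/3" 0 b] T half_gt_zero[OF \<epsilon>] unfolding rt_def by (metis divide_pos_pos zero_less_numeral)
  obtain C2 \<rho>2 where C2: "0 < C2" "0 < \<rho>2" and st2: "\<And>x. norm (x - u2 0) \<le> \<rho>2 \<Longrightarrow>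
      \<exists>v. sol s2 c2 v \<and> v 0 = x \<and> (\<forall>t\<in>{0..s2}. norm (v t - u2 t) \<le> C2 * norm (x - u2 0))"
    using stability[OF less_imp_le[OF u2(1)] u2(4)] by metis
  define r where "r = min \<rho>2 (\<epsilon> / (2 * C2))"
  have r: "0 < r" using C2 \<epsilon> by (simp add: r_def)
  obtain C0 \<rho>0 where C0: "0 < C0" "0 < \<rho>0" and st0: "\<And>x. norm (x - 0) \<le> \<rho>0 \<Longrightarrow>
      \<exists>v. sol T (\<lambda>_. 0) v \<and> v 0 = x \<and> (\<forall>t\<in>{0..T}. norm (v t - 0) \<le> C0 * norm (x - 0))"
    using stability[OF less_imp_le[OF T] sol_zero] by metis
  have "0 < min \<rho>0 (r / C0)" using C0 r by simp
  then obtain s1 c1 u1 where u1: "0 < s1" "s1 \<le> T/3" "ctl c1" "sol s1 c1 u1" "u1 0 = a" "norm (u1 s1 - 0) < min \<rho>0 (r / C0)"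
    using rt_all[of "T/3" a 0] T unfolding rt_def by (metis divide_pos_pos zero_less_numeral)
  define m where "m = T - s1 - s2"
  have m: "0 < m" "m \<le> T" using u1 u2 T by (auto simp: m_def)
  obtain v where v: "sol T (\<lambda>_. 0) v" "v 0 = u1 s1" "\<And>t. t \<in> {0..T} \<Longrightarrow> norm (v t) \<le> C0 * norm (u1 s1)"
    using st0[of "u1 s1"] u1(6) by auto
  have "norm (v m) \<le> C0 * norm (u1 s1)" using v(3)[of m] m by simp
  also have "\<dots> \<le> C0 * (r / C0)" using u1(6) C0 by (intro mult_left_mono) auto
  finally have vm: "norm (v m) \<le> r" using C0 by simp
  obtain w where w: "sol s2 c2 w" "w 0 = v m" "\<And>t. t \<in> {0..s2} \<Longrightarrow> norm (w t - u2 t) \<le> C2 * norm (v m)"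
    using st2[of "v m"] vm u2(5) by (auto simp: r_def)
  have "norm (w s2 - u2 s2) \<le> C2 * norm (v m)" using w(3)[of s2] u2(1) by simp
  also have "\<dots> \<le> C2 * (\<epsilon> / (2 * C2))" using vm C2 by (intro mult_left_mono) (auto simp: r_def)
  finally have "norm (w s2 - u2 s2) \<le> \<epsilon> / 2" using C2 by simp
  then have final: "norm (w s2 - b) < \<epsilon>" using norm_triangle_ineq[of "w s2 - u2 s2" "u2 s2 - b"] u2(6) by simp
  have s12: "sol (s1 + m) (cat s1 c1 (\<lambda>_. 0)) (cat s1 u1 v)"
    using m u1 by (intro sol_cat sol_subinterval[OF v(1)] v(2)) auto
  have "cat s1 u1 v (s1 + m) = v m" using m by (simp add: cat_def)
  then have "sol (s1 + m + s2) (cat (s1 + m) (cat s1 c1 (\<lambda>_. 0)) c2) (cat (s1 + m) (cat s1 u1 v) w)"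
    using m u1 u2 w by (intro sol_cat[OF _ _ s12 w(1)]) auto
  moreover have "s1 + m + s2 = T" by (simp add: m_def)
  ultimately have "sol T (cat (s1 + m) (cat s1 c1 (\<lambda>_. 0)) c2) (cat (s1 + m) (cat s1 u1 v) w)" by simp
  moreover have "ctl (cat (s1 + m) (cat s1 c1 (\<lambda>_. 0)) c2)"
    by (intro ctl_cat u1 u2 ctl_const zero_in_base)
  moreover have "cat (s1 + m) (cat s1 u1 v) w 0 = a" using m u1 by (simp add: cat_def)
  moreover have "cat (s1 + m) (cat s1 u1 v) w T = w s2" using m u2 by (simp add: cat_def m_def)
  ultimately show ?thesis using that final by metis
qed

end

section \<open>Identification of the semigroup\<close>

text \<open>The gap between the two sides is \<open>(q - 2)^2 / 2\<close> with
  \<open>q = (freq n)^2\<close>.\<close>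

lemma lam_le: "lam n \<le> 5 / 2 - (1 + (freq n)\<^sup>2)\<^sup>2 / 2"
proof -
  define q where "q = (freq n)\<^sup>2"
  have "lam n = q - q\<^sup>2" by (simp add: lam_def q_def)
  moreover have "0 \<le> (q - 2)\<^sup>2" by simp
  moreover have "(q - 2)\<^sup>2 = q\<^sup>2 - 4 * q + 4" "(1 + q)\<^sup>2 = 1 + 2 * q + q\<^sup>2"
    by (simp_all add: power2_eq_square algebra_simps)
  ultimately show ?thesis unfolding q_def[symmetric] by linarith
qed

text \<open>Decay of arbitrary polynomial order, from \<open>x \<le> exp x\<close> at
  \<open>x = X * t / (2 * k)\<close> raised to the power \<open>k\<close>.\<close>

lemma exp_lam_decay:
  assumes t: "0 < t"
  obtains K where "0 < K" "\<And>n :: int^'d. exp (lam n * t) \<le> K / (1 + (freq n)\<^sup>2) ^ k"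
proof (cases "k = 0")
  case True
  have "exp (lam n * t) \<le> 1 / (1 + (freq n)\<^sup>2) ^ k" for n :: "int^'d"
    using True t lam_nonpos[of n] by (simp add: mult_nonpos_nonneg)
  then show ?thesis using that[of 1] by simp
next
  case False
  define K where "K = exp (5 / 2 * t) * (2 * real k / t) ^ k"
  have "exp (lam n * t) \<le> K / (1 + (freq n)\<^sup>2) ^ k" for n :: "int^'d"
  proof -
    define X where "X = 1 + (freq n)\<^sup>2"
    have X: "1 \<le> X" by (simp add: X_def)
    have "lam n \<le> 5 / 2 - X\<^sup>2 / 2" unfolding X_def by (rule lam_le)
    also have "\<dots> \<le> 5 / 2 - X / 2" using X by (simp add: power2_eq_square)
    finally have "lam n * t \<le> (5 / 2 - X / 2) * t" using t by (intro mult_right_mono) auto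
    then have "exp (lam n * t) \<le> exp (5 / 2 * t) * exp (- (X * t / 2))"
      by (simp add: exp_add[symmetric] algebra_simps)
    also have "exp (- (X * t / 2)) \<le> (2 * real k / t) ^ k / X ^ k"
    proof -
      have p: "0 < X * t / (2 * real k)" using X t False by simp
      have "(X * t / (2 * real k)) ^ k \<le> exp (X * t / (2 * real k)) ^ k"
        using p exp_ge_add_one_self[of "X * t / (2 * real k)"] by (intro power_mono) linarith+
      also have "\<dots> = exp (X * t / 2)" using False by (simp add: exp_of_nat_mult[symmetric])
      finally have le: "(X * t / (2 * real k)) ^ k \<le> exp (X * t / 2)" .
      have "exp (- (X * t / 2)) = 1 / exp (X * t / 2)" by (simp only: exp_minus inverse_eq_divide)
      also have "\<dots> \<le> 1 / (X * t / (2 * real k)) ^ k" using le p by (intro divide_left_mono) auto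
      also have "\<dots> = (2 * real k / t) ^ k / X ^ k" using X t False by (simp add: power_divide power_mult_distrib)
      finally show ?thesis .
    qed
    finally show ?thesis by (simp add: K_def X_def mult_left_mono)
  qed
  moreover have "0 < K" using t False by (simp add: K_def)
  ultimately show ?thesis using that by blast
qed

text \<open>The growth allowed for \<open>c\<close> covers the coefficients of L2 functions as well
  as the H^-2 families on which the extended semigroup acts.\<close>

lemma heat_abs_summable:
  fixes c :: "int^'d \<Rightarrow> complex"
  assumes t: "0 < t" and c: "\<And>n. cmod (c n) \<le> B * (1 + (freq n)\<^sup>2)"
  shows "(\<lambda>n. of_real (exp (lam n * t)) * c n) abs_summable_on UNIV"
proof -
  obtain K where K: "0 < K" "\<And>n :: int^'d. exp (lam n * t) \<le> K / (1 + (freq n)\<^sup>2) ^ Suc CARD('d)"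
    using exp_lam_decay[OF t] by metis
  have "(\<lambda>n :: int^'d. K * B * (1 / (wt CARD('d) n)\<^sup>2)) summable_on UNIV"
    by (intro summable_on_cmult_right summable_inverse_wt) simp
  then show ?thesis
  proof (rule Infinite_Sum.abs_summable_on_comparison_test')
    fix n :: "int^'d"
    let ?X = "1 + (freq n)\<^sup>2"
    have X: "0 < ?X" by (simp add: add_pos_nonneg)
    have "cmod (of_real (exp (lam n * t)) * c n) \<le> K / ?X ^ Suc CARD('d) * (B * ?X)"
      unfolding norm_mult using K(2)[of n] c[of n] K(1) X by (intro mult_mono) auto
    also have "\<dots> = K * B * (1 / (wt CARD('d) n)\<^sup>2)" using X by (simp add: wt_power2)
    finally show "cmod (of_real (exp (lam n * t)) * c n) \<le> K * B * (1 / (wt CARD('d) n)\<^sup>2)" .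
  qed
qed

lemma herm_heat: "herm c \<Longrightarrow> herm (\<lambda>n. of_real (exp (lam n * t)) * c n)"
  by (simp add: herm_def)

lemma fourier_coeff_bounded:
  assumes "u \<in> L2" shows "cmod (fourier_coeff u n) \<le> norm (emb u) * (1 + (freq n)\<^sup>2)"
proof -
  have "cmod (fourier_coeff u n) \<le> norm (emb u) * 1" using co_le_norm[of "emb u" n] by (simp add: co_emb[OF assms])
  also have "\<dots> \<le> norm (emb u) * (1 + (freq n)\<^sup>2)" by (intro mult_left_mono) auto
  finally show ?thesis .
qed

text \<open>A witness for the choice in \<open>CH_semigroup\<close>. At \<open>t = 0\<close> the
  series of an L2 function need not converge absolutely, hence the case split.\<close>

definition heat :: "real \<Rightarrow> (real^'d \<Rightarrow> real) \<Rightarrow> (real^'d \<Rightarrow> real)" where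
  "heat t u = (if t \<le> 0 then u else trig (\<lambda>n. of_real (exp (lam n * t)) * fourier_coeff u n))"

lemma
  assumes u: "u \<in> L2" and t: "0 \<le> t"
  shows heat_L2: "heat t u \<in> L2"
    and fourier_coeff_heat: "fourier_coeff (heat t u) = (\<lambda>n. of_real (exp (lam n * t)) * fourier_coeff u n)"
proof -
  have s: "(\<lambda>n. of_real (exp (lam n * t)) * fourier_coeff u n) abs_summable_on UNIV" if "0 < t"
    by (rule heat_abs_summable[OF that fourier_coeff_bounded[OF u]])
  note h = herm_heat[OF herm_fourier_coeff[of u], of t]
  show "heat t u \<in> L2" using u trig_in_L2[OF s h] by (auto simp: heat_def)
  show "fourier_coeff (heat t u) = (\<lambda>n. of_real (exp (lam n * t)) * fourier_coeff u n)"
    using t fourier_coeff_trig[OF s h] by (cases "t = 0") (auto simp: heat_def)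
qed

lemma emb_eqI: "u \<in> L2 \<Longrightarrow> (\<And>n. fourier_coeff u n = co x n) \<Longrightarrow> emb u = x"
  by (rule l2_eqI) (simp add: co_emb)

lemma emb_linear:
  assumes "u \<in> L2" "v \<in> L2"
  shows "emb (\<lambda>x. u x + v x) = emb u + emb v" "emb (\<lambda>x. u x - v x) = emb u - emb v"
    "emb (\<lambda>x. a * u x) = a *\<^sub>R emb u"
  using assms by (auto intro!: emb_eqI simp: L2_add L2_diff L2_scale co_emb fourier_coeff_add fourier_coeff_diff fourier_coeff_scale)

lemma ae_eq_iff_emb: "u \<in> L2 \<Longrightarrow> v \<in> L2 \<Longrightarrow> ae_eq u v \<longleftrightarrow> emb u = emb v"
  by (metis ae_eq_iff_fourier_coeff co_emb emb_def)

lemma L2_norm_diff: "u \<in> L2 \<Longrightarrow> v \<in> L2 \<Longrightarrow> L2_norm (u - v) = sqrt ((2 * pi) ^ CARD('d)) * norm (emb u - emb (v :: real^'d \<Rightarrow> real))"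
  using parseval[OF L2_diff[of u v]] by (simp add: fun_diff_def emb_linear)

lemma emb_heat: "u \<in> L2 \<Longrightarrow> 0 \<le> t \<Longrightarrow> emb (heat t u) = sg t (emb u)"
  by (rule emb_eqI) (simp_all add: heat_L2 fourier_coeff_heat co_sg co_emb)

lemma emb_surj: obtains u where "u \<in> L2" "emb u = x"
proof -
  obtain v where v: "v \<in> L2" "fourier_coeff v = co x" by (rule riesz_fischer[of x])
  then have "emb v = x" by (intro emb_eqI) simp_all
  then show ?thesis by (rule that[OF v(1)])
qed

lemma tendsto_mult_norm_iff:
  fixes f :: "'a \<Rightarrow> 'b::real_normed_vector"
  assumes "s \<noteq> 0" shows "((\<lambda>x. s * norm (f x)) \<longlongrightarrow> 0) F \<longleftrightarrow> (f \<longlongrightarrow> 0) F"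
  using tendsto_mult_left_iff[OF assms, of "\<lambda>x. norm (f x)" 0 F] by (simp add: tendsto_norm_zero_iff)

lemma C0_semigroup_heat: "C0_semigroup (heat :: real \<Rightarrow> (real^'d \<Rightarrow> real) \<Rightarrow> _)"
  unfolding C0_semigroup_def
proof (intro conjI allI impI ballI)
  fix t :: real and u v :: "real^'d \<Rightarrow> real" and a b :: real
  assume t: "0 \<le> t" and u: "u \<in> L2" and v: "v \<in> L2"
  show "ae_eq (heat t (\<lambda>x. a * u x + b * v x)) (\<lambda>x. a * heat t u x + b * heat t v x)"
    by (subst ae_eq_iff_fourier_coeff)
      (auto simp: heat_L2 L2_add L2_scale u v t fourier_coeff_heat fourier_coeff_add fourier_coeff_scale algebra_simps)
next
  fix t :: real assume t: "0 \<le> t"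
  show "\<exists>M. \<forall>u :: real^'d \<Rightarrow> real \<in> L2. L2_norm (heat t u) \<le> M * L2_norm u"
  proof (intro exI[of _ 1] ballI)
    fix u :: "real^'d \<Rightarrow> real" assume u: "u \<in> L2"
    show "L2_norm (heat t u) \<le> 1 * L2_norm u"
      using norm_sg_le[OF t, of "emb u"] by (simp add: parseval heat_L2 u t emb_heat)
  qed
next
  fix s t :: real and u :: "real^'d \<Rightarrow> real" assume "0 \<le> s" "0 \<le> t" "u \<in> L2"
  then show "ae_eq (heat (s + t) u) (heat s (heat t u))"
    by (subst ae_eq_iff_fourier_coeff) (auto simp: heat_L2 fourier_coeff_heat distrib_left exp_add)
next
  fix u :: "real^'d \<Rightarrow> real" assume u: "u \<in> L2"
  have "((\<lambda>t. sg t (emb u)) \<longlongrightarrow> sg 0 (emb u)) (at 0 within {0..})"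
    using continuous_on_sg[of "emb u"] unfolding continuous_on_def by (rule bspec) simp
  from tendsto_within_subset[OF this, of "{0<..}"]
  have "((\<lambda>t. sg t (emb u)) \<longlongrightarrow> emb u) (at_right 0)" by (simp add: sg_0 subset_iff)
  then have "((\<lambda>t. sg t (emb u) - emb u) \<longlongrightarrow> 0) (at_right 0)" by (rule LIM_zero)
  then have "((\<lambda>t. sqrt ((2 * pi) ^ CARD('d)) * norm (sg t (emb u) - emb u)) \<longlongrightarrow> 0) (at_right 0)"
    by (subst tendsto_mult_norm_iff) auto
  then show "((\<lambda>t. L2_norm (heat t u - u)) \<longlongrightarrow> 0) (at_right 0)"
    by (rule Lim_transform_eventually)
      (auto simp: eventually_at_filter L2_norm_diff heat_L2 u emb_heat intro!: always_eventually)
next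
  fix t :: real and u :: "real^'d \<Rightarrow> real" assume "0 \<le> t" "u \<in> L2"
  then show "heat t u \<in> L2" by (intro heat_L2)
next
  fix u :: "real^'d \<Rightarrow> real"
  show "ae_eq (heat 0 u) u" by (simp add: ae_eq_def heat_def)
qed

section \<open>Generators on the Fourier side\<close>

lemma laplacian_lam: "- laplacian (laplacian c) n - laplacian c n = of_real (lam n) * c n"
  by (simp add: laplacian_def lam_def freq_def algebra_simps power2_eq_square power4_eq_xxxx)

lemma generator_graph_iff:
  fixes u v :: "real^'d \<Rightarrow> real"
  assumes S: "C0_semigroup S" and u: "u \<in> L2" and v: "v \<in> L2"
  shows "(u, v) \<in> generator_graph S \<longleftrightarrow> ((\<lambda>h. (1 / h) *\<^sub>R (emb (S h u) - emb u)) \<longlongrightarrow> emb v) (at_right 0)"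
proof -
  let ?s = "sqrt ((2 * pi) ^ CARD('d))"
  have eq: "L2_norm (\<lambda>x. (S h u x - u x) / h - v x) = ?s * norm ((1 / h) *\<^sub>R (emb (S h u) - emb u) - emb v)" if h: "0 < h" for h
  proof -
    have Su: "S h u \<in> L2" using S u h by (simp add: C0_semigroup_def)
    have "(\<lambda>x. (S h u x - u x) / h - v x) = (\<lambda>x. (1 / h) * (S h u x - u x) - v x)" by simp
    then show ?thesis
      using parseval[OF L2_diff[OF L2_scale[OF L2_diff[OF Su u], of "1 / h"] v]]
      by (simp only: emb_linear(2)[OF L2_scale[OF L2_diff[OF Su u]] v] emb_linear(3)[OF L2_diff[OF Su u] v] emb_linear(2)[OF Su u])
  qed
  have "(u, v) \<in> generator_graph S \<longleftrightarrow> ((\<lambda>h. L2_norm (\<lambda>x. (S h u x - u x) / h - v x)) \<longlongrightarrow> 0) (at_right 0)"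
    using u v by (simp add: generator_graph_def)
  also have "\<dots> \<longleftrightarrow> ((\<lambda>h. ?s * norm ((1 / h) *\<^sub>R (emb (S h u) - emb u) - emb v)) \<longlongrightarrow> 0) (at_right 0)"
    by (rule tendsto_cong) (use eq in \<open>auto simp: eventually_at_filter intro!: always_eventually\<close>)
  also have "\<dots> \<longleftrightarrow> ((\<lambda>h. (1 / h) *\<^sub>R (emb (S h u) - emb u) - emb v) \<longlongrightarrow> 0) (at_right 0)"
    by (rule tendsto_mult_norm_iff) simp
  also have "\<dots> \<longleftrightarrow> ((\<lambda>h. (1 / h) *\<^sub>R (emb (S h u) - emb u)) \<longlongrightarrow> emb v) (at_right 0)"
    by (rule LIM_zero_iff)
  finally show ?thesis .
qed

text \<open>The H^4 condition is implied by the coefficient relation: \<open>lam_le\<close> bounds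
  \<open>(1 + |n|^2)^2\<close> by \<open>5 - 2 * lam n\<close>, whose square is at most
  \<open>50 + 8 * (lam n)^2\<close>.\<close>

lemma A_graph_iff:
  fixes u v :: "real^'d \<Rightarrow> real"
  assumes u: "u \<in> L2" and v: "v \<in> L2"
  shows "(u, v) \<in> A_graph \<longleftrightarrow> (\<forall>n. co (emb v) n = of_real (lam n) * co (emb u) n)"
proof -
  have "fourier_coeff u \<in> sobolev_coeffs (int 4)" if eq: "\<And>n. fourier_coeff v n = of_real (lam n) * fourier_coeff u n"
  proof -
    have "(\<lambda>n. 50 * (cmod (co (emb u) n))\<^sup>2 + 8 * (cmod (co (emb v) n))\<^sup>2) summable_on UNIV"
      by (intro summable_on_add summable_on_cmult_right co_summable)
    then have "sobolev_weight (int 4) (fourier_coeff u) summable_on UNIV"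
    proof (rule summable_on_comparison_test)
      fix n :: "int^'d"
      define X where "X = 1 + (freq n)\<^sup>2"
      have "X\<^sup>2 \<le> 5 - 2 * lam n" using lam_le[of n] by (simp add: X_def)
      then have "(X\<^sup>2)\<^sup>2 \<le> (5 - 2 * lam n)\<^sup>2" by (intro power_mono) auto
      also have "\<dots> \<le> 50 + 8 * (lam n)\<^sup>2"
        using zero_le_power2[of "5 + 2 * lam n"] by (simp add: power2_eq_square algebra_simps)
      finally have X4: "X ^ 4 \<le> 50 + 8 * (lam n)\<^sup>2" by simp
      have w: "sobolev_weight (int 4) (fourier_coeff u) n = (cmod (fourier_coeff u n))\<^sup>2 * X ^ 4"
        by (simp only: sobolev_weight_def power_int_of_nat X_def freq_def)
      show "sobolev_weight (int 4) (fourier_coeff u) n \<le> 50 * (cmod (co (emb u) n))\<^sup>2 + 8 * (cmod (co (emb v) n))\<^sup>2"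
        unfolding w using mult_left_mono[OF X4, of "(cmod (fourier_coeff u n))\<^sup>2"]
        by (simp add: co_emb u v eq norm_mult power_mult_distrib algebra_simps)
      show "0 \<le> sobolev_weight (int 4) (fourier_coeff u) n" unfolding w by (simp add: X_def)
    qed
    then show ?thesis by (simp add: sobolev_coeffs_def)
  qed
  then show ?thesis
    using u v by (auto simp: A_graph_def sobolev_space_def laplacian_lam co_emb)
qed

lemma one_minus_exp_bound: "\<bar>(exp (l * h) - 1) / h\<bar> \<le> \<bar>l\<bar>" if "l \<le> 0" "0 < h" for l h :: real
proof -
  have "exp (l * h) \<le> 1" using that by (simp add: mult_nonpos_nonneg)
  moreover have "1 + l * h \<le> exp (l * h)" by (rule exp_ge_add_one_self)
  ultimately have "\<bar>exp (l * h) - 1\<bar> \<le> - (l * h)" by linarith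
  then show ?thesis using that by (simp add: abs_divide pos_divide_le_eq)
qed

lemma exp_difference_quotient: "((\<lambda>h. (exp (l * h) - 1) / h) \<longlongrightarrow> l) (at_right 0)" for l :: real
proof -
  have "((\<lambda>h. exp (l * h)) has_real_derivative l) (at 0)"
    by (auto intro!: derivative_eq_intros)
  then have "((\<lambda>h. (exp (l * h) - 1) / h) \<longlongrightarrow> l) (at 0)" by (simp add: DERIV_def)
  then show ?thesis by (rule tendsto_within_subset) simp
qed

text \<open>Coefficients of the difference quotient converge individually, and by
  \<open>one_minus_exp_bound\<close> they are dominated by those of the limit. So convergence in
  norm holds as soon as the limit family is square summable.\<close>

lemma sg_generator_iff:
  "((\<lambda>h. (1 / h) *\<^sub>R (sg h x - x)) \<longlongrightarrow> y) (at_right 0) \<longleftrightarrow> (\<forall>n. co y n = of_real (lam n) * co x n)"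
proof
  have c: "co ((1 / h) *\<^sub>R (sg h x - x)) n = of_real ((exp (lam n * h) - 1) / h) * co x n" if "0 < h" for h n
    using that by (simp add: co_sg field_simps)
  have lim: "((\<lambda>h. co ((1 / h) *\<^sub>R (sg h x - x)) n) \<longlongrightarrow> of_real (lam n) * co x n) (at_right 0)" for n
  proof (rule Lim_transform_eventually)
    show "((\<lambda>h. of_real ((exp (lam n * h) - 1) / h) * co x n) \<longlongrightarrow> of_real (lam n) * co x n) (at_right 0)"
      by (intro tendsto_mult tendsto_of_real exp_difference_quotient tendsto_const)
    show "\<forall>\<^sub>F h in at_right 0. of_real ((exp (lam n * h) - 1) / h) * co x n = co ((1 / h) *\<^sub>R (sg h x - x)) n"
      using c by (auto simp: eventually_at_filter intro!: always_eventually)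
  qed
  show "\<forall>n. co y n = of_real (lam n) * co x n" if "((\<lambda>h. (1 / h) *\<^sub>R (sg h x - x)) \<longlongrightarrow> y) (at_right 0)"
    using tendsto_unique[OF _ tendsto_co[OF that] lim] by simp
  assume y: "\<forall>n. co y n = of_real (lam n) * co x n"
  show "((\<lambda>h. (1 / h) *\<^sub>R (sg h x - x)) \<longlongrightarrow> y) (at_right 0)"
  proof (rule l2_tendsto_dominated[where b="\<lambda>n. cmod (co y n)"])
    show "((\<lambda>h. co ((1 / h) *\<^sub>R (sg h x - x)) n) \<longlongrightarrow> co y n) (at_right 0)" for n using lim[of n] y by simp
    have "cmod (co ((1 / h) *\<^sub>R (sg h x - x)) n) \<le> cmod (co y n)" if "0 < h" for h n
    proof -
      have "cmod (of_real ((exp (lam n * h) - 1) / h) * co x n) \<le> cmod (of_real (lam n) * co x n)"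
        unfolding norm_mult norm_of_real by (rule mult_right_mono[OF one_minus_exp_bound[OF lam_nonpos that] norm_ge_zero])
      then show ?thesis unfolding c[OF that] y[rule_format] .
    qed
    then show "\<forall>\<^sub>F h in at_right 0. \<forall>n. cmod (co ((1 / h) *\<^sub>R (sg h x - x)) n) \<le> cmod (co y n)"
      by (auto simp: eventually_at_filter intro!: always_eventually)
  qed (auto simp: co_summable)
qed

lemma generator_graph_heat: "generator_graph heat = (A_graph :: ((real^'d \<Rightarrow> real) \<times> _) set)"
proof -
  have "(u, v) \<in> generator_graph heat \<longleftrightarrow> (u, v) \<in> A_graph" for u v :: "real^'d \<Rightarrow> real"
  proof (cases "u \<in> L2 \<and> v \<in> L2")
    case True
    then have uv: "u \<in> L2" "v \<in> L2" by auto
    have "((\<lambda>h. (1 / h) *\<^sub>R (emb (heat h u) - emb u)) \<longlongrightarrow> emb v) (at_right 0) \<longleftrightarrow>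
        ((\<lambda>h. (1 / h) *\<^sub>R (sg h (emb u) - emb u)) \<longlongrightarrow> emb v) (at_right 0)"
      by (rule tendsto_cong) (auto simp: eventually_at_filter emb_heat uv intro!: always_eventually)
    then show ?thesis
      by (simp add: generator_graph_iff[OF C0_semigroup_heat uv] A_graph_iff[OF uv] sg_generator_iff)
  next
    case False
    then show ?thesis by (auto simp: generator_graph_def A_graph_def sobolev_space_def)
  qed
  then show ?thesis by auto
qed

section \<open>Uniqueness of the semigroup with a given generator\<close>

lemma finite_lam_level: "finite {n :: int^'d. lam n = l}"
proof (rule finite_subset[OF _ finite_freq_le[of "6 - 2 * l"]], rule subsetI)
  fix n :: "int^'d" assume "n \<in> {n. lam n = l}"
  then have "(1 + (freq n)\<^sup>2)\<^sup>2 \<le> 5 - 2 * l" using lam_le[of n] by simp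
  moreover have "1 + (freq n)\<^sup>2 \<le> (1 + (freq n)\<^sup>2)\<^sup>2" by (rule self_le_power) simp_all
  moreover have "freq n \<le> 1 + (freq n)\<^sup>2"
  proof -
    have "0 \<le> (freq n - 1)\<^sup>2" "0 \<le> (freq n)\<^sup>2" by simp_all
    moreover have "(freq n - 1)\<^sup>2 = (freq n)\<^sup>2 - 2 * freq n + 1" by (simp add: power2_eq_square algebra_simps)
    ultimately show ?thesis by linarith
  qed
  ultimately show "n \<in> {n. freq n \<le> 6 - 2 * l}" by simp
qed

text \<open>On the finite-dimensional eigenspaces of the generator no uniform boundedness principle is
  needed: \<open>R h = exp (l h) + o(h)\<close> there, and \<open>R t = (R (t / N)) ^ N\<close>.\<close>

lemma l2_semigroup_unique:
  fixes R :: "real \<Rightarrow> 'd::finite l2 \<Rightarrow> 'd l2"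
  assumes bl: "\<And>t. 0 \<le> t \<Longrightarrow> bounded_linear (R t)"
    and R0: "\<And>x. R 0 x = x" and semi: "\<And>s t x. 0 \<le> s \<Longrightarrow> 0 \<le> t \<Longrightarrow> R (s + t) x = R s (R t x)"
    and gen: "\<And>x y. ((\<lambda>h. (1 / h) *\<^sub>R (R h x - x)) \<longlongrightarrow> y) (at_right 0) \<longleftrightarrow> (\<forall>n. co y n = of_real (lam n) * co x n)"
    and t: "0 \<le> t"
  shows "R t x = sg t x"
proof -
  have eig: "R t v = exp (l * t) *\<^sub>R v" if t: "0 < t" and v: "\<And>n. lam n \<noteq> l \<Longrightarrow> co v n = 0" for l t v
  proof -
    define F where "F = {n :: int^'d. lam n = l}"
    have F: "finite F" unfolding F_def by (rule finite_lam_level)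
    define V where "V = {x :: 'd l2. \<forall>n. n \<notin> F \<longrightarrow> co x n = 0}"
    have Vgen: "((\<lambda>h. (1 / h) *\<^sub>R (R h x - x)) \<longlongrightarrow> l *\<^sub>R x) (at_right 0)" if "x \<in> V" for x
      unfolding gen using that by (auto simp: V_def F_def)
    \<comment> \<open>\<open>R s\<close> commutes with the difference quotients, so
      \<open>R s x\<close> is again an eigenvector for \<open>l\<close>; by \<open>gen\<close> its
      coefficients live on \<open>F\<close>.\<close>
    have RV: "R s x \<in> V" if x: "x \<in> V" and s: "0 \<le> s" for s x
    proof -
      interpret bounded_linear "R s" by (rule bl[OF s])
      have "((\<lambda>h. R s ((1 / h) *\<^sub>R (R h x - x))) \<longlongrightarrow> R s (l *\<^sub>R x)) (at_right 0)"
        by (rule tendsto[OF Vgen[OF x]])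
      moreover have "\<forall>\<^sub>F h in at_right 0. R s ((1 / h) *\<^sub>R (R h x - x)) = (1 / h) *\<^sub>R (R h (R s x) - R s x)"
        unfolding eventually_at_filter
      proof (intro always_eventually allI impI)
        fix h :: real assume "h \<in> {0<..}"
        then have "R s (R h x) = R h (R s x)" using semi[of s h x] semi[of h s x] s by (simp add: add.commute)
        then show "R s ((1 / h) *\<^sub>R (R h x - x)) = (1 / h) *\<^sub>R (R h (R s x) - R s x)" by (simp add: scaleR diff)
      qed
      ultimately have "((\<lambda>h. (1 / h) *\<^sub>R (R h (R s x) - R s x)) \<longlongrightarrow> l *\<^sub>R R s x) (at_right 0)"
        using Lim_transform_eventually by (fastforce simp: scaleR)
      then have "of_real l * co (R s x) n = of_real (lam n) * co (R s x) n" for n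
        unfolding gen by simp
      then show ?thesis by (auto simp: V_def F_def)
    qed
    have near: "\<exists>\<delta>>0. \<forall>h x. 0 < h \<longrightarrow> h < \<delta> \<longrightarrow> x \<in> V \<longrightarrow> norm (R h x - exp (l * h) *\<^sub>R x) \<le> \<epsilon> * h * norm x" if \<epsilon>: "0 < \<epsilon>" for \<epsilon>
    proof -
      define \<epsilon>' where "\<epsilon>' = \<epsilon> / (real (card F) + 1)"
      have \<epsilon>': "0 < \<epsilon>'" using \<epsilon> by (simp add: \<epsilon>'_def add_nonneg_pos)
      \<comment> \<open>These finitely many vectors span \<open>V\<close> over the reals, so
        convergence on each of them is uniform on bounded subsets of \<open>V\<close>; \<epsilon>'
        absorbs the number of modes.\<close>
      define Bs :: "'d l2 set" where "Bs = (\<lambda>n. mode n 1) ` F \<union> (\<lambda>n. mode n \<i>) ` F"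
      have BV: "b \<in> V" if "b \<in> Bs" for b
        using that by (auto simp: Bs_def V_def F_def co_mode split: if_splits)
      have "\<forall>\<^sub>F h in at_right 0. norm (R h b - exp (l * h) *\<^sub>R b) \<le> \<epsilon>' * h" if b: "b \<in> Bs" for b
      proof -
        have "((\<lambda>h. (1 / h) *\<^sub>R (R h b - b) - ((exp (l * h) - 1) / h) *\<^sub>R b) \<longlongrightarrow> l *\<^sub>R b - l *\<^sub>R b) (at_right 0)"
          by (intro tendsto_intros Vgen BV b exp_difference_quotient)
        then have "\<forall>\<^sub>F h in at_right 0. dist ((1 / h) *\<^sub>R (R h b - b) - ((exp (l * h) - 1) / h) *\<^sub>R b) 0 < \<epsilon>'"
          using \<epsilon>' by (intro tendstoD) auto
        moreover have "\<forall>\<^sub>F h :: real in at_right 0. 0 < h" by (simp add: eventually_at_filter)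
        ultimately show ?thesis
        proof eventually_elim
          case (elim h)
          have "(1 / h) *\<^sub>R (R h b - b) - ((exp (l * h) - 1) / h) *\<^sub>R b = (1 / h) *\<^sub>R (R h b - exp (l * h) *\<^sub>R b)"
            by (simp add: algebra_simps diff_divide_distrib)
          then have "norm (R h b - exp (l * h) *\<^sub>R b) / h < \<epsilon>'" using elim by simp
          then show ?case using elim by (simp add: pos_divide_less_eq)
        qed
      qed
      moreover have "finite Bs" using F by (simp add: Bs_def)
      ultimately have "\<forall>\<^sub>F h in at_right 0. \<forall>b\<in>Bs. norm (R h b - exp (l * h) *\<^sub>R b) \<le> \<epsilon>' * h"
        by (intro eventually_ball_finite) auto
      then obtain \<delta> where \<delta>: "0 < \<delta>" "\<And>h b. 0 < h \<Longrightarrow> h < \<delta> \<Longrightarrow> b \<in> Bs \<Longrightarrow> norm (R h b - exp (l * h) *\<^sub>R b) \<le> \<epsilon>' * h"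
        unfolding eventually_at_right_field by auto
      have "norm (R h x - exp (l * h) *\<^sub>R x) \<le> \<epsilon> * h * norm x" if h: "0 < h" "h < \<delta>" and x: "x \<in> V" for h x
      proof -
        interpret bounded_linear "R h" by (rule bl) (use h in simp)
        let ?D = "\<lambda>x. R h x - exp (l * h) *\<^sub>R x"
        have mode_split: "mode n w = Re w *\<^sub>R mode n 1 + Im w *\<^sub>R mode n \<i>" for n :: "int^'d" and w
          by (rule l2_eqI) (auto simp: co_mode complex_eq_iff)
        have sub: "supp x \<subseteq> F" using x by (auto simp: V_def supp_def)
        have fs: "finite (supp x)" by (rule finite_subset[OF sub F])
        have mt: "norm (?D ((1/2) *\<^sub>R mode n (co x n))) \<le> norm x * (\<epsilon>' * h)" if n: "n \<in> supp x" for n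
        proof -
          have b: "norm (?D (mode n 1)) \<le> \<epsilon>' * h" "norm (?D (mode n \<i>)) \<le> \<epsilon>' * h"
            using n sub by (auto intro!: \<delta>(2) h simp: Bs_def)
          have "?D ((1/2) *\<^sub>R mode n (co x n)) = (1/2) *\<^sub>R (Re (co x n) *\<^sub>R ?D (mode n 1) + Im (co x n) *\<^sub>R ?D (mode n \<i>))"
            unfolding mode_split[of n "co x n"] by (simp add: add scaleR algebra_simps)
          also have "norm \<dots> \<le> (1/2) * (\<bar>Re (co x n)\<bar> * (\<epsilon>' * h) + \<bar>Im (co x n)\<bar> * (\<epsilon>' * h))"
            using b by (simp, intro norm_triangle_mono) (auto intro: mult_left_mono)
          also have "\<dots> \<le> (1/2) * (norm x * (\<epsilon>' * h) + norm x * (\<epsilon>' * h))"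
            using abs_Re_le_cmod[of "co x n"] abs_Im_le_cmod[of "co x n"] co_le_norm[of x n] \<epsilon>' h
            by (intro mult_left_mono add_mono mult_right_mono) (auto intro: order_trans)
          finally show ?thesis by (simp add: mult_ac)
        qed
        have "?D x = (\<Sum>n\<in>supp x. ?D ((1/2) *\<^sub>R mode n (co x n)))"
          by (subst (1 2) mode_decomposition[OF fs]) (simp add: sum sum_subtractf scaleR_sum_right)
        then have "norm (?D x) \<le> (\<Sum>n\<in>supp x. norm x * (\<epsilon>' * h))"
          using mt by (simp only:) (rule order_trans[OF norm_sum sum_mono])
        also have "\<dots> = real (card (supp x)) * \<epsilon>' * (h * norm x)" by simp
        also have "\<dots> \<le> \<epsilon> * (h * norm x)"
        proof (rule mult_right_mono)
          have "real (card (supp x)) * \<epsilon>' \<le> (real (card F) + 1) * \<epsilon>'"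
            using card_mono[OF F sub] \<epsilon>' by (intro mult_right_mono) auto
          also have "\<dots> = \<epsilon>" unfolding \<epsilon>'_def by (simp add: add_nonneg_pos less_imp_neq[symmetric])
          finally show "real (card (supp x)) * \<epsilon>' \<le> \<epsilon>" .
        qed (use h in simp)
        finally show ?thesis by (simp add: mult.assoc)
      qed
      then show ?thesis using \<delta>(1) by blast
    qed
    have l0: "l \<le> 0 \<or> F = {}" using lam_nonpos by (auto simp: F_def)
    show ?thesis
    proof (cases "F = {}")
      case True
      then have "v = 0" using v by (intro l2_eqI) (auto simp: F_def)
      then show ?thesis using bounded_linear.linear[OF bl[of t]] t by (simp add: linear_0)
    next
      case False
      then have l0: "l \<le> 0" using l0 by simp
      have vV: "v \<in> V" using v by (auto simp: V_def F_def)
      have bound: "norm (R t v - exp (l * t) *\<^sub>R v) \<le> (exp (\<epsilon> * t) - 1) * norm v" if \<epsilon>: "0 < \<epsilon>" for \<epsilon>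
      proof -
        obtain \<delta> where \<delta>: "0 < \<delta>" "\<And>h x. 0 < h \<Longrightarrow> h < \<delta> \<Longrightarrow> x \<in> V \<Longrightarrow> norm (R h x - exp (l * h) *\<^sub>R x) \<le> \<epsilon> * h * norm x"
          using near[OF \<epsilon>] by blast
        obtain N :: nat where N: "t / \<delta> < real N" using reals_Archimedean2 by blast
        then have N0: "0 < N" using t \<delta> by (metis divide_pos_pos gr0I of_nat_0 order_less_asym)
        define h where "h = t / real N"
        have h: "0 < h" "h < \<delta>" using t N N0 \<delta> by (auto simp: h_def field_simps)
        have e1: "exp (l * h) \<le> 1" using l0 h by (simp add: mult_nonpos_nonneg)
        \<comment> \<open>The errors of the single steps are accumulated; since
          \<open>exp (l * h) \<le> 1\<close>, errors already made are not amplified.\<close>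
        have it: "norm (R (real j * h) v - exp (l * (real j * h)) *\<^sub>R v) \<le> ((1 + \<epsilon> * h) ^ j - 1) * norm v" for j
        proof (induction j)
          case 0
          then show ?case by (simp add: R0)
        next
          case (Suc j)
          let ?x = "R (real j * h) v" and ?y = "exp (l * (real j * h)) *\<^sub>R v"
          have eq: "R (real (Suc j) * h) v - exp (l * (real (Suc j) * h)) *\<^sub>R v = (R h ?x - exp (l * h) *\<^sub>R ?x) + exp (l * h) *\<^sub>R (?x - ?y)"
            using semi[of h "real j * h" v] h by (simp add: algebra_simps exp_add)
          have ny: "norm ?y \<le> norm v" using l0 h by (simp add: mult_nonpos_nonneg mult_left_le_one_le)
          have nx: "norm ?x \<le> (1 + \<epsilon> * h) ^ j * norm v"
            using norm_triangle_ineq[of "?x - ?y" ?y] Suc.IH ny by (simp add: algebra_simps)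
          have "norm (R (real (Suc j) * h) v - exp (l * (real (Suc j) * h)) *\<^sub>R v)
              \<le> \<epsilon> * h * norm ?x + 1 * norm (?x - ?y)"
            unfolding eq using e1 h RV[OF vV] mult_right_mono[OF e1 norm_ge_zero[of "?x - ?y"]]
            by (intro norm_triangle_mono \<delta>(2)) auto
          also have "\<dots> \<le> \<epsilon> * h * ((1 + \<epsilon> * h) ^ j * norm v) + 1 * (((1 + \<epsilon> * h) ^ j - 1) * norm v)"
            using Suc.IH nx \<epsilon> h by (intro add_mono mult_left_mono) auto
          also have "\<dots> = ((1 + \<epsilon> * h) ^ Suc j - 1) * norm v" by (simp add: algebra_simps)
          finally show ?case .
        qed
        have "(1 + \<epsilon> * h) ^ N \<le> exp (\<epsilon> * h) ^ N" using \<epsilon> h by (intro power_mono) auto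
        also have "\<dots> = exp (\<epsilon> * t)" using N0 by (simp add: exp_of_nat_mult[symmetric] h_def)
        finally have "((1 + \<epsilon> * h) ^ N - 1) * norm v \<le> (exp (\<epsilon> * t) - 1) * norm v" by (intro mult_right_mono) auto
        moreover have "real N * h = t" using N0 by (simp add: h_def)
        ultimately show ?thesis using it[of N] by simp
      qed
      have "((\<lambda>\<epsilon>. (exp (\<epsilon> * t) - 1) * norm v) \<longlongrightarrow> (exp (0 * t) - 1) * norm v) (at_right 0)"
        by (intro tendsto_intros)
      then have "norm (R t v - exp (l * t) *\<^sub>R v) \<le> (exp (0 * t) - 1) * norm v"
        by (rule tendsto_lowerbound) (use bound in \<open>auto simp: eventually_at_filter intro!: always_eventually\<close>)
      then show ?thesis by simp
    qed
  qed
  show ?thesis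
  proof (cases "t = 0")
    case False
    then have t: "0 < t" using t by simp
    interpret bounded_linear "R t" by (rule bl) (use t in simp)
    have sgmode: "sg t (mode n w) = exp (lam n * t) *\<^sub>R mode n w" for n :: "int^'d" and w
      by (rule l2_eqI) (use t in \<open>auto simp: co_sg co_mode\<close>)
    have m: "R t (mode n w) = sg t (mode n w)" for n w
      unfolding sgmode by (rule eig[OF t]) (auto simp: co_mode split: if_splits)
    have sgl: "sg t (\<Sum>i\<in>I. r *\<^sub>R f i) = (\<Sum>i\<in>I. r *\<^sub>R sg t (f i))" for I :: "(int^'d) set" and r and f :: "int^'d \<Rightarrow> 'd l2"
      by (rule l2_eqI) (use t in \<open>simp add: co_sg sum_distrib_left mult_ac\<close>)
    have fin: "R t y = sg t y" if "finite (supp y)" for y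
      by (subst (1 2) mode_decomposition[OF that]) (simp only: sgl sum scaleR m)
    have "((\<lambda>r. R t (proj r x)) \<longlongrightarrow> R t x) at_top" by (rule tendsto[OF proj_tendsto])
    moreover have "((\<lambda>r. R t (proj r x)) \<longlongrightarrow> sg t x) at_top"
    proof -
      have "bounded_linear (sg t :: 'd l2 \<Rightarrow> 'd l2)"
        by (rule bounded_linear_intro[of _ 1]) (use t in \<open>auto intro!: l2_eqI simp: co_sg norm_sg_le algebra_simps\<close>)
      from bounded_linear.tendsto[OF this proj_tendsto[of x]] show ?thesis by (simp add: fin finite_supp_proj)
    qed
    ultimately show ?thesis by (rule tendsto_unique[rotated]) simp
  qed (simp add: R0)
qed

lemma norm_l2_compare:
  assumes K: "0 \<le> K" and le: "\<And>n. cmod (co x n) \<le> K * cmod (co y n)"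
  shows "norm x \<le> K * norm y"
proof (rule l2_norm_leI)
  fix F
  have "L2_set (\<lambda>n. cmod (co x n)) F \<le> L2_set (\<lambda>n. K * cmod (co y n)) F"
    by (intro L2_set_mono le norm_ge_zero)
  also have "\<dots> = K * L2_set (\<lambda>n. cmod (co y n)) F" by (rule L2_set_right_distrib[OF K, symmetric])
  also have "\<dots> \<le> K * norm y" by (intro mult_left_mono L2_set_co_le_norm K)
  finally show "L2_set (\<lambda>n. cmod (co x n)) F \<le> K * norm y" .
qed (use K in simp)

lemma
  C0_semigroup_CH: "C0_semigroup (CH_semigroup :: real \<Rightarrow> (real^'d \<Rightarrow> real) \<Rightarrow> _)"
  and generator_graph_CH: "generator_graph (CH_semigroup :: real \<Rightarrow> (real^'d \<Rightarrow> real) \<Rightarrow> _) = A_graph"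
proof -
  have "C0_semigroup (CH_semigroup :: real \<Rightarrow> (real^'d \<Rightarrow> real) \<Rightarrow> _) \<and> generator_graph CH_semigroup = (A_graph :: ((real^'d \<Rightarrow> real) \<times> _) set)"
    unfolding CH_semigroup_def
    by (rule someI[of "\<lambda>S. C0_semigroup S \<and> generator_graph S = (A_graph :: ((real^'d \<Rightarrow> real) \<times> _) set)" heat])
      (simp add: C0_semigroup_heat generator_graph_heat)
  then show "C0_semigroup (CH_semigroup :: real \<Rightarrow> (real^'d \<Rightarrow> real) \<Rightarrow> _)"
    "generator_graph (CH_semigroup :: real \<Rightarrow> (real^'d \<Rightarrow> real) \<Rightarrow> _) = A_graph" by simp_all
qed

lemma emb_scale: "u \<in> L2 \<Longrightarrow> emb (\<lambda>x. a * u x) = a *\<^sub>R emb u"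
  by (rule emb_linear(3))

lemma CH_semigroup_L2:
  fixes u :: "real^'d \<Rightarrow> real"
  shows "0 \<le> t \<Longrightarrow> u \<in> L2 \<Longrightarrow> CH_semigroup t u \<in> L2"
  using C0_semigroup_CH[where 'd='d] by (simp add: C0_semigroup_def)

text \<open>\<open>CH_semigroup\<close> acts on representatives, so it is transported to a map
  \<open>R\<close> on coefficient families through chosen preimages. Linearity and boundedness make
  this independent of the choice, and \<open>l2_semigroup_unique\<close> identifies
  \<open>R\<close>.\<close>

lemma emb_CH_semigroup:
  fixes u :: "real^'d \<Rightarrow> real"
  assumes u: "u \<in> L2" and t: "0 \<le> t"
  shows "emb (CH_semigroup t u) = sg t (emb u)"
proof -
  let ?S = "CH_semigroup :: real \<Rightarrow> (real^'d \<Rightarrow> real) \<Rightarrow> _"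
  note S = C0_semigroup_CH[unfolded C0_semigroup_def]
  have lin: "emb (?S t (\<lambda>x. a * u x + b * v x)) = a *\<^sub>R emb (?S t u) + b *\<^sub>R emb (?S t v)"
    if t: "0 \<le> t" and u: "u \<in> L2" and v: "v \<in> L2" for t a b u v
  proof -
    have "ae_eq (?S t (\<lambda>x. a * u x + b * v x)) (\<lambda>x. a * ?S t u x + b * ?S t v x)" using S t u v by blast
    then have "emb (?S t (\<lambda>x. a * u x + b * v x)) = emb (\<lambda>x. a * ?S t u x + b * ?S t v x)"
      using t u v by (subst ae_eq_iff_emb[symmetric]) (auto intro!: L2_add L2_scale CH_semigroup_L2)
    then show ?thesis
      using emb_linear(1)[OF L2_scale[OF CH_semigroup_L2[OF t u], of a] L2_scale[OF CH_semigroup_L2[OF t v], of b]]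
      by (simp add: emb_scale CH_semigroup_L2 t u v)
  qed
  have bnd: "\<exists>M. \<forall>u\<in>L2. norm (emb (?S t u)) \<le> M * norm (emb u)" if t: "0 \<le> t" for t
  proof -
    obtain M where M: "\<And>u. u \<in> L2 \<Longrightarrow> L2_norm (?S t u) \<le> M * L2_norm u" using S t by metis
    have "norm (emb (?S t u)) \<le> M * norm (emb u)" if u: "u \<in> L2" for u
    proof -
      have "sqrt ((2 * pi) ^ CARD('d)) * norm (emb (?S t u)) \<le> sqrt ((2 * pi) ^ CARD('d)) * (M * norm (emb u))"
        using M[OF u] unfolding parseval[OF u] parseval[OF CH_semigroup_L2[OF t u]] by (simp only: mult_ac)
      then show ?thesis by (rule mult_left_le_imp_le) simp
    qed
    then show ?thesis by blast
  qed
  have wd: "emb (?S t u) = emb (?S t v)" if t: "0 \<le> t" and u: "u \<in> L2" and v: "v \<in> L2" and eq: "emb u = emb v" for t u v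
  proof -
    obtain M where M: "\<And>u. u \<in> L2 \<Longrightarrow> norm (emb (?S t u)) \<le> M * norm (emb u)" using bnd[OF t] by metis
    have "(\<lambda>x. 1 * u x + (-1) * v x) = (\<lambda>x. u x - v x)" by simp
    then have "emb (?S t (\<lambda>x. u x - v x)) = emb (?S t u) - emb (?S t v)"
      using lin[OF t u v, of 1 "-1"] by simp
    moreover have "emb (\<lambda>x. u x - v x) = 0" using eq by (simp add: emb_linear u v)
    ultimately show ?thesis using M[OF L2_diff[OF u v]] by simp
  qed
  define pick where "pick x = (SOME u :: real^'d \<Rightarrow> real. u \<in> L2 \<and> emb u = x)" for x
  have pick: "pick x \<in> L2" "emb (pick x) = x" for x
  proof -
    have "\<exists>u :: real^'d \<Rightarrow> real. u \<in> L2 \<and> emb u = x" using emb_surj[of x] by metis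
    from someI_ex[OF this] show "pick x \<in> L2" "emb (pick x) = x" unfolding pick_def by simp_all
  qed
  define R where "R t x = emb (?S t (pick x))" for t x
  have R: "R t (emb u) = emb (?S t u)" if "0 \<le> t" "u \<in> L2" for t u
    unfolding R_def by (rule wd) (simp_all add: that pick)
  have "R t (emb u) = sg t (emb u)"
  proof (rule l2_semigroup_unique[OF _ _ _ _ t])
    fix t :: real assume t: "0 \<le> t"
    obtain M where M: "\<And>u. u \<in> L2 \<Longrightarrow> norm (emb (?S t u)) \<le> M * norm (emb u)" using bnd[OF t] by metis
    show "bounded_linear (R t)"
    proof (rule bounded_linear_intro[of _ M])
      fix x y :: "'d l2" and r :: real
      have "R t (emb (\<lambda>z. pick x z + pick y z)) = R t x + R t y"
        using lin[OF t pick(1) pick(1), of 1 x 1 y] by (simp add: R t L2_add pick, simp add: R_def)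
      then show "R t (x + y) = R t x + R t y" by (simp add: emb_linear pick)
      have "R t (emb (\<lambda>z. r * pick x z)) = r *\<^sub>R R t x"
        using lin[OF t pick(1) pick(1), of r x 0 x] by (simp add: R t L2_scale pick, simp add: R_def)
      then show "R t (r *\<^sub>R x) = r *\<^sub>R R t x" by (simp add: emb_scale pick)
      show "norm (R t x) \<le> norm x * M" using M[OF pick(1), of x] by (simp add: R_def pick mult.commute)
    qed
  next
    fix x
    have "ae_eq (?S 0 (pick x)) (pick x)" using S pick(1) by blast
    then have "emb (?S 0 (pick x)) = emb (pick x)"
      by (subst ae_eq_iff_emb[symmetric]) (auto intro!: CH_semigroup_L2 pick)
    then show "R 0 x = x" by (simp add: R_def pick)
  next
    fix s t :: real and x assume st: "0 \<le> s" "0 \<le> t"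
    have "ae_eq (?S (s + t) (pick x)) (?S s (?S t (pick x)))"
      by (rule S[THEN conjunct2, THEN conjunct2, THEN conjunct2, THEN conjunct2, THEN conjunct1, rule_format, OF st pick(1)])
    then have "emb (?S (s + t) (pick x)) = emb (?S s (?S t (pick x)))"
      using st by (subst ae_eq_iff_emb[symmetric]) (auto intro!: CH_semigroup_L2 pick)
    also have "\<dots> = R s (R t x)" unfolding R_def[of t] using st by (intro R[symmetric] CH_semigroup_L2 pick)
    finally show "R (s + t) x = R s (R t x)" by (simp add: R_def)
  next
    fix x y :: "'d l2"
    have "((\<lambda>h. (1 / h) *\<^sub>R (R h x - x)) \<longlongrightarrow> y) (at_right 0) \<longleftrightarrow> (pick x, pick y) \<in> generator_graph ?S"
      unfolding generator_graph_iff[OF C0_semigroup_CH pick(1) pick(1)] by (simp add: R_def pick)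
    then show "((\<lambda>h. (1 / h) *\<^sub>R (R h x - x)) \<longlongrightarrow> y) (at_right 0) \<longleftrightarrow> (\<forall>n. co y n = of_real (lam n) * co x n)"
      unfolding generator_graph_CH A_graph_iff[OF pick(1) pick(1)] by (simp add: pick)
  qed
  then show ?thesis by (simp add: R t u)
qed

section \<open>The extension to order -2\<close>

lemma sobolev_weight_minus_2: "sobolev_weight (- 2) c n = (cmod (c n / of_real (1 + (freq n)\<^sup>2)))\<^sup>2"
proof -
  have "sobolev_weight (- 2) c n = (cmod (c n))\<^sup>2 / (1 + (freq n)\<^sup>2)\<^sup>2"
    by (simp only: sobolev_weight_def freq_def power_int_minus) (simp add: divide_inverse)
  also have "\<dots> = (cmod (c n / of_real (1 + (freq n)\<^sup>2)))\<^sup>2"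
    by (simp only: norm_divide norm_of_real power_divide power2_abs)
  finally show ?thesis .
qed

text \<open>The multiplier series shows that the choice in \<open>CH_semigroup_ext\<close> has a
  solution. The chosen function is then compared with that series along one approximating sequence,
  which determines it almost everywhere.\<close>

lemma CH_semigroup_ext:
  fixes F :: "int^'d \<Rightarrow> complex"
  assumes t: "0 < t" and h: "herm F" and F: "F \<in> sobolev_coeffs (- 2)"
  shows CH_semigroup_ext_L2: "CH_semigroup_ext t F \<in> L2"
    and fourier_coeff_CH_semigroup_ext: "fourier_coeff (CH_semigroup_ext t F) = (\<lambda>n. of_real (exp (lam n * t)) * F n)"
proof -
  define X where "X n = complex_of_real (1 + (freq n)\<^sup>2)" for n :: "int^'d"
  have X0: "X n \<noteq> 0" for n unfolding X_def by (simp only: of_real_eq_0_iff) (use zero_le_power2[of "freq n"] in linarith)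
  have X_minus: "X (- n) = X n" for n by (simp add: X_def)
  have cX: "cmod (X n) = 1 + (freq n)\<^sup>2" for n unfolding X_def norm_of_real by (rule abs_of_nonneg) simp
  have hX: "herm (\<lambda>n. c n / X n)" if "herm c" for c using that by (simp add: herm_def X_minus) (simp add: X_def)
  have co_mk: "co (mkl2 (\<lambda>n. c n / X n)) = (\<lambda>n. c n / X n)" and norm_mk: "norm (mkl2 (\<lambda>n. c n / X n)) = sobolev_coeffs_norm (- 2) c"
    if c: "herm c" "c \<in> sobolev_coeffs (- 2)" for c
  proof -
    have "(\<lambda>n. (cmod (c n / X n))\<^sup>2) summable_on UNIV"
      using c(2) by (simp add: sobolev_coeffs_def sobolev_weight_minus_2[abs_def] X_def)
    then show co: "co (mkl2 (\<lambda>n. c n / X n)) = (\<lambda>n. c n / X n)" by (rule co_mkl2_summable[OF hX[OF c(1)]])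
    show "norm (mkl2 (\<lambda>n. c n / X n)) = sobolev_coeffs_norm (- 2) c"
      by (simp only: norm_l2_def co sobolev_coeffs_norm_def sobolev_weight_minus_2) (simp only: X_def)
  qed
  \<comment> \<open>Division by \<open>1 + |n|^2\<close> turns the H^-2 norm into the norm of
    \<open>l2\<close>.\<close>
  define G :: "'d l2" where "G = mkl2 (\<lambda>n. F n / X n)"
  have G: "F n = X n * co G n" for n using X0 by (simp add: G_def co_mk h F)
  have Fb: "cmod (F n) \<le> norm G * (1 + (freq n)\<^sup>2)" for n
    unfolding G[of n] norm_mult cX mult.commute[of "1 + (freq n)\<^sup>2"] by (rule mult_right_mono[OF co_le_norm]) simp
  define e where "e n = of_real (exp (lam n * t)) * F n" for n
  have e: "e abs_summable_on UNIV" "herm e"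
    unfolding e_def[abs_def] by (rule heat_abs_summable[OF t Fb], rule herm_heat[OF h])
  have w0: "trig e \<in> L2" "fourier_coeff (trig e) = e" using trig_in_L2[OF e] fourier_coeff_trig[OF e] by auto
  obtain K where K: "0 < K" "\<And>n :: int^'d. exp (lam n * t) \<le> K / (1 + (freq n)\<^sup>2) ^ 1"
    using exp_lam_decay[OF t, where k=1 and 'd='d] by metis
  define Q where "Q w \<longleftrightarrow> w \<in> L2 \<and> (\<forall>f :: nat \<Rightarrow> real^'d \<Rightarrow> real.
        (\<forall>j. f j \<in> L2 \<and> fourier_coeff (f j) - F \<in> sobolev_coeffs (- 2)) \<and>
        (\<lambda>j. sobolev_coeffs_norm (- 2) (fourier_coeff (f j) - F)) \<longlonglongrightarrow> 0 \<longrightarrow>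
        (\<lambda>j. L2_norm (CH_semigroup t (f j) - w)) \<longlonglongrightarrow> 0)" for w
  have t0: "0 \<le> t" using t by simp
  have lim0: "(\<lambda>j. emb (CH_semigroup t (f j))) \<longlonglongrightarrow> emb (trig e)"
    if f: "\<And>j. f j \<in> L2" "\<And>j. fourier_coeff (f j) - F \<in> sobolev_coeffs (- 2)"
      "(\<lambda>j. sobolev_coeffs_norm (- 2) (fourier_coeff (f j) - F)) \<longlonglongrightarrow> 0" for f :: "nat \<Rightarrow> real^'d \<Rightarrow> real"
  proof (rule LIM_zero_cancel, rule Lim_null_comparison)
    show "(\<lambda>j. K * sobolev_coeffs_norm (- 2) (fourier_coeff (f j) - F)) \<longlonglongrightarrow> 0"
      using tendsto_mult_left[OF f(3), of K] by simp
    have "norm (emb (CH_semigroup t (f j)) - emb (trig e)) \<le> K * sobolev_coeffs_norm (- 2) (fourier_coeff (f j) - F)" for j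
    proof -
      have hd: "herm (fourier_coeff (f j) - F)" using h herm_fourier_coeff[of "f j"] by (simp add: herm_def)
      note mk = co_mk[OF hd f(2)] norm_mk[OF hd f(2)]
      have "norm (emb (CH_semigroup t (f j)) - emb (trig e)) \<le> K * norm (mkl2 (\<lambda>n. (fourier_coeff (f j) - F) n / X n) :: 'd l2)"
      proof (rule norm_l2_compare)
        fix n
        have "co (emb (CH_semigroup t (f j)) - emb (trig e)) n = of_real (exp (lam n * t)) * (fourier_coeff (f j) n - F n)"
          using t0 by (simp add: emb_CH_semigroup f(1) co_sg co_emb w0 e_def algebra_simps)
        then have "cmod (co (emb (CH_semigroup t (f j)) - emb (trig e)) n) = exp (lam n * t) * cmod ((fourier_coeff (f j) - F) n)"
          by (simp add: norm_mult)
        also have "\<dots> \<le> K / (1 + (freq n)\<^sup>2) ^ 1 * cmod ((fourier_coeff (f j) - F) n)"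
          by (intro mult_right_mono K(2) norm_ge_zero)
        also have "\<dots> = K * cmod ((fourier_coeff (f j) - F) n / X n)" by (simp add: norm_divide cX)
        finally show "cmod (co (emb (CH_semigroup t (f j)) - emb (trig e)) n) \<le> K * cmod (co (mkl2 (\<lambda>n. (fourier_coeff (f j) - F) n / X n) :: 'd l2) n)"
          unfolding mk(1) .
      qed (use K in simp)
      then show ?thesis unfolding mk(2) .
    qed
    then show "\<forall>\<^sub>F j in sequentially. norm (emb (CH_semigroup t (f j)) - emb (trig e)) \<le> K * sobolev_coeffs_norm (- 2) (fourier_coeff (f j) - F)"
      by simp
  qed
  have L2_lim: "(\<lambda>j. L2_norm (CH_semigroup t (f j) - w)) \<longlonglongrightarrow> 0 \<longleftrightarrow> (\<lambda>j. emb (CH_semigroup t (f j))) \<longlonglongrightarrow> emb w"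
    if "w \<in> L2" "\<And>j. f j \<in> L2" for w and f :: "nat \<Rightarrow> real^'d \<Rightarrow> real"
    unfolding L2_norm_diff[OF CH_semigroup_L2[OF t0 that(2)] that(1)]
    by (subst tendsto_mult_norm_iff) (simp_all add: LIM_zero_iff)
  have "Q (trig e)" unfolding Q_def using w0(1) lim0 by (auto simp: L2_lim)
  then have "Q (SOME w. Q w)" by (rule someI[of Q])
  then have "Q (CH_semigroup_ext t F)" unfolding CH_semigroup_ext_def Q_def[abs_def] .
  then have w: "CH_semigroup_ext t F \<in> L2" and lim: "\<And>f. (\<And>j. f j \<in> L2) \<Longrightarrow> (\<And>j. fourier_coeff (f j) - F \<in> sobolev_coeffs (- 2)) \<Longrightarrow>
      (\<lambda>j. sobolev_coeffs_norm (- 2) (fourier_coeff (f j) - F)) \<longlonglongrightarrow> 0 \<Longrightarrow> (\<lambda>j. L2_norm (CH_semigroup t (f j) - CH_semigroup_ext t F)) \<longlonglongrightarrow> 0"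
    unfolding Q_def by blast+
  show "CH_semigroup_ext t F \<in> L2" by (rule w)
  \<comment> \<open>Truncations of \<open>F\<close>. They supply an actual sequence of L2 functions
    converging to \<open>F\<close>; without one the characterising property would say
    nothing.\<close>
  define c where "c j n = X n * co (proj (real j) G) n" for j n
  have c: "c j abs_summable_on UNIV" "herm (c j)" for j
  proof -
    show "c j abs_summable_on UNIV"
      by (rule finite_support_abs_summable[OF finite_freq_le[of "real j"]]) (simp add: c_def co_proj)
    show "herm (c j)" unfolding herm_def c_def by (simp add: X_minus co_uminus_index) (simp add: X_def)
  qed
  define f where "f j = trig (c j)" for j
  have f: "f j \<in> L2" "fourier_coeff (f j) = c j" for j
    unfolding f_def using trig_in_L2[OF c] fourier_coeff_trig[OF c] by auto
  have cF: "(c j - F) n / X n = co (proj (real j) G - G) n" for j n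
    using X0[of n] by (simp add: c_def G[of n] diff_divide_distrib)
  have wt: "sobolev_weight (- 2) (c j - F) = (\<lambda>n. (cmod (co (proj (real j) G - G) n))\<^sup>2)" for j
    unfolding sobolev_weight_minus_2[abs_def] cF[symmetric] X_def ..
  have sc: "fourier_coeff (f j) - F \<in> sobolev_coeffs (- 2)" for j
    unfolding f sobolev_coeffs_def mem_Collect_eq unfolding wt by (rule co_summable)
  have "((\<lambda>j. proj (real j) G - G) \<longlongrightarrow> 0) sequentially"
    by (intro LIM_zero filterlim_compose[OF proj_tendsto filterlim_real_sequentially])
  then have "(\<lambda>j. sobolev_coeffs_norm (- 2) (fourier_coeff (f j) - F)) \<longlonglongrightarrow> 0"
    unfolding f sobolev_coeffs_norm_def unfolding wt norm_l2_def[symmetric] by (rule tendsto_norm_zero)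
  note sn = this
  have "(\<lambda>j. emb (CH_semigroup t (f j))) \<longlonglongrightarrow> emb (CH_semigroup_ext t F)"
    using lim[of f, OF f(1) sc sn] by (rule L2_lim[OF w f(1), THEN iffD1])
  moreover have "(\<lambda>j. emb (CH_semigroup t (f j))) \<longlonglongrightarrow> emb (trig e)"
    by (rule lim0[OF f(1) sc sn])
  ultimately have eq: "emb (CH_semigroup_ext t F) = emb (trig e)" by (rule LIMSEQ_unique)
  show "fourier_coeff (CH_semigroup_ext t F) = (\<lambda>n. of_real (exp (lam n * t)) * F n)"
  proof
    fix n
    have "fourier_coeff (CH_semigroup_ext t F) n = co (emb (trig e)) n" using eq[symmetric] by (simp only: co_emb[OF w])
    then show "fourier_coeff (CH_semigroup_ext t F) n = of_real (exp (lam n * t)) * F n"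
      by (simp add: co_emb w0 e_def)
  qed
qed

section \<open>Functions and coefficient families\<close>

definition embk :: "nat \<Rightarrow> (real^'d \<Rightarrow> real) \<Rightarrow> 'd::finite l2" where
  "embk k u = mkl2 (\<lambda>n. of_real (wt k n) * fourier_coeff u n)"

lemma sobolev_weight_wt: "sobolev_weight (int k) c n = (cmod (of_real (wt k n) * c n))\<^sup>2"
proof -
  have "sobolev_weight (int k) c n = (cmod (c n))\<^sup>2 * (wt k n)\<^sup>2"
    by (simp only: sobolev_weight_def power_int_of_nat wt_power2 freq_def)
  then show ?thesis by (simp add: norm_mult power_mult_distrib)
qed

lemma sobolev_space_L2: "u \<in> sobolev_space k \<Longrightarrow> u \<in> L2"
  by (simp add: sobolev_space_def)

lemma
  fixes u :: "real^'d \<Rightarrow> real"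
  assumes u: "u \<in> sobolev_space k"
  shows co_embk: "co (embk k u) n = of_real (wt k n) * fourier_coeff u n"
    and hat_embk: "hat k (embk k u) n = fourier_coeff u n"
    and norm_embk: "norm (embk k u) = sobolev_norm k u"
proof -
  have "herm (\<lambda>n. of_real (wt k n) * fourier_coeff u n)"
    using herm_fourier_coeff[of u] by (simp add: herm_def)
  moreover have "(\<lambda>n. (cmod (of_real (wt k n) * fourier_coeff u n))\<^sup>2) summable_on UNIV"
    using u by (simp only: sobolev_space_def sobolev_coeffs_def mem_Collect_eq sobolev_weight_wt[abs_def])
  ultimately have co: "co (embk k u) = (\<lambda>n. of_real (wt k n) * fourier_coeff u n)"
    unfolding embk_def by (rule co_mkl2_summable)
  show "co (embk k u) n = of_real (wt k n) * fourier_coeff u n" by (simp only: co)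
  show "hat k (embk k u) n = fourier_coeff u n" using wt_pos[of k n] by (simp add: hat_def co)
  show "norm (embk k u) = sobolev_norm k u"
    by (simp only: norm_l2_def co sobolev_norm_def sobolev_coeffs_norm_def sobolev_weight_wt)
qed

lemma sobolev_spaceI:
  fixes u :: "real^'d \<Rightarrow> real"
  assumes u: "u \<in> L2" and eq: "\<And>n. fourier_coeff u n = hat k x n"
  shows "u \<in> sobolev_space k" and "embk k u = x"
proof -
  have c: "of_real (wt k n) * fourier_coeff u n = co x n" for n by (simp add: eq co_hat[of x n k])
  show s: "u \<in> sobolev_space k"
    using u by (simp add: sobolev_space_def sobolev_coeffs_def sobolev_weight_wt[abs_def] c co_summable)
  show "embk k u = x" by (rule l2_eqI) (simp add: co_embk[OF s] c)
qed

lemma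
  fixes u v :: "real^'d \<Rightarrow> real"
  assumes u: "u \<in> sobolev_space k" and v: "v \<in> sobolev_space k"
  shows sobolev_space_diff: "u - v \<in> sobolev_space k"
    and sobolev_norm_diff: "sobolev_norm k (u - v) = norm (embk k u - embk k v)"
proof -
  have L: "u - v \<in> L2" using L2_diff[of u v] sobolev_space_L2[OF u] sobolev_space_L2[OF v] by (simp add: fun_diff_def)
  have c: "fourier_coeff (u - v) n = hat k (embk k u - embk k v) n" for n
    using fourier_coeff_diff[OF sobolev_space_L2[OF u] sobolev_space_L2[OF v], of n]
    by (simp add: fun_diff_def hat_embk u v)
  show s: "u - v \<in> sobolev_space k" by (rule sobolev_spaceI[OF L c])
  show "sobolev_norm k (u - v) = norm (embk k u - embk k v)"
    unfolding norm_embk[OF s, symmetric] sobolev_spaceI(2)[OF L c] ..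
qed

lemma cmod_hat_le: "cmod (hat k x n) \<le> cmod (co x n)"
proof -
  have "cmod (hat k x n) = cmod (co x n) / wt k n" using wt_pos[of k n] by (simp add: hat_def norm_divide)
  also have "\<dots> \<le> cmod (co x n) / 1" using wt_ge_1[of k n] by (intro divide_left_mono) auto
  finally show ?thesis by simp
qed

section \<open>The control space\<close>

interpretation H0_space: module "\<lambda>c (f :: real^'d \<Rightarrow> real). (\<lambda>x. c * f x)"
  by standard (auto simp: fun_eq_iff algebra_simps)

lemma H0_linear:
  fixes f g :: "real^'d \<Rightarrow> real"
  shows "f \<in> H0 \<Longrightarrow> g \<in> H0 \<Longrightarrow> (\<lambda>x. f x + g x) \<in> H0" "f \<in> H0 \<Longrightarrow> (\<lambda>x. a * f x) \<in> H0" "(\<lambda>x. 0) \<in> (H0 :: (real^'d \<Rightarrow> real) set)"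
proof -
  show "(\<lambda>x. f x + g x) \<in> H0" if "f \<in> H0" "g \<in> H0"
    using H0_space.span_add[of f _ g] that by (simp add: H0_def plus_fun_def)
  show "(\<lambda>x. a * f x) \<in> H0" if "f \<in> H0"
    using H0_space.span_scale[of f _ a] that by (simp add: H0_def)
  show "(\<lambda>x. 0) \<in> (H0 :: (real^'d \<Rightarrow> real) set)"
    using H0_space.span_zero by (simp add: H0_def zero_fun_def)
qed

lemma H0_sum:
  fixes f :: "'a \<Rightarrow> real^'d \<Rightarrow> real"
  shows "finite A \<Longrightarrow> (\<And>a. a \<in> A \<Longrightarrow> f a \<in> H0) \<Longrightarrow> (\<lambda>x. \<Sum>a\<in>A. f a x) \<in> H0"
  by (induct A rule: finite_induct) (auto intro: H0_linear)

lemma H0_trig: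
  fixes n :: "int^'d"
  assumes n: "n \<in> {0} \<union> canonical_K \<union> uminus ` canonical_K"
  shows "(\<lambda>x. Re (a * cis (x \<bullet> lattice_vec n))) \<in> H0"
proof -
  let ?c = "\<lambda>(n :: int^'d) x. cos (x \<bullet> lattice_vec n)" and ?s = "\<lambda>(n :: int^'d) x. sin (x \<bullet> lattice_vec n)"
  have one: "(\<lambda>x. 1) \<in> (H0 :: (real^'d \<Rightarrow> real) set)" unfolding H0_def by (rule H0_space.span_base) simp
  have K: "?c m \<in> H0" "?s m \<in> H0" if "m \<in> canonical_K" for m
    unfolding H0_def using that by (auto intro!: H0_space.span_base)
  have e: "lattice_vec (- m) = - lattice_vec m" "lattice_vec 0 = (0 :: real^'d)" for m :: "int^'d"
    by (simp_all add: lattice_vec_def vec_eq_iff)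
  have "?c n \<in> H0 \<and> ?s n \<in> H0"
  proof -
    consider "n = 0" | "n \<in> canonical_K" | m where "m \<in> canonical_K" "n = - m" using n by blast
    then show ?thesis
    proof cases
      case 1
      then show ?thesis using one H0_linear(3) by (simp add: e)
    next
      case 2
      then show ?thesis using K by blast
    next
      case 3
      have "?s n = (\<lambda>x. (-1) * ?s m x)" by (simp add: 3 e)
      moreover have "?c n = ?c m" by (simp add: 3 e)
      ultimately show ?thesis using K[OF 3(1)] H0_linear(2)[of "?s m" "-1"] by simp
    qed
  qed
  then have "(\<lambda>x. Re a * ?c n x + (- Im a) * ?s n x) \<in> H0" by (intro H0_linear) auto
  then show ?thesis by simp
qed

lemma ctl_measurable_set:
  assumes "ctl c" shows "{t. c t \<in> A} \<in> sets borel"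
proof -
  have "{t. c t \<in> A} = (\<Union>x\<in>range c \<inter> A. {t. c t = x})" by auto
  also have "\<dots> \<in> sets borel" using assms by (intro sets.finite_UN) (auto simp: ctl_def)
  finally show ?thesis .
qed

lemma ctl_measurable:
  fixes f :: "'d::finite l2 \<Rightarrow> 'b::topological_space"
  assumes c: "ctl c" shows "(\<lambda>t. f (c t)) \<in> borel_measurable borel"
proof (rule borel_measurableI)
  fix S :: "'b set" assume "open S"
  have "(\<lambda>t. f (c t)) -` S \<inter> space borel = {t. c t \<in> f -` S}" by auto
  then show "(\<lambda>t. f (c t)) -` S \<inter> space borel \<in> sets borel" by (simp only: ctl_measurable_set[OF c])
qed

lemma ctl_bounded:
  fixes f :: "'d::finite l2 \<Rightarrow> 'a::real_normed_vector"
  assumes "ctl c" shows "\<exists>B. \<forall>t. norm (f (c t)) \<le> B"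
proof (intro exI allI)
  fix t
  have "finite (range c)" using assms by (simp add: ctl_def)
  then show "norm (f (c t)) \<le> (\<Sum>x\<in>range c. norm (f x))"
    by (intro member_le_sum[of "c t" "range c" "\<lambda>x. norm (f x)"]) auto
qed

lemma borel_lebesgue: "A \<in> sets borel \<Longrightarrow> A \<in> sets (lebesgue :: real measure)"
  using sets_completionI_sets[of A lborel] by simp

section \<open>Representing functions, controls and the mild integrand\<close>

context sobolev
begin

lemma
  fixes x :: "'d l2"
  shows rl_L2: "rl k x \<in> L2" and fourier_coeff_rl: "fourier_coeff (rl k x) = hat k x"
  unfolding rl_trig using trig_in_L2[OF hat_abs_summable herm_hat] fourier_coeff_trig[OF hat_abs_summable herm_hat] by auto

lemma
  fixes x :: "'d l2"
  shows rl_sobolev: "rl k x \<in> sobolev_space k" and embk_rl: "embk k (rl k x) = x"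
  using sobolev_spaceI[OF rl_L2, of x k x] by (simp_all add: fourier_coeff_rl)

text \<open>\<open>u\<close> agrees almost everywhere with the continuous function
  \<open>rl k (embk k u)\<close>, whose cube is a product in the algebra.\<close>

lemma fourier_coeff_cube:
  fixes u :: "real^'d \<Rightarrow> real"
  assumes u: "u \<in> sobolev_space k" shows "fourier_coeff (\<lambda>x. (u x) ^ 3) = hat k (cub (embk k u))"
proof -
  have "ae_eq u (rl k (embk k u))"
    by (subst ae_eq_iff_fourier_coeff) (auto simp: sobolev_space_L2[OF u] rl_L2 fourier_coeff_rl hat_embk[OF u])
  then have "AE x in torus. (u x) ^ 3 = rl k (cub (embk k u)) x"
    unfolding ae_eq_def by eventually_elim (simp add: rl_cub)
  then have "fourier_coeff (\<lambda>x. (u x) ^ 3) = fourier_coeff (rl k (cub (embk k u)))"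
    by (rule fourier_coeff_cong_AE[OF _ borel_measurable_power[OF L2_D(2)[OF sobolev_space_L2[OF u]]] L2_D(2)[OF rl_L2]])
  then show ?thesis by (simp add: fourier_coeff_rl)
qed

lemma rl_base_H0:
  fixes x :: "'d l2"
  assumes x: "x \<in> base" shows "rl k x \<in> H0"
proof -
  have "rl k x = (\<lambda>v. \<Sum>n\<in>supp x. Re (hat k x n * cis (v \<bullet> lattice_vec n)))"
  proof
    fix v
    have "((\<lambda>n. hat k x n * cis (v \<bullet> lattice_vec n)) has_sum (\<Sum>n\<in>supp x. hat k x n * cis (v \<bullet> lattice_vec n))) UNIV"
      by (rule has_sum_finite_neutralI[OF finite_supp_base[OF x]]) (auto simp: hat_def supp_def)
    then show "rl k x v = (\<Sum>n\<in>supp x. Re (hat k x n * cis (v \<bullet> lattice_vec n)))"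
      unfolding rl_def fser_def by (simp only: infsumI Re_sum)
  qed
  also have "\<dots> \<in> H0" using x by (intro H0_sum finite_supp_base H0_trig) (auto simp: base_def)
  finally show ?thesis .
qed

lemma control_Linfty:
  fixes c :: "real \<Rightarrow> 'd l2"
  assumes c: "ctl c" shows "(\<lambda>t. rl k (c t)) \<in> Linfty_H0 T"
proof -
  have H: "rl k (c t) \<in> H0" for t using c by (intro rl_base_H0) (auto simp: ctl_def)
  have "finite ((\<lambda>t. rl k (c t)) ` {0<..<T})"
    by (rule finite_subset[of _ "rl k ` range c"]) (use c in \<open>auto simp: ctl_def\<close>)
  moreover have "{t \<in> {0<..<T}. rl k (c t) = y} \<in> sets lebesgue" for y
  proof -
    have "{t \<in> {0<..<T}. rl k (c t) = y} = {0<..<T} \<inter> {t. c t \<in> {x. rl k x = y}}" by auto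
    also have "\<dots> \<in> sets lebesgue" by (intro borel_lebesgue sets.Int ctl_measurable_set[OF c]) simp
    finally show ?thesis .
  qed
  ultimately have "simple_curve H0 {0<..<T} (\<lambda>t. rl k (c t))" using H by (auto simp: simple_curve_def)
  then have "strongly_measurable_curve H0 {0<..<T} (\<lambda>t. rl k (c t))"
    unfolding strongly_measurable_curve_def using H
    by (intro conjI exI[of _ "\<lambda>_ t. rl k (c t)"]) (auto simp: L2_norm_def zero_fun_def)
  moreover obtain B where "\<And>t. norm (L2_norm (rl k (c t))) \<le> B"
    using ctl_bounded[OF c, of "\<lambda>x. L2_norm (rl k x)"] by metis
  then have "\<exists>M. AE t in lebesgue_on {0<..<T}. L2_norm (rl k (c t)) \<le> M"
    by (intro exI[of _ B] AE_I2) (auto intro: order_trans[OF abs_ge_self])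
  ultimately show ?thesis by (simp add: Linfty_H0_def)
qed

text \<open>The \<open>n\<close>-th Fourier coefficient of the integrand in the mild formulation, times \<open>wt k n\<close>.\<close>

definition src :: "(real \<Rightarrow> 'd l2) \<Rightarrow> (real \<Rightarrow> 'd l2) \<Rightarrow> real \<Rightarrow> int^'d \<Rightarrow> real \<Rightarrow> complex" where
  "src V c t n \<sigma> = exp (lam n * (t - \<sigma>)) *\<^sub>R (co (c \<sigma>) n - (freq n)\<^sup>2 *\<^sub>R co (cub (V \<sigma>)) n)"

lemma src_integrable:
  assumes V: "continuous_on {0..T} V" and c: "ctl c" and t: "t \<in> {0..T}"
  shows "integrable (lebesgue_on {0..t}) (src V c t n)"
proof -
  have "finite_measure (lebesgue_on {0..t})" by (rule finite_measure_lebesgue_on) simp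
  then interpret finite_measure "lebesgue_on {0..t}" .
  have cc: "continuous_on {0..t} (\<lambda>\<sigma>. co (cub (V \<sigma>)) n)"
    using t by (intro continuous_on_co continuous_on_cub continuous_on_subset[OF V]) auto
  have m1: "(\<lambda>\<sigma>. co (c \<sigma>) n) \<in> borel_measurable (lebesgue_on {0..t})"
    using ctl_measurable[OF c, of "\<lambda>x. co x n"] by (intro measurable_restrict_space1 measurable_completion) simp
  obtain B where B: "\<And>\<sigma>. norm (co (c \<sigma>) n) \<le> B" using ctl_bounded[OF c, of "\<lambda>x. co x n"] by metis
  have i1: "integrable (lebesgue_on {0..t}) (\<lambda>\<sigma>. exp (lam n * (t - \<sigma>)) *\<^sub>R co (c \<sigma>) n)"
  proof (rule integrable_const_bound[where B=B])
    show "(\<lambda>\<sigma>. exp (lam n * (t - \<sigma>)) *\<^sub>R co (c \<sigma>) n) \<in> borel_measurable (lebesgue_on {0..t})"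
      by (intro borel_measurable_scaleR m1 continuous_imp_measurable_on_sets_lebesgue continuous_intros) simp
    have "norm (exp (lam n * (t - \<sigma>)) *\<^sub>R co (c \<sigma>) n) \<le> B" if "\<sigma> \<in> {0..t}" for \<sigma>
    proof -
      have "exp (lam n * (t - \<sigma>)) \<le> 1" using that lam_nonpos[of n] by (simp add: mult_nonpos_nonneg)
      then have "exp (lam n * (t - \<sigma>)) * cmod (co (c \<sigma>) n) \<le> 1 * B" using B by (intro mult_mono) auto
      then show ?thesis by simp
    qed
    then show "AE \<sigma> in lebesgue_on {0..t}. norm (exp (lam n * (t - \<sigma>)) *\<^sub>R co (c \<sigma>) n) \<le> B"
      by (intro AE_I2) simp
  qed
  have "continuous_on {0..t} (\<lambda>\<sigma>. exp (lam n * (t - \<sigma>)) *\<^sub>R ((freq n)\<^sup>2 *\<^sub>R co (cub (V \<sigma>)) n))"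
    by (intro continuous_intros cc)
  then have "integrable (lebesgue_on {0..t}) (\<lambda>\<sigma>. exp (lam n * (t - \<sigma>)) *\<^sub>R ((freq n)\<^sup>2 *\<^sub>R co (cub (V \<sigma>)) n))"
    by (rule continuous_imp_integrable_real)
  from Bochner_Integration.integrable_diff[OF i1 this] show ?thesis
    by (simp add: src_def[abs_def] scaleR_diff_right)
qed

text \<open>Variation of constants: differentiating
  \<open>exp (lam n * (t - \<sigma>)) *\<^sub>R co (U \<sigma>) n\<close> cancels the
  \<open>lam\<close> term. The fundamental theorem tolerates the finitely many switching
  times.\<close>

lemma sol_src_has_integral:
  assumes U: "sol T c U" and t: "t \<in> {0..T}"
  shows "(src U c t n has_integral co (U t) n - exp (lam n * t) *\<^sub>R co (U 0) n) {0..t}"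
proof -
  obtain P where P: "finite P" "\<And>t n. t \<in> {0<..<T} - P \<Longrightarrow> ((\<lambda>t. co (U t) n) has_vector_derivative
      lam n *\<^sub>R co (U t) n - (freq n)\<^sup>2 *\<^sub>R co (cub (U t)) n + co (c t) n) (at t)"
    and Uc: "continuous_on {0..T} U" using U by (auto simp: sol_def)
  have "(src U c t n has_integral exp (lam n * (t - t)) *\<^sub>R co (U t) n - exp (lam n * (t - 0)) *\<^sub>R co (U 0) n) {0..t}"
  proof (rule fundamental_theorem_of_calculus_interior_strong[OF P(1)])
    show "continuous_on {0..t} (\<lambda>\<sigma>. exp (lam n * (t - \<sigma>)) *\<^sub>R co (U \<sigma>) n)"
      using t by (intro continuous_intros continuous_on_co continuous_on_subset[OF Uc]) auto
    fix \<sigma> assume \<sigma>: "\<sigma> \<in> {0<..<t} - P"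
    have "((\<lambda>\<sigma>. exp (lam n * (t - \<sigma>))) has_real_derivative (- lam n * exp (lam n * (t - \<sigma>)))) (at \<sigma>)"
      by (auto intro!: derivative_eq_intros)
    moreover have "((\<lambda>t. co (U t) n) has_vector_derivative
        lam n *\<^sub>R co (U \<sigma>) n - (freq n)\<^sup>2 *\<^sub>R co (cub (U \<sigma>)) n + co (c \<sigma>) n) (at \<sigma>)"
      by (rule P(2)) (use \<sigma> t in auto)
    ultimately have "((\<lambda>\<sigma>. exp (lam n * (t - \<sigma>)) *\<^sub>R co (U \<sigma>) n) has_vector_derivative
        exp (lam n * (t - \<sigma>)) *\<^sub>R (lam n *\<^sub>R co (U \<sigma>) n - (freq n)\<^sup>2 *\<^sub>R co (cub (U \<sigma>)) n + co (c \<sigma>) n)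
        + (- lam n * exp (lam n * (t - \<sigma>))) *\<^sub>R co (U \<sigma>) n) (at \<sigma>)"
      by (rule has_vector_derivative_scaleR)
    then show "((\<lambda>\<sigma>. exp (lam n * (t - \<sigma>)) *\<^sub>R co (U \<sigma>) n) has_vector_derivative src U c t n \<sigma>) (at \<sigma>)"
      by (rule has_vector_derivative_eq_rhs) (simp add: src_def algebra_simps)
  qed (use t in auto)
  then show ?thesis by simp
qed

lemma sol_src_integral:
  assumes U: "sol T c U" and c: "ctl c" and t: "t \<in> {0..T}"
  shows "(\<integral>\<sigma>. src U c t n \<sigma> \<partial>lebesgue_on {0..t}) = co (U t) n - exp (lam n * t) *\<^sub>R co (U 0) n"
proof -
  have "continuous_on {0..T} U" using U by (simp add: sol_def)
  from lebesgue_integral_eq_integral[OF src_integrable[OF this c t]]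
  show ?thesis using integral_unique[OF sol_src_has_integral[OF U t]] by simp
qed

text \<open>The mild integrand with the time of the semigroup and of the state frozen at \<gamma>,
  and the control value kept as a separate argument. Discretising \<gamma> alone then yields simple
  curves. The value 0 for \<open>\<gamma> \<ge> t\<close> avoids the extension at nonpositive
  times.\<close>

definition evo :: "(real \<Rightarrow> 'd l2) \<Rightarrow> real \<Rightarrow> real \<Rightarrow> 'd l2 \<Rightarrow> real^'d \<Rightarrow> real" where
  "evo V t \<gamma> y = (if \<gamma> < t then CH_semigroup_ext (t - \<gamma>) (laplacian (hat k (cub (V \<gamma>))) + hat k y) else (\<lambda>_. 0))"

text \<open>The source lies in H^-2: the Laplacian costs the factor \<open>(freq n)^2\<close>, which
  division by \<open>1 + (freq n)^2\<close> compensates.\<close>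

lemma
  assumes \<gamma>: "\<gamma> < t"
  shows fourier_coeff_evo: "fourier_coeff (evo V t \<gamma> y) n =
    of_real (exp (lam n * (t - \<gamma>))) * (hat k y n - of_real ((freq n)\<^sup>2) * hat k (cub (V \<gamma>)) n)"
    and evo_L2_aux: "evo V t \<gamma> y \<in> L2"
proof -
  let ?F = "laplacian (hat k (cub (V \<gamma>))) + hat k y"
  let ?x = "cub (V \<gamma>)"
  have F: "?F n = hat k y n - of_real ((freq n)\<^sup>2) * hat k ?x n" for n
    by (simp add: laplacian_def freq_def)
  have h: "herm ?F" using herm_hat[of k y] herm_hat[of k ?x] unfolding herm_def F by simp
  have "(\<lambda>n. 2 * (cmod (co ?x n))\<^sup>2 + 2 * (cmod (co y n))\<^sup>2) summable_on UNIV"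
    by (intro summable_on_add summable_on_cmult_right co_summable)
  then have "sobolev_weight (- 2) ?F summable_on UNIV"
  proof (rule summable_on_comparison_test)
    fix n :: "int^'d"
    let ?X = "1 + (freq n)\<^sup>2"
    have X: "1 \<le> ?X" by simp
    have "cmod (?F n / of_real ?X) = cmod (?F n) / ?X" using X by (simp only: norm_divide norm_of_real abs_of_nonneg)
    also have "\<dots> \<le> (?X * (cmod (co ?x n) + cmod (co y n))) / ?X"
    proof (rule divide_right_mono)
      have "cmod (?F n) \<le> cmod (hat k y n) + (freq n)\<^sup>2 * cmod (hat k ?x n)"
        unfolding F using norm_triangle_ineq4[of "hat k y n" "of_real ((freq n)\<^sup>2) * hat k ?x n"] by (simp add: norm_mult norm_power)
      also have "\<dots> \<le> ?X * cmod (co y n) + ?X * cmod (co ?x n)"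
        using cmod_hat_le[of k y n] cmod_hat_le[of k ?x n] mult_right_mono[OF X norm_ge_zero[of "co y n"]]
        by (intro add_mono mult_mono) auto
      finally show "cmod (?F n) \<le> ?X * (cmod (co ?x n) + cmod (co y n))" by (simp add: algebra_simps)
    qed (use X in simp)
    also have "\<dots> = cmod (co ?x n) + cmod (co y n)" using X by (intro nonzero_mult_div_cancel_left) linarith
    finally have "sobolev_weight (- 2) ?F n \<le> (cmod (co ?x n) + cmod (co y n))\<^sup>2"
      unfolding sobolev_weight_minus_2 by (intro power_mono) auto
    also have "\<dots> \<le> 2 * (cmod (co ?x n))\<^sup>2 + 2 * (cmod (co y n))\<^sup>2"
      using zero_le_power2[of "cmod (co ?x n) - cmod (co y n)"] by (simp add: power2_sum power2_diff)
    finally show "sobolev_weight (- 2) ?F n \<le> 2 * (cmod (co ?x n))\<^sup>2 + 2 * (cmod (co y n))\<^sup>2" .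
    show "0 \<le> sobolev_weight (- 2) ?F n" unfolding sobolev_weight_minus_2 by simp
  qed
  then have s: "?F \<in> sobolev_coeffs (- 2)" by (simp add: sobolev_coeffs_def)
  have t: "0 < t - \<gamma>" using \<gamma> by simp
  show "fourier_coeff (evo V t \<gamma> y) n =
    of_real (exp (lam n * (t - \<gamma>))) * (hat k y n - of_real ((freq n)\<^sup>2) * hat k (cub (V \<gamma>)) n)"
    using \<gamma> fun_cong[OF fourier_coeff_CH_semigroup_ext[OF t h s], of n] unfolding evo_def F by simp
  show "evo V t \<gamma> y \<in> L2" using \<gamma> CH_semigroup_ext_L2[OF t h s] by (simp add: evo_def)
qed

lemma evo_L2: "evo V t \<gamma> y \<in> L2"
  using evo_L2_aux[of \<gamma> t V y] L2_const[of 0] by (cases "\<gamma> < t") (auto simp: evo_def)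

lemma fourier_coeff_evo_src: "\<sigma> < t \<Longrightarrow> fourier_coeff (evo V t \<sigma> (c \<sigma>)) n = src V c t n \<sigma> / of_real (wt k n)"
  by (simp add: fourier_coeff_evo src_def hat_def scaleR_conv_of_real diff_divide_distrib[symmetric])

end

section \<open>Bochner integrals of curves\<close>

lemma AE_interior: "AE \<sigma> in lebesgue_on {0..t :: real}. \<sigma> \<in> {0..<t}"
proof -
  have "AE \<sigma> in lebesgue. \<sigma> \<notin> {t}" by (rule AE_not_in) (simp add: negligible_iff_null_sets[symmetric])
  then have "AE \<sigma> in lebesgue. \<sigma> \<in> {0..t} \<longrightarrow> \<sigma> \<in> {0..<t}" by eventually_elim auto
  then show ?thesis by (subst AE_restrict_space_iff) simp_all
qed

lemma simple_curve_integral: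
  fixes f :: "(real^'d \<Rightarrow> real) \<Rightarrow> complex"
  assumes s: "simple_curve X I s" and I: "I \<in> lmeasurable"
  shows "has_bochner_integral (lebesgue_on I) (\<lambda>\<sigma>. f (s \<sigma>)) (\<Sum>y\<in>s ` I. of_real (measure lebesgue {t \<in> I. s t = y}) * f y)"
proof -
  let ?A = "\<lambda>y. {t \<in> I. s t = y}"
  have "finite_measure (lebesgue_on I)" by (rule finite_measure_lebesgue_on[OF I])
  then interpret finite_measure "lebesgue_on I" .
  have Is: "I \<in> sets lebesgue" using I by (rule fmeasurableD)
  have A: "?A y \<in> sets lebesgue" for y using s by (simp add: simple_curve_def)
  have A': "?A y \<in> sets (lebesgue_on I)" for y using A[of y] Is by (simp add: sets_restrict_space_iff)
  have m: "measure (lebesgue_on I) (?A y) = measure lebesgue (?A y)" for y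
    by (rule measure_restrict_space) (use Is in auto)
  have "has_bochner_integral (lebesgue_on I) (\<lambda>\<sigma>. \<Sum>y\<in>s ` I. indicator (?A y) \<sigma> *\<^sub>R f y) (\<Sum>y\<in>s ` I. measure (lebesgue_on I) (?A y) *\<^sub>R f y)"
    by (intro has_bochner_integral_sum has_bochner_integral_scaleR_left has_bochner_integral_real_indicator A')
      (simp add: emeasure_eq_measure)
  also have "?this \<longleftrightarrow> ?thesis"
  proof (rule has_bochner_integral_cong[OF refl])
    fix \<sigma> assume "\<sigma> \<in> space (lebesgue_on I)"
    then have \<sigma>: "\<sigma> \<in> I" by simp
    have "(\<Sum>y\<in>s ` I. indicator (?A y) \<sigma> *\<^sub>R f y) = (\<Sum>y\<in>s ` I. if y = s \<sigma> then f y else 0)"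
      using \<sigma> by (intro sum.cong) (auto simp: indicator_def)
    also have "\<dots> = f (s \<sigma>)" using s \<sigma> by (simp add: simple_curve_def)
    finally show "(\<Sum>y\<in>s ` I. indicator (?A y) \<sigma> *\<^sub>R f y) = f (s \<sigma>)" .
  qed (simp add: m scaleR_conv_of_real)
  finally show ?thesis .
qed

lemma
  fixes s :: "real \<Rightarrow> real^'d \<Rightarrow> real"
  assumes s: "simple_curve L2 I s"
  shows simple_integral_L2: "simple_integral I s \<in> L2"
    and fourier_coeff_simple_integral: "fourier_coeff (simple_integral I s) n =
      (\<Sum>y\<in>s ` I. of_real (measure lebesgue {t \<in> I. s t = y}) * fourier_coeff y n)"
proof -
  have fin: "finite (s ` I)" and L: "y \<in> L2" if "y \<in> s ` I" for y using s that by (auto simp: simple_curve_def)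
  have fin: "finite (s ` I)" using s by (simp add: simple_curve_def)
  show "simple_integral I s \<in> L2" unfolding simple_integral_def by (intro L2_sum fin L2_scale L)
  show "fourier_coeff (simple_integral I s) n =
      (\<Sum>y\<in>s ` I. of_real (measure lebesgue {t \<in> I. s t = y}) * fourier_coeff y n)"
    unfolding simple_integral_def by (subst fourier_coeff_sum) (auto simp: fin L L2_scale fourier_coeff_scale)
qed

lemma norm_emb_diff_le:
  fixes u v :: "real^'d \<Rightarrow> real"
  assumes "u \<in> L2" "v \<in> L2" shows "norm (emb u - emb v) \<le> L2_norm (u - v)"
proof -
  have "1 \<le> (2 * pi) ^ CARD('d)" using pi_ge_two by (intro one_le_power) linarith
  then have "1 \<le> sqrt ((2 * pi) ^ CARD('d))" by simp
  then have "1 * norm (emb u - emb v) \<le> sqrt ((2 * pi) ^ CARD('d)) * norm (emb u - emb v)"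
    by (intro mult_right_mono) auto
  then show ?thesis by (simp only: L2_norm_diff[OF assms] mult_1)
qed

text \<open>The integral is estimated by duality, since the norm of the integrand need not be known to be
  measurable.\<close>

lemma simple_integral_error:
  fixes f s :: "real \<Rightarrow> real^'d \<Rightarrow> real"
  assumes s: "simple_curve L2 I s" and I: "I \<in> lmeasurable" and f: "AE \<sigma> in lebesgue_on I. f \<sigma> \<in> L2"
    and g: "\<And>n. integrable (lebesgue_on I) (g n)" "\<And>n. AE \<sigma> in lebesgue_on I. fourier_coeff (f \<sigma>) n = g n \<sigma>"
    and G: "finite G"
  shows "ennreal (L2_set (\<lambda>n. cmod (fourier_coeff (simple_integral I s) n - (\<integral>\<sigma>. g n \<sigma> \<partial>lebesgue_on I))) G)
     \<le> (\<integral>\<^sup>+\<sigma>. ennreal (L2_norm (f \<sigma> - s \<sigma>)) \<partial>lebesgue_on I)"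
proof -
  let ?M = "lebesgue_on I"
  define a where "a n = fourier_coeff (simple_integral I s) n - (\<integral>\<sigma>. g n \<sigma> \<partial>?M)" for n
  define N where "N = L2_set (\<lambda>n. cmod (a n)) G"
  have N0: "0 \<le> N" by (simp add: N_def)
  have "ennreal N \<le> (\<integral>\<^sup>+\<sigma>. ennreal (L2_norm (f \<sigma> - s \<sigma>)) \<partial>?M)"
  proof (cases "N = 0")
    case False
    then have N: "0 < N" using N0 by simp
    \<comment> \<open>Normalised dual vector: pairing with \<open>b\<close> recovers
      \<open>N\<close>, and Cauchy-Schwarz against it costs a factor of at most 1.\<close>
    define b where "b n = a n / of_real N" for n
    let ?h = "\<lambda>\<sigma>. \<Sum>n\<in>G. cnj (b n) * (fourier_coeff (s \<sigma>) n - g n \<sigma>)"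
    have sc: "has_bochner_integral ?M (\<lambda>\<sigma>. fourier_coeff (s \<sigma>) n) (fourier_coeff (simple_integral I s) n)" for n
      unfolding fourier_coeff_simple_integral[OF s] by (rule simple_curve_integral[OF s I])
    have "has_bochner_integral ?M ?h (\<Sum>n\<in>G. cnj (b n) * a n)"
      unfolding a_def by (intro has_bochner_integral_sum has_bochner_integral_mult_right has_bochner_integral_diff
          sc has_bochner_integral_integrable g(1))
    moreover have "(\<Sum>n\<in>G. cnj (b n) * a n) = of_real N"
    proof -
      have "cnj (b n) * a n = of_real ((cmod (a n))\<^sup>2 / N)" for n
        using complex_norm_square[of "a n"] by (simp add: b_def mult.commute)
      then have "(\<Sum>n\<in>G. cnj (b n) * a n) = of_real ((\<Sum>n\<in>G. (cmod (a n))\<^sup>2) / N)"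
        by (simp only: of_real_sum sum_divide_distrib)
      also have "(\<Sum>n\<in>G. (cmod (a n))\<^sup>2) = N\<^sup>2" by (simp add: N_def L2_set_def sum_nonneg)
      finally show ?thesis using N by (simp add: power2_eq_square)
    qed
    ultimately have h: "integrable ?M ?h" "integral\<^sup>L ?M ?h = of_real N"
      by (simp_all add: has_bochner_integral_iff)
    have "ennreal N = ennreal (norm (integral\<^sup>L ?M ?h))" using N by (simp add: h(2))
    also have "\<dots> \<le> (\<integral>\<^sup>+\<sigma>. ennreal (norm (?h \<sigma>)) \<partial>?M)" by (rule integral_norm_bound_ennreal[OF h(1)])
    also have "\<dots> \<le> (\<integral>\<^sup>+\<sigma>. ennreal (L2_norm (f \<sigma> - s \<sigma>)) \<partial>?M)"
    proof (rule nn_integral_mono_AE)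
      have "AE \<sigma> in ?M. \<forall>n\<in>G. fourier_coeff (f \<sigma>) n = g n \<sigma>" using g(2) G by (intro AE_finite_allI)
      moreover have "AE \<sigma> in ?M. \<sigma> \<in> I" by (rule AE_I2) simp
      ultimately show "AE \<sigma> in ?M. ennreal (norm (?h \<sigma>)) \<le> ennreal (L2_norm (f \<sigma> - s \<sigma>))"
        using f
      proof eventually_elim
        case (elim \<sigma>)
        have sL: "s \<sigma> \<in> L2" using s elim(2) by (auto simp: simple_curve_def)
        let ?x = "emb (f \<sigma>) - emb (s \<sigma>)"
        have "norm (?h \<sigma>) \<le> (\<Sum>n\<in>G. norm (cnj (b n) * (fourier_coeff (s \<sigma>) n - g n \<sigma>)))" by (rule norm_sum)
        also have "\<dots> = (\<Sum>n\<in>G. \<bar>cmod (b n)\<bar> * \<bar>cmod (co ?x n)\<bar>)"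
          by (intro sum.cong refl) (use elim in \<open>simp add: norm_mult co_emb sL norm_minus_commute\<close>)
        also have "\<dots> \<le> L2_set (\<lambda>n. cmod (b n)) G * L2_set (\<lambda>n. cmod (co ?x n)) G" by (rule L2_set_mult_ineq)
        also have "\<dots> \<le> 1 * norm ?x"
        proof (rule mult_mono)
          have "L2_set (\<lambda>n. cmod (b n)) G = L2_set (\<lambda>n. (1 / N) * cmod (a n)) G"
            using N by (simp add: b_def norm_divide)
          also have "\<dots> = (1 / N) * N" unfolding N_def[of] using N by (subst L2_set_right_distrib) (simp_all add: N_def)
          finally show "L2_set (\<lambda>n. cmod (b n)) G \<le> 1" using N by simp
        qed (rule L2_set_co_le_norm, simp_all)
        also have "\<dots> \<le> L2_norm (f \<sigma> - s \<sigma>)" using norm_emb_diff_le[OF elim(3) sL] by simp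
        finally show ?case by (rule ennreal_leI)
      qed
    qed
    finally show ?thesis .
  qed simp
  then show ?thesis by (simp add: N_def a_def)
qed

lemma ennreal_null_comparison:
  assumes "\<And>j. ennreal (x j) \<le> b j" "\<And>j. 0 \<le> x j" "b \<longlonglongrightarrow> 0" shows "x \<longlonglongrightarrow> 0"
proof -
  have "(\<lambda>j. ennreal (x j)) \<longlonglongrightarrow> ennreal 0"
    unfolding ennreal_0 by (rule tendsto_sandwich[OF _ _ tendsto_const assms(3)]) (simp_all add: assms(1))
  then show ?thesis by (rule tendsto_ennrealD) (simp_all add: assms(2))
qed

text \<open>Reads Duhamel's formula for the coefficients off an arbitrary mild solution;
  \<open>has_L2_bochner_integralI\<close> goes in the opposite direction.\<close>

lemma bochner_integral_coeff:
  fixes f :: "real \<Rightarrow> real^'d \<Rightarrow> real"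
  assumes fw: "has_L2_bochner_integral f w I" and I: "I \<in> lmeasurable"
    and g: "\<And>n. integrable (lebesgue_on I) (g n)" "\<And>n. AE \<sigma> in lebesgue_on I. fourier_coeff (f \<sigma>) n = g n \<sigma>"
  shows "fourier_coeff w n = (\<integral>\<sigma>. g n \<sigma> \<partial>lebesgue_on I)"
proof -
  have f: "AE \<sigma> in lebesgue_on I. f \<sigma> \<in> L2" and w: "w \<in> L2"
    using fw by (simp_all add: has_L2_bochner_integral_def strongly_measurable_curve_def)
  obtain s where s: "\<And>j :: nat. simple_curve L2 I (s j)"
    and lim: "(\<lambda>j. \<integral>\<^sup>+t. ennreal (L2_norm (f t - s j t)) \<partial>lebesgue_on I) \<longlonglongrightarrow> 0"
      "(\<lambda>j. L2_norm (simple_integral I (s j) - w)) \<longlonglongrightarrow> 0"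
    using fw unfolding has_L2_bochner_integral_def by blast
  have "(\<lambda>j. cmod (fourier_coeff (simple_integral I (s j)) n - (\<integral>\<sigma>. g n \<sigma> \<partial>lebesgue_on I))) \<longlonglongrightarrow> 0"
  proof (rule ennreal_null_comparison[OF _ _ lim(1)])
    fix j
    show "ennreal (cmod (fourier_coeff (simple_integral I (s j)) n - (\<integral>\<sigma>. g n \<sigma> \<partial>lebesgue_on I)))
        \<le> (\<integral>\<^sup>+t. ennreal (L2_norm (f t - s j t)) \<partial>lebesgue_on I)"
      using simple_integral_error[OF s[of j] I f g, of "{n}"] by simp
  qed simp
  then have 1: "(\<lambda>j. fourier_coeff (simple_integral I (s j)) n) \<longlonglongrightarrow> (\<integral>\<sigma>. g n \<sigma> \<partial>lebesgue_on I)"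
    by (simp add: tendsto_norm_zero_iff LIM_zero_iff)
  have "(\<lambda>j. fourier_coeff (simple_integral I (s j)) n - fourier_coeff w n) \<longlonglongrightarrow> 0"
  proof (rule Lim_null_comparison[OF _ lim(2)], rule always_eventually, rule allI)
    fix j
    have "cmod (fourier_coeff (simple_integral I (s j)) n - fourier_coeff w n) = cmod (co (emb (simple_integral I (s j)) - emb w) n)"
      by (simp add: co_emb simple_integral_L2[OF s] w)
    also have "\<dots> \<le> norm (emb (simple_integral I (s j)) - emb w)" by (rule co_le_norm)
    also have "\<dots> \<le> L2_norm (simple_integral I (s j) - w)" by (rule norm_emb_diff_le[OF simple_integral_L2[OF s] w])
    finally show "cmod (fourier_coeff (simple_integral I (s j)) n - fourier_coeff w n) \<le> L2_norm (simple_integral I (s j) - w)" .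
  qed
  then have "(\<lambda>j. fourier_coeff (simple_integral I (s j)) n) \<longlonglongrightarrow> fourier_coeff w n" by (rule LIM_zero_cancel)
  then show ?thesis using 1 by (rule LIMSEQ_unique)
qed

text \<open>The integrals of the simple curves need no separate treatment: the duality estimate
  bounds their distance to \<open>w\<close> by the L1 distance of the curves.\<close>

lemma has_L2_bochner_integralI:
  fixes f :: "real \<Rightarrow> real^'d \<Rightarrow> real"
  assumes s: "\<And>j :: nat. simple_curve L2 I (s j)" and I: "I \<in> lmeasurable" and f: "AE \<sigma> in lebesgue_on I. f \<sigma> \<in> L2"
    and g: "\<And>n. integrable (lebesgue_on I) (g n)" "\<And>n. AE \<sigma> in lebesgue_on I. fourier_coeff (f \<sigma>) n = g n \<sigma>"
    and w: "w \<in> L2" "\<And>n. fourier_coeff w n = (\<integral>\<sigma>. g n \<sigma> \<partial>lebesgue_on I)"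
    and ae: "AE \<sigma> in lebesgue_on I. (\<lambda>j. L2_norm (f \<sigma> - s j \<sigma>)) \<longlonglongrightarrow> 0"
    and lim: "(\<lambda>j. \<integral>\<^sup>+\<sigma>. ennreal (L2_norm (f \<sigma> - s j \<sigma>)) \<partial>lebesgue_on I) \<longlonglongrightarrow> 0"
  shows "has_L2_bochner_integral f w I"
proof -
  let ?E = "\<lambda>j. \<integral>\<^sup>+\<sigma>. ennreal (L2_norm (f \<sigma> - s j \<sigma>)) \<partial>lebesgue_on I"
  let ?d = "\<lambda>j. emb (simple_integral I (s j)) - emb w"
  have "(\<lambda>j. norm (?d j)) \<longlonglongrightarrow> 0"
  proof (rule ennreal_null_comparison[OF _ _ lim])
    fix j
    show "ennreal (norm (?d j)) \<le> ?E j"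
    proof (cases "?E j")
      case (real r)
      have "norm (?d j) \<le> r"
      proof (rule l2_norm_leI[OF real(1)])
        fix G assume G: "finite (G :: (int^'d) set)"
        have "L2_set (\<lambda>n. cmod (co (?d j) n)) G = L2_set (\<lambda>n. cmod (fourier_coeff (simple_integral I (s j)) n - (\<integral>\<sigma>. g n \<sigma> \<partial>lebesgue_on I))) G"
          by (simp add: co_emb simple_integral_L2[OF s] w)
        moreover have "ennreal \<dots> \<le> ennreal r" using simple_integral_error[OF s[of j] I f g G] real(2) by simp
        ultimately show "L2_set (\<lambda>n. cmod (co (?d j) n)) G \<le> r" using real(1) by simp
      qed
      then show ?thesis unfolding real(2) by (rule ennreal_leI)
    qed simp
  qed simp
  then have "(\<lambda>j. sqrt ((2 * pi) ^ CARD('d)) * norm (?d j)) \<longlonglongrightarrow> 0"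
    using tendsto_mult_left[of "\<lambda>j. norm (?d j)" 0 sequentially "sqrt ((2 * pi) ^ CARD('d))"] by simp
  then have "(\<lambda>j. L2_norm (simple_integral I (s j) - w)) \<longlonglongrightarrow> 0"
    by (simp only: L2_norm_diff[OF simple_integral_L2[OF s] w(1)])
  moreover have "strongly_measurable_curve L2 I f"
    unfolding strongly_measurable_curve_def using f s ae by (intro conjI exI[of _ s]) auto
  ultimately show ?thesis
    unfolding has_L2_bochner_integral_def using s lim w(1) by (intro conjI exI[of _ s]) auto
qed

section \<open>Mild solutions\<close>

lemma freq_dichotomy: "freq n = 0 \<or> 1 \<le> freq n"
proof (rule ccontr)
  assume "\<not> ?thesis"
  then have f: "0 < freq n" "freq n < 1" using freq_nonneg[of n] by linarith+
  have "freq n ^ 4 < freq n ^ 2" by (rule power_strict_decreasing) (use f in auto)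
  then show False using lam_nonpos[of n] by (simp add: lam_def)
qed

lemma freq_powers: "(freq n)\<^sup>2 \<le> freq n ^ 3" "freq n * (1 + (freq n)\<^sup>2) \<le> 2 * freq n ^ 3"
proof -
  show 1: "(freq n)\<^sup>2 \<le> freq n ^ 3" using freq_dichotomy[of n] by (auto intro: power_increasing)
  have "freq n \<le> freq n ^ 3" using freq_dichotomy[of n] by (auto intro: self_le_power)
  then show "freq n * (1 + (freq n)\<^sup>2) \<le> 2 * freq n ^ 3" by (simp add: algebra_simps power2_eq_square power3_eq_cube)
qed

text \<open>With \<open>z = freq n * root 4 \<tau>\<close> this is
  \<open>z^3 \<le> exp (z^4 / 2)\<close>. Three powers of the frequency are what the time increments
  of the integrand require, and the resulting singularity of exponent 3/4 is integrable.\<close>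

lemma cubic_decay:
  assumes \<tau>: "0 < \<tau>" shows "freq n ^ 3 * exp (lam n * \<tau>) \<le> exp (\<tau> / 2) / root 4 \<tau> ^ 3"
proof -
  define r where "r = root 4 \<tau>"
  have r: "0 < r" "r ^ 4 = \<tau>" using \<tau> by (simp_all add: r_def)
  define z where "z = freq n * r"
  have z: "0 \<le> z" using r by (simp add: z_def)
  have z3: "z ^ 3 \<le> exp (z ^ 4 / 2)"
  proof (cases "z \<le> 1")
    case True
    then have "z ^ 3 \<le> 1" using z by (intro power_le_one)
    also have "1 \<le> exp (z ^ 4 / 2)" using z by simp
    finally show ?thesis .
  next
    case False
    then have "z ^ 3 \<le> z ^ 4" by (intro power_increasing) auto
    also have "z ^ 4 \<le> 1 + z ^ 4 / 2 + (z ^ 4 / 2)\<^sup>2 / 2"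
    proof -
      have "0 \<le> (z ^ 4 - 2)\<^sup>2" by simp
      moreover have "(z ^ 4 - 2)\<^sup>2 = (z ^ 4)\<^sup>2 - 4 * z ^ 4 + 4" by (simp add: power2_eq_square algebra_simps)
      moreover have "(z ^ 4 / 2)\<^sup>2 = (z ^ 4)\<^sup>2 / 4" by (simp add: power_divide)
      ultimately show ?thesis by linarith
    qed
    also have "\<dots> \<le> exp (z ^ 4 / 2)" by (rule exp_lower_Taylor_quadratic) simp
    finally show ?thesis .
  qed
  have "0 \<le> ((freq n)\<^sup>2 - 1)\<^sup>2" by simp
  moreover have "((freq n)\<^sup>2 - 1)\<^sup>2 = freq n ^ 4 - 2 * (freq n)\<^sup>2 + 1" by (simp add: power2_eq_square power4_eq_xxxx algebra_simps)
  ultimately have "lam n \<le> 1 / 2 - freq n ^ 4 / 2" by (simp add: lam_def)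
  then have "lam n * \<tau> \<le> (1 / 2 - freq n ^ 4 / 2) * \<tau>" using \<tau> by (intro mult_right_mono) auto
  also have "\<dots> = \<tau> / 2 - z ^ 4 / 2" by (simp add: z_def power_mult_distrib r algebra_simps)
  finally have "exp (lam n * \<tau>) \<le> exp (\<tau> / 2) / exp (z ^ 4 / 2)" by (simp add: exp_diff[symmetric])
  then have "z ^ 3 * exp (lam n * \<tau>) \<le> exp (z ^ 4 / 2) * (exp (\<tau> / 2) / exp (z ^ 4 / 2))"
    using z3 z by (intro mult_mono) auto
  then have "z ^ 3 * exp (lam n * \<tau>) \<le> exp (\<tau> / 2)" by simp
  then have "freq n ^ 3 * exp (lam n * \<tau>) * r ^ 3 \<le> exp (\<tau> / 2)" by (simp add: z_def power_mult_distrib mult_ac)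
  then show ?thesis using r by (simp add: r_def[symmetric] pos_le_divide_eq)
qed

text \<open>Hoelder continuity of exponent 1/4 in time at the price of one power of the frequency,
  since both 1 and \<open>z^4\<close> bound the increment and their minimum is at most
  \<open>z\<close>. A Lipschitz bound would cost four powers and make the singularity
  nonintegrable.\<close>

lemma exp_increment:
  assumes \<delta>: "0 \<le> \<delta>" shows "1 - exp (lam n * \<delta>) \<le> freq n * root 4 \<delta>"
proof -
  define z where "z = freq n * root 4 \<delta>"
  have z: "0 \<le> z" using \<delta> by (simp add: z_def)
  have "1 - exp (lam n * \<delta>) \<le> z"
  proof (cases "1 \<le> z")
    case True
    then show ?thesis using exp_gt_zero[of "lam n * \<delta>"] by linarith
  next
    case False
    have "1 - exp (lam n * \<delta>) \<le> - lam n * \<delta>" using exp_ge_add_one_self[of "lam n * \<delta>"] by linarith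
    also have "\<dots> \<le> freq n ^ 4 * \<delta>" using \<delta> by (intro mult_right_mono) (auto simp: lam_def)
    also have "\<dots> = z ^ 4" using \<delta> by (simp add: z_def power_mult_distrib)
    also have "\<dots> \<le> z ^ 1" using False z by (intro power_decreasing) auto
    finally show ?thesis by simp
  qed
  then show ?thesis by (simp add: z_def)
qed

lemma norm_l2_compare3:
  fixes x a b c :: "'d::finite l2"
  assumes K: "0 \<le> K" and s: "0 \<le> s"
    and le: "\<And>n. cmod (co x n) \<le> K * (cmod (co a n) + s * (cmod (co b n) + cmod (co c n)))"
  shows "norm x \<le> K * (norm a + s * (norm b + norm c))"
proof (rule l2_norm_leI)
  fix F :: "(int^'d) set"
  let ?L = "\<lambda>x :: 'd l2. L2_set (\<lambda>n. cmod (co x n)) F"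
  have "?L x \<le> L2_set (\<lambda>n. K * (cmod (co a n) + s * (cmod (co b n) + cmod (co c n)))) F"
    by (intro L2_set_mono le norm_ge_zero)
  also have "\<dots> = K * L2_set (\<lambda>n. cmod (co a n) + s * (cmod (co b n) + cmod (co c n))) F"
    by (rule L2_set_right_distrib[OF K, symmetric])
  also have "\<dots> \<le> K * (?L a + L2_set (\<lambda>n. s * (cmod (co b n) + cmod (co c n))) F)"
    by (intro mult_left_mono L2_set_triangle_ineq K)
  also have "L2_set (\<lambda>n. s * (cmod (co b n) + cmod (co c n))) F = s * L2_set (\<lambda>n. cmod (co b n) + cmod (co c n)) F"
    by (rule L2_set_right_distrib[OF s, symmetric])
  also have "K * (?L a + s * L2_set (\<lambda>n. cmod (co b n) + cmod (co c n)) F) \<le> K * (?L a + s * (?L b + ?L c))"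
    by (intro mult_left_mono add_left_mono L2_set_triangle_ineq K s)
  also have "\<dots> \<le> K * (norm a + s * (norm b + norm c))"
    by (intro mult_left_mono add_mono L2_set_co_le_norm K s)
  finally show "?L x \<le> K * (norm a + s * (norm b + norm c))" .
qed (use K s in simp)

text \<open>The antiderivative \<open>- 4 * root 4 (t - \<sigma>)\<close> is continuous up to the
  singular endpoint.\<close>

lemma root_singularity_integrable:
  fixes t :: real
  assumes t: "0 \<le> t"
  obtains C where "0 \<le> C" "(\<integral>\<^sup>+\<sigma>. ennreal (1 / root 4 (t - \<sigma>) ^ 3) \<partial>lebesgue_on {0..t}) = ennreal C"
proof -
  let ?f = "\<lambda>\<sigma>. 1 / root 4 (t - \<sigma>) ^ 3"
  have nn: "0 \<le> ?f \<sigma>" if "\<sigma> \<in> {0..t}" for \<sigma> using that by simp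
  have I: "(?f has_integral (- 4 * root 4 (t - t)) - (- 4 * root 4 (t - 0))) {0..t}"
  proof (rule fundamental_theorem_of_calculus_interior[OF t])
    show "continuous_on {0..t} (\<lambda>\<sigma>. - 4 * root 4 (t - \<sigma>))" by (intro continuous_intros)
    fix \<sigma> assume \<sigma>: "\<sigma> \<in> {0<..<t}"
    then have "0 < t - \<sigma>" by simp
    from DERIV_real_root[of 4, OF _ this]
    have d: "DERIV (root 4) (t - \<sigma>) :> inverse (4 * root 4 (t - \<sigma>) ^ 3)" by (simp add: eval_nat_numeral)
    have "((\<lambda>\<sigma>. t - \<sigma>) has_real_derivative - 1) (at \<sigma>)" by (auto intro!: derivative_eq_intros)
    from DERIV_cmult[OF DERIV_chain2[OF d this], of "- 4"]
    have "((\<lambda>\<sigma>. - 4 * root 4 (t - \<sigma>)) has_real_derivative ?f \<sigma>) (at \<sigma>)" by (simp add: field_simps)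
    then show "((\<lambda>\<sigma>. - 4 * root 4 (t - \<sigma>)) has_vector_derivative ?f \<sigma>) (at \<sigma>)"
      by (simp add: has_real_derivative_iff_has_vector_derivative)
  qed
  have "(\<integral>\<^sup>+\<sigma>. ennreal (?f \<sigma>) \<partial>lebesgue_on {0..t}) = (\<integral>\<^sup>+\<sigma>. ennreal (?f \<sigma>) * indicator {0..t} \<sigma> \<partial>lebesgue)"
    by (rule nn_integral_restrict_space) simp
  also have "\<dots> = (\<integral>\<^sup>+\<sigma>. ennreal (?f \<sigma>) * indicator {0..t} \<sigma> \<partial>lborel)" by (rule nn_integral_completion)
  also have "\<dots> = (\<integral>\<^sup>+\<sigma>. ennreal (indicator {0..t} \<sigma> * ?f \<sigma>) \<partial>lborel)"
    by (intro nn_integral_cong) (simp add: indicator_def)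
  also have "\<dots> = ennreal ((- 4 * root 4 (t - t)) - (- 4 * root 4 (t - 0)))"
    by (rule nn_integral_has_integral_lebesgue[OF nn I])
  finally show ?thesis using t by (intro that[of "4 * root 4 t"]) simp_all
qed

lemma fourier_coeff_CH_semigroup:
  fixes u :: "real^'d \<Rightarrow> real"
  assumes u: "u \<in> L2" and t: "0 \<le> t"
  shows "fourier_coeff (CH_semigroup t u) n = of_real (exp (lam n * t)) * fourier_coeff u n"
proof -
  have "fourier_coeff (CH_semigroup t u) n = co (sg t (emb u)) n"
    unfolding emb_CH_semigroup[OF u t, symmetric] by (simp only: co_emb[OF CH_semigroup_L2[OF t u]])
  then show ?thesis by (simp only: co_sg[OF t] co_emb[OF u])
qed

section \<open>Discretisation of the mild integrand in time\<close>

definition grid :: "nat \<Rightarrow> real \<Rightarrow> real" where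
  "grid j \<sigma> = of_int \<lfloor>real (Suc j) * \<sigma>\<rfloor> / real (Suc j)"

text \<open>Rounding down keeps grid points in \<open>{0..t}\<close> and never shortens the
  smoothing time \<open>t - \<sigma>\<close>.\<close>

lemma grid_le: "grid j \<sigma> \<le> \<sigma>" and grid_ge: "\<sigma> - grid j \<sigma> \<le> inverse (real (Suc j))"
  and grid_nonneg: "0 \<le> \<sigma> \<Longrightarrow> 0 \<le> grid j \<sigma>"
proof -
  let ?N = "real (Suc j)"
  have N: "0 < ?N" by simp
  show "grid j \<sigma> \<le> \<sigma>" unfolding grid_def using of_int_floor_le[of "?N * \<sigma>"] N by (simp add: pos_divide_le_eq mult.commute)
  have "?N * \<sigma> - of_int \<lfloor>?N * \<sigma>\<rfloor> \<le> 1" by linarith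
  then have "(?N * \<sigma> - of_int \<lfloor>?N * \<sigma>\<rfloor>) / ?N \<le> 1 / ?N" by (intro divide_right_mono) auto
  then show "\<sigma> - grid j \<sigma> \<le> inverse (real (Suc j))"
    unfolding grid_def diff_divide_distrib using N by (simp add: inverse_eq_divide)
  show "0 \<le> grid j \<sigma>" if "0 \<le> \<sigma>" unfolding grid_def using that by simp
qed

lemma finite_grid: "finite (grid j ` {0..t})"
proof (rule finite_subset)
  show "grid j ` {0..t} \<subseteq> (\<lambda>i. of_int i / real (Suc j)) ` {0..\<lfloor>real (Suc j) * t\<rfloor>}"
  proof (rule image_subsetI)
    fix \<sigma> assume "\<sigma> \<in> {0..t}"
    then have "\<lfloor>real (Suc j) * \<sigma>\<rfloor> \<in> {0..\<lfloor>real (Suc j) * t\<rfloor>}" by (auto intro!: floor_mono mult_left_mono)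
    then show "grid j \<sigma> \<in> (\<lambda>i. of_int i / real (Suc j)) ` {0..\<lfloor>real (Suc j) * t\<rfloor>}" unfolding grid_def by (rule imageI)
  qed
qed simp

lemma grid_level: "{\<sigma>. grid j \<sigma> = p} \<in> sets borel"
proof -
  have "grid j \<in> borel_measurable borel" unfolding grid_def[abs_def] by measurable
  from measurable_sets[OF this, of "{p}"] show ?thesis by (simp add: vimage_def)
qed

context sobolev
begin

text \<open>After the common factor \<open>exp (lam n * (t - \<sigma>))\<close> is taken out, a
  change of the state costs the two powers of the Laplacian, and a change of the smoothing time
  costs one more by \<open>exp_increment\<close>. Both are covered by
  \<open>cubic_decay\<close>.\<close>

lemma evo_diff:
  assumes \<gamma>: "\<gamma> \<le> \<sigma>" and \<sigma>: "\<sigma> < t"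
  shows "L2_norm (evo V t \<sigma> y - evo V t \<gamma> y) \<le> sqrt ((2 * pi) ^ CARD('d)) * (exp ((t - \<sigma>) / 2) / root 4 (t - \<sigma>) ^ 3 *
    (norm (cub (V \<sigma>) - cub (V \<gamma>)) + 2 * root 4 (\<sigma> - \<gamma>) * (norm (cub (V \<sigma>)) + norm y)))"
  unfolding L2_norm_diff[OF evo_L2 evo_L2]
proof (rule mult_left_mono, rule norm_l2_compare3)
  fix n :: "int^'d"
  let ?X = "cub (V \<sigma>)" and ?X' = "cub (V \<gamma>)"
  define f r e d where "f = freq n" and "r = root 4 (\<sigma> - \<gamma>)" and "e = exp (lam n * (t - \<sigma>))" and "d = exp (lam n * (\<sigma> - \<gamma>))"
  define x x' h where "x = hat k ?X n" and "x' = hat k ?X' n" and "h = hat k y n"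
  define m p where "m = cmod (x' - x)" and "p = cmod x + cmod h"
  have f: "0 \<le> f" "f\<^sup>2 \<le> f ^ 3" "f * (1 + f\<^sup>2) \<le> 2 * f ^ 3" using freq_powers[of n] by (simp_all add: f_def)
  have r: "0 \<le> r" and e: "0 < e" and d: "0 < d" using \<gamma> by (simp_all add: r_def e_def d_def)
  have d1: "d \<le> 1" unfolding d_def using lam_nonpos[of n] \<gamma> by (simp add: mult_nonpos_nonneg)
  have dr: "1 - d \<le> f * r" unfolding d_def f_def r_def using \<gamma> by (intro exp_increment) simp
  have mp: "0 \<le> m" "0 \<le> p" by (simp_all add: m_def p_def)
  have ed: "exp (lam n * (t - \<gamma>)) = e * d" by (simp add: e_def d_def exp_add[symmetric] algebra_simps)
  have "co (emb (evo V t \<sigma> y) - emb (evo V t \<gamma> y)) n =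
      of_real e * (h - of_real (f\<^sup>2) * x) - of_real (e * d) * (h - of_real (f\<^sup>2) * x')"
    by (simp only: co_minus co_emb[OF evo_L2] fourier_coeff_evo[OF \<sigma>] fourier_coeff_evo[OF order.strict_trans1[OF \<gamma> \<sigma>]] ed
        e_def[symmetric] f_def[symmetric] x_def[symmetric] x'_def[symmetric] h_def[symmetric])
  also have "\<dots> = of_real (e * (1 - d)) * (h - of_real (f\<^sup>2) * x) + of_real (e * d * f\<^sup>2) * (x' - x)"
    by (simp add: algebra_simps)
  also have "cmod \<dots> \<le> e * (1 - d) * (cmod h + f\<^sup>2 * cmod x) + e * d * f\<^sup>2 * m"
  proof (rule norm_triangle_mono)
    have "cmod (h - of_real (f\<^sup>2) * x) \<le> cmod h + f\<^sup>2 * cmod x"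
      using norm_triangle_ineq4[of h "of_real (f\<^sup>2) * x"] by (simp add: norm_mult norm_power)
    then show "cmod (of_real (e * (1 - d)) * (h - of_real (f\<^sup>2) * x)) \<le> e * (1 - d) * (cmod h + f\<^sup>2 * cmod x)"
      unfolding norm_mult[of "of_real _"] norm_of_real using e d1 by (simp add: mult_left_mono)
    show "cmod (of_real (e * d * f\<^sup>2) * (x' - x)) \<le> e * d * f\<^sup>2 * m"
      unfolding norm_mult[of "of_real _"] norm_of_real m_def using e d by simp
  qed
  also have "\<dots> \<le> e * (f * r) * ((1 + f\<^sup>2) * p) + e * 1 * f ^ 3 * m"
  proof (rule add_mono)
    have "cmod h + f\<^sup>2 * cmod x \<le> (1 + f\<^sup>2) * p" by (simp add: p_def algebra_simps)
    then show "e * (1 - d) * (cmod h + f\<^sup>2 * cmod x) \<le> e * (f * r) * ((1 + f\<^sup>2) * p)"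
      using dr e d1 f r mp by (intro mult_mono) auto
    show "e * d * f\<^sup>2 * m \<le> e * 1 * f ^ 3 * m" using d1 d e f mp by (intro mult_mono) auto
  qed
  also have "\<dots> = e * r * p * (f * (1 + f\<^sup>2)) + e * f ^ 3 * m" by (simp only: mult_ac mult_1_right)
  also have "\<dots> \<le> e * r * p * (2 * f ^ 3) + e * f ^ 3 * m"
    using e r mp f by (intro add_right_mono mult_left_mono) auto
  also have "\<dots> = (f ^ 3 * e) * (m + 2 * r * p)" by (simp add: algebra_simps)
  also have "\<dots> \<le> exp ((t - \<sigma>) / 2) / root 4 (t - \<sigma>) ^ 3 * (cmod (co (?X - ?X') n) + 2 * r * (cmod (co ?X n) + cmod (co y n)))"
  proof (rule mult_mono)
    show "f ^ 3 * e \<le> exp ((t - \<sigma>) / 2) / root 4 (t - \<sigma>) ^ 3" unfolding f_def e_def using \<sigma> by (intro cubic_decay) simp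
    have "m \<le> cmod (co (?X - ?X') n)"
      unfolding m_def x_def x'_def using cmod_hat_le[of k "?X - ?X'" n] by (simp add: norm_minus_commute)
    moreover have "p \<le> cmod (co ?X n) + cmod (co y n)" unfolding p_def x_def h_def by (intro add_mono cmod_hat_le)
    ultimately show "m + 2 * r * p \<le> cmod (co (?X - ?X') n) + 2 * r * (cmod (co ?X n) + cmod (co y n))"
      using r by (intro add_mono mult_left_mono) auto
  qed (use \<sigma> r mp in auto)
  finally show "cmod (co (emb (evo V t \<sigma> y) - emb (evo V t \<gamma> y)) n) \<le> exp ((t - \<sigma>) / 2) / root 4 (t - \<sigma>) ^ 3 *
      (cmod (co (?X - ?X') n) + 2 * root 4 (\<sigma> - \<gamma>) * (cmod (co ?X n) + cmod (co y n)))"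
    unfolding r_def .
qed (use \<gamma> \<sigma> in auto)

lemma evo_simple_curve:
  assumes c: "ctl c" shows "simple_curve L2 {0..t} (\<lambda>\<sigma>. evo V t (grid j \<sigma>) (c \<sigma>))"
proof -
  let ?s = "\<lambda>\<sigma>. evo V t (grid j \<sigma>) (c \<sigma>)" and ?P = "grid j ` {0..t} \<times> range c"
  have fin: "finite ?P" using finite_grid c by (simp add: ctl_def)
  have "finite (?s ` {0..t})"
    by (rule finite_subset[OF _ finite_imageI[OF fin, of "\<lambda>(p, z). evo V t p z"]]) auto
  moreover have "{\<sigma> \<in> {0..t}. ?s \<sigma> = y} \<in> sets lebesgue" for y
  proof -
    have "{\<sigma> \<in> {0..t}. ?s \<sigma> = y} = (\<Union>(p, z)\<in>{(p, z) \<in> ?P. evo V t p z = y}. {0..t} \<inter> ({\<sigma>. grid j \<sigma> = p} \<inter> {\<sigma>. c \<sigma> \<in> {z}}))"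
      by auto (metis atLeastAtMost_iff)
    also have "\<dots> \<in> sets borel"
    proof (rule sets.finite_UN)
      show "finite {(p, z) \<in> ?P. evo V t p z = y}" by (rule finite_subset[OF _ fin]) auto
      fix q assume "q \<in> {(p, z) \<in> ?P. evo V t p z = y}"
      have "{0..t} \<inter> ({\<sigma>. grid j \<sigma> = fst q} \<inter> {\<sigma>. c \<sigma> \<in> {snd q}}) \<in> sets borel"
        by (intro sets.Int grid_level ctl_measurable_set[OF c]) simp
      then show "(case q of (p, z) \<Rightarrow> {0..t} \<inter> ({\<sigma>. grid j \<sigma> = p} \<inter> {\<sigma>. c \<sigma> \<in> {z}})) \<in> sets borel"
        by (simp only: split_beta)
    qed
    finally show ?thesis by (rule borel_lebesgue)
  qed
  ultimately show ?thesis unfolding simple_curve_def using evo_L2 by blast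
qed

text \<open>The approximating simple curves freeze the time on a grid but keep the control exact.
  Their error is at most \<open>\<kappa> j\<close> times an integrable singularity with
  \<open>\<kappa> j\<close> tending to 0, which gives the pointwise and the L1 convergence at
  once.\<close>

lemma evo_bochner:
  assumes V: "continuous_on {0..T} V" and c: "ctl c" and t: "t \<in> {0..T}"
    and f: "\<And>\<sigma>. \<sigma> \<in> {0..<t} \<Longrightarrow> f \<sigma> = evo V t \<sigma> (c \<sigma>)"
    and w: "w \<in> L2" "\<And>n. fourier_coeff w n = (\<integral>\<sigma>. src V c t n \<sigma> / of_real (wt k n) \<partial>lebesgue_on {0..t})"
  shows "has_L2_bochner_integral f w {0..t}"
proof (rule has_L2_bochner_integralI[where s="\<lambda>j \<sigma>. evo V t (grid j \<sigma>) (c \<sigma>)" and g="\<lambda>n \<sigma>. src V c t n \<sigma> / of_real (wt k n)"])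
  let ?s = "\<lambda>j \<sigma>. evo V t (grid j \<sigma>) (c \<sigma>)" and ?M = "lebesgue_on {0..t}"
  have t0: "0 \<le> t" using t by simp
  have inn: "AE \<sigma> in ?M. \<sigma> \<in> {0..<t}" by (rule AE_interior)
  show "simple_curve L2 {0..t} (?s j)" for j by (rule evo_simple_curve[OF c])
  show "AE \<sigma> in ?M. f \<sigma> \<in> L2" using inn by eventually_elim (simp add: f evo_L2)
  show "integrable ?M (\<lambda>\<sigma>. src V c t n \<sigma> / of_real (wt k n))" for n
    by (intro integrable_divide src_integrable[OF V c t])
  show "AE \<sigma> in ?M. fourier_coeff (f \<sigma>) n = src V c t n \<sigma> / of_real (wt k n)" for n
    using inn by eventually_elim (simp add: f fourier_coeff_evo_src)
  define X where "X \<sigma> = cub (V \<sigma>)" for \<sigma>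
  have Xc: "continuous_on {0..t} X"
    unfolding X_def[abs_def] using t by (intro continuous_on_cub continuous_on_subset[OF V]) auto
  have "bounded (X ` {0..t})" by (intro compact_imp_bounded compact_continuous_image Xc) simp
  then obtain B where "\<forall>y\<in>X ` {0..t}. norm y \<le> B" unfolding bounded_iff by (rule exE)
  then have B: "norm (X \<sigma>) \<le> B" if "\<sigma> \<in> {0..t}" for \<sigma> using that by blast
  obtain Y where Y: "\<And>\<sigma>. norm (c \<sigma>) \<le> Y" using ctl_bounded[OF c, of "\<lambda>x. x"] by metis
  have BY: "0 \<le> B" "0 \<le> Y" using order_trans[OF norm_ge_zero B[of 0]] order_trans[OF norm_ge_zero Y[of 0]] t0 by simp_all
  have gr: "grid j \<sigma> \<in> {0..t}" if "\<sigma> \<in> {0..t}" for j \<sigma>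
    using that grid_le[of j \<sigma>] grid_nonneg[of \<sigma> j] by simp
  define D where "D j \<sigma> = norm (X \<sigma> - X (grid j \<sigma>))" for j \<sigma>
  have bdd: "bdd_above (D j ` {0..t})" for j
  proof (rule bdd_aboveI2)
    fix \<sigma> assume \<sigma>: "\<sigma> \<in> {0..t}"
    show "D j \<sigma> \<le> B + B" unfolding D_def
      using norm_triangle_ineq4[of "X \<sigma>" "X (grid j \<sigma>)"] B[OF \<sigma>] B[OF gr[OF \<sigma>, of j]] by linarith
  qed
  \<comment> \<open>The oscillation of the cubed state over one grid cell, uniform in time; it tends
    to 0 by uniform continuity on the compact interval.\<close>
  define \<omega> where "\<omega> j = (SUP \<sigma>\<in>{0..t}. D j \<sigma>)" for j
  have \<omega>: "D j \<sigma> \<le> \<omega> j" if "\<sigma> \<in> {0..t}" for j \<sigma> unfolding \<omega>_def by (rule cSUP_upper[OF that bdd])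
  have \<omega>0: "0 \<le> \<omega> j" for j using order_trans[OF _ \<omega>[of 0 j], of 0] t0 by (simp add: D_def)
  have \<omega>_lim: "\<omega> \<longlonglongrightarrow> 0"
  proof (rule LIMSEQ_I)
    fix r :: real assume r: "0 < r"
    have "uniformly_continuous_on {0..t} X" by (rule compact_uniformly_continuous[OF Xc]) simp
    then obtain \<delta> where \<delta>: "0 < \<delta>" "\<And>x x'. x \<in> {0..t} \<Longrightarrow> x' \<in> {0..t} \<Longrightarrow> dist x' x < \<delta> \<Longrightarrow> dist (X x') (X x) < r / 2"
      unfolding uniformly_continuous_on_def using half_gt_zero[OF r] by metis
    obtain N where N: "inverse (real (Suc N)) < \<delta>" using reals_Archimedean[OF \<delta>(1)] by blast
    have "norm (\<omega> j - 0) < r" if j: "N \<le> j" for j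
    proof -
      have "\<omega> j \<le> r / 2" unfolding \<omega>_def
      proof (rule cSUP_least)
        fix \<sigma> assume \<sigma>: "\<sigma> \<in> {0..t}"
        have "inverse (real (Suc j)) \<le> inverse (real (Suc N))" using j by (intro le_imp_inverse_le) auto
        moreover have "dist \<sigma> (grid j \<sigma>) = \<sigma> - grid j \<sigma>" using grid_le[of j \<sigma>] by (simp add: dist_real_def)
        ultimately have "dist \<sigma> (grid j \<sigma>) < \<delta>" using grid_ge[of \<sigma> j] N by linarith
        from \<delta>(2)[OF gr[OF \<sigma>] \<sigma> this] show "D j \<sigma> \<le> r / 2" by (simp add: D_def dist_norm)
      qed (use t0 in simp)
      then show ?thesis using \<omega>0[of j] r by simp
    qed
    then show "\<exists>no. \<forall>n\<ge>no. norm (\<omega> n - 0) < r" by blast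
  qed
  define \<kappa> where "\<kappa> j = sqrt ((2 * pi) ^ CARD('d)) * (exp (t / 2) * (\<omega> j + 2 * root 4 (inverse (real (Suc j))) * (B + Y)))" for j
  have \<kappa>0: "0 \<le> \<kappa> j" for j unfolding \<kappa>_def using \<omega>0[of j] BY by (intro mult_nonneg_nonneg add_nonneg_nonneg) auto
  have "\<kappa> \<longlonglongrightarrow> sqrt ((2 * pi) ^ CARD('d)) * (exp (t / 2) * (0 + 2 * root 4 0 * (B + Y)))"
    unfolding \<kappa>_def[abs_def] by (intro tendsto_intros \<omega>_lim LIMSEQ_inverse_real_of_nat)
  then have \<kappa>_lim: "\<kappa> \<longlonglongrightarrow> 0" by simp
  have est: "L2_norm (f \<sigma> - ?s j \<sigma>) \<le> \<kappa> j * (1 / root 4 (t - \<sigma>) ^ 3)" if \<sigma>: "\<sigma> \<in> {0..<t}" for \<sigma> j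
  proof -
    have \<sigma>': "\<sigma> \<in> {0..t}" "\<sigma> < t" using \<sigma> by auto
    have "L2_norm (f \<sigma> - ?s j \<sigma>) \<le> sqrt ((2 * pi) ^ CARD('d)) * (exp ((t - \<sigma>) / 2) / root 4 (t - \<sigma>) ^ 3 *
        (D j \<sigma> + 2 * root 4 (\<sigma> - grid j \<sigma>) * (norm (X \<sigma>) + norm (c \<sigma>))))"
      unfolding f[OF \<sigma>] D_def X_def by (rule evo_diff[OF grid_le \<sigma>'(2)])
    also have "\<dots> \<le> sqrt ((2 * pi) ^ CARD('d)) * (exp (t / 2) / root 4 (t - \<sigma>) ^ 3 *
        (\<omega> j + 2 * root 4 (inverse (real (Suc j))) * (B + Y)))"
      using \<sigma>' grid_le[of j \<sigma>] BY
      by (intro mult_left_mono mult_mono divide_right_mono add_mono \<omega> real_root_le_mono grid_ge B Y) (auto simp: D_def)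
    finally show ?thesis by (simp add: \<kappa>_def mult_ac)
  qed
  show "AE \<sigma> in ?M. (\<lambda>j. L2_norm (f \<sigma> - ?s j \<sigma>)) \<longlonglongrightarrow> 0"
    using inn
  proof eventually_elim
    case (elim \<sigma>)
    have "(\<lambda>j. \<kappa> j * (1 / root 4 (t - \<sigma>) ^ 3)) \<longlonglongrightarrow> 0"
      using tendsto_mult_right[OF \<kappa>_lim, of "1 / root 4 (t - \<sigma>) ^ 3"] by simp
    then show ?case
      by (rule Lim_null_comparison[rotated], intro always_eventually allI)
        (simp only: real_norm_def abs_of_nonneg[OF L2_norm_nonneg] est[OF elim])
  qed
  obtain C where C: "0 \<le> C" "(\<integral>\<^sup>+\<sigma>. ennreal (1 / root 4 (t - \<sigma>) ^ 3) \<partial>?M) = ennreal C"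
    using root_singularity_integrable[OF t0] by metis
  have meas: "(\<lambda>\<sigma>. ennreal (1 / root 4 (t - \<sigma>) ^ 3)) \<in> borel_measurable ?M"
    by (intro measurable_compose[OF _ measurable_ennreal] borel_measurable_divide borel_measurable_const
        continuous_imp_measurable_on_sets_lebesgue continuous_intros) simp
  have le: "(\<integral>\<^sup>+\<sigma>. ennreal (L2_norm (f \<sigma> - ?s j \<sigma>)) \<partial>?M) \<le> ennreal (\<kappa> j * C)" for j
  proof -
    have "(\<integral>\<^sup>+\<sigma>. ennreal (L2_norm (f \<sigma> - ?s j \<sigma>)) \<partial>?M) \<le> (\<integral>\<^sup>+\<sigma>. ennreal (\<kappa> j) * ennreal (1 / root 4 (t - \<sigma>) ^ 3) \<partial>?M)"
    proof (rule nn_integral_mono_AE)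
      show "AE \<sigma> in ?M. ennreal (L2_norm (f \<sigma> - ?s j \<sigma>)) \<le> ennreal (\<kappa> j) * ennreal (1 / root 4 (t - \<sigma>) ^ 3)"
        using inn
      proof eventually_elim
        case (elim \<sigma>)
        have "0 \<le> 1 / root 4 (t - \<sigma>) ^ 3" using elim by simp
        then show ?case using est[OF elim, of j] \<kappa>0[of j] by (simp only: ennreal_mult[symmetric] ennreal_leI)
      qed
    qed
    also have "\<dots> = ennreal (\<kappa> j) * ennreal C" unfolding C(2)[symmetric] by (rule nn_integral_cmult[OF meas])
    also have "\<dots> = ennreal (\<kappa> j * C)" using \<kappa>0 C(1) by (simp only: ennreal_mult)
    finally show ?thesis .
  qed
  have "(\<lambda>j. ennreal (\<kappa> j * C)) \<longlonglongrightarrow> ennreal (0 * C)" by (intro tendsto_ennrealI tendsto_mult_right \<kappa>_lim)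
  then have \<kappa>C: "(\<lambda>j. ennreal (\<kappa> j * C)) \<longlonglongrightarrow> 0" by simp
  show "(\<lambda>j. \<integral>\<^sup>+\<sigma>. ennreal (L2_norm (f \<sigma> - ?s j \<sigma>)) \<partial>?M) \<longlonglongrightarrow> 0"
    by (rule tendsto_sandwich[OF _ _ tendsto_const \<kappa>C]) (simp_all add: le)
qed (use w in auto)

section \<open>From coefficient equations to mild solutions and back\<close>

lemma mild_integrand:
  fixes v :: "real \<Rightarrow> real^'d \<Rightarrow> real"
  assumes v: "v \<sigma> \<in> sobolev_space k" and \<sigma>: "\<sigma> \<in> {0..<t}"
  shows "CH_semigroup_ext (t - \<sigma>) (laplacian (fourier_coeff (\<lambda>x. (v \<sigma> x) ^ 3)) + fourier_coeff (rl k (c \<sigma>)))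
    = evo (\<lambda>\<sigma>. embk k (v \<sigma>)) t \<sigma> (c \<sigma>)"
  using \<sigma> by (simp add: evo_def fourier_coeff_cube[OF v] fourier_coeff_rl)

lemma sol_mild_solution:
  assumes U: "sol T c U" and c: "ctl c" and u0: "u0 \<in> sobolev_space k" "U 0 = embk k u0"
  shows "mild_solution k T u0 (\<lambda>t. rl k (c t)) (\<lambda>t. rl k (U t))"
  unfolding mild_solution_def
proof (intro conjI ballI)
  have Uc: "continuous_on {0..T} U" using U by (simp add: sol_def)
  show "continuous_curve k T (\<lambda>t. rl k (U t))"
    unfolding continuous_curve_def
  proof (intro ballI conjI rl_sobolev)
    fix t assume "t \<in> {0..T}"
    then have "(U \<longlongrightarrow> U t) (at t within {0..T})" using Uc by (simp add: continuous_on_def)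
    then have "((\<lambda>s. norm (U s - U t)) \<longlongrightarrow> 0) (at t within {0..T})" by (intro tendsto_norm_zero LIM_zero)
    then show "((\<lambda>s. sobolev_norm k (rl k (U s) - rl k (U t))) \<longlongrightarrow> 0) (at t within {0..T})"
      by (simp add: sobolev_norm_diff[OF rl_sobolev rl_sobolev] embk_rl)
  qed
  fix t assume t: "t \<in> {0..T}"
  then have t0: "0 \<le> t" by simp
  let ?S = "CH_semigroup t u0"
  \<comment> \<open>The only possible candidate; that it is the Bochner integral is seen on its
    coefficients, by variation of constants.\<close>
  define w where "w = rl k (U t) - ?S"
  have S: "?S \<in> L2" by (rule CH_semigroup_L2[OF t0 sobolev_space_L2[OF u0(1)]])
  have w: "w \<in> L2" using L2_diff[OF rl_L2 S] by (simp add: w_def fun_diff_def)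
  have fc: "fourier_coeff w n = (\<integral>\<sigma>. src U c t n \<sigma> / of_real (wt k n) \<partial>lebesgue_on {0..t})" for n
  proof -
    have "fourier_coeff w n = hat k (U t) n - of_real (exp (lam n * t)) * hat k (U 0) n"
      using fourier_coeff_diff[OF rl_L2 S, of "U t" n]
      by (simp add: w_def fun_diff_def fourier_coeff_rl fourier_coeff_CH_semigroup[OF sobolev_space_L2[OF u0(1)] t0] u0(2) hat_embk[OF u0(1)])
    also have "\<dots> = (co (U t) n - exp (lam n * t) *\<^sub>R co (U 0) n) / of_real (wt k n)"
      by (simp add: hat_def diff_divide_distrib scaleR_conv_of_real)
    also have "\<dots> = (\<integral>\<sigma>. src U c t n \<sigma> \<partial>lebesgue_on {0..t}) / of_real (wt k n)"
      by (simp only: sol_src_integral[OF U c t])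
    finally show ?thesis by simp
  qed
  have "has_L2_bochner_integral (\<lambda>\<sigma>. CH_semigroup_ext (t - \<sigma>)
      (laplacian (fourier_coeff (\<lambda>x. (rl k (U \<sigma>) x) ^ 3)) + fourier_coeff (rl k (c \<sigma>)))) w {0..t}"
  proof (rule evo_bochner[OF Uc c t _ w fc])
    fix \<sigma> assume "\<sigma> \<in> {0..<t}"
    from mild_integrand[where v="\<lambda>\<sigma>. rl k (U \<sigma>)", OF rl_sobolev this, of c]
    show "CH_semigroup_ext (t - \<sigma>) (laplacian (fourier_coeff (\<lambda>x. (rl k (U \<sigma>) x) ^ 3)) + fourier_coeff (rl k (c \<sigma>))) = evo U t \<sigma> (c \<sigma>)"
      by (simp only: embk_rl)
  qed
  moreover have "ae_eq (rl k (U t)) (?S + w)" by (simp add: ae_eq_def w_def)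
  ultimately show "\<exists>w. has_L2_bochner_integral (\<lambda>\<sigma>. CH_semigroup_ext (t - \<sigma>)
      (laplacian (fourier_coeff (\<lambda>x. (rl k (U \<sigma>) x) ^ 3)) + fourier_coeff (rl k (c \<sigma>)))) w {0..t} \<and>
      ae_eq (rl k (U t)) (?S + w)" by blast
qed

text \<open>For an arbitrary mild solution nothing is known about derivatives in time; its
  coefficients are obtained from the integral equation alone.\<close>

lemma
  assumes v: "mild_solution k T u0 (\<lambda>t. rl k (c t)) v" and c: "ctl c" and u0: "u0 \<in> sobolev_space k"
  defines "V \<equiv> \<lambda>t. embk k (v t)"
  shows mild_solution_continuous: "continuous_on {0..T} V"
    and mild_solution_coeff: "t \<in> {0..T} \<Longrightarrow>
      co (V t) n = exp (lam n * t) *\<^sub>R co (embk k u0) n + integral {0..t} (src V c t n)"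
proof -
  have cc: "continuous_curve k T v" using v by (simp add: mild_solution_def)
  have vs: "v t \<in> sobolev_space k" if "t \<in> {0..T}" for t using cc that by (simp add: continuous_curve_def)
  show Vc: "continuous_on {0..T} V"
    unfolding continuous_on_def
  proof
    fix t assume t: "t \<in> {0..T}"
    have "((\<lambda>s. sobolev_norm k (v s - v t)) \<longlongrightarrow> 0) (at t within {0..T})"
      using cc t unfolding continuous_curve_def by simp
    moreover have "\<forall>\<^sub>F s in at t within {0..T}. sobolev_norm k (v s - v t) = norm (V s - V t)"
      unfolding eventually_at_filter V_def
      by (intro always_eventually allI impI sobolev_norm_diff vs t)
    ultimately have "((\<lambda>s. norm (V s - V t)) \<longlongrightarrow> 0) (at t within {0..T})" by (rule Lim_transform_eventually)
    then show "(V \<longlongrightarrow> V t) (at t within {0..T})" by (simp add: tendsto_norm_zero_iff LIM_zero_iff)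
  qed
  assume t: "t \<in> {0..T}"
  then have t0: "0 \<le> t" by simp
  let ?\<Phi> = "\<lambda>\<sigma>. CH_semigroup_ext (t - \<sigma>) (laplacian (fourier_coeff (\<lambda>x. (v \<sigma> x) ^ 3)) + fourier_coeff (rl k (c \<sigma>)))"
  obtain w where w: "has_L2_bochner_integral ?\<Phi> w {0..t}" "ae_eq (v t) (CH_semigroup t u0 + w)"
    using v t unfolding mild_solution_def by blast
  have S: "CH_semigroup t u0 \<in> L2" by (rule CH_semigroup_L2[OF t0 sobolev_space_L2[OF u0]])
  have wL: "w \<in> L2" using w(1) by (simp add: has_L2_bochner_integral_def)
  have "fourier_coeff w n = (\<integral>\<sigma>. src V c t n \<sigma> / of_real (wt k n) \<partial>lebesgue_on {0..t})"
  proof (rule bochner_integral_coeff[OF w(1), where g="\<lambda>n \<sigma>. src V c t n \<sigma> / of_real (wt k n)"])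
    show "integrable (lebesgue_on {0..t}) (\<lambda>\<sigma>. src V c t n \<sigma> / of_real (wt k n))" for n
      by (intro integrable_divide src_integrable[OF Vc c t])
    show "AE \<sigma> in lebesgue_on {0..t}. fourier_coeff (?\<Phi> \<sigma>) n = src V c t n \<sigma> / of_real (wt k n)" for n
      using AE_interior[of t]
    proof eventually_elim
      case (elim \<sigma>)
      then have "v \<sigma> \<in> sobolev_space k" using t by (intro vs) auto
      from mild_integrand[where v=v and c=c, OF this elim] have "?\<Phi> \<sigma> = evo V t \<sigma> (c \<sigma>)" by (simp only: V_def)
      then show ?case using elim fourier_coeff_evo_src[of \<sigma> t V c n] by simp
    qed
  qed simp
  also have "\<dots> = integral {0..t} (src V c t n) / of_real (wt k n)"
    using lebesgue_integral_eq_integral[OF src_integrable[OF Vc c t, of n]] by simp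
  finally have fw: "of_real (wt k n) * fourier_coeff w n = integral {0..t} (src V c t n)"
    using wt_pos[of k n] by simp
  have "fourier_coeff (v t) n = fourier_coeff (\<lambda>x. CH_semigroup t u0 x + w x) n"
    using w(2) L2_add[OF S wL] sobolev_space_L2[OF vs[OF t]]
    by (subst (asm) ae_eq_iff_fourier_coeff) (simp_all add: plus_fun_def)
  also have "\<dots> = of_real (exp (lam n * t)) * fourier_coeff u0 n + fourier_coeff w n"
    by (simp add: fourier_coeff_add[OF S wL] fourier_coeff_CH_semigroup[OF sobolev_space_L2[OF u0] t0])
  finally have "co (V t) n = of_real (exp (lam n * t)) * (of_real (wt k n) * fourier_coeff u0 n) + of_real (wt k n) * fourier_coeff w n"
    unfolding V_def co_embk[OF vs[OF t]] by (simp add: algebra_simps)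
  then show "co (V t) n = exp (lam n * t) *\<^sub>R co (embk k u0) n + integral {0..t} (src V c t n)"
    unfolding fw co_embk[OF u0] scaleR_conv_of_real .
qed

text \<open>The control and the initial value cancel in the difference, which is therefore
  \<open>duh D\<close>. Both solutions are bounded on \<open>{0..T}\<close>, so the cube is
  Lipschitz along them. Equality is stated for \<open>embk\<close> because solutions are determined
  only up to equality almost everywhere.\<close>

lemma mild_solution_unique:
  fixes c :: "real \<Rightarrow> 'd l2" and u0 :: "real^'d \<Rightarrow> real"
  assumes v: "mild_solution k T u0 (\<lambda>t. rl k (c t)) v" and v': "mild_solution k T u0 (\<lambda>t. rl k (c t)) v'"
    and c: "ctl c" and u0: "u0 \<in> sobolev_space k" and t: "t \<in> {0..T}"
  shows "embk k (v t) = embk k (v' t)"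
proof -
  define V V' where "V t = embk k (v t)" and "V' t = embk k (v' t)" for t
  have Vc: "continuous_on {0..T} V" "continuous_on {0..T} V'"
    using mild_solution_continuous[OF v c u0] mild_solution_continuous[OF v' c u0]
    unfolding V_def[abs_def] V'_def[abs_def] by simp_all
  define D where "D s = cub (V s) - cub (V' s)" for s
  have Dc: "continuous_on {0..T} D" unfolding D_def[abs_def] by (intro continuous_intros continuous_on_cub Vc)
  have eq: "V t - V' t = duh D t" if t: "t \<in> {0..T}" for t
  proof (rule l2_eqI)
    fix n
    note co1 = mild_solution_coeff[OF v c u0 t, of n, folded V_def]
      and co2 = mild_solution_coeff[OF v' c u0 t, of n, folded V'_def]
    have int: "src V c t n integrable_on {0..t}" "src V' c t n integrable_on {0..t}"
      using integrable_on_lebesgue_on[OF src_integrable[OF Vc(1) c t]] integrable_on_lebesgue_on[OF src_integrable[OF Vc(2) c t]] by simp_all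
    have "co (V t - V' t) n = integral {0..t} (src V c t n) - integral {0..t} (src V' c t n)"
      by (simp add: co1 co2)
    also have "\<dots> = integral {0..t} (\<lambda>s. src V c t n s - src V' c t n s)" by (rule integral_diff[OF int, symmetric])
    also have "(\<lambda>s. src V c t n s - src V' c t n s) = (\<lambda>s. (- exp (lam n * t)) *\<^sub>R ((exp (- lam n * s) * (freq n)\<^sup>2) *\<^sub>R co (D s) n))"
    proof
      fix s
      have "exp (lam n * (t - s)) = exp (lam n * t) * exp (- lam n * s)" by (simp add: exp_add[symmetric] algebra_simps)
      then show "src V c t n s - src V' c t n s = (- exp (lam n * t)) *\<^sub>R ((exp (- lam n * s) * (freq n)\<^sup>2) *\<^sub>R co (D s) n)"
        by (simp add: src_def D_def scaleR_conv_of_real algebra_simps)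
    qed
    also have "integral {0..t} \<dots> = co (duh D t) n" unfolding co_duh[OF Dc t] integral_cmul by simp
    finally show "co (V t - V' t) n = co (duh D t) n" .
  qed
  have "bounded (V ` {0..T} \<union> V' ` {0..T})"
    unfolding bounded_Un by (intro conjI compact_imp_bounded compact_continuous_image Vc) simp_all
  then obtain X where "\<forall>y\<in>V ` {0..T} \<union> V' ` {0..T}. norm y \<le> X" unfolding bounded_iff by (rule exE)
  then have X: "norm (V s) \<le> X" "norm (V' s) \<le> X" if "s \<in> {0..T}" for s using that by blast+
  define L where "L = 3 * (pc * X)\<^sup>2"
  let ?y = "\<lambda>t. (norm (V t - V' t))\<^sup>2"
  have le: "?y t \<le> 0 + exp T * L\<^sup>2 * integral {0..t} ?y" if t: "t \<in> {0..T}" for t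
  proof -
    have sub: "{0..t} \<subseteq> {0..T}" using t by auto
    have "?y t \<le> exp T * integral {0..t} (\<lambda>s. (norm (D s))\<^sup>2)" unfolding eq[OF t] by (rule norm_duh_le[OF Dc t])
    also have "integral {0..t} (\<lambda>s. (norm (D s))\<^sup>2) \<le> integral {0..t} (\<lambda>s. L\<^sup>2 * ?y s)"
    proof (intro integral_le integrable_continuous_interval continuous_intros continuous_on_subset[OF Dc sub]
        continuous_on_subset[OF Vc(1) sub] continuous_on_subset[OF Vc(2) sub])
      fix s assume "s \<in> {0..t}"
      then have "norm (D s) \<le> L * norm (V s - V' s)"
        unfolding D_def L_def using sub by (intro cub_lipschitz X) auto
      then have "(norm (D s))\<^sup>2 \<le> (L * norm (V s - V' s))\<^sup>2" by (intro power_mono) auto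
      then show "(norm (D s))\<^sup>2 \<le> L\<^sup>2 * ?y s" by (simp only: power_mult_distrib)
    qed
    finally show ?thesis by (simp add: mult.assoc)
  qed
  have "?y t \<le> 0 * (1 + exp T * L\<^sup>2 * T * exp (exp T * L\<^sup>2 * T))"
    by (rule gronwall[OF _ le _ _ t]) (intro continuous_intros Vc, simp_all)
  then show ?thesis by (simp add: V_def V'_def)
qed

end

theorem theorem1p2:
  fixes k :: nat and T \<epsilon> :: real and u0 u1 :: "real^'d \<Rightarrow> real"
  assumes "k \<ge> 1" and "real k > real CARD('d) / 2"
    and "T > 0" and "u0 \<in> sobolev_space k" and "u1 \<in> sobolev_space k" and "\<epsilon> > 0"
  shows "\<exists>\<eta> \<in> Linfty_H0 T.
    (\<exists>u. mild_solution k T u0 \<eta> u) \<and>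
    (\<forall>u. mild_solution k T u0 \<eta> u \<longrightarrow> sobolev_norm k (u T - u1) < \<epsilon>)"
proof -
  have "CARD('d) < 2 * k" using assms(2) by linarith
  then interpret sobolev k "TYPE('d)" by unfold_locales
  obtain c U where c: "ctl c" and U: "sol T c U" "U 0 = embk k u0" "norm (U T - embk k u1) < \<epsilon>"
    by (rule approximate_controllability[OF assms(3,6)])
  have m: "mild_solution k T u0 (\<lambda>t. rl k (c t)) (\<lambda>t. rl k (U t))"
    by (rule sol_mild_solution[OF U(1) c assms(4) U(2)])
  \<comment> \<open>Any other mild solution for this control has the same coefficients at time
    \<open>T\<close>, and these alone determine the Sobolev norm.\<close>
  have "sobolev_norm k (u T - u1) < \<epsilon>" if u: "mild_solution k T u0 (\<lambda>t. rl k (c t)) u" for u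
  proof -
    have T: "T \<in> {0..T}" using assms(3) by simp
    have "u T \<in> sobolev_space k" using u T unfolding mild_solution_def continuous_curve_def by blast
    then have "sobolev_norm k (u T - u1) = norm (embk k (u T) - embk k u1)" by (rule sobolev_norm_diff[OF _ assms(5)])
    also have "embk k (u T) = U T" using mild_solution_unique[OF u m c assms(4) T] by (simp add: embk_rl)
    finally have e: "sobolev_norm k (u T - u1) = norm (U T - embk k u1)" .
    show ?thesis unfolding e by (rule U(3))
  qed
  then show ?thesis using control_Linfty[OF c, of T] m by blast
qed

end
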